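(* Let $\mathcal{X}$ be the Cartan scheme of a group $G\in\mathcal{L}$, and let $H$ be the Cartan subgroup of $G$. Then $b(\mathcal{X})\le 2$, and $b(\mathcal{X})=1$ if and only if the group $H$ is trivial.
   Context: **Coherent configurations.** Let $\Omega$ be a finite set. For $r\subseteq\Omega\times\Omega$ and $\alpha\in\Omega$ put $r^*=\{(\beta,\alpha):(\alpha,\beta)\in r\}$ and $\alpha r=\{\beta:(\alpha,\beta)\in r\}$; $1_\Omega$ is the diagonal of $\Omega\times\Omega$. A coherent configuration on $\Omega$ is a pair $\mathcal{X}=(\Omega,S)$, where $S$ is a partition of $\Omega\times\Omega$ such that $1_\Omega$ is a union of elements of $S$, $s^*\in S$ for all $s\in S$, and for all $r,s,t\in S$ the number $c_{rs}^t=|\alpha r\cap\beta s^*|$ does not depend on $(\alpha,\beta)\in t$. Unions of elements of $S$ are the relations of $\mathcal{X}$. For coherent configurations on the same set, $\mathcal{X}\le\mathcal{X}'$ means that every relation of $\mathcal{X}$ is a relation of $\mathcal{X}'$. $\mathcal{X}$ is complete if all its basis relations (elements of $S$) are singletons. For points $\alpha,\beta,\ldots\in\Omega$ the point extension $\mathcal{X}_{\alpha,\beta,\ldots}$ is the smallest coherent configuration on $\Omega$ that is $\ge\mathcal{X}$ and has $\{(\alpha,\alpha)\},\{(\beta,\beta)\},\ldots$ as relations. A set $\{\alpha,\beta,\ldots\}\subseteq\Omega$ is a base of $\mathcal{X}$ if $\mathcal{X}_{\alpha,\beta,\ldots}$ is complete; the base number $b(\mathcal{X})$ is the smallest cardinality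 of a base. For a group $G$ acting on $\Omega$, $\mathrm{Inv}(G,\Omega)=(\Omega,S)$ with $S$ the set of orbits of $G$ on $\Omega\times\Omega$. **Groups.** Notation ${}^t\Phi_l(q)$ is used for all simple groups of Lie type ($t$ is empty for untwisted groups), with ${}^t\Phi_l(q)$ for twisted groups denoting what Carter's book denotes ${}^t\Phi_l(q^t)$; thus the classical groups are $A_l(q)=\mathrm{PSL}(l+1,q)$, ${}^2A_l(q)=\mathrm{PSU}(l+1,q)$ (matrices over $\mathbb{F}_{q^2}$), $B_l(q)=\Omega_{2l+1}(q)$ with $q$ odd (for $q$ even $B_l(q)\cong C_l(q)$), $C_l(q)=\mathrm{PSp}(2l,q)$, $D_l(q)=\mathrm{P}\Omega^+_{2l}(q)$, ${}^2D_l(q)=\mathrm{P}\Omega^-_{2l}(q)$. $B$, $N$, $H=B\cap N$ denote the standard Borel, monomial and Cartan subgroups of $G$ (forming the standard $(B,N)$-pair). The Cartan scheme of $G$ is $\mathcal{X}=\mathrm{Inv}(G,\Omega)$, where $\Omega=G/H$ is the set of right cosets of $H$ in $G$ and $G$ acts by right multiplication. **The class $\mathcal{L}$** consists of all simple exceptional groups of Lie type (types $E_6,E_7,E_8,F_4,G_2,{}^2E_6,{}^3D_4,{}^2F_4,{}^2G_2,{}^2B_2$) and all simple classical groups ${}^t\Phi_l(q)$ with $l\ge l_0$ and $q\ge al$, where $(l_0,a)$ equals $(7,4)$ for $A_l$, $(6,4)$ for ${}^2A_l$, $(4,4)$ for $B_l$, $(3,4)$ for $C_l$, $(4,2)$ for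 $D_l$, and $(4,2)$ for ${}^2D_l$. *)

theory Defs
  imports "HOL-Algebra.SimpleGroups" "HOL-Algebra.Group_Action" "HOL-Algebra.Generated_Groups"
    "HOL-Library.Disjoint_Sets" "HOL-Library.Function_Algebras" "HOL-Library.Cardinality"
begin

section \<open>Coherent configurations\<close>

text \<open>A coherent configuration is given by its point set \<open>\<Omega>\<close> and its set \<open>S\<close> of basis
  relations. The intersection number for \<open>r\<close>, \<open>s\<close>, \<open>t\<close> is the cardinality of
  \<open>\<alpha>r \<inter> \<beta>s\<^sup>*\<close>, where \<open>(\<alpha>, \<beta>) \<in> t\<close>.\<close>

definition coherent_configuration :: "'a set \<Rightarrow> 'a rel set \<Rightarrow> bool" where
  "coherent_configuration \<Omega> S \<longleftrightarrow>
     finite \<Omega> \<and> partition_on (\<Omega> \<times> \<Omega>) S \<and>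
     (\<exists>T \<subseteq> S. Id_on \<Omega> = \<Union>T) \<and>
     (\<forall>s\<in>S. s\<inverse> \<in> S) \<and>
     (\<forall>r\<in>S. \<forall>s\<in>S. \<forall>t\<in>S. \<exists>c. \<forall>(\<alpha>, \<beta>)\<in>t. card (r `` {\<alpha>} \<inter> s\<inverse> `` {\<beta>}) = c)"

definition cc_relations :: "'a rel set \<Rightarrow> 'a rel set" where
  "cc_relations S = {\<Union>T | T. T \<subseteq> S}"

definition cc_le :: "'a rel set \<Rightarrow> 'a rel set \<Rightarrow> bool" where
  "cc_le S S' \<longleftrightarrow> cc_relations S \<subseteq> cc_relations S'"

definition cc_complete :: "'a rel set \<Rightarrow> bool" where
  "cc_complete S \<longleftrightarrow> (\<forall>s\<in>S. is_singleton s)"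

definition cc_fixing :: "'a set \<Rightarrow> 'a rel set \<Rightarrow> 'a set \<Rightarrow> 'a rel set \<Rightarrow> bool" where
  "cc_fixing \<Omega> S A S' \<longleftrightarrow>
     coherent_configuration \<Omega> S' \<and> cc_le S S' \<and> (\<forall>\<alpha>\<in>A. {(\<alpha>, \<alpha>)} \<in> cc_relations S')"

definition point_extension :: "'a set \<Rightarrow> 'a rel set \<Rightarrow> 'a set \<Rightarrow> 'a rel set" where
  "point_extension \<Omega> S A =
     (THE S'. cc_fixing \<Omega> S A S' \<and> (\<forall>S''. cc_fixing \<Omega> S A S'' \<longrightarrow> cc_le S' S''))"

definition cc_base :: "'a set \<Rightarrow> 'a rel set \<Rightarrow> 'a set \<Rightarrow> bool" where
  "cc_base \<Omega> S A \<longleftrightarrow> A \<subseteq> \<Omega> \<and> cc_complete (point_extension \<Omega> S A)"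

definition base_number :: "'a set \<Rightarrow> 'a rel set \<Rightarrow> nat" where
  "base_number \<Omega> S = (LEAST n. \<exists>A. cc_base \<Omega> S A \<and> card A = n)"

text \<open>\<open>Inv(G, \<Omega>)\<close> for \<open>\<Omega>\<close> the set of right cosets of \<open>H\<close>, on which \<open>G\<close> acts by right
  multiplication. Only the orbits matter here, so the library's \<open>orbits\<close> is used although
  the action is a right action.\<close>

definition cartan_scheme :: "('g, 'm) monoid_scheme \<Rightarrow> 'g set \<Rightarrow> 'g set rel set" where
  "cartan_scheme G H =
     orbits G ((rcosets\<^bsub>G\<^esub> H) \<times> (rcosets\<^bsub>G\<^esub> H)) (\<lambda>g. \<lambda>(P, Q). (P #>\<^bsub>G\<^esub> g, Q #>\<^bsub>G\<^esub> g))"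


section \<open>Root systems\<close>

text \<open>The nodes of a diagram of rank \<open>l\<close> are \<open>0, \<dots>, l - 1\<close>. In types \<open>D\<close> and \<open>E\<close> the
  nodes \<open>0, \<dots>, l - 2\<close> form a chain and the node \<open>l - 1\<close> is joined to the node
  \<open>l - 3\<close> (type \<open>D\<close>) or \<open>2\<close> (type \<open>E\<close>).\<close>

datatype dynkin = DynA nat | DynB nat | DynC nat | DynD nat | DynE nat | DynF4 | DynG2

fun dyn_rank :: "dynkin \<Rightarrow> nat" where
  "dyn_rank (DynA l) = l"
| "dyn_rank (DynB l) = l"
| "dyn_rank (DynC l) = l"
| "dyn_rank (DynD l) = l"
| "dyn_rank (DynE l) = l"
| "dyn_rank DynF4 = 4"
| "dyn_rank DynG2 = 2"

fun dyn_edge :: "dynkin \<Rightarrow> nat \<Rightarrow> nat \<Rightarrow> bool" where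
  "dyn_edge (DynD l) i j \<longleftrightarrow> (j = i + 1 \<and> j < l - 1) \<or> (i = l - 3 \<and> j = l - 1)"
| "dyn_edge (DynE l) i j \<longleftrightarrow> (j = i + 1 \<and> j < l - 1) \<or> (i = 2 \<and> j = l - 1)"
| "dyn_edge D i j \<longleftrightarrow> j = i + 1"

text \<open>The squared length of the \<open>i\<close>-th fundamental root, normalised so that short roots
  (all roots, if there is only one length) have squared length 2.\<close>

fun dyn_len :: "dynkin \<Rightarrow> nat \<Rightarrow> int" where
  "dyn_len (DynB l) i = (if i < l - 1 then 4 else 2)"
| "dyn_len (DynC l) i = (if i < l - 1 then 2 else 4)"
| "dyn_len DynF4 i = (if i < 2 then 4 else 2)"
| "dyn_len DynG2 i = (if i = 0 then 2 else 6)"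
| "dyn_len D i = 2"

text \<open>The inner product of two adjacent fundamental roots is minus half the larger of the two
  squared lengths.\<close>

definition dyn_gram :: "dynkin \<Rightarrow> nat \<Rightarrow> nat \<Rightarrow> int" where
  "dyn_gram D i j =
     (if i = j then dyn_len D i
      else if dyn_edge D i j \<or> dyn_edge D j i then - (max (dyn_len D i) (dyn_len D j) div 2)
      else 0)"

text \<open>Elements of the root lattice are represented by their coefficients with respect to the
  fundamental roots, with coefficient 0 at indices outside the diagram.\<close>

type_synonym root = "nat \<Rightarrow> int"

definition simple_root :: "nat \<Rightarrow> root" where
  "simple_root i = (\<lambda>j. if j = i then 1 else 0)"

definition root_ip :: "dynkin \<Rightarrow> root \<Rightarrow> root \<Rightarrow> int" where
  "root_ip D r s = (\<Sum>i<dyn_rank D. \<Sum>j<dyn_rank D. r i * s j * dyn_gram D i j)"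

text \<open>\<open>cartan_int D r s\<close> is Carter's \<open>A\<^sub>r\<^sub>s = 2(r,s)/(r,r)\<close>. The division is exact for roots.\<close>

definition cartan_int :: "dynkin \<Rightarrow> root \<Rightarrow> root \<Rightarrow> int" where
  "cartan_int D r s = 2 * root_ip D r s div root_ip D r r"

text \<open>Every root is the image of a fundamental root under a product of fundamental reflections.\<close>

inductive_set roots :: "dynkin \<Rightarrow> root set" for D where
  simple: "i < dyn_rank D \<Longrightarrow> simple_root i \<in> roots D"
| reflect: "r \<in> roots D \<Longrightarrow> i < dyn_rank D \<Longrightarrow>
     (\<lambda>j. r j - cartan_int D (simple_root i) r * simple_root i j) \<in> roots D"

definition pos_roots :: "dynkin \<Rightarrow> root set" where
  "pos_roots D = {r \<in> roots D. \<forall>i. r i \<ge> 0}"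

definition neg_roots :: "dynkin \<Rightarrow> root set" where
  "neg_roots D = {r \<in> roots D. \<forall>i. r i \<le> 0}"


section \<open>Chevalley bases\<close>

text \<open>\<open>Hb i\<close> stands for the co-root \<open>h\<close> of the \<open>i\<close>-th fundamental root and \<open>Eb r\<close> for the
  root vector \<open>e\<^sub>r\<close>.\<close>

datatype chev_idx = Hb nat | Eb root

definition chev_basis :: "dynkin \<Rightarrow> chev_idx set" where
  "chev_basis D = Hb ` {..<dyn_rank D} \<union> Eb ` roots D"

text \<open>The coefficient at the \<open>i\<close>-th fundamental co-root of the co-root \<open>h\<^sub>r\<close>, which is
  \<open>2r/(r,r)\<close>. The division is exact for roots.\<close>

definition coroot_coeff :: "dynkin \<Rightarrow> root \<Rightarrow> nat \<Rightarrow> int" where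
  "coroot_coeff D r i = r i * dyn_len D i div root_ip D r r"

text \<open>\<open>lie_coeff D N a b c\<close> is the coefficient at \<open>c\<close> of the bracket \<open>[a, b]\<close> of two basis
  elements, where \<open>N r s\<close> is the coefficient of \<open>[e\<^sub>r, e\<^sub>s]\<close> at \<open>e\<^bsub>r+s\<^esub>\<close>.\<close>

fun lie_coeff ::
  "dynkin \<Rightarrow> (root \<Rightarrow> root \<Rightarrow> int) \<Rightarrow> chev_idx \<Rightarrow> chev_idx \<Rightarrow> chev_idx \<Rightarrow> int" where
  "lie_coeff D N (Hb i) (Hb j) c = 0"
| "lie_coeff D N (Hb i) (Eb s) c = (if c = Eb s then cartan_int D (simple_root i) s else 0)"
| "lie_coeff D N (Eb r) (Hb j) c = (if c = Eb r then - cartan_int D (simple_root j) r else 0)"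
| "lie_coeff D N (Eb r) (Eb s) c =
     (if s = - r then (case c of Hb i \<Rightarrow> coroot_coeff D r i | Eb _ \<Rightarrow> 0)
      else if r + s \<in> roots D \<and> c = Eb (r + s) then N r s
      else 0)"

text \<open>\<open>N\<close> is the system of structure constants of a Chevalley basis of the simple Lie algebra of
  type \<open>D\<close>: they are \<open>\<plusminus>(p + 1)\<close>, where \<open>-pr + s\<close> is the first member of the \<open>r\<close>-string
  through \<open>s\<close>, and the resulting bracket is a Lie bracket.\<close>

definition chevalley_constants :: "dynkin \<Rightarrow> (root \<Rightarrow> root \<Rightarrow> int) \<Rightarrow> bool" where
  "chevalley_constants D N \<longleftrightarrow>
     (\<forall>r\<in>roots D. \<forall>s\<in>roots D. r + s \<in> roots D \<longrightarrow>
        \<bar>N r s\<bar> = int (Max {p. (\<lambda>j. s j - int p * r j) \<in> roots D}) + 1) \<and>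
     (\<forall>a\<in>chev_basis D. \<forall>b\<in>chev_basis D. \<forall>c\<in>chev_basis D.
        lie_coeff D N a b c = - lie_coeff D N b a c) \<and>
     (\<forall>a\<in>chev_basis D. \<forall>b\<in>chev_basis D. \<forall>c\<in>chev_basis D. \<forall>e\<in>chev_basis D.
        (\<Sum>d\<in>chev_basis D.
           lie_coeff D N a b d * lie_coeff D N d c e +
           lie_coeff D N b c d * lie_coeff D N d a e +
           lie_coeff D N c a d * lie_coeff D N d b e) = 0)"

text \<open>\<open>ad_power D N r k a c\<close> is the coefficient at \<open>c\<close> of \<open>(ad e\<^sub>r)\<^sup>k a\<close>.\<close>

fun ad_power ::
  "dynkin \<Rightarrow> (root \<Rightarrow> root \<Rightarrow> int) \<Rightarrow> root \<Rightarrow> nat \<Rightarrow> chev_idx \<Rightarrow> chev_idx \<Rightarrow> int" where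
  "ad_power D N r 0 a c = (if a = c then 1 else 0)"
| "ad_power D N r (Suc k) a c =
     (\<Sum>b\<in>chev_basis D. ad_power D N r k a b * lie_coeff D N (Eb r) b c)"


section \<open>Chevalley groups\<close>

text \<open>The Lie algebra over the field \<open>'k\<close> is the space of functions from \<open>chev_basis D\<close>
  to \<open>'k\<close>. Functions on all of \<open>chev_idx\<close> are used, and the coordinates outside the basis
  are left unchanged by all maps considered.\<close>

type_synonym 'k lie_map = "(chev_idx \<Rightarrow> 'k) \<Rightarrow> (chev_idx \<Rightarrow> 'k)"

abbreviation lie_perm :: "'k lie_map monoid" where
  "lie_perm \<equiv> BijGroup UNIV"

text \<open>\<open>x\<^sub>r(t) = exp (t ad e\<^sub>r)\<close>. The matrix of \<open>(ad e\<^sub>r)\<^sup>k / k!\<close> is integral, so that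
  the integer division is exact, and it vanishes for \<open>k > 3\<close>.\<close>

definition chev_x ::
  "dynkin \<Rightarrow> (root \<Rightarrow> root \<Rightarrow> int) \<Rightarrow> root \<Rightarrow> 'k::field \<Rightarrow> 'k lie_map" where
  "chev_x D N r t v =
     (\<lambda>c. if c \<in> chev_basis D
          then \<Sum>a\<in>chev_basis D. (\<Sum>k\<le>3. of_int (ad_power D N r k a c div fact k) * t ^ k) * v a
          else v c)"

definition chev_n ::
  "dynkin \<Rightarrow> (root \<Rightarrow> root \<Rightarrow> int) \<Rightarrow> root \<Rightarrow> 'k::field \<Rightarrow> 'k lie_map" where
  "chev_n D N r t = chev_x D N r t \<circ> chev_x D N (- r) (- inverse t) \<circ> chev_x D N r t"

definition chev_h ::
  "dynkin \<Rightarrow> (root \<Rightarrow> root \<Rightarrow> int) \<Rightarrow> root \<Rightarrow> 'k::field \<Rightarrow> 'k lie_map" where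
  "chev_h D N r t = chev_n D N r t \<circ> chev_n D N r (- 1)"

definition chev_group ::
  "dynkin \<Rightarrow> (root \<Rightarrow> root \<Rightarrow> int) \<Rightarrow> 'k::field lie_map monoid" where
  "chev_group D N =
     lie_perm\<lparr>carrier := generate lie_perm {chev_x D N r t | r t. r \<in> roots D}\<rparr>"

definition chev_U :: "dynkin \<Rightarrow> (root \<Rightarrow> root \<Rightarrow> int) \<Rightarrow> 'k::field lie_map set" where
  "chev_U D N = generate lie_perm {chev_x D N r t | r t. r \<in> pos_roots D}"

definition chev_V :: "dynkin \<Rightarrow> (root \<Rightarrow> root \<Rightarrow> int) \<Rightarrow> 'k::field lie_map set" where
  "chev_V D N = generate lie_perm {chev_x D N r t | r t. r \<in> neg_roots D}"

definition chev_torus :: "dynkin \<Rightarrow> (root \<Rightarrow> root \<Rightarrow> int) \<Rightarrow> 'k::field lie_map set" where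
  "chev_torus D N = generate lie_perm {chev_h D N r t | r t. r \<in> roots D \<and> t \<noteq> 0}"

definition chev_borel :: "dynkin \<Rightarrow> (root \<Rightarrow> root \<Rightarrow> int) \<Rightarrow> 'k::field lie_map set" where
  "chev_borel D N = chev_U D N <#>\<^bsub>lie_perm\<^esub> chev_torus D N"

definition chev_monomial :: "dynkin \<Rightarrow> (root \<Rightarrow> root \<Rightarrow> int) \<Rightarrow> 'k::field lie_map set" where
  "chev_monomial D N =
     generate lie_perm (chev_torus D N \<union> {chev_n D N r 1 | r. r \<in> roots D})"


section \<open>Twisted groups\<close>

text \<open>\<open>Tw2A l\<close>, \<open>Tw2D l\<close>, \<open>Tw2E6\<close>, \<open>Tw3D4\<close>, \<open>Tw2B2\<close>, \<open>Tw2F4\<close>, \<open>Tw2G2\<close>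
  stand for \<open>\<^sup>2A\<^sub>l\<close>, \<open>\<^sup>2D\<^sub>l\<close>, \<open>\<^sup>2E\<^sub>6\<close>, \<open>\<^sup>3D\<^sub>4\<close>, \<open>\<^sup>2B\<^sub>2\<close>, \<open>\<^sup>2F\<^sub>4\<close>, \<open>\<^sup>2G\<^sub>2\<close>.\<close>

datatype twist = Tw2A nat | Tw2D nat | Tw2E6 | Tw3D4 | Tw2B2 | Tw2F4 | Tw2G2

fun twist_diagram :: "twist \<Rightarrow> dynkin" where
  "twist_diagram (Tw2A l) = DynA l"
| "twist_diagram (Tw2D l) = DynD l"
| "twist_diagram Tw2E6 = DynE 6"
| "twist_diagram Tw3D4 = DynD 4"
| "twist_diagram Tw2B2 = DynB 2"
| "twist_diagram Tw2F4 = DynF4"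
| "twist_diagram Tw2G2 = DynG2"

fun twist_symmetry :: "twist \<Rightarrow> nat \<Rightarrow> nat" where
  "twist_symmetry (Tw2A l) i = l - 1 - i"
| "twist_symmetry (Tw2D l) i = (if i = l - 1 then l - 2 else if i = l - 2 then l - 1 else i)"
| "twist_symmetry Tw2E6 i = (if i \<le> 4 then 4 - i else i)"
| "twist_symmetry Tw3D4 i = (if i = 0 then 2 else if i = 2 then 3 else if i = 3 then 0 else i)"
| "twist_symmetry Tw2B2 i = 1 - i"
| "twist_symmetry Tw2F4 i = 3 - i"
| "twist_symmetry Tw2G2 i = 1 - i"

definition field_aut :: "('k::field \<Rightarrow> 'k) \<Rightarrow> bool" where
  "field_aut f \<longleftrightarrow> bij f \<and> (\<forall>x y. f (x + y) = f x + f y) \<and> (\<forall>x y. f (x * y) = f x * f y)"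

text \<open>The condition on the field automorphism: it has the same order as the symmetry if all roots
  have the same length; otherwise the characteristic is the ratio \<open>p\<close> of the squared root
  lengths and the automorphism \<open>\<theta>\<close> satisfies \<open>p\<theta>\<^sup>2 = 1\<close>.\<close>

fun twist_field_aut :: "twist \<Rightarrow> ('k::field \<Rightarrow> 'k) \<Rightarrow> bool" where
  "twist_field_aut (Tw2A l) f \<longleftrightarrow> field_aut f \<and> f \<noteq> id \<and> f ^^ 2 = id"
| "twist_field_aut (Tw2D l) f \<longleftrightarrow> field_aut f \<and> f \<noteq> id \<and> f ^^ 2 = id"
| "twist_field_aut Tw2E6 f \<longleftrightarrow> field_aut f \<and> f \<noteq> id \<and> f ^^ 2 = id"
| "twist_field_aut Tw3D4 f \<longleftrightarrow> field_aut f \<and> f \<noteq> id \<and> f ^^ 3 = id"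
| "twist_field_aut Tw2B2 f \<longleftrightarrow> field_aut f \<and> CHAR('k) = 2 \<and> (\<forall>t. f (f t) ^ 2 = t)"
| "twist_field_aut Tw2F4 f \<longleftrightarrow> field_aut f \<and> CHAR('k) = 2 \<and> (\<forall>t. f (f t) ^ 2 = t)"
| "twist_field_aut Tw2G2 f \<longleftrightarrow> field_aut f \<and> CHAR('k) = 3 \<and> (\<forall>t. f (f t) ^ 3 = t)"

text \<open>\<open>\<sigma>\<close> is the product of the graph automorphism of the Chevalley group and the field
  automorphism. The elements \<open>x\<^sub>r(t)\<close> with \<open>r\<close> or \<open>-r\<close> fundamental generate the group,
  hence \<open>\<sigma>\<close> is determined by its values there. These involve no signs, and the exponent
  \<open>m\<close> is 1 unless there are two root lengths and the image root is long, in which case it is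
  the ratio of the squared lengths.\<close>

definition twist_aut ::
  "twist \<Rightarrow> (root \<Rightarrow> root \<Rightarrow> int) \<Rightarrow> ('k::field \<Rightarrow> 'k) \<Rightarrow> ('k lie_map \<Rightarrow> 'k lie_map) \<Rightarrow> bool" where
  "twist_aut w N f \<sigma> \<longleftrightarrow>
     (let D = twist_diagram w in
      \<sigma> \<in> iso (chev_group D N) (chev_group D N) \<and>
      (\<forall>i<dyn_rank D. \<forall>t.
         let j = twist_symmetry w i; m = nat (dyn_len D j div 2) in
         \<sigma> (chev_x D N (simple_root i) t) = chev_x D N (simple_root j) (f t ^ m) \<and>
         \<sigma> (chev_x D N (- simple_root i) t) = chev_x D N (- simple_root j) (f t ^ m)))"

definition twisted_U ::
  "twist \<Rightarrow> (root \<Rightarrow> root \<Rightarrow> int) \<Rightarrow> ('k::field lie_map \<Rightarrow> 'k lie_map) \<Rightarrow> 'k lie_map set" where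
  "twisted_U w N \<sigma> = {u \<in> chev_U (twist_diagram w) N. \<sigma> u = u}"

definition twisted_V ::
  "twist \<Rightarrow> (root \<Rightarrow> root \<Rightarrow> int) \<Rightarrow> ('k::field lie_map \<Rightarrow> 'k lie_map) \<Rightarrow> 'k lie_map set" where
  "twisted_V w N \<sigma> = {u \<in> chev_V (twist_diagram w) N. \<sigma> u = u}"

definition twisted_group ::
  "twist \<Rightarrow> (root \<Rightarrow> root \<Rightarrow> int) \<Rightarrow> ('k::field lie_map \<Rightarrow> 'k lie_map) \<Rightarrow> 'k lie_map monoid" where
  "twisted_group w N \<sigma> =
     lie_perm\<lparr>carrier := generate lie_perm (twisted_U w N \<sigma> \<union> twisted_V w N \<sigma>)\<rparr>"

definition twisted_torus ::
  "twist \<Rightarrow> (root \<Rightarrow> root \<Rightarrow> int) \<Rightarrow> ('k::field lie_map \<Rightarrow> 'k lie_map) \<Rightarrow> 'k lie_map set" where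
  "twisted_torus w N \<sigma> = chev_torus (twist_diagram w) N \<inter> carrier (twisted_group w N \<sigma>)"

definition twisted_borel ::
  "twist \<Rightarrow> (root \<Rightarrow> root \<Rightarrow> int) \<Rightarrow> ('k::field lie_map \<Rightarrow> 'k lie_map) \<Rightarrow> 'k lie_map set" where
  "twisted_borel w N \<sigma> = twisted_U w N \<sigma> <#>\<^bsub>lie_perm\<^esub> twisted_torus w N \<sigma>"

definition twisted_monomial ::
  "twist \<Rightarrow> (root \<Rightarrow> root \<Rightarrow> int) \<Rightarrow> ('k::field lie_map \<Rightarrow> 'k lie_map) \<Rightarrow> 'k lie_map set" where
  "twisted_monomial w N \<sigma> =
     chev_monomial (twist_diagram w) N \<inter> carrier (twisted_group w N \<sigma>)"


section \<open>Groups of Lie type\<close>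

datatype lie_type = Untwisted dynkin | Twisted twist

text \<open>\<open>lie_type_BN T G B M\<close>: \<open>G\<close> is the group of type \<open>T\<close> over the field \<open>'k\<close> (Carter's
  construction), with standard Borel subgroup \<open>B\<close> and standard monomial subgroup \<open>M\<close>.\<close>

fun lie_type_BN ::
  "lie_type \<Rightarrow> 'k::field lie_map monoid \<Rightarrow> 'k lie_map set \<Rightarrow> 'k lie_map set \<Rightarrow> bool" where
  "lie_type_BN (Untwisted D) G B M \<longleftrightarrow>
     (\<exists>N. chevalley_constants D N \<and>
        G = chev_group D N \<and> B = chev_borel D N \<and> M = chev_monomial D N)"
| "lie_type_BN (Twisted w) G B M \<longleftrightarrow>
     (\<exists>N f \<sigma>. chevalley_constants (twist_diagram w) N \<and> twist_field_aut w f \<and> twist_aut w N f \<sigma> \<and>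
        G = twisted_group w N \<sigma> \<and> B = twisted_borel w N \<sigma> \<and> M = twisted_monomial w N \<sigma>)"

text \<open>The restrictions on rank and \<open>q\<close> in the definition of the class \<open>\<L>\<close>; here \<open>k\<close> is the
  order of the field over which the group is constructed, which is \<open>q\<close> for untwisted types
  and \<open>q\<^sup>t\<close> for types twisted by a symmetry of order \<open>t\<close>. The notation \<open>B\<^sub>l(q)\<close> is
  used for odd \<open>q\<close> only.\<close>

fun class_L_type :: "lie_type \<Rightarrow> nat \<Rightarrow> bool" where
  "class_L_type (Untwisted (DynA l)) k \<longleftrightarrow> l \<ge> 7 \<and> k \<ge> 4 * l"
| "class_L_type (Untwisted (DynB l)) k \<longleftrightarrow> odd k \<and> l \<ge> 4 \<and> k \<ge> 4 * l"
| "class_L_type (Untwisted (DynC l)) k \<longleftrightarrow> l \<ge> 3 \<and> k \<ge> 4 * l"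
| "class_L_type (Untwisted (DynD l)) k \<longleftrightarrow> l \<ge> 4 \<and> k \<ge> 2 * l"
| "class_L_type (Untwisted (DynE l)) k \<longleftrightarrow> l \<in> {6, 7, 8}"
| "class_L_type (Untwisted DynF4) k \<longleftrightarrow> True"
| "class_L_type (Untwisted DynG2) k \<longleftrightarrow> True"
| "class_L_type (Twisted (Tw2A l)) k \<longleftrightarrow> l \<ge> 6 \<and> (\<exists>q. k = q ^ 2 \<and> q \<ge> 4 * l)"
| "class_L_type (Twisted (Tw2D l)) k \<longleftrightarrow> l \<ge> 4 \<and> (\<exists>q. k = q ^ 2 \<and> q \<ge> 2 * l)"
| "class_L_type (Twisted Tw2E6) k \<longleftrightarrow> True"
| "class_L_type (Twisted Tw3D4) k \<longleftrightarrow> True"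
| "class_L_type (Twisted Tw2B2) k \<longleftrightarrow> True"
| "class_L_type (Twisted Tw2F4) k \<longleftrightarrow> True"
| "class_L_type (Twisted Tw2G2) k \<longleftrightarrow> True"

text \<open>The members of \<open>\<L>\<close> defined over the finite field \<open>'k\<close>, together with their standard
  Borel and monomial subgroups. Simplicity excludes \<open>G\<^sub>2(2)\<close> and the smallest Suzuki and
  Ree groups.\<close>

definition class_L ::
  "'k::{field,finite} lie_map monoid \<Rightarrow> 'k lie_map set \<Rightarrow> 'k lie_map set \<Rightarrow> bool" where
  "class_L G B M \<longleftrightarrow>
     simple_group G \<and> (\<exists>T. class_L_type T CARD('k) \<and> lie_type_BN T G B M)"

end

theory Submission
  imports Defs Complex_Main
begin

text \<open>The Cartan subgroup \<open>H = B \<inter> N\<close> lies in the group \<open>T\<close> of diagonal automorphisms of the Lie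
  algebra, and the opposite unipotent subgroups \<open>U\<close> and \<open>V\<close> consist of upper and lower
  unitriangular matrices with respect to the height of roots. Choose \<open>v \<in> V\<close>
  and \<open>u \<in> U\<close> whose centralisers in \<open>T\<close> are trivial, and put \<open>P = \<langle>U, H\<rangle>\<close>,
  \<open>Q = \<langle>V, H\<rangle>\<close>. If \<open>h \<in> H\<close> and \<open>v\<inverse>hv \<in> P\<close>, then \<open>v\<inverse>hv\<close> is both upper and
  lower triangular, hence \<open>h\<close> commutes with \<open>v\<close> and is trivial. Therefore a coherent
  configuration above the Cartan scheme that fixes the points \<open>H x\<close> and \<open>H v x\<close> fixes
  \<open>H p x\<close> for all \<open>p \<in> P\<close>, as \<open>H p x\<close> is the only common point of its orbits under
  the two point stabilisers. The same holds with \<open>Q\<close> and \<open>u\<close>, and since \<open>P\<close> and \<open>Q\<close>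
  generate \<open>G\<close>, all points are fixed: \<open>{H, H v}\<close> is a base. If one point is a base, its
  stabiliser, a conjugate of \<open>H\<close>, acts trivially, and \<open>H = 1\<close> by simplicity.

  An element of \<open>V\<close> has trivial centraliser in \<open>T\<close> as soon as its components at all negated
  fundamental roots are nonzero. In a twisted group such an element must also be fixed by
  \<open>\<sigma>\<close>; it is assembled from one element per orbit of the diagram symmetry. Orbits of pairwise
  orthogonal roots are immediate, pairs of type \<open>A\<^sub>2\<close> and \<open>B\<^sub>2\<close> need commutator relations,
  and pairs of type \<open>G\<^sub>2\<close> are treated by extracting a square root in a group of odd order.\<close>

section \<open>Coherent configurations\<close>

text \<open>An element of T acts on the component of v at a negated fundamental root through its
  character, and the values of the character at the fundamental roots determine the element; hence
  nonzero components suffice. That H lies in T is read off from matrices too: a monomial map that is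
  unitriangular up to a diagonal factor is diagonal. The labour lies in two places. The structure
  constants are known only up to sign, so each root string is rescaled by signs until the root
  elements act on it as on binary forms under SL_2; this makes h_r(t) diagonal and n_r(t) monomial.
  For a pair p, q of type B_2 the fixed element is the commutator, supported on p+q and 2p+q. Its
  components at p and q vanish, but p+q and 2p+q generate the same lattice, so the torus values are
  still determined.\<close>

lemma cc_relations_iff_saturated:
  assumes "partition_on X S"
  shows "R \<in> cc_relations S \<longleftrightarrow> R \<subseteq> X \<and> (\<forall>s\<in>S. s \<subseteq> R \<or> s \<inter> R = {})"
proof
  assume "R \<in> cc_relations S"
  then obtain T where T: "T \<subseteq> S" "R = \<Union>T" unfolding cc_relations_def by auto
  have "s \<subseteq> R \<or> s \<inter> R = {}" if "s \<in> S" for s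
    using T that assms unfolding partition_on_def disjoint_def by blast
  moreover have "R \<subseteq> X" using T assms unfolding partition_on_def by blast
  ultimately show "R \<subseteq> X \<and> (\<forall>s\<in>S. s \<subseteq> R \<or> s \<inter> R = {})" by blast
next
  assume R: "R \<subseteq> X \<and> (\<forall>s\<in>S. s \<subseteq> R \<or> s \<inter> R = {})"
  have "R = \<Union>{s\<in>S. s \<subseteq> R}"
  proof
    show "R \<subseteq> \<Union>{s\<in>S. s \<subseteq> R}"
    proof
      fix x assume x: "x \<in> R"
      then obtain s where "s \<in> S" "x \<in> s" using R assms unfolding partition_on_def by blast
      then show "x \<in> \<Union>{s\<in>S. s \<subseteq> R}" using R x by blast
    qed
  qed auto
  then show "R \<in> cc_relations S" unfolding cc_relations_def by blast
qed

lemma basis_in_cc_relations: "s \<in> S \<Longrightarrow> s \<in> cc_relations S"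
  unfolding cc_relations_def by (rule CollectI, rule exI[of _ "{s}"]) auto

text \<open>A larger configuration has a finer partition. In this form orbit partitions of subgroups
  can be compared directly.\<close>

lemma cc_le_refines:
  assumes "partition_on X S" "partition_on X S'"
  shows "cc_le S S' \<longleftrightarrow> (\<forall>s'\<in>S'. \<exists>s\<in>S. s' \<subseteq> s)"
proof
  assume le: "cc_le S S'"
  show "\<forall>s'\<in>S'. \<exists>s\<in>S. s' \<subseteq> s"
  proof
    fix s' assume s': "s' \<in> S'"
    then obtain x where x: "x \<in> s'" using assms(2) unfolding partition_on_def by (metis ex_in_conv)
    then have "x \<in> X" using s' assms(2) unfolding partition_on_def by blast
    then obtain s where s: "s \<in> S" "x \<in> s" using assms(1) unfolding partition_on_def by blast
    then have "s \<in> cc_relations S'" using le basis_in_cc_relations unfolding cc_le_def by blast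
    then have "s' \<subseteq> s" using s' x s unfolding cc_relations_iff_saturated[OF assms(2)] by blast
    then show "\<exists>s\<in>S. s' \<subseteq> s" using s by blast
  qed
next
  assume R: "\<forall>s'\<in>S'. \<exists>s\<in>S. s' \<subseteq> s"
  show "cc_le S S'"
    unfolding cc_le_def
  proof
    fix Q assume "Q \<in> cc_relations S"
    then have Q: "Q \<subseteq> X" "\<And>s. s \<in> S \<Longrightarrow> s \<subseteq> Q \<or> s \<inter> Q = {}"
      unfolding cc_relations_iff_saturated[OF assms(1)] by auto
    have "s' \<subseteq> Q \<or> s' \<inter> Q = {}" if s': "s' \<in> S'" for s'
    proof -
      obtain s where "s \<in> S" "s' \<subseteq> s" using R s' by blast
      then show ?thesis using Q(2)[of s] by blast
    qed
    then show "Q \<in> cc_relations S'"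
      unfolding cc_relations_iff_saturated[OF assms(2)] using Q(1) by blast
  qed
qed

lemma cc_le_antisym:
  assumes "partition_on X S" "partition_on X S'" "cc_le S S'" "cc_le S' S"
  shows "S = S'"
proof -
  have *: "A \<subseteq> B" if p: "partition_on X A" "partition_on X B" "cc_le A B" "cc_le B A" for A B :: "'a rel set"
  proof
    fix s assume s: "s \<in> A"
    then obtain t where t: "t \<in> B" "s \<subseteq> t" using p cc_le_refines by metis
    then obtain u where u: "u \<in> A" "t \<subseteq> u" using p cc_le_refines by metis
    have "s \<noteq> {}" using s p(1) unfolding partition_on_def by blast
    then have "s = u" using s u t p(1) unfolding partition_on_def disjoint_def by blast
    then show "s \<in> B" using t u by (metis subset_antisym)
  qed
  show ?thesis using *[OF assms] *[OF assms(2,1,4,3)] by blast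
qed

lemma cc_partition: "coherent_configuration \<Omega> S \<Longrightarrow> partition_on (\<Omega> \<times> \<Omega>) S"
  unfolding coherent_configuration_def by blast

section \<open>Meets of coherent configurations\<close>

definition cc_same :: "'a rel set \<Rightarrow> ('a \<times> 'a) rel" where
  "cc_same S = {(p, q). \<exists>s\<in>S. p \<in> s \<and> q \<in> s}"

lemma cc_same_equiv: "partition_on X S \<Longrightarrow> equiv X (cc_same S)"
  unfolding cc_same_def using equiv_partition_on by (simp add: Bex_def)

definition class_fun :: "'a rel set \<Rightarrow> ('a \<times> 'a \<Rightarrow> 'b) \<Rightarrow> bool" where
  "class_fun S f \<longleftrightarrow> (\<forall>s\<in>S. \<forall>p\<in>s. \<forall>q\<in>s. f p = f q)"

lemma cc_relation_class_fun:
  assumes "partition_on X S"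
  shows "R \<in> cc_relations S \<longleftrightarrow> R \<subseteq> X \<and> class_fun S (\<lambda>p. p \<in> R)"
proof -
  have "(s \<subseteq> R \<or> s \<inter> R = {}) \<longleftrightarrow> (\<forall>p\<in>s. \<forall>q\<in>s. (p \<in> R) = (q \<in> R))" for s
    unfolding subset_iff disjoint_iff by metis
  then show ?thesis unfolding cc_relations_iff_saturated[OF assms] class_fun_def by simp
qed

text \<open>Having this for all relations, not only for basis relations, makes coherent configurations closed
  under meets.\<close>

lemma cc_relation_product:
  assumes cc: "coherent_configuration \<Omega> S" and R: "R \<in> cc_relations S" and Q: "Q \<in> cc_relations S"
  shows "class_fun S (\<lambda>(\<alpha>, \<beta>). card (R `` {\<alpha>} \<inter> Q\<inverse> `` {\<beta>}))"
  unfolding class_fun_def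
proof (intro ballI)
  fix t p q assume t: "t \<in> S" "p \<in> t" "q \<in> t"
  have fin: "finite \<Omega>" and part: "partition_on (\<Omega> \<times> \<Omega>) S"
    using cc unfolding coherent_configuration_def by auto
  have "finite S" using finite_elements[OF _ part] fin by simp
  obtain A where A: "A \<subseteq> S" "R = \<Union>A" using R unfolding cc_relations_def by auto
  obtain B where B: "B \<subseteq> S" "Q = \<Union>B" using Q unfolding cc_relations_def by auto
  have finAB: "finite A" "finite B" using A B \<open>finite S\<close> finite_subset by auto
  have disj: "disjoint S" using part unfolding partition_on_def by blast
  have sub: "s \<subseteq> \<Omega> \<times> \<Omega>" if "s \<in> S" for s using part that unfolding partition_on_def by blast
  have key: "card (R `` {\<alpha>} \<inter> Q\<inverse> `` {\<beta>}) = (\<Sum>(r, s)\<in>A \<times> B. card (r `` {\<alpha>} \<inter> s\<inverse> `` {\<beta>}))" for \<alpha> \<beta>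
  proof -
    have "R `` {\<alpha>} \<inter> Q\<inverse> `` {\<beta>} = (\<Union>x\<in>A \<times> B. fst x `` {\<alpha>} \<inter> (snd x)\<inverse> `` {\<beta>})"
      unfolding A B by fastforce
    also have "card \<dots> = (\<Sum>x\<in>A \<times> B. card (fst x `` {\<alpha>} \<inter> (snd x)\<inverse> `` {\<beta>}))"
    proof (rule card_UN_disjoint)
      show "finite (A \<times> B)" using finAB by simp
      show "\<forall>i\<in>A \<times> B. finite (fst i `` {\<alpha>} \<inter> (snd i)\<inverse> `` {\<beta>})"
      proof
        fix i assume "i \<in> A \<times> B"
        then have "fst i \<subseteq> \<Omega> \<times> \<Omega>" using A(1) sub by (metis mem_Times_iff subsetD)
        then have "fst i `` {\<alpha>} \<subseteq> \<Omega>" by auto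
        then show "finite (fst i `` {\<alpha>} \<inter> (snd i)\<inverse> `` {\<beta>})" using fin finite_subset by blast
      qed
      show "\<forall>i\<in>A \<times> B. \<forall>j\<in>A \<times> B. i \<noteq> j \<longrightarrow>
        fst i `` {\<alpha>} \<inter> (snd i)\<inverse> `` {\<beta>} \<inter> (fst j `` {\<alpha>} \<inter> (snd j)\<inverse> `` {\<beta>}) = {}"
      proof (intro ballI impI, rule ccontr)
        fix i j assume i: "i \<in> A \<times> B" and j: "j \<in> A \<times> B" and ne: "i \<noteq> j"
          and "fst i `` {\<alpha>} \<inter> (snd i)\<inverse> `` {\<beta>} \<inter> (fst j `` {\<alpha>} \<inter> (snd j)\<inverse> `` {\<beta>}) \<noteq> {}"
        then obtain g where "(\<alpha>, g) \<in> fst i" "(\<alpha>, g) \<in> fst j" "(g, \<beta>) \<in> snd i" "(g, \<beta>) \<in> snd j" by auto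
        moreover have "fst i \<in> S" "fst j \<in> S" "snd i \<in> S" "snd j \<in> S" using i j A(1) B(1) by auto
        ultimately have "fst i = fst j" "snd i = snd j"
          using disjointD[OF disj] by blast+
        then show False using ne by (simp add: prod_eq_iff)
      qed
    qed
    finally show ?thesis by (simp add: split_def)
  qed
  obtain a b where p: "p = (a, b)" by (cases p)
  obtain a' b' where q: "q = (a', b')" by (cases q)
  have "card (r `` {a} \<inter> s\<inverse> `` {b}) = card (r `` {a'} \<inter> s\<inverse> `` {b'})" if "r \<in> A" "s \<in> B" for r s
  proof -
    have "\<exists>c. \<forall>(\<alpha>, \<beta>)\<in>t. card (r `` {\<alpha>} \<inter> s\<inverse> `` {\<beta>}) = c"
      using cc that A(1) B(1) t(1) unfolding coherent_configuration_def by blast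
    then show ?thesis using t p q by (metis (mono_tags, lifting) case_prodD)
  qed
  then show "(case p of (\<alpha>, \<beta>) \<Rightarrow> card (R `` {\<alpha>} \<inter> Q\<inverse> `` {\<beta>})) =
      (case q of (\<alpha>, \<beta>) \<Rightarrow> card (R `` {\<alpha>} \<inter> Q\<inverse> `` {\<beta>}))"
    unfolding p q by (auto simp: key intro!: sum.cong)
qed

text \<open>Generated equivalence: the finest partition coarser than every member of
  \<open>F\<close>. Its relations are those common to all members, so it is the greatest lower bound
  for \<open>cc_le\<close>.\<close>

definition cc_meet :: "'a set \<Rightarrow> 'a rel set set \<Rightarrow> 'a rel set" where
  "cc_meet \<Omega> F = (\<Omega> \<times> \<Omega>) // ((\<Union>(cc_same ` F))\<^sup>+)"

lemma cc_meet_equiv: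
  assumes "F \<noteq> {}" "\<forall>S\<in>F. partition_on (\<Omega> \<times> \<Omega>) S"
  shows "equiv (\<Omega> \<times> \<Omega>) ((\<Union>(cc_same ` F))\<^sup>+)"
proof (rule equivI)
  have eq: "equiv (\<Omega> \<times> \<Omega>) (cc_same S)" if "S \<in> F" for S using cc_same_equiv assms(2) that by blast
  have "\<Union>(cc_same ` F) \<subseteq> (\<Omega> \<times> \<Omega>) \<times> (\<Omega> \<times> \<Omega>)"
    using eq equiv_type by fastforce
  then show "((\<Union>(cc_same ` F))\<^sup>+) \<subseteq> (\<Omega> \<times> \<Omega>) \<times> \<Omega> \<times> \<Omega>"
    by (rule trancl_subset_Sigma)
  show "refl_on (\<Omega> \<times> \<Omega>) ((\<Union>(cc_same ` F))\<^sup>+)"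
    using assms(1) eq unfolding refl_on_def equiv_def by blast
  have "sym (\<Union>(cc_same ` F))" using eq unfolding equiv_def sym_def by blast
  then show "sym ((\<Union>(cc_same ` F))\<^sup>+)" by (rule sym_trancl)
qed (rule trans_trancl)

lemma cc_meet_class_fun:
  assumes "\<And>S. S \<in> F \<Longrightarrow> class_fun S f"
  shows "class_fun (cc_meet \<Omega> F) f"
proof -
  have *: "f p = f q" if "(p, q) \<in> (\<Union>(cc_same ` F))\<^sup>+" for p q
    using that
  proof (induction rule: trancl_induct)
    case (base y)
    then show ?case using assms unfolding cc_same_def class_fun_def by blast
  next
    case (step y z)
    then have "f y = f z" using assms unfolding cc_same_def class_fun_def by blast
    then show ?case using step.IH by simp
  qed
  have "f p = f q" if s: "s \<in> cc_meet \<Omega> F" and pq: "p \<in> s" "q \<in> s" for s p q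
  proof -
    obtain x where "s = (\<Union>(cc_same ` F))\<^sup>+ `` {x}"
      using s unfolding cc_meet_def by (rule quotientE)
    then have "(x, p) \<in> (\<Union>(cc_same ` F))\<^sup>+" "(x, q) \<in> (\<Union>(cc_same ` F))\<^sup>+"
      using pq by simp_all
    then show ?thesis using * by metis
  qed
  then show ?thesis unfolding class_fun_def by blast
qed

lemma cc_meet_partition:
  assumes "F \<noteq> {}" "\<forall>S\<in>F. partition_on (\<Omega> \<times> \<Omega>) S"
  shows "partition_on (\<Omega> \<times> \<Omega>) (cc_meet \<Omega> F)"
  unfolding cc_meet_def using partition_on_quotient[OF cc_meet_equiv[OF assms]] by simp

lemma cc_relations_meet:
  assumes "F \<noteq> {}" "\<forall>S\<in>F. partition_on (\<Omega> \<times> \<Omega>) S"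
  shows "R \<in> cc_relations (cc_meet \<Omega> F) \<longleftrightarrow> (\<forall>S\<in>F. R \<in> cc_relations S)"
proof
  assume R: "R \<in> cc_relations (cc_meet \<Omega> F)"
  show "\<forall>S\<in>F. R \<in> cc_relations S"
  proof
    fix S assume S: "S \<in> F"
    have "cc_le (cc_meet \<Omega> F) S"
      unfolding cc_le_refines[OF cc_meet_partition[OF assms] bspec[OF assms(2) S]]
    proof
      fix s assume s: "s \<in> S"
      have p: "partition_on (\<Omega> \<times> \<Omega>) S" using assms(2) S by blast
      then obtain x where x: "x \<in> s" using s unfolding partition_on_def by (metis ex_in_conv)
      then have xO: "x \<in> \<Omega> \<times> \<Omega>" using s p unfolding partition_on_def by blast
      have "s \<subseteq> (\<Union>(cc_same ` F))\<^sup>+ `` {x}"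
        using S s x unfolding cc_same_def by (auto intro!: r_into_trancl)
      then show "\<exists>m\<in>cc_meet \<Omega> F. s \<subseteq> m" unfolding cc_meet_def using quotientI[OF xO] by blast
    qed
    then show "R \<in> cc_relations S" using R unfolding cc_le_def by blast
  qed
next
  assume "\<forall>S\<in>F. R \<in> cc_relations S"
  then have *: "\<And>S. S \<in> F \<Longrightarrow> R \<subseteq> \<Omega> \<times> \<Omega> \<and> class_fun S (\<lambda>p. p \<in> R)"
    using assms(2) cc_relation_class_fun by blast
  then show "R \<in> cc_relations (cc_meet \<Omega> F)"
    unfolding cc_relation_class_fun[OF cc_meet_partition[OF assms]]
    using cc_meet_class_fun[of F "\<lambda>p. p \<in> R"] assms(1) by blast
qed

lemma cc_relations_converse:
  assumes "coherent_configuration \<Omega> S" "R \<in> cc_relations S"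
  shows "R\<inverse> \<in> cc_relations S"
proof -
  obtain T where T: "T \<subseteq> S" "R = \<Union>T" using assms unfolding cc_relations_def by auto
  then have "R\<inverse> = \<Union>(converse ` T)" by auto
  moreover have "converse ` T \<subseteq> S" using T assms unfolding coherent_configuration_def by auto
  ultimately show ?thesis unfolding cc_relations_def by blast
qed

text \<open>A class of the meet is a relation of every member, so each member sees the intersection
  number as a function constant on its own classes. Such a function is constant along the chains
  that generate the meet.\<close>

lemma coherent_configuration_meet:
  assumes ne: "F \<noteq> {}" and cc: "\<And>S. S \<in> F \<Longrightarrow> coherent_configuration \<Omega> S"
  shows "coherent_configuration \<Omega> (cc_meet \<Omega> F)"
proof -
  have part: "\<forall>S\<in>F. partition_on (\<Omega> \<times> \<Omega>) S" using cc cc_partition by blast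
  note mp = cc_meet_partition[OF ne part] and mr = cc_relations_meet[OF ne part]
  have fin: "finite \<Omega>" using ne cc unfolding coherent_configuration_def by blast
  have diag: "Id_on \<Omega> \<in> cc_relations (cc_meet \<Omega> F)"
  proof -
    have "Id_on \<Omega> \<in> cc_relations S" if "S \<in> F" for S
      using cc[OF that] unfolding coherent_configuration_def cc_relations_def by auto
    then show ?thesis unfolding mr by blast
  qed
  have conv: "s\<inverse> \<in> cc_meet \<Omega> F" if s: "s \<in> cc_meet \<Omega> F" for s
  proof -
    have rel: "R\<inverse> \<in> cc_relations (cc_meet \<Omega> F)" if "R \<in> cc_relations (cc_meet \<Omega> F)" for R
      using that cc_relations_converse[OF cc] unfolding mr by blast
    have "s \<noteq> {}" using s mp unfolding partition_on_def by blast
    then obtain x where x: "x \<in> s\<inverse>" by auto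
    have sr: "s\<inverse> \<in> cc_relations (cc_meet \<Omega> F)" using rel basis_in_cc_relations[OF s] by blast
    \<comment> \<open>So far the converse of \<open>s\<close> is only a union of classes. Let
      \<open>u\<close> be one of them; its converse is again a union of classes and meets
      \<open>s\<close>, hence contains it, and the two inclusions give equality.\<close>
    then obtain u where u: "u \<in> cc_meet \<Omega> F" "x \<in> u" "u \<subseteq> s\<inverse>"
      using x unfolding cc_relations_def by blast
    have "u\<inverse> \<in> cc_relations (cc_meet \<Omega> F)" using rel basis_in_cc_relations[OF u(1)] by blast
    then have "s \<subseteq> u\<inverse> \<or> s \<inter> u\<inverse> = {}" using s cc_relations_iff_saturated[OF mp] by blast
    then have "s \<subseteq> u\<inverse>" using u x by fastforce
    then have "s\<inverse> = u" using u by blast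
    then show ?thesis using u by blast
  qed
  have "\<exists>c. \<forall>(\<alpha>, \<beta>)\<in>t. card (r `` {\<alpha>} \<inter> s\<inverse> `` {\<beta>}) = c"
    if "r \<in> cc_meet \<Omega> F" "s \<in> cc_meet \<Omega> F" "t \<in> cc_meet \<Omega> F" for r s t
  proof -
    have "class_fun (cc_meet \<Omega> F) (\<lambda>(\<alpha>, \<beta>). card (r `` {\<alpha>} \<inter> s\<inverse> `` {\<beta>}))"
    proof (rule cc_meet_class_fun)
      fix S assume S: "S \<in> F"
      show "class_fun S (\<lambda>(\<alpha>, \<beta>). card (r `` {\<alpha>} \<inter> s\<inverse> `` {\<beta>}))"
        by (rule cc_relation_product[OF cc[OF S]])
          (use that(1,2)[THEN basis_in_cc_relations] S in \<open>auto simp: mr\<close>)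
    qed
    then have "\<forall>p\<in>t. \<forall>q\<in>t. (\<lambda>(\<alpha>, \<beta>). card (r `` {\<alpha>} \<inter> s\<inverse> `` {\<beta>})) p = (\<lambda>(\<alpha>, \<beta>). card (r `` {\<alpha>} \<inter> s\<inverse> `` {\<beta>})) q"
      using that(3) unfolding class_fun_def by blast
    then show ?thesis by (intro exI[of _ "case (SOME p. p \<in> t) of (\<alpha>, \<beta>) \<Rightarrow> card (r `` {\<alpha>} \<inter> s\<inverse> `` {\<beta>})"])
        (use someI[of "\<lambda>p. p \<in> t"] in fast)
  qed
  then show ?thesis
    unfolding coherent_configuration_def using fin mp diag conv by (auto simp: cc_relations_def)
qed

section \<open>Point extensions and bases\<close>

text \<open>One admissible configuration \<open>S0\<close> makes the family nonempty. Its meet is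
  then admissible and least, and antisymmetry of \<open>cc_le\<close> makes the definite description
  refer to it.\<close>

lemma point_extension_meet:
  assumes "cc_fixing \<Omega> S A S0"
  shows "point_extension \<Omega> S A = cc_meet \<Omega> {S'. cc_fixing \<Omega> S A S'}"
    and "cc_fixing \<Omega> S A (point_extension \<Omega> S A)"
    and "cc_le (point_extension \<Omega> S A) S0"
proof -
  let ?F = "{S'. cc_fixing \<Omega> S A S'}"
  have ne: "?F \<noteq> {}" using assms by blast
  have cc: "coherent_configuration \<Omega> S'" if "S' \<in> ?F" for S' using that unfolding cc_fixing_def by blast
  have part: "\<forall>S'\<in>?F. partition_on (\<Omega> \<times> \<Omega>) S'" using cc cc_partition by blast
  note mr = cc_relations_meet[OF ne part]
  have fixm: "cc_fixing \<Omega> S A (cc_meet \<Omega> ?F)"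
  proof (subst cc_fixing_def, intro conjI)
    show "coherent_configuration \<Omega> (cc_meet \<Omega> ?F)"
      by (rule coherent_configuration_meet[OF ne cc])
    show "cc_le S (cc_meet \<Omega> ?F)"
      unfolding cc_le_def subset_iff mr by (simp add: cc_fixing_def cc_le_def subset_iff)
    show "\<forall>\<alpha>\<in>A. {(\<alpha>, \<alpha>)} \<in> cc_relations (cc_meet \<Omega> ?F)"
      unfolding mr by (simp add: cc_fixing_def)
  qed
  have lem: "cc_le (cc_meet \<Omega> ?F) S''" if "cc_fixing \<Omega> S A S''" for S''
    unfolding cc_le_def subset_iff mr using that by simp
  show 1: "point_extension \<Omega> S A = cc_meet \<Omega> ?F"
    unfolding point_extension_def
  proof (rule the_equality)
    show "cc_fixing \<Omega> S A (cc_meet \<Omega> ?F) \<and> (\<forall>S''. cc_fixing \<Omega> S A S'' \<longrightarrow> cc_le (cc_meet \<Omega> ?F) S'')"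
      using fixm lem by blast
    fix S' assume S': "cc_fixing \<Omega> S A S' \<and> (\<forall>S''. cc_fixing \<Omega> S A S'' \<longrightarrow> cc_le S' S'')"
    show "S' = cc_meet \<Omega> ?F"
      by (rule cc_le_antisym[OF bspec[OF part] bspec[OF part]]) (use S' fixm lem in auto)
  qed
  show "cc_fixing \<Omega> S A (point_extension \<Omega> S A)" "cc_le (point_extension \<Omega> S A) S0"
    unfolding 1 using fixm lem assms by auto
qed

lemma cc_complete_le:
  assumes "partition_on X S" "partition_on X S'" "cc_le S S'" "cc_complete S"
  shows "cc_complete S'"
  unfolding cc_complete_def
proof
  fix s' assume s': "s' \<in> S'"
  then obtain s where s: "s \<in> S" "s' \<subseteq> s" using assms cc_le_refines by metis
  then have "is_singleton s" using assms(4) unfolding cc_complete_def by blast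
  moreover have "s' \<noteq> {}" using s' assms(2) unfolding partition_on_def by blast
  ultimately show "is_singleton s'" using s(2) unfolding is_singleton_def by blast
qed

text \<open>Completeness passes to finer configurations and the point extension is itself
  admissible. All later arguments quantify over admissible configurations and never touch the
  definite description.\<close>

lemma cc_base_iff:
  assumes "cc_fixing \<Omega> S A S0" "A \<subseteq> \<Omega>"
  shows "cc_base \<Omega> S A \<longleftrightarrow> (\<forall>S'. cc_fixing \<Omega> S A S' \<longrightarrow> cc_complete S')"
proof
  assume b: "cc_base \<Omega> S A"
  show "\<forall>S'. cc_fixing \<Omega> S A S' \<longrightarrow> cc_complete S'"
  proof (intro allI impI)
    fix S' assume S': "cc_fixing \<Omega> S A S'"
    have "cc_complete (point_extension \<Omega> S A)" using b unfolding cc_base_def by blast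
    moreover have "cc_le (point_extension \<Omega> S A) S'" using point_extension_meet(3)[OF S'] .
    moreover have "partition_on (\<Omega> \<times> \<Omega>) (point_extension \<Omega> S A)" "partition_on (\<Omega> \<times> \<Omega>) S'"
      using point_extension_meet(2)[OF S'] S' cc_partition unfolding cc_fixing_def by auto
    ultimately show "cc_complete S'" using cc_complete_le by metis
  qed
next
  assume "\<forall>S'. cc_fixing \<Omega> S A S' \<longrightarrow> cc_complete S'"
  then show "cc_base \<Omega> S A"
    unfolding cc_base_def using assms point_extension_meet(2)[OF assms(1)] by blast
qed

lemma partition_on_singletons: "partition_on X ((\<lambda>x. {x}) ` X)"
  unfolding partition_on_def disjoint_def by auto

lemma coherent_configuration_discrete:
  assumes "finite \<Omega>"
  shows "coherent_configuration \<Omega> ((\<lambda>p. {p}) ` (\<Omega> \<times> \<Omega>))"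
  unfolding coherent_configuration_def
proof (intro conjI)
  show "\<exists>T\<subseteq>(\<lambda>p. {p}) ` (\<Omega> \<times> \<Omega>). Id_on \<Omega> = \<Union>T"
    by (rule exI[of _ "(\<lambda>x. {(x, x)}) ` \<Omega>"]) auto
  show "\<forall>s\<in>(\<lambda>p. {p}) ` (\<Omega> \<times> \<Omega>). s\<inverse> \<in> (\<lambda>p. {p}) ` (\<Omega> \<times> \<Omega>)"
    by auto
qed (use assms partition_on_singletons in auto)

text \<open>Supplies the admissible configuration that \<open>cc_base_iff\<close> asks for.\<close>

lemma cc_fixing_discrete:
  assumes "finite \<Omega>" "A \<subseteq> \<Omega>" "partition_on (\<Omega> \<times> \<Omega>) S"
  shows "cc_fixing \<Omega> S A ((\<lambda>p. {p}) ` (\<Omega> \<times> \<Omega>))"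
proof -
  have "R \<in> cc_relations ((\<lambda>p. {p}) ` (\<Omega> \<times> \<Omega>))" if "R \<subseteq> \<Omega> \<times> \<Omega>" for R
    unfolding cc_relations_iff_saturated[OF partition_on_singletons] using that by auto
  then show ?thesis
    unfolding cc_fixing_def cc_le_def
    using coherent_configuration_discrete[OF assms(1)] assms(2)
      cc_relations_iff_saturated[OF assms(3)] by auto
qed

section \<open>Points fixed by a coherent configuration\<close>

definition cc_fixed :: "'a rel set \<Rightarrow> 'a \<Rightarrow> bool" where
  "cc_fixed S \<alpha> \<longleftrightarrow> {(\<alpha>, \<alpha>)} \<in> cc_relations S"

text \<open>Take (a, b) in a class s. The intersection number of {(a, a)} and s is 1 at (a, b) and 0
  at a pair whose first point is not a; as it is constant on s, all pairs in s begin with a. The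
  second point is treated in the same way.\<close>

lemma cc_complete_if_all_fixed:
  assumes cc: "coherent_configuration \<Omega> S" and f: "\<And>\<alpha>. \<alpha> \<in> \<Omega> \<Longrightarrow> cc_fixed S \<alpha>"
  shows "cc_complete S"
  unfolding cc_complete_def
proof
  note part = cc_partition[OF cc]
  fix s assume s: "s \<in> S"
  have "p = q" if pq: "p \<in> s" "q \<in> s" for p q
  proof -
    obtain a b where p: "p = (a, b)" by (cases p)
    obtain a' b' where q: "q = (a', b')" by (cases q)
    have O: "a \<in> \<Omega>" "b \<in> \<Omega>" using pq(1) p s part unfolding partition_on_def by blast+
    have O': "a' \<in> \<Omega>" "b' \<in> \<Omega>" using pq(2) q s part unfolding partition_on_def by blast+
    have sr: "s \<in> cc_relations S" using basis_in_cc_relations[OF s] .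
    have "class_fun S (\<lambda>(\<alpha>, \<beta>). card ({(a, a)} `` {\<alpha>} \<inter> s\<inverse> `` {\<beta>}))"
      using cc_relation_product[OF cc _ sr] f[OF O(1)] unfolding cc_fixed_def by blast
    from this[unfolded class_fun_def, rule_format, OF s pq]
    have "card ({(a, a)} `` {a} \<inter> s\<inverse> `` {b}) = card ({(a, a)} `` {a'} \<inter> s\<inverse> `` {b'})"
      using p q by simp
    moreover have "{(a, a)} `` {a} \<inter> s\<inverse> `` {b} = {a}" using pq(1) p by auto
    ultimately have "a' = a" by (metis Image_singleton_iff Int_empty_left card.empty card_1_singleton_iff equals0I prod.inject singletonD zero_neq_one One_nat_def)
    have "class_fun S (\<lambda>(\<alpha>, \<beta>). card (s `` {\<alpha>} \<inter> {(b, b)}\<inverse> `` {\<beta>}))"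
      using cc_relation_product[OF cc sr] f[OF O(2)] unfolding cc_fixed_def by blast
    from this[unfolded class_fun_def, rule_format, OF s pq]
    have "card (s `` {a} \<inter> {(b, b)}\<inverse> `` {b}) = card (s `` {a'} \<inter> {(b, b)}\<inverse> `` {b'})"
      using p q by simp
    moreover have "s `` {a} \<inter> {(b, b)}\<inverse> `` {b} = {b}" using pq(1) p by auto
    ultimately have "b' = b" by (metis Image_singleton_iff Int_empty_right card.empty card_1_singleton_iff converse_iff equals0I prod.inject singletonD zero_neq_one One_nat_def)
    then show "p = q" using p q \<open>a' = a\<close> by simp
  qed
  moreover have "s \<noteq> {}" using s part unfolding partition_on_def by blast
  ultimately show "is_singleton s" unfolding is_singleton_def by (metis ex_in_conv insertI1 subset_antisym subset_singletonD singletonD equals0I subsetI)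
qed

lemma cc_relations_Int:
  assumes "partition_on X S" "R \<in> cc_relations S" "Q \<in> cc_relations S"
  shows "R \<inter> Q \<in> cc_relations S"
  using assms(2,3) unfolding cc_relations_iff_saturated[OF assms(1)] by blast

text \<open>A pair belongs to the composite exactly when its intersection number is nonzero, and
  that number is constant on classes.\<close>

lemma cc_relations_relcomp:
  assumes cc: "coherent_configuration \<Omega> S" and R: "R \<in> cc_relations S" and Q: "Q \<in> cc_relations S"
  shows "R O Q \<in> cc_relations S"
proof -
  note part = cc_partition[OF cc]
  have sub: "R \<subseteq> \<Omega> \<times> \<Omega>" "Q \<subseteq> \<Omega> \<times> \<Omega>" using R Q unfolding cc_relations_iff_saturated[OF part] by auto
  have "(x, y) \<in> R O Q \<longleftrightarrow> card (R `` {x} \<inter> Q\<inverse> `` {y}) \<noteq> 0" for x y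
  proof -
    have "finite (R `` {x} \<inter> Q\<inverse> `` {y})"
      using sub cc finite_subset[of "R `` {x} \<inter> Q\<inverse> `` {y}" \<Omega>] unfolding coherent_configuration_def by blast
    then show ?thesis by auto
  qed
  then have eq: "(\<lambda>p. p \<in> R O Q) = (\<lambda>p. (\<lambda>(\<alpha>, \<beta>). card (R `` {\<alpha>} \<inter> Q\<inverse> `` {\<beta>})) p \<noteq> 0)"
    by (simp add: fun_eq_iff split_paired_all)
  have "class_fun S (\<lambda>p. p \<in> R O Q)"
    using cc_relation_product[OF assms] unfolding class_fun_def eq by metis
  then show ?thesis unfolding cc_relation_class_fun[OF part] using sub by blast
qed

text \<open>The neighbourhood A of a fixed point under a relation gives the relation A x A, a
  composite through the fixed point. Two such squares whose sides share a single point intersect in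
  that point's diagonal pair.\<close>

lemma cc_fixed_intersection:
  assumes cc: "coherent_configuration \<Omega> S" and fa: "cc_fixed S \<alpha>" and fb: "cc_fixed S \<beta>"
    and R: "R \<in> cc_relations S" and Q: "Q \<in> cc_relations S" and single: "R `` {\<alpha>} \<inter> Q `` {\<beta>} = {\<gamma>}"
  shows "cc_fixed S \<gamma>"
proof -
  have sq: "A `` {x} \<times> A `` {x} \<in> cc_relations S" if "A \<in> cc_relations S" "cc_fixed S x" for A x
  proof -
    have "A\<inverse> O {(x, x)} O A \<in> cc_relations S"
      using that cc_relations_relcomp[OF cc] cc_relations_converse[OF cc] unfolding cc_fixed_def by blast
    also have "A\<inverse> O {(x, x)} O A = A `` {x} \<times> A `` {x}" by auto
    finally show ?thesis .
  qed
  have "(R `` {\<alpha>} \<times> R `` {\<alpha>}) \<inter> (Q `` {\<beta>} \<times> Q `` {\<beta>}) \<in> cc_relations S"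
    using cc_relations_Int[OF cc_partition[OF cc]] sq[OF R fa] sq[OF Q fb] by blast
  also have "(R `` {\<alpha>} \<times> R `` {\<alpha>}) \<inter> (Q `` {\<beta>} \<times> Q `` {\<beta>}) = {(\<gamma>, \<gamma>)}" using single by blast
  finally show ?thesis unfolding cc_fixed_def .
qed

section \<open>Orbit schemes on cosets\<close>

text \<open>The acting group \<open>K\<close> is kept apart from \<open>G\<close>: the whole group
  gives the Cartan scheme, a subgroup that fixes given points gives a configuration admissible for
  these points.\<close>

definition coset_scheme :: "('g, 'm) monoid_scheme \<Rightarrow> 'g set \<Rightarrow> 'g set \<Rightarrow> 'g set rel set" where
  "coset_scheme G H K =
     (\<lambda>(P, Q). (\<lambda>k. (P #>\<^bsub>G\<^esub> k, Q #>\<^bsub>G\<^esub> k)) ` K) ` ((rcosets\<^bsub>G\<^esub> H) \<times> (rcosets\<^bsub>G\<^esub> H))"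

lemma cartan_scheme_eq: "cartan_scheme G H = coset_scheme G H (carrier G)"
  unfolding cartan_scheme_def coset_scheme_def orbits_def orbit_def by (auto simp: image_def split_def)

context group begin

lemma inv_mult_cancel:
  assumes "g \<in> carrier G" "y \<in> carrier G"
  shows "inv g \<otimes> (g \<otimes> y) = y" "g \<otimes> (inv g \<otimes> y) = y"
  using assms by (simp_all flip: m_assoc)

lemma rcoset_act_closed:
  assumes "subgroup H G" "P \<in> rcosets H" "g \<in> carrier G"
  shows "P #> g \<in> rcosets H"
  using assms coset_mult_assoc[of H] subgroup.subset[OF assms(1)] unfolding RCOSETS_def by force

lemma rcoset_act_assoc:
  assumes "subgroup H G" "P \<in> rcosets H" "g \<in> carrier G" "h \<in> carrier G"
  shows "P #> g #> h = P #> (g \<otimes> h)"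
  using coset_mult_assoc[OF subgroup.rcosets_carrier[OF assms(1) is_group assms(2)]] assms(3,4) by simp

lemma rcoset_act_one:
  assumes "subgroup H G" "P \<in> rcosets H"
  shows "P #> \<one> = P"
  using coset_mult_one[OF subgroup.rcosets_carrier[OF assms(1) is_group assms(2)]] .

lemma rcoset_act_cancel:
  assumes "subgroup H G" "P \<in> rcosets H" "g \<in> carrier G"
  shows "P #> g #> inv g = P" "P #> inv g #> g = P"
  using assms by (simp_all add: rcoset_act_assoc rcoset_act_one)

lemma coset_scheme_partition:
  assumes H: "subgroup H G" and K: "subgroup K G"
  shows "partition_on ((rcosets H) \<times> (rcosets H)) (coset_scheme G H K)"
proof -
  interpret K: subgroup K G by fact
  let ?O = "rcosets H"
  let ?orb = "\<lambda>P Q. (\<lambda>k. (P #> k, Q #> k)) ` K"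
  have self: "(P, Q) \<in> ?orb P Q" if "P \<in> ?O" "Q \<in> ?O" for P Q
    by (rule image_eqI[of _ _ \<one>]) (use that rcoset_act_one[OF H] in auto)
  have eq: "?orb P' Q' = ?orb P Q" if "P \<in> ?O" "Q \<in> ?O" "k \<in> K" "P' = P #> k" "Q' = Q #> k" for P Q P' Q' k
  proof
    show "?orb P' Q' \<subseteq> ?orb P Q"
    proof clarify
      fix j assume "j \<in> K"
      then have "(P' #> j, Q' #> j) = (P #> (k \<otimes> j), Q #> (k \<otimes> j))" "k \<otimes> j \<in> K"
        using that rcoset_act_assoc[OF H] by auto
      then show "(P' #> j, Q' #> j) \<in> ?orb P Q" by blast
    qed
    show "?orb P Q \<subseteq> ?orb P' Q'"
    proof clarify
      fix j assume j: "j \<in> K"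
      then have "(P #> j, Q #> j) = (P' #> (inv k \<otimes> j), Q' #> (inv k \<otimes> j))" "inv k \<otimes> j \<in> K"
        using that j by (simp_all add: rcoset_act_closed[OF H] rcoset_act_cancel[OF H] flip: rcoset_act_assoc[OF H])
      then show "(P #> j, Q #> j) \<in> ?orb P' Q'" by blast
    qed
  qed
  show ?thesis
  proof (rule partition_onI)
    show "\<Union>(coset_scheme G H K) = ?O \<times> ?O"
    proof
      show "\<Union>(coset_scheme G H K) \<subseteq> ?O \<times> ?O"
        unfolding coset_scheme_def using rcoset_act_closed[OF H] K.mem_carrier by clarsimp
      show "?O \<times> ?O \<subseteq> \<Union>(coset_scheme G H K)"
      proof clarify
        fix P Q assume "P \<in> ?O" "Q \<in> ?O"
        moreover from this have "?orb P Q \<in> coset_scheme G H K"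
          unfolding coset_scheme_def by (intro image_eqI[of _ _ "(P, Q)"]) auto
        ultimately show "(P, Q) \<in> \<Union>(coset_scheme G H K)" using self by blast
      qed
    qed
    show "{} \<notin> coset_scheme G H K"
    proof
      assume "{} \<in> coset_scheme G H K"
      then obtain A B where "A \<in> ?O" "B \<in> ?O" "{} = ?orb A B" unfolding coset_scheme_def by auto
      then show False using self by blast
    qed
    fix p q assume p: "p \<in> coset_scheme G H K"
    assume q: "q \<in> coset_scheme G H K" and ne: "p \<noteq> q"
    obtain P Q where PQ: "p = ?orb P Q" "P \<in> ?O" "Q \<in> ?O" using p unfolding coset_scheme_def by auto
    obtain P' Q' where PQ': "q = ?orb P' Q'" "P' \<in> ?O" "Q' \<in> ?O" using q unfolding coset_scheme_def by auto
    show "disjnt p q" unfolding disjnt_def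
    proof (rule ccontr)
      assume "p \<inter> q \<noteq> {}"
      then obtain x where "x \<in> p" "x \<in> q" by blast
      then obtain k k' where "k \<in> K" "k' \<in> K" "x = (P #> k, Q #> k)" "x = (P' #> k', Q' #> k')"
        using PQ PQ' by blast
      then have "?orb (fst x) (snd x) = ?orb P Q" "?orb (fst x) (snd x) = ?orb P' Q'"
        using eq[OF PQ(2,3), of k "fst x" "snd x"] eq[OF PQ'(2,3), of k' "fst x" "snd x"] by simp_all
      then have "p = q" using PQ(1) PQ'(1) by simp
      then show False using ne by simp
    qed
  qed
qed

lemma coset_scheme_invariant:
  assumes H: "subgroup H G" and K: "subgroup K G" and s: "s \<in> coset_scheme G H K" and k: "k \<in> K"
    and PQ: "(P, Q) \<in> s"
  shows "(P #> k, Q #> k) \<in> s"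
proof -
  interpret K: subgroup K G by fact
  obtain A B where "A \<in> rcosets H" "B \<in> rcosets H" "s = (\<lambda>k. (A #> k, B #> k)) ` K"
    using s unfolding coset_scheme_def by auto
  moreover from this obtain j where "j \<in> K" "P = A #> j" "Q = B #> j" using PQ by auto
  ultimately show ?thesis using k by (auto simp: rcoset_act_assoc[OF H])
qed

lemma coset_scheme_transitive:
  assumes H: "subgroup H G" and K: "subgroup K G" and s: "s \<in> coset_scheme G H K"
    and PQ: "(P, Q) \<in> s" and PQ': "(P', Q') \<in> s"
  shows "\<exists>k\<in>K. P' = P #> k \<and> Q' = Q #> k"
proof -
  interpret K: subgroup K G by fact
  obtain A B where AB: "A \<in> rcosets H" "B \<in> rcosets H" "s = (\<lambda>k. (A #> k, B #> k)) ` K"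
    using s unfolding coset_scheme_def by auto
  obtain j where j: "j \<in> K" "P = A #> j" "Q = B #> j" using PQ AB by auto
  obtain j' where j': "j' \<in> K" "P' = A #> j'" "Q' = B #> j'" using PQ' AB by auto
  have "X #> j' = X #> j #> (inv j \<otimes> j')" if "X \<in> rcosets H" for X
    using that j j' by (simp add: rcoset_act_closed[OF H] rcoset_act_cancel[OF H] flip: rcoset_act_assoc[OF H])
  then show ?thesis using AB j j' by (intro bexI[of _ "inv j \<otimes> j'"]) auto
qed

lemma finite_rcosets: "finite (carrier G) \<Longrightarrow> finite (rcosets H)"
  unfolding RCOSETS_def by auto

lemma coset_scheme_coherent:
  assumes fin: "finite (carrier G)" and H: "subgroup H G" and K: "subgroup K G"
  shows "coherent_configuration (rcosets H) (coset_scheme G H K)"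
  unfolding coherent_configuration_def
proof (intro conjI)
  interpret K: subgroup K G by fact
  let ?O = "rcosets H" and ?S = "coset_scheme G H K"
  have part: "partition_on (?O \<times> ?O) ?S" by (rule coset_scheme_partition[OF H K])
  show "finite ?O" using finite_rcosets[OF fin] .
  show "partition_on (?O \<times> ?O) ?S" by fact
  show "\<exists>T\<subseteq>?S. Id_on ?O = \<Union>T"
  proof (intro exI conjI)
    let ?T = "(\<lambda>P. (\<lambda>k. (P #> k, P #> k)) ` K) ` ?O"
    show "?T \<subseteq> ?S" unfolding coset_scheme_def by fastforce
    show "Id_on ?O = \<Union>?T"
    proof
      show "Id_on ?O \<subseteq> \<Union>?T"
      proof clarify
        fix P assume P: "P \<in> ?O"
        then have "(P, P) \<in> (\<lambda>k. (P #> k, P #> k)) ` K"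
          by (intro image_eqI[of _ _ \<one>]) (auto simp: rcoset_act_one[OF H])
        then show "(P, P) \<in> \<Union>?T" using P by blast
      qed
      show "\<Union>?T \<subseteq> Id_on ?O" using rcoset_act_closed[OF H] by auto
    qed
  qed
  show "\<forall>s\<in>?S. s\<inverse> \<in> ?S"
  proof
    fix s assume "s \<in> ?S"
    then obtain A B where AB: "A \<in> ?O" "B \<in> ?O" "s = (\<lambda>k. (A #> k, B #> k)) ` K"
      unfolding coset_scheme_def by auto
    then have "s\<inverse> = (\<lambda>k. (B #> k, A #> k)) ` K" by auto
    then show "s\<inverse> \<in> ?S" unfolding coset_scheme_def using AB by force
  qed
  show "\<forall>r\<in>?S. \<forall>s\<in>?S. \<forall>t\<in>?S. \<exists>c. \<forall>(\<alpha>, \<beta>)\<in>t. card (r `` {\<alpha>} \<inter> s\<inverse> `` {\<beta>}) = c"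
  proof (intro ballI)
    fix r s t assume r: "r \<in> ?S" and s: "s \<in> ?S" and t: "t \<in> ?S"
    have sub: "r \<subseteq> ?O \<times> ?O" using r part unfolding partition_on_def by blast
    \<comment> \<open>One inequality is enough: the two pairs of the orbit play symmetric roles.
      Translation by the \<open>k\<close> that carries one pair to the other is the
      injection.\<close>
    have le: "card (r `` {a} \<inter> s\<inverse> `` {b}) \<le> card (r `` {a'} \<inter> s\<inverse> `` {b'})"
      if ab: "(a, b) \<in> t" and ab': "(a', b') \<in> t" for a b a' b'
    proof -
      obtain k where k: "k \<in> K" "a' = a #> k" "b' = b #> k"
        using coset_scheme_transitive[OF H K t ab ab'] by blast
      show ?thesis
      proof (rule card_inj_on_le[where f = "\<lambda>X. X #> k"])
        show "inj_on (\<lambda>X. X #> k) (r `` {a} \<inter> s\<inverse> `` {b})"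
        proof (rule inj_onI)
          fix X Y assume "X \<in> r `` {a} \<inter> s\<inverse> `` {b}" "Y \<in> r `` {a} \<inter> s\<inverse> `` {b}" "X #> k = Y #> k"
          then show "X = Y" using sub k by (metis Image_singleton_iff Int_iff K.mem_carrier SigmaE2 rcoset_act_cancel(1)[OF H] subsetD)
        qed
        show "(\<lambda>X. X #> k) ` (r `` {a} \<inter> s\<inverse> `` {b}) \<subseteq> r `` {a'} \<inter> s\<inverse> `` {b'}"
          using coset_scheme_invariant[OF H K r k(1)] coset_scheme_invariant[OF H K s k(1)] k by auto
        show "finite (r `` {a'} \<inter> s\<inverse> `` {b'})"
          using sub finite_rcosets[OF fin, of H] finite_subset[of "r `` {a'} \<inter> s\<inverse> `` {b'}" ?O] by blast
      qed
    qed
    show "\<exists>c. \<forall>(\<alpha>, \<beta>)\<in>t. card (r `` {\<alpha>} \<inter> s\<inverse> `` {\<beta>}) = c"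
    proof (cases "t = {}")
      case False
      then obtain a b where ab: "(a, b) \<in> t" by auto
      show ?thesis
        by (rule exI[of _ "card (r `` {a} \<inter> s\<inverse> `` {b})"]) (use le ab in \<open>auto intro!: le_antisym\<close>)
    qed auto
  qed
qed

lemma coset_scheme_fixing:
  assumes fin: "finite (carrier G)" and H: "subgroup H G" and K: "subgroup K G" and A: "A \<subseteq> rcosets H"
    and fixA: "\<And>k P. k \<in> K \<Longrightarrow> P \<in> A \<Longrightarrow> P #> k = P"
  shows "cc_fixing (rcosets H) (cartan_scheme G H) A (coset_scheme G H K)"
  unfolding cc_fixing_def cartan_scheme_eq
proof (intro conjI ballI)
  interpret K: subgroup K G by fact
  show "coherent_configuration (rcosets H) (coset_scheme G H K)"
    by (rule coset_scheme_coherent[OF fin H K])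
  show "cc_le (coset_scheme G H (carrier G)) (coset_scheme G H K)"
    unfolding cc_le_refines[OF coset_scheme_partition[OF H subgroup_self] coset_scheme_partition[OF H K]]
  proof
    fix s assume "s \<in> coset_scheme G H K"
    then obtain A B where AB: "A \<in> rcosets H" "B \<in> rcosets H" "s = (\<lambda>k. (A #> k, B #> k)) ` K"
      unfolding coset_scheme_def by auto
    then have "s \<subseteq> (\<lambda>k. (A #> k, B #> k)) ` carrier G" using K.subset by auto
    moreover have "(\<lambda>k. (A #> k, B #> k)) ` carrier G \<in> coset_scheme G H (carrier G)"
      unfolding coset_scheme_def using AB by (intro image_eqI[of _ _ "(A, B)"]) auto
    ultimately show "\<exists>s'\<in>coset_scheme G H (carrier G). s \<subseteq> s'" by blast
  qed
  fix P assume P: "P \<in> A"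
  then have "(\<lambda>k. (P #> k, P #> k)) ` K = (\<lambda>k. (P, P)) ` K" using fixA by (intro image_cong) auto
  then have "(\<lambda>k. (P #> k, P #> k)) ` K = {(P, P)}" using image_constant[OF K.one_closed] by metis
  moreover have "(\<lambda>k. (P #> k, P #> k)) ` K \<in> coset_scheme G H K"
    unfolding coset_scheme_def using P A by force
  ultimately show "{(P, P)} \<in> cc_relations (coset_scheme G H K)" using basis_in_cc_relations by metis
qed

text \<open>The orbits of \<open>K\<close> form an admissible configuration, which must be complete;
  orbits of pairs that are singletons mean that \<open>K\<close> moves nothing.\<close>

lemma cc_base_stabilizer_trivial:
  assumes fin: "finite (carrier G)" and H: "subgroup H G" and K: "subgroup K G"
    and base: "cc_base (rcosets H) (cartan_scheme G H) A"
    and fixA: "\<And>k P. k \<in> K \<Longrightarrow> P \<in> A \<Longrightarrow> P #> k = P"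
    and k: "k \<in> K" and P: "P \<in> rcosets H"
  shows "P #> k = P"
proof -
  interpret K: subgroup K G by fact
  have A: "A \<subseteq> rcosets H" using base unfolding cc_base_def by blast
  have f: "cc_fixing (rcosets H) (cartan_scheme G H) A (coset_scheme G H K)"
    by (rule coset_scheme_fixing[OF fin H K A fixA])
  have c: "cc_complete (coset_scheme G H K)"
    using base f unfolding cc_base_iff[OF f A] by blast
  have "(\<lambda>k. (P #> k, P #> k)) ` K \<in> coset_scheme G H K"
    unfolding coset_scheme_def using P by force
  then have "is_singleton ((\<lambda>k. (P #> k, P #> k)) ` K)" using c unfolding cc_complete_def by blast
  moreover have "(P #> k, P #> k) \<in> (\<lambda>k. (P #> k, P #> k)) ` K" "(P #> \<one>, P #> \<one>) \<in> (\<lambda>k. (P #> k, P #> k)) ` K"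
    using k by auto
  ultimately have "(P #> k, P #> k) = (P #> \<one>, P #> \<one>)" unfolding is_singleton_def by (metis singletonD)
  then show ?thesis using rcoset_act_one[OF H P] by simp
qed

lemma cartan_base_iff:
  assumes "finite (carrier G)" "subgroup H G" "A \<subseteq> rcosets H"
  shows "cc_base (rcosets H) (cartan_scheme G H) A \<longleftrightarrow>
    (\<forall>S'. cc_fixing (rcosets H) (cartan_scheme G H) A S' \<longrightarrow> cc_complete S')"
  using cc_base_iff[OF cc_fixing_discrete] finite_rcosets assms coset_scheme_partition[OF assms(2) subgroup_self]
  unfolding cartan_scheme_eq by metis

text \<open>The stabiliser of \<open>H x\<close> is \<open>x\<inverse>Hx\<close>; the hypothesis says that the orbits of
  \<open>H p x\<close> under the stabilisers of \<open>H x\<close> and \<open>H g x\<close> meet only in \<open>H p x\<close>.\<close>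

lemma cartan_fixed_step:
  assumes H: "subgroup H G" and P: "subgroup P G" and HP: "H \<subseteq> P"
    and f: "cc_fixing (rcosets H) (cartan_scheme G H) A S'"
    and x: "x \<in> carrier G" and g: "g \<in> carrier G" and p: "p \<in> P"
    and hg: "\<And>h. h \<in> H \<Longrightarrow> inv g \<otimes> h \<otimes> g \<in> P \<Longrightarrow> h = \<one>"
    and fx: "cc_fixed S' (H #> x)" and fgx: "cc_fixed S' (H #> (g \<otimes> x))"
  shows "cc_fixed S' (H #> (p \<otimes> x))"
proof -
  interpret H: subgroup H G by fact
  interpret P: subgroup P G by fact
  let ?\<gamma> = "H #> (p \<otimes> x)"
  let ?R = "\<lambda>y. (\<lambda>k. (H #> y #> k, ?\<gamma> #> k)) ` carrier G"
  have pc: "p \<in> carrier G" using p by simp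
  have rel: "?R y \<in> cc_relations S'" if "y \<in> carrier G" for y
  proof -
    have "?R y \<in> coset_scheme G H (carrier G)"
      unfolding coset_scheme_def using that x pc H.subset rcosetsI[of H] by force
    then show ?thesis using f basis_in_cc_relations unfolding cc_fixing_def cc_le_def cartan_scheme_eq by blast
  qed
  have single: "?R x `` {H #> x} \<inter> ?R (g \<otimes> x) `` {H #> (g \<otimes> x)} = {?\<gamma>}"
  proof
    show "{?\<gamma>} \<subseteq> ?R x `` {H #> x} \<inter> ?R (g \<otimes> x) `` {H #> (g \<otimes> x)}"
    proof -
      have "(H #> y, ?\<gamma>) \<in> ?R y" if "y \<in> carrier G" for y
        by (rule image_eqI[of _ _ \<one>]) (use that x pc H.subset in \<open>auto simp: coset_mult_assoc\<close>)
      then show ?thesis using x g by auto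
    qed
    show "?R x `` {H #> x} \<inter> ?R (g \<otimes> x) `` {H #> (g \<otimes> x)} \<subseteq> {?\<gamma>}"
    proof
      fix \<delta> assume "\<delta> \<in> ?R x `` {H #> x} \<inter> ?R (g \<otimes> x) `` {H #> (g \<otimes> x)}"
      then obtain k k' where k: "k \<in> carrier G" "H #> x #> k = H #> x" "\<delta> = ?\<gamma> #> k"
        and k': "k' \<in> carrier G" "H #> (g \<otimes> x) #> k' = H #> (g \<otimes> x)" "\<delta> = ?\<gamma> #> k'"
        by auto
      have stab: "y \<otimes> j \<otimes> inv y \<in> H" if "y \<in> carrier G" "j \<in> carrier G" "H #> y #> j = H #> y" for y j
      proof (rule coset_join1)
        have "H #> (y \<otimes> j \<otimes> inv y) = H #> y #> j #> inv y" using that(1,2) H.subset by (simp add: coset_mult_assoc)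
        also have "\<dots> = H" unfolding that(3) using that(1) H.subset by (simp add: coset_mult_assoc)
        finally show "H #> (y \<otimes> j \<otimes> inv y) = H" .
      qed (use that H in auto)
      have a: "x \<otimes> k \<otimes> inv x \<in> H" by (rule stab[OF x k(1,2)])
      have b: "(g \<otimes> x) \<otimes> k' \<otimes> inv (g \<otimes> x) \<in> H" using stab[OF _ k'(1,2)] g x by simp
      have "H #> (p \<otimes> x \<otimes> k) = H #> (p \<otimes> x \<otimes> k')"
        using k k' x pc H.subset by (simp add: coset_mult_assoc)
      have c: "p \<otimes> x \<otimes> k \<otimes> inv (p \<otimes> x \<otimes> k') \<in> H"
      proof (rule coset_join1)
        have "H #> (p \<otimes> x \<otimes> k \<otimes> inv (p \<otimes> x \<otimes> k')) = H #> (p \<otimes> x \<otimes> k) #> inv (p \<otimes> x \<otimes> k')"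
          using k k' x pc H.subset by (simp add: coset_mult_assoc)
        also have "\<dots> = H #> (p \<otimes> x \<otimes> k') #> inv (p \<otimes> x \<otimes> k')"
          using \<open>H #> (p \<otimes> x \<otimes> k) = H #> (p \<otimes> x \<otimes> k')\<close> by simp
        also have "\<dots> = H" using k' x pc H.subset by (simp add: coset_mult_assoc del: inv_mult_group)
        finally show "H #> (p \<otimes> x \<otimes> k \<otimes> inv (p \<otimes> x \<otimes> k')) = H" .
      qed (use k k' x pc H in auto)
      \<comment> \<open>The element x k' x^{-1} is a g-conjugate of an element of H. The equality of
        the two descriptions of the common point rewrites it as a product of elements of P, so
        \<open>hg\<close> makes it trivial.\<close>
      have "inv g \<otimes> ((g \<otimes> x) \<otimes> k' \<otimes> inv (g \<otimes> x)) \<otimes> g = x \<otimes> k' \<otimes> inv x"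
        using g x k' by (simp add: m_assoc inv_mult_group inv_mult_cancel)
      also have "\<dots> = inv p \<otimes> inv (p \<otimes> x \<otimes> k \<otimes> inv (p \<otimes> x \<otimes> k')) \<otimes> p \<otimes> (x \<otimes> k \<otimes> inv x)"
        using pc x k k' by (simp add: m_assoc inv_mult_group inv_mult_cancel)
      also have "\<dots> \<in> P" using p c a HP by (meson P.m_closed P.m_inv_closed subsetD)
      finally have "(g \<otimes> x) \<otimes> k' \<otimes> inv (g \<otimes> x) = \<one>" using hg b by blast
      then have "inv (g \<otimes> x) \<otimes> ((g \<otimes> x) \<otimes> k' \<otimes> inv (g \<otimes> x)) \<otimes> (g \<otimes> x) = \<one>" using g x k' by simp
      then have "k' = \<one>" using g x k' by (simp add: m_assoc inv_mult_group inv_mult_cancel)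
      then show "\<delta> \<in> {?\<gamma>}" using k'(3) x pc H.subset by (simp add: coset_mult_assoc)
    qed
  qed
  have cc: "coherent_configuration (rcosets H) S'" using f unfolding cc_fixing_def by blast
  have gx: "g \<otimes> x \<in> carrier G" using g x by simp
  show ?thesis by (rule cc_fixed_intersection[OF cc fx fgx rel[OF x] rel[OF gx] single])
qed

text \<open>The element \<open>g\<close> of Q drives the steps along P, the element
  \<open>g'\<close> of P those along Q. Each step needs two fixed points already, and the two kinds
  of step supply them to each other.\<close>

theorem cartan_base_opposite:
  assumes fin: "finite (carrier G)" and H: "subgroup H G" and P: "subgroup P G" and Q: "subgroup Q G"
    and HP: "H \<subseteq> P" and HQ: "H \<subseteq> Q" and gen: "generate G (P \<union> Q) = carrier G"
    and g: "g \<in> Q" and hg: "\<And>h. h \<in> H \<Longrightarrow> inv g \<otimes> h \<otimes> g \<in> P \<Longrightarrow> h = \<one>"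
    and g': "g' \<in> P" and hg': "\<And>h. h \<in> H \<Longrightarrow> inv g' \<otimes> h \<otimes> g' \<in> Q \<Longrightarrow> h = \<one>"
  shows "cc_base (rcosets H) (cartan_scheme G H) {H, H #> g}"
proof -
  interpret H: subgroup H G by fact
  interpret P: subgroup P G by fact
  interpret Q: subgroup Q G by fact
  have A: "{H, H #> g} \<subseteq> rcosets H"
    using g H.subset rcosetsI[of H] rcosetsI[of H \<one>] by auto
  show ?thesis
    unfolding cartan_base_iff[OF fin H A]
  proof (intro allI impI)
    fix S' assume f: "cc_fixing (rcosets H) (cartan_scheme G H) {H, H #> g} S'"
    define F where "F x = cc_fixed S' (H #> x)" for x
    note stepP = cartan_fixed_step[OF H P HP f _ _ _ hg, folded F_def]
    note stepQ = cartan_fixed_step[OF H Q HQ f _ _ _ hg', folded F_def]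
    \<comment> \<open>Both families are demanded so that Z survives multiplication from either side.
      For p x the P-family is only reindexed; it contains p x and g' p x, from which the step along
      Q starts. With P and Q exchanged, \<open>g\<close> takes the place of
      \<open>g'\<close>.\<close>
    define Z where "Z = {x \<in> carrier G. (\<forall>p\<in>P. F (p \<otimes> x)) \<and> (\<forall>q\<in>Q. F (q \<otimes> x))}"
    have "F \<one>" "F g" using f H.subset unfolding F_def cc_fixing_def cc_fixed_def by auto
    then have "F p" if "p \<in> P" for p using stepP[of \<one> g p] that g by simp
    moreover from this have "F q" if "q \<in> Q" for q using stepQ[of \<one> g' q] that g' \<open>F \<one>\<close> by simp
    ultimately have one: "\<one> \<in> Z" unfolding Z_def by simp
    have zp: "p \<otimes> x \<in> Z" if p: "p \<in> P" and x: "x \<in> Z" for p x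
    proof -
      have xc: "x \<in> carrier G" using x unfolding Z_def by blast
      have "F (p' \<otimes> (p \<otimes> x))" if "p' \<in> P" for p'
        using x p that xc unfolding Z_def by (simp flip: m_assoc)
      moreover from this[OF P.one_closed] this[OF g'] have "F (q \<otimes> (p \<otimes> x))" if "q \<in> Q" for q
        using stepQ[of "p \<otimes> x" g' q] that xc p g' by simp
      ultimately show ?thesis unfolding Z_def using xc p by simp
    qed
    have zq: "q \<otimes> x \<in> Z" if q: "q \<in> Q" and x: "x \<in> Z" for q x
    proof -
      have xc: "x \<in> carrier G" using x unfolding Z_def by blast
      have "F (q' \<otimes> (q \<otimes> x))" if "q' \<in> Q" for q'
        using x q that xc unfolding Z_def by (simp flip: m_assoc)
      moreover from this[OF Q.one_closed] this[OF g] have "F (p \<otimes> (q \<otimes> x))" if "p \<in> P" for p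
        using stepP[of "q \<otimes> x" g p] that xc q g by simp
      ultimately show ?thesis unfolding Z_def using xc q by simp
    qed
    have "\<forall>x\<in>Z. y \<otimes> x \<in> Z" if "y \<in> generate G (P \<union> Q)" for y
      using that
    proof (induction rule: generate.induct)
      case one
      then show ?case unfolding Z_def by simp
    next
      case (incl h)
      then show ?case using zp zq by blast
    next
      case (inv h)
      then show ?case using zp zq P.m_inv_closed Q.m_inv_closed by blast
    next
      case (eng h1 h2)
      have "h1 \<in> carrier G" "h2 \<in> carrier G" using eng gen by auto
      then show ?case using eng unfolding Z_def by (auto simp: m_assoc)
    qed
    then have "y \<in> Z" if "y \<in> carrier G" for y using that one gen by (metis r_one)
    then have "F (\<one> \<otimes> y)" if "y \<in> carrier G" for y using that P.one_closed unfolding Z_def by blast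
    then have all: "F y" if "y \<in> carrier G" for y using that by simp
    show "cc_complete S'"
      by (rule cc_complete_if_all_fixed[of "rcosets H"])
        (use f all in \<open>auto simp: cc_fixing_def F_def RCOSETS_def\<close>)
  qed
qed

end

text \<open>For a one-point base the stabiliser of that point fixes all points, so it lies in the
  kernel \<open>N\<close> of the action. Simplicity leaves two cases for the kernel. For trivial H
  the action is regular, and a single fixed point determines all others.\<close>

theorem cartan_base_number:
  fixes G (structure)
  assumes "simple_group G" and fin: "finite (carrier G)" and H: "subgroup H G"
    and base: "cc_base (rcosets\<^bsub>G\<^esub> H) (cartan_scheme G H) {H, H #>\<^bsub>G\<^esub> g}"
  shows "base_number (rcosets\<^bsub>G\<^esub> H) (cartan_scheme G H) \<le> 2 \<and>
    (base_number (rcosets\<^bsub>G\<^esub> H) (cartan_scheme G H) = 1 \<longleftrightarrow> H = {\<one>\<^bsub>G\<^esub>})"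
proof -
  interpret simple_group G by fact
  interpret H: subgroup H G by fact
  let ?O = "rcosets H" and ?S = "cartan_scheme G H"
  let ?b = "base_number ?O ?S"
  have ex: "\<exists>n A. cc_base ?O ?S A \<and> card A = n" using base by blast
  have le: "?b \<le> card A" if "cc_base ?O ?S A" for A
    unfolding base_number_def using that by (intro Least_le) blast
  have att: "\<exists>A. cc_base ?O ?S A \<and> card A = ?b"
    unfolding base_number_def using LeastI_ex[OF ex] .
  have finO: "finite ?O" using finite_rcosets[OF fin] .
  have HO: "H \<in> ?O" using rcosetsI[OF H.subset one_closed] H.subset by simp
  have "card {H, H #> g} \<le> 2" by (simp add: card_insert_if)
  then have le2: "?b \<le> 2" using le[OF base] by linarith
  have "?b = 1" if triv: "H = {\<one>}"
  proof -
    have "cc_base ?O ?S {H}"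
      unfolding cartan_base_iff[OF fin H] using HO
    proof (subst cartan_base_iff[OF fin H], simp, intro allI impI)
      fix S' assume f: "cc_fixing ?O ?S {H} S'"
      then have cc: "coherent_configuration ?O S'" and fH: "cc_fixed S' H"
        unfolding cc_fixing_def cc_fixed_def by auto
      show "cc_complete S'"
      proof (rule cc_complete_if_all_fixed[OF cc])
        fix \<alpha> assume \<alpha>: "\<alpha> \<in> ?O"
        then obtain y where y: "y \<in> carrier G" "\<alpha> = H #> y" unfolding RCOSETS_def by auto
        let ?R = "(\<lambda>k. (H #> k, \<alpha> #> k)) ` carrier G"
        have "?R \<in> coset_scheme G H (carrier G)" unfolding coset_scheme_def using HO \<alpha> by force
        then have R: "?R \<in> cc_relations S'"
          using f basis_in_cc_relations unfolding cc_fixing_def cc_le_def cartan_scheme_eq by blast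
        have "k = \<one>" if "k \<in> carrier G" "H #> k = H" for k
          using that triv unfolding r_coset_def by auto
        then have "?R `` {H} \<subseteq> {\<alpha> #> \<one>}" by fastforce
        moreover have "(H #> \<one>, \<alpha> #> \<one>) \<in> ?R" by blast
        ultimately have "?R `` {H} \<inter> ?R `` {H} = {\<alpha>}"
          using rcoset_act_one[OF H] HO \<alpha> by auto
        then show "cc_fixed S' \<alpha>" using cc_fixed_intersection[OF cc fH fH R R] by blast
      qed
    qed
    then have "?b \<le> 1" using le by fastforce
    \<comment> \<open>An empty base would make the whole group act trivially on the cosets of the
      trivial subgroup, so the group would be trivial.\<close>
    moreover have "?b \<noteq> 0"
    proof
      assume "?b = 0"
      then obtain A where A: "cc_base ?O ?S A" "card A = 0" using att by auto
      then have "A = {}" using finite_subset[OF _ finO, of A] unfolding cc_base_def by simp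
      then have "H #> k = H" if "k \<in> carrier G" for k
        using cc_base_stabilizer_trivial[OF fin H subgroup_self A(1) _ that HO] by simp
      then have "k = \<one>" if kc: "k \<in> carrier G" for k
      proof -
        have "\<one> \<otimes> k \<in> H #> k" unfolding r_coset_def using H.one_closed by blast
        then show ?thesis using \<open>\<And>k. k \<in> carrier G \<Longrightarrow> H #> k = H\<close>[OF kc] triv kc by simp
      qed
      then have "carrier G = {\<one>}" by blast
      then show False using simple_not_triv by simp
    qed
    ultimately show ?thesis by linarith
  qed
  moreover have "H = {\<one>}" if b1: "?b = 1"
  proof -
    obtain A where A: "cc_base ?O ?S A" "card A = 1" using att b1 by auto
    then obtain \<alpha> where \<alpha>: "A = {\<alpha>}" using card_1_singletonE by blast
    then have \<alpha>O: "\<alpha> \<in> ?O" using A unfolding cc_base_def by blast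
    then obtain x where x: "x \<in> carrier G" "\<alpha> = H #> x" unfolding RCOSETS_def by auto
    define N where "N = {k \<in> carrier G. \<forall>P\<in>?O. P #> k = P}"
    have "N \<lhd> G"
    proof (rule normal_invI)
      show "subgroup N G"
      proof (rule subgroupI)
        show "N \<noteq> {}" unfolding N_def using rcoset_act_one[OF H] by auto
        fix a assume a: "a \<in> N"
        then show "inv a \<in> N" unfolding N_def using rcoset_act_cancel[OF H] by force
        fix b assume b: "b \<in> N"
        then show "a \<otimes> b \<in> N" using a unfolding N_def by (simp flip: rcoset_act_assoc[OF H])
      qed (auto simp: N_def)
      fix y h assume y: "y \<in> carrier G" and h: "h \<in> N"
      have "P #> (y \<otimes> h \<otimes> inv y) = P" if "P \<in> ?O" for P
        using that y h unfolding N_def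
        by (simp add: rcoset_act_closed[OF H] rcoset_act_cancel[OF H] flip: rcoset_act_assoc[OF H])
      then show "y \<otimes> h \<otimes> inv y \<in> N" using y h unfolding N_def by auto
    qed
    then consider "N = carrier G" | "N = {\<one>}" using no_real_normal_subgroup by blast
    then show "H = {\<one>}"
    proof cases
      \<comment> \<open>The whole group acts trivially, so there is one point only. Its
        configuration is complete with nothing fixed, and the base number would be 0 instead of
        1.\<close>
      case 1
      have single: "P = H" if PO: "P \<in> ?O" for P
      proof -
        obtain y where "y \<in> carrier G" "P = H #> y" using PO unfolding RCOSETS_def by auto
        then show ?thesis using 1 HO unfolding N_def by auto
      qed
      then have O: "?O = {H}" using HO by blast
      have "cc_base ?O ?S {}"
      proof (subst cartan_base_iff[OF fin H], simp, intro allI impI)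
        fix S' assume "cc_fixing ?O ?S {} S'"
        then have cc: "coherent_configuration ?O S'" unfolding cc_fixing_def by auto
        show "cc_complete S'"
        proof (rule cc_complete_if_all_fixed[OF cc])
          fix \<alpha> assume "\<alpha> \<in> ?O"
          moreover have "\<Union>S' \<in> cc_relations S'" unfolding cc_relations_def by blast
          ultimately show "cc_fixed S' \<alpha>"
            using partition_onD1[OF cc_partition[OF cc]] unfolding cc_fixed_def O by simp
        qed
      qed
      then show ?thesis using le b1 by fastforce
    next
      case 2
      define K where "K = {k \<in> carrier G. \<alpha> #> k = \<alpha>}"
      have K: "subgroup K G"
      proof (rule subgroupI)
        show "K \<noteq> {}" unfolding K_def using rcoset_act_one[OF H \<alpha>O] by auto
        fix a assume a: "a \<in> K"
        then show "inv a \<in> K" unfolding K_def using rcoset_act_cancel[OF H \<alpha>O] by force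
        fix b assume b: "b \<in> K"
        then show "a \<otimes> b \<in> K" using a \<alpha>O unfolding K_def by (simp flip: rcoset_act_assoc[OF H])
      qed (auto simp: K_def)
      have "K \<subseteq> N"
      proof
        fix k assume k: "k \<in> K"
        have "P #> k = P" if "P \<in> ?O" for P
          using cc_base_stabilizer_trivial[OF fin H K A(1) _ k that] \<alpha> unfolding K_def by blast
        then show "k \<in> N" using k unfolding N_def K_def by blast
      qed
      then have K1: "k = \<one>" if "k \<in> K" for k using that 2 by blast
      have "h = \<one>" if h: "h \<in> H" for h
      proof -
        have "H #> x #> (inv x \<otimes> h \<otimes> x) = H #> (h \<otimes> x)"
          using x h H.subset by (simp add: coset_mult_assoc m_assoc[symmetric])
        also have "\<dots> = H #> x" using x h H.subset by (simp add: H.rcos_const flip: coset_mult_assoc)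
        finally have "inv x \<otimes> h \<otimes> x \<in> K" unfolding K_def using x h by simp
        from K1[OF this] have "x \<otimes> (inv x \<otimes> h \<otimes> x) \<otimes> inv x = \<one>" using x by simp
        then show ?thesis using x h by (simp add: m_assoc inv_mult_cancel)
      qed
      then show ?thesis using H.one_closed by blast
    qed
  qed
  ultimately show ?thesis using le2 by blast
qed

section \<open>Root systems of finite type\<close>

definition smul :: "int \<Rightarrow> root \<Rightarrow> root" where
  "smul k r = (\<lambda>j. k * r j)"

lemma smul_apply [simp]: "smul k r j = k * r j"
  unfolding smul_def by simp

lemma dyn_len_cases: "dyn_len D i \<in> {2, 4, 6}"
  by (cases "(D, i)" rule: dyn_len.cases) auto

lemma dyn_len_pos: "dyn_len D i > 0"
  using dyn_len_cases[of D i] by auto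

lemma dyn_gram_sym: "dyn_gram D i j = dyn_gram D j i"
  unfolding dyn_gram_def by (auto simp: max.commute)

lemma dyn_gram_diag: "dyn_gram D i i = dyn_len D i"
  unfolding dyn_gram_def by simp

lemma dyn_gram_off: "i \<noteq> j \<Longrightarrow> dyn_gram D i j \<le> 0"
  unfolding dyn_gram_def using dyn_len_cases[of D i] dyn_len_cases[of D j] by auto

lemma root_ip_sym: "root_ip D r s = root_ip D s r"
proof -
  have "root_ip D r s = (\<Sum>j<dyn_rank D. \<Sum>i<dyn_rank D. r i * s j * dyn_gram D i j)"
    unfolding root_ip_def by (rule sum.swap)
  also have "\<dots> = root_ip D s r"
    unfolding root_ip_def by (intro sum.cong refl) (simp add: dyn_gram_sym mult.commute mult.left_commute)
  finally show ?thesis .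
qed

lemma root_ip_add: "root_ip D (r + s) t = root_ip D r t + root_ip D s t"
  unfolding root_ip_def by (simp add: algebra_simps sum.distrib)

lemma root_ip_smul: "root_ip D (smul k r) t = k * root_ip D r t"
  unfolding root_ip_def by (simp add: sum_distrib_left algebra_simps)

lemma root_ip_add_right: "root_ip D t (r + s) = root_ip D t r + root_ip D t s"
  using root_ip_add root_ip_sym by metis

lemma root_ip_smul_right: "root_ip D t (smul k r) = k * root_ip D t r"
  using root_ip_smul root_ip_sym by metis

lemma uminus_root: "- r = smul (-1) r" for r :: root
  by (auto simp: fun_eq_iff)

lemma root_ip_minus: "root_ip D (- r) s = - root_ip D r s" "root_ip D r (- s) = - root_ip D r s"
  unfolding uminus_root by (simp_all add: root_ip_smul root_ip_smul_right)

lemmas root_ip_linear = root_ip_add root_ip_add_right root_ip_smul root_ip_smul_right root_ip_minus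

lemma root_ip_simple:
  assumes "i < dyn_rank D"
  shows "root_ip D (simple_root i) s = (\<Sum>j<dyn_rank D. dyn_gram D i j * s j)"
proof -
  have "root_ip D (simple_root i) s =
      (\<Sum>k<dyn_rank D. if k = i then (\<Sum>j<dyn_rank D. dyn_gram D i j * s j) else 0)"
    unfolding root_ip_def simple_root_def by (intro sum.cong refl) (auto simp: mult.commute intro!: sum.cong)
  then show ?thesis using assms by simp
qed

lemma root_ip_simple_simple:
  assumes "i < dyn_rank D" "j < dyn_rank D"
  shows "root_ip D (simple_root i) (simple_root j) = dyn_gram D i j"
proof -
  have "(\<Sum>k<dyn_rank D. dyn_gram D i k * simple_root j k) =
      (\<Sum>k<dyn_rank D. if k = j then dyn_gram D i j else 0)"
    unfolding simple_root_def by (intro sum.cong) auto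
  then show ?thesis using assms by (simp add: root_ip_simple)
qed

definition root_refl :: "dynkin \<Rightarrow> root \<Rightarrow> root \<Rightarrow> root" where
  "root_refl D r s = s + smul (- cartan_int D r s) r"

lemma root_refl_alt: "root_refl D r s = (\<lambda>j. s j - cartan_int D r s * r j)"
  unfolding root_refl_def by (auto simp: fun_eq_iff)

text \<open>The last hypothesis is Vinberg's criterion: a symmetric matrix with nonpositive entries off the
  diagonal is positive definite if it maps some positive vector to a positive vector.\<close>

locale finite_dynkin =
  fixes D :: dynkin and \<kappa> :: int and u :: "nat \<Rightarrow> int"
  assumes ratio: "\<kappa> \<in> {1, 2, 3}"
    and lens: "\<And>i. i < dyn_rank D \<Longrightarrow> dyn_len D i = 2 \<or> dyn_len D i = 2 * \<kappa>"
    and u_pos: "\<And>i. i < dyn_rank D \<Longrightarrow> u i > 0"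
    and gram_u_pos: "\<And>i. i < dyn_rank D \<Longrightarrow> (\<Sum>j<dyn_rank D. dyn_gram D i j * u j) > 0"
begin

abbreviation "rk \<equiv> dyn_rank D"
abbreviation "R \<equiv> roots D"
abbreviation "ip \<equiv> root_ip D"
abbreviation "cart \<equiv> cartan_int D"

section \<open>Positive definiteness and integrality\<close>

text \<open>Put w_i = v_i / u_i. The form equals the sum of w_i^2 u_i (Gu)_i minus half the sum of
  g_ij u_i u_j (w_i - w_j)^2, and the subtracted sum is nonpositive because off-diagonal entries
  are. By integrality (Gu)_i is at least 1, which turns positivity into this explicit bound.\<close>

lemma coord_sq_le_norm:
  assumes "i < rk"
  shows "(v i)\<^sup>2 \<le> u i * ip v v"
proof -
  let ?g = "\<lambda>i j. real_of_int (dyn_gram D i j)"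
  let ?v = "\<lambda>i. real_of_int (v i)" and ?u = "\<lambda>i. real_of_int (u i)"
  let ?w = "\<lambda>i. ?v i / ?u i"
  have un: "?u i \<noteq> 0" if "i < rk" for i using u_pos[OF that] by simp
  have "real_of_int (ip v v) = (\<Sum>i<rk. \<Sum>j<rk. ?g i j * ?v i * ?v j)"
    unfolding root_ip_def by (simp add: mult.commute mult.left_commute)
  also have "\<dots> = (\<Sum>i<rk. \<Sum>j<rk. (?g i j * ?u i * ?u j * (?w i)\<^sup>2 + ?g i j * ?u i * ?u j * (?w j)\<^sup>2
      - ?g i j * ?u i * ?u j * (?w i - ?w j)\<^sup>2) / 2)"
  proof (intro sum.cong refl)
    fix i j assume "i \<in> {..<rk}" "j \<in> {..<rk}"
    then have e: "?v i = ?w i * ?u i" "?v j = ?w j * ?u j" using un by auto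
    show "?g i j * ?v i * ?v j = (?g i j * ?u i * ?u j * (?w i)\<^sup>2 + ?g i j * ?u i * ?u j * (?w j)\<^sup>2
      - ?g i j * ?u i * ?u j * (?w i - ?w j)\<^sup>2) / 2"
      by (subst e(1), subst e(2)) (simp add: power2_eq_square algebra_simps del: times_divide_eq_left times_divide_eq_right)
  qed
  also have "\<dots> = ((\<Sum>i<rk. \<Sum>j<rk. ?g i j * ?u i * ?u j * (?w i)\<^sup>2) + (\<Sum>i<rk. \<Sum>j<rk. ?g i j * ?u i * ?u j * (?w j)\<^sup>2)
      - (\<Sum>i<rk. \<Sum>j<rk. ?g i j * ?u i * ?u j * (?w i - ?w j)\<^sup>2)) / 2"
    by (simp add: sum.distrib sum_subtractf sum_divide_distrib[symmetric])
  also have "(\<Sum>i<rk. \<Sum>j<rk. ?g i j * ?u i * ?u j * (?w j)\<^sup>2) = (\<Sum>i<rk. \<Sum>j<rk. ?g i j * ?u i * ?u j * (?w i)\<^sup>2)"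
    by (subst sum.swap) (intro sum.cong refl, simp add: dyn_gram_sym mult.commute mult.left_commute)
  also have "((\<Sum>i<rk. \<Sum>j<rk. ?g i j * ?u i * ?u j * (?w i)\<^sup>2) + (\<Sum>i<rk. \<Sum>j<rk. ?g i j * ?u i * ?u j * (?w i)\<^sup>2)
      - (\<Sum>i<rk. \<Sum>j<rk. ?g i j * ?u i * ?u j * (?w i - ?w j)\<^sup>2)) / 2
    = (\<Sum>i<rk. \<Sum>j<rk. ?g i j * ?u i * ?u j * (?w i)\<^sup>2) - (\<Sum>i<rk. \<Sum>j<rk. ?g i j * ?u i * ?u j * (?w i - ?w j)\<^sup>2) / 2"
    by simp
  finally have q: "real_of_int (ip v v) = (\<Sum>i<rk. \<Sum>j<rk. ?g i j * ?u i * ?u j * (?w i)\<^sup>2)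
    - (\<Sum>i<rk. \<Sum>j<rk. ?g i j * ?u i * ?u j * (?w i - ?w j)\<^sup>2) / 2" .
  have "(\<Sum>i<rk. \<Sum>j<rk. ?g i j * ?u i * ?u j * (?w i - ?w j)\<^sup>2) \<le> 0"
  proof (intro sum_nonpos)
    fix i j assume ij: "i \<in> {..<rk}" "j \<in> {..<rk}"
    show "?g i j * ?u i * ?u j * (?w i - ?w j)\<^sup>2 \<le> 0"
    proof (cases "i = j")
      case False
      have "?g i j * (?u i * ?u j * (?w i - ?w j)\<^sup>2) \<le> 0"
        using dyn_gram_off[OF False] u_pos[of i] u_pos[of j] ij by (intro mult_nonpos_nonneg) auto
      then show ?thesis by (simp add: mult.assoc)
    qed simp
  qed
  with q have "real_of_int (ip v v) \<ge> (\<Sum>i<rk. \<Sum>j<rk. ?g i j * ?u i * ?u j * (?w i)\<^sup>2)"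
    by linarith
  moreover have "(\<Sum>i<rk. \<Sum>j<rk. ?g i j * ?u i * ?u j * (?w i)\<^sup>2) = (\<Sum>i<rk. (?v i)\<^sup>2 / ?u i * (\<Sum>j<rk. ?g i j * ?u j))"
  proof (intro sum.cong refl)
    fix i assume "i \<in> {..<rk}"
    then have "?u i \<noteq> 0" using un by simp
    then show "(\<Sum>j<rk. ?g i j * ?u i * ?u j * (?w i)\<^sup>2) = (?v i)\<^sup>2 / ?u i * (\<Sum>j<rk. ?g i j * ?u j)"
      unfolding sum_distrib_left by (intro sum.cong refl) (simp add: field_simps power2_eq_square)
  qed
  moreover have "(?v i)\<^sup>2 / ?u i \<le> (\<Sum>i<rk. (?v i)\<^sup>2 / ?u i * (\<Sum>j<rk. ?g i j * ?u j))"
  proof -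
    have ge1: "(\<Sum>j<rk. ?g i j * ?u j) \<ge> 1" if "i < rk" for i
    proof -
      have "(\<Sum>j<rk. ?g i j * ?u j) = real_of_int (\<Sum>j<rk. dyn_gram D i j * u j)" by simp
      then show ?thesis using gram_u_pos[OF that] by linarith
    qed
    have nn: "(?v i)\<^sup>2 / ?u i \<ge> 0" if "i < rk" for i using u_pos[OF that] by simp
    have "(?v i)\<^sup>2 / ?u i \<le> (?v i)\<^sup>2 / ?u i * (\<Sum>j<rk. ?g i j * ?u j)"
      using mult_left_mono[OF ge1[OF assms] nn[OF assms]] by simp
    also have "\<dots> \<le> (\<Sum>i<rk. (?v i)\<^sup>2 / ?u i * (\<Sum>j<rk. ?g i j * ?u j))"
    proof (rule member_le_sum)
      fix k assume "k \<in> {..<rk} - {i}"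
      then have k: "k < rk" by simp
      then show "0 \<le> (?v k)\<^sup>2 / ?u k * (\<Sum>j<rk. ?g k j * ?u j)"
        using nn[OF k] ge1[OF k] by (intro mult_nonneg_nonneg) linarith+
    qed (use assms in auto)
    finally show ?thesis .
  qed
  ultimately have "(?v i)\<^sup>2 / ?u i \<le> real_of_int (ip v v)" by linarith
  then have "(?v i)\<^sup>2 \<le> ?u i * real_of_int (ip v v)"
    using u_pos[OF assms] by (simp add: field_simps)
  then show ?thesis by (metis of_int_le_iff of_int_mult of_int_power)
qed

lemma ip_nonneg: "ip v v \<ge> 0"
proof (cases "rk = 0")
  case False
  then have "0 \<le> u 0 * ip v v" using coord_sq_le_norm[of 0 v] zero_le_power2[of "v 0"] by linarith
  then show ?thesis using u_pos[of 0] False by (simp add: zero_le_mult_iff)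
qed (simp add: root_ip_def)

lemma ip_zeroD: "ip v v = 0 \<Longrightarrow> i < rk \<Longrightarrow> v i = 0"
  using coord_sq_le_norm[of i v] by simp

lemma len_dvd_gram:
  assumes "i < rk" "j < rk"
  shows "dyn_len D i dvd 2 * dyn_gram D i j"
  using lens[OF assms(1)] lens[OF assms(2)] ratio unfolding dyn_gram_def by (auto simp: max_def)

text \<open>The divisibility says that the co-root has integral coordinates. A reflection in the
  i-th fundamental root a preserves the norm and changes only the i-th coordinate; after
  multiplication by the squared length of a the change is 2(a, r), which the induction hypothesis
  shows to be a multiple of (r, r).\<close>

lemma root_invariant:
  assumes "r \<in> R"
  shows "(\<exists>i<rk. ip r r = dyn_len D i) \<and> (\<forall>i<rk. ip r r dvd r i * dyn_len D i) \<and> (\<forall>i\<ge>rk. r i = 0)"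
  using assms
proof induction
  case (simple i)
  have "ip (simple_root i) (simple_root i) = dyn_len D i"
    using simple by (simp add: root_ip_simple_simple dyn_gram_diag)
  then show ?case using simple by (auto simp: simple_root_def)
next
  case (reflect r i)
  let ?a = "simple_root i" and ?c = "cart (simple_root i) r"
  have aa: "ip ?a ?a = dyn_len D i" using reflect by (simp add: root_ip_simple_simple dyn_gram_diag)
  have dv: "dyn_len D i dvd 2 * ip ?a r"
  proof -
    have "2 * ip ?a r = (\<Sum>j<rk. 2 * dyn_gram D i j * r j)"
      using reflect by (simp add: root_ip_simple sum_distrib_left mult.assoc)
    also have "dyn_len D i dvd \<dots>" using reflect by (intro dvd_sum dvd_mult2 [of _ "2 * _"] len_dvd_gram) auto
    finally show ?thesis .
  qed
  have c: "?c * dyn_len D i = 2 * ip ?a r" unfolding cartan_int_def aa using dv by simp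
  define r' where "r' = root_refl D ?a r"
  have r': "r' = (\<lambda>j. r j - ?c * ?a j)" unfolding r'_def root_refl_alt ..
  have "ip r' r' = ip r r - 2 * ?c * ip ?a r + ?c * (?c * ip ?a ?a)"
    unfolding r'_def root_refl_def by (simp add: root_ip_linear root_ip_sym[of D r ?a] algebra_simps)
  also have "\<dots> = ip r r" unfolding aa c by simp
  finally have norm: "ip r' r' = ip r r" .
  have "ip r r dvd r' j * dyn_len D j" if j: "j < rk" for j
  proof (cases "j = i")
    case False
    then show ?thesis using reflect j unfolding r' by (simp add: simple_root_def)
  next
    case True
    have "ip r r dvd 2 * ip ?a r"
    proof -
      have "2 * ip r ?a = (\<Sum>k<rk. r k * dyn_len D k * (2 * dyn_gram D k i div dyn_len D k))"
      proof -
        have "2 * ip ?a r = (\<Sum>k<rk. 2 * dyn_gram D k i * r k)"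
          using reflect by (simp add: root_ip_simple sum_distrib_left dyn_gram_sym mult.assoc)
        also have "\<dots> = (\<Sum>k<rk. r k * dyn_len D k * (2 * dyn_gram D k i div dyn_len D k))"
          using len_dvd_gram reflect by (intro sum.cong) (auto simp: mult.commute mult.assoc)
        finally show ?thesis by (simp add: root_ip_sym)
      qed
      also have "ip r r dvd \<dots>" using reflect by (intro dvd_sum dvd_mult2[of _ "_ * _"]) auto
      finally show ?thesis by (simp add: root_ip_sym)
    qed
    moreover have "r' i * dyn_len D i = r i * dyn_len D i - 2 * ip ?a r"
      unfolding r' using c by (simp add: simple_root_def algebra_simps)
    ultimately show ?thesis using reflect True by simp
  qed
  moreover have "r' j = 0" if "j \<ge> rk" for j
    using that reflect unfolding r' by (auto simp: simple_root_def)
  ultimately show ?case using reflect norm unfolding r' by auto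
qed

lemma root_norm: "r \<in> R \<Longrightarrow> ip r r = 2 \<or> ip r r = 2 * \<kappa>"
  using root_invariant lens by metis

lemma root_norm_pos: "r \<in> R \<Longrightarrow> ip r r > 0"
  using root_norm ratio by fastforce

lemma root_coord_outside: "r \<in> R \<Longrightarrow> i \<ge> rk \<Longrightarrow> r i = 0"
  using root_invariant by blast

lemma coroot_exact:
  assumes "r \<in> R" "i < rk"
  shows "coroot_coeff D r i * ip r r = r i * dyn_len D i"
  unfolding coroot_coeff_def using root_invariant assms by simp

text \<open>Pairing with the integral co-root; since all factors on the right are integers, the
  division in \<open>cartan_int\<close> is exact for every lattice vector.\<close>

lemma double_ip_coroot:
  assumes "r \<in> R"
  shows "2 * ip r s = ip r r * (\<Sum>i<rk. coroot_coeff D r i * (\<Sum>j<rk. 2 * dyn_gram D i j div dyn_len D i * s j))"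
proof -
  have "2 * ip r s = (\<Sum>i<rk. r i * (\<Sum>j<rk. 2 * dyn_gram D i j * s j))"
    unfolding root_ip_def by (simp add: sum_distrib_left algebra_simps)
  also have "\<dots> = (\<Sum>i<rk. r i * dyn_len D i * (\<Sum>j<rk. 2 * dyn_gram D i j div dyn_len D i * s j))"
  proof (intro sum.cong refl)
    fix i assume i: "i \<in> {..<rk}"
    have "(\<Sum>j<rk. 2 * dyn_gram D i j * s j) = (\<Sum>j<rk. dyn_len D i * (2 * dyn_gram D i j div dyn_len D i * s j))"
    proof (intro sum.cong refl)
      fix j assume "j \<in> {..<rk}"
      then have "dyn_len D i * (2 * dyn_gram D i j div dyn_len D i) = 2 * dyn_gram D i j"
        using len_dvd_gram i by simp
      then show "2 * dyn_gram D i j * s j = dyn_len D i * (2 * dyn_gram D i j div dyn_len D i * s j)"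
        by (metis mult.assoc)
    qed
    then show "r i * (\<Sum>j<rk. 2 * dyn_gram D i j * s j) =
        r i * dyn_len D i * (\<Sum>j<rk. 2 * dyn_gram D i j div dyn_len D i * s j)"
      by (simp add: sum_distrib_left mult.assoc)
  qed
  also have "\<dots> = (\<Sum>i<rk. ip r r * (coroot_coeff D r i * (\<Sum>j<rk. 2 * dyn_gram D i j div dyn_len D i * s j)))"
  proof (intro sum.cong refl)
    fix i assume "i \<in> {..<rk}"
    then have e: "r i * dyn_len D i = ip r r * coroot_coeff D r i"
      using coroot_exact[OF assms, of i] by (simp add: mult.commute)
    show "r i * dyn_len D i * (\<Sum>j<rk. 2 * dyn_gram D i j div dyn_len D i * s j) =
        ip r r * (coroot_coeff D r i * (\<Sum>j<rk. 2 * dyn_gram D i j div dyn_len D i * s j))"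
      unfolding e by (rule mult.assoc)
  qed
  finally show ?thesis by (simp add: sum_distrib_left)
qed

lemma cart_exact:
  assumes "r \<in> R"
  shows "cart r s * ip r r = 2 * ip r s"
  unfolding cartan_int_def using double_ip_coroot[OF assms] by simp

lemma cart_eqI:
  assumes "r \<in> R" "c * ip r r = 2 * ip r s"
  shows "cart r s = c"
  using cart_exact[OF assms(1), of s] assms root_norm_pos[OF assms(1)] by (metis mult_cancel_right less_irrefl)

lemma cart_add: "r \<in> R \<Longrightarrow> cart r (s + t) = cart r s + cart r t"
  by (rule cart_eqI) (simp_all add: distrib_right cart_exact root_ip_linear)

lemma cart_smul: "r \<in> R \<Longrightarrow> cart r (smul k s) = k * cart r s"
  by (rule cart_eqI) (simp_all add: cart_exact root_ip_linear mult.assoc)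

lemma cart_minus: "r \<in> R \<Longrightarrow> cart r (- s) = - cart r s"
  by (rule cart_eqI) (simp_all add: cart_exact root_ip_linear)

lemma cart_self: "r \<in> R \<Longrightarrow> cart r r = 2"
  by (rule cart_eqI) auto

lemma cart_simple_expand:
  assumes "r \<in> R" "\<forall>i\<ge>rk. s i = 0"
  shows "cart r s = (\<Sum>i<rk. s i * cart r (simple_root i))"
proof (rule cart_eqI[OF assms(1)])
  have "(\<Sum>i<rk. s i * cart r (simple_root i)) * ip r r = (\<Sum>i<rk. s i * (2 * ip r (simple_root i)))"
    using cart_exact[OF assms(1)] by (simp add: sum_distrib_right mult.assoc)
  also have "\<dots> = 2 * ip r s"
  proof -
    have "ip r (simple_root i) = (\<Sum>j<rk. r j * dyn_gram D j i)" if "i < rk" for i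
      using root_ip_simple[OF that, of r] by (simp add: root_ip_sym dyn_gram_sym mult.commute)
    then have "(\<Sum>i<rk. s i * (2 * ip r (simple_root i))) = (\<Sum>i<rk. \<Sum>j<rk. 2 * (r j * s i * dyn_gram D j i))"
      by (simp add: sum_distrib_left mult.commute mult.left_commute)
    also have "\<dots> = 2 * ip r s"
      unfolding root_ip_def by (subst sum.swap) (simp add: sum_distrib_left)
    finally show ?thesis .
  qed
  finally show "(\<Sum>i<rk. s i * cart r (simple_root i)) * ip r r = 2 * ip r s" .
qed

lemma simple_in_R: "i < rk \<Longrightarrow> simple_root i \<in> R"
  by (rule roots.simple)

lemma refl_ip:
  assumes r: "r \<in> R"
  shows "ip (root_refl D r s) (root_refl D r t) = ip s t"
proof -
  have "ip (root_refl D r s) (root_refl D r t) =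
      ip s t - cart r t * ip r s - cart r s * ip r t + cart r s * (cart r t * ip r r)"
    unfolding root_refl_def by (simp add: root_ip_linear root_ip_sym[of D s r] algebra_simps)
  moreover have "cart r s * (cart r t * ip r r) = cart r t * (cart r s * ip r r)" by simp
  ultimately show ?thesis unfolding cart_exact[OF r] by linarith
qed

lemma refl_refl: "r \<in> R \<Longrightarrow> root_refl D r (root_refl D r s) = s"
  unfolding root_refl_def by (simp add: cart_add cart_smul cart_self fun_eq_iff algebra_simps)

lemma refl_simple_in_R: "i < rk \<Longrightarrow> r \<in> R \<Longrightarrow> root_refl D (simple_root i) r \<in> R"
  unfolding root_refl_alt by (rule roots.reflect)

text \<open>\<open>roots\<close> is closed under fundamental reflections by definition. The
  reflection in w(r) is the conjugate by w of the reflection in r, and the induction along the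
  generation of r follows these conjugations.\<close>

lemma refl_in_R: "r \<in> R \<Longrightarrow> s \<in> R \<Longrightarrow> root_refl D r s \<in> R"
proof (induction arbitrary: s rule: roots.induct)
  case (simple i)
  then show ?case using refl_simple_in_R by blast
next
  case (reflect r i)
  let ?w = "root_refl D (simple_root i)"
  note a = simple_in_R[OF reflect(2)]
  have r': "(\<lambda>j. r j - cart (simple_root i) r * simple_root i j) = ?w r" unfolding root_refl_alt ..
  have wr: "?w r \<in> R" using refl_simple_in_R reflect by blast
  have "cart (?w r) s = cart r (?w s)"
  proof (rule cart_eqI[OF wr])
    have "ip (?w r) s = ip r (?w s)" using refl_ip[OF a, of r "?w s"] refl_refl[OF a] by simp
    then show "cart r (?w s) * ip (?w r) (?w r) = 2 * ip (?w r) s"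
      using cart_exact[OF reflect(1), of "?w s"] refl_ip[OF a] by simp
  qed
  then have "root_refl D (?w r) s = ?w (root_refl D r (?w s))"
    using refl_refl[OF a, of s] a unfolding root_refl_def
    by (simp add: cart_add cart_smul cart_self fun_eq_iff algebra_simps)
  moreover have "?w (root_refl D r (?w s)) \<in> R"
    using reflect refl_simple_in_R by blast
  ultimately show ?case unfolding r' by simp
qed

lemma uminus_in_R: "r \<in> R \<Longrightarrow> - r \<in> R"
proof -
  assume r: "r \<in> R"
  have "root_refl D r r = - r" unfolding root_refl_def by (simp add: cart_self[OF r] fun_eq_iff)
  then show ?thesis using refl_in_R[OF r r] by simp
qed

lemma uminus_in_R_iff: "- r \<in> R \<longleftrightarrow> r \<in> R"
  using uminus_in_R[of r] uminus_in_R[of "- r"] by auto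

lemma zero_notin_R: "0 \<notin> R"
proof
  assume "0 \<in> R"
  then show False using root_norm_pos[of 0] by (simp add: root_ip_def)
qed

text \<open>Norms of roots are at most 6, so \<open>coord_sq_le_norm\<close> bounds every
  coordinate.\<close>

lemma finite_R: "finite R"
proof (rule finite_subset)
  define M where "M = (\<Sum>i<rk. u i * 6)"
  have M: "\<bar>r i\<bar> \<le> M" if r: "r \<in> R" and i: "i < rk" for r i
  proof -
    have "\<bar>r i\<bar> \<le> (r i)\<^sup>2"
      using mult_left_mono[of 1 "\<bar>r i\<bar>" "\<bar>r i\<bar>"] by (cases "r i = 0") (auto simp: power2_eq_square)
    also have "\<dots> \<le> u i * ip r r" using coord_sq_le_norm[OF i] .
    also have "\<dots> \<le> u i * 6" using root_norm[OF r] ratio u_pos[OF i] by (intro mult_left_mono) auto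
    also have "\<dots> \<le> M" unfolding M_def using i u_pos by (intro member_le_sum) (auto simp: less_imp_le)
    finally show ?thesis .
  qed
  show "R \<subseteq> (\<lambda>f i. if i < rk then f i else 0) ` ({..<rk} \<rightarrow>\<^sub>E {-M..M})"
  proof
    fix r assume r: "r \<in> R"
    have "r = (\<lambda>i. if i < rk then restrict r {..<rk} i else 0)"
      using root_coord_outside[OF r] by (auto simp: fun_eq_iff)
    moreover have "restrict r {..<rk} \<in> {..<rk} \<rightarrow>\<^sub>E {-M..M}"
    proof
      fix i assume "i \<in> {..<rk}"
      then show "restrict r {..<rk} i \<in> {-M..M}" using M[OF r, of i] by auto
    qed simp
    ultimately show "r \<in> (\<lambda>f i. if i < rk then f i else 0) ` ({..<rk} \<rightarrow>\<^sub>E {-M..M})" by blast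
  qed
  show "finite ((\<lambda>f i. if i < rk then f i else 0) ` ({..<rk} \<rightarrow>\<^sub>E {-M..M}))"
    by (intro finite_imageI finite_PiE) auto
qed

section \<open>Root strings\<close>

text \<open>The ratio of two root norms is 1, 2, 3 or the inverse of one of these, and among them
  only 1 is the square of a rational. Hence b = a or b = -a. The factor 2 on the side of s allows
  for half-integral multiples, which arise from Cartan integers.\<close>

lemma root_multiple:
  assumes r: "r \<in> R" and s: "s \<in> R" and eq: "smul a s = smul b r" and a: "a = 1 \<or> a = 2"
  shows "s = r \<or> s = - r"
proof -
  have rk: "a\<^sup>2 * ip s s = b\<^sup>2 * ip r r"
  proof -
    have "ip (smul a s) (smul a s) = ip (smul b r) (smul b r)" using eq by simp
    then show ?thesis by (simp add: root_ip_linear power2_eq_square mult.assoc)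
  qed
  have b: "b\<^sup>2 = c \<Longrightarrow> c \<le> 12 \<Longrightarrow> b \<in> {-3, -2, -1, 0, 1, 2, 3}" for c
  proof -
    assume "b\<^sup>2 = c" "c \<le> 12"
    then have "\<bar>b\<bar>\<^sup>2 < 4\<^sup>2" by simp
    then have "\<bar>b\<bar> < 4" by (rule power_less_imp_less_base) simp
    then show ?thesis by auto
  qed
  have "b\<^sup>2 \<le> 12"
    using rk a root_norm[OF r] root_norm[OF s] ratio by auto
  then have "b \<in> {-3, -2, -1, 0, 1, 2, 3}" using b by blast
  then have "b = a \<or> b = - a"
    using rk a root_norm[OF r] root_norm[OF s] ratio by auto
  moreover have "a * s i = b * r i" for i using eq by (auto simp: fun_eq_iff)
  ultimately have "(\<forall>i. a * s i = a * r i) \<or> (\<forall>i. a * s i = a * (- r i))" by auto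
  moreover have "a \<noteq> 0" using a by auto
  ultimately show ?thesis by (auto simp: fun_eq_iff mult_cancel_left simp del: mult_minus_right)
qed

text \<open>Strict Cauchy-Schwarz inequality: the vector (r,r)s - (r,s)r has norm (r,r)((r,r)(s,s) -
  (r,s)^2), and it vanishes only for proportional roots.\<close>

lemma cart_prod_lt_4:
  assumes r: "r \<in> R" and s: "s \<in> R" and ne: "s \<noteq> r" "s \<noteq> - r"
  shows "cart r s * cart s r \<le> 3"
proof -
  let ?X = "ip r r" and ?Y = "ip s s" and ?z = "ip r s"
  have X: "?X > 0" and Y: "?Y > 0" using root_norm_pos r s by auto
  let ?v = "smul ?X s + smul (- ?z) r"
  have vv: "ip ?v ?v = ?X * (?X * ?Y - ?z * ?z)"
    by (simp add: root_ip_linear root_ip_sym[of D s r] algebra_simps)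
  have "ip ?v ?v \<noteq> 0"
  proof
    assume "ip ?v ?v = 0"
    then have v: "?X * s i = ?z * r i" for i
      using ip_zeroD[of ?v i] root_coord_outside[OF r, of i] root_coord_outside[OF s, of i]
      by (cases "i < rk") auto
    have "2 * s i = cart r s * r i" for i
    proof -
      have "?X * (2 * s i) = 2 * ?z * r i" using v[of i] by (simp add: mult.left_commute)
      also have "\<dots> = ?X * (cart r s * r i)" using cart_exact[OF r, of s] by (simp add: mult.commute mult.left_commute)
      finally show ?thesis using X by simp
    qed
    then have "smul 2 s = smul (cart r s) r" by (auto simp: fun_eq_iff)
    then show False using root_multiple[OF r s] ne by blast
  qed
  then have "ip ?v ?v > 0" using ip_nonneg[of ?v] by linarith
  then have lt: "?z * ?z < ?X * ?Y" using vv X by (simp add: zero_less_mult_iff)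
  have "(cart r s * cart s r) * (?X * ?Y) = (cart r s * ?X) * (cart s r * ?Y)" by (simp add: algebra_simps)
  also have "\<dots> = 4 * (?z * ?z)"
    unfolding cart_exact[OF r] cart_exact[OF s] by (simp add: root_ip_sym[of D s r])
  also have "\<dots> < 4 * (?X * ?Y)" using lt by simp
  finally show ?thesis using X Y by (metis mult_less_cancel_right_pos mult_pos_pos zless_imp_add1_zle add_le_imp_le_right numeral_plus_one semiring_norm(2) semiring_norm(8) zle_add1_eq_le)
qed

lemma cart_sign: "r \<in> R \<Longrightarrow> cart r s > 0 \<longleftrightarrow> ip r s > 0" "r \<in> R \<Longrightarrow> cart r s < 0 \<longleftrightarrow> ip r s < 0"
  using cart_exact[of r s] root_norm_pos[of r]
  by (metis zero_less_mult_iff zero_less_numeral less_asym, metis mult_less_0_iff zero_less_numeral less_asym)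

text \<open>Two positive integers with product at most 3 include a 1. The reflection with that
  Cartan integer subtracts exactly one root from the other, up to sign.\<close>

lemma root_diff:
  assumes r: "r \<in> R" and s: "s \<in> R" and ne: "s \<noteq> r" and pos: "ip r s > 0"
  shows "s - r \<in> R"
proof -
  have "s \<noteq> - r" using pos root_norm_pos[OF r] by (auto simp: root_ip_linear)
  then have le: "cart r s * cart s r \<le> 3" using cart_prod_lt_4[OF r s ne] by blast
  have p: "cart r s > 0" "cart s r > 0"
    using pos cart_sign(1)[OF r, of s] cart_sign(1)[OF s, of r] by (auto simp: root_ip_sym)
  have "cart r s = 1 \<or> cart s r = 1"
  proof (rule ccontr)
    assume "\<not> ?thesis"
    then have "cart r s \<ge> 2" "cart s r \<ge> 2" using p by auto
    then have "2 * 2 \<le> cart r s * cart s r" by (intro mult_mono) auto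
    then show False using le by simp
  qed
  then show ?thesis
  proof
    assume "cart r s = 1"
    then have "root_refl D r s = s - r" unfolding root_refl_def by (auto simp: fun_eq_iff)
    then show ?thesis using refl_in_R[OF r s] by simp
  next
    assume "cart s r = 1"
    then have "- root_refl D s r = s - r" unfolding root_refl_def by (auto simp: fun_eq_iff)
    then show ?thesis using uminus_in_R[OF refl_in_R[OF s r]] by simp
  qed
qed

lemma root_sum:
  assumes "r \<in> R" "s \<in> R" "s \<noteq> - r" "ip r s < 0"
  shows "s + r \<in> R"
  using root_diff[of "- r" s] assms uminus_in_R by (simp add: root_ip_linear)

text \<open>At an upper end of a segment of the string the product with r is nonnegative, at a lower
  end it is nonpositive, and it grows strictly along the string; so there is no gap. The reflection
  in r reverses the string, which relates its ends to the Cartan integer.\<close>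

lemma root_string:
  assumes r: "r \<in> R" and s: "s \<in> R" and ne: "s \<noteq> r" "s \<noteq> - r"
  obtains p q :: nat where "\<And>k. s + smul k r \<in> R \<longleftrightarrow> - int p \<le> k \<and> k \<le> int q"
    and "int p - int q = cart r s" and "p + q \<le> 3"
proof -
  define K where "K = {k. s + smul k r \<in> R}"
  have X: "ip r r > 0" using root_norm_pos[OF r] .
  have r0: "r \<noteq> 0" using r zero_notin_R by blast
  have finK: "finite K"
  proof (rule finite_imageD)
    show "finite ((\<lambda>k. s + smul k r) ` K)" by (rule finite_subset[OF _ finite_R]) (auto simp: K_def)
    show "inj_on (\<lambda>k. s + smul k r) K"
    proof (rule inj_onI)
      fix k k' assume "s + smul k r = s + smul k' r"
      then have "k * r i = k' * r i" for i by (auto simp: fun_eq_iff)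
      then show "k = k'" using r0 by (auto simp: fun_eq_iff)
    qed
  qed
  have "s + smul 0 r = s" by (simp add: fun_eq_iff)
  then have K0: "0 \<in> K" using s unfolding K_def by simp
  have nonpar: "s + smul k r \<noteq> r \<and> s + smul k r \<noteq> - r" for k
  proof -
    have "smul 1 s = smul (1 - k) r" if "s + smul k r = r"
      using that by (auto simp: fun_eq_iff algebra_simps)
    moreover have "smul 1 s = smul (- 1 - k) r" if "s + smul k r = - r"
      using that by (auto simp: fun_eq_iff algebra_simps)
    ultimately show ?thesis using root_multiple[OF r s] ne by blast
  qed
  have up: "ip r s + k * ip r r \<ge> 0" if "k \<in> K" "k + 1 \<notin> K" for k
  proof (rule ccontr)
    assume "\<not> ?thesis"
    then have "ip r (s + smul k r) < 0" by (simp add: root_ip_linear)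
    then have "(s + smul k r) + r \<in> R" using root_sum[OF r] that(1) nonpar unfolding K_def by blast
    moreover have "(s + smul k r) + r = s + smul (k + 1) r" by (simp add: fun_eq_iff algebra_simps)
    ultimately show False using that(2) unfolding K_def by simp
  qed
  have down: "ip r s + k * ip r r \<le> 0" if "k \<in> K" "k - 1 \<notin> K" for k
  proof (rule ccontr)
    assume "\<not> ?thesis"
    then have "ip r (s + smul k r) > 0" by (simp add: root_ip_linear)
    then have "(s + smul k r) - r \<in> R" using root_diff[OF r] that(1) nonpar unfolding K_def by blast
    moreover have "(s + smul k r) - r = s + smul (k - 1) r" by (simp add: fun_eq_iff algebra_simps)
    ultimately show False using that(2) unfolding K_def by simp
  qed
  have unbroken: "k \<in> K" if a: "a \<in> K" "a \<le> k" and b: "b \<in> K" "k \<le> b" for a b k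
  proof (rule ccontr)
    assume k: "k \<notin> K"
    let ?A = "{j \<in> K. j < k}" and ?B = "{j \<in> K. j > k}"
    have A: "finite ?A" "?A \<noteq> {}" using finK a k by (auto simp: order.order_iff_strict)
    have B: "finite ?B" "?B \<noteq> {}" using finK b k by (auto simp: order.order_iff_strict)
    have 1: "Max ?A \<in> K" "Max ?A < k" using Max_in[OF A] by auto
    have 2: "Min ?B \<in> K" "Min ?B > k" using Min_in[OF B] by auto
    have "Max ?A + 1 \<notin> K"
    proof
      assume *: "Max ?A + 1 \<in> K"
      then have "Max ?A + 1 \<in> ?A" using k 1 by (cases "Max ?A + 1 = k") auto
      then show False using Max_ge[OF A(1)] by fastforce
    qed
    moreover have "Min ?B - 1 \<notin> K"
    proof
      assume *: "Min ?B - 1 \<in> K"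
      then have "Min ?B - 1 \<in> ?B" using k 2 by (cases "Min ?B - 1 = k") auto
      then show False using Min_le[OF B(1)] by fastforce
    qed
    ultimately have "ip r s + Max ?A * ip r r \<ge> 0" "ip r s + Min ?B * ip r r \<le> 0"
      using up down 1 2 by auto
    then have "Min ?B * ip r r \<le> Max ?A * ip r r" by linarith
    then show False using X 1 2 by simp
  qed
  have refl: "- cart r s - k \<in> K" if "k \<in> K" for k
  proof -
    have "root_refl D r (s + smul k r) = s + smul (- cart r s - k) r"
      unfolding root_refl_def by (simp add: cart_add cart_smul cart_self r fun_eq_iff algebra_simps)
    then show ?thesis using refl_in_R[OF r] that unfolding K_def by (metis mem_Collect_eq)
  qed
  define m where "m = Min K"
  define M where "M = Max K"
  have "K \<noteq> {}" using K0 by blast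
  then have mK: "m \<in> K" and MK: "M \<in> K" unfolding m_def M_def using finK by simp_all
  have bnd: "m \<le> k \<and> k \<le> M" if "k \<in> K" for k unfolding m_def M_def using finK that by simp
  have m: "m \<in> K" "m \<le> 0" and M: "M \<in> K" "0 \<le> M" using mK MK bnd[OF K0] by simp_all
  have iff: "k \<in> K \<longleftrightarrow> m \<le> k \<and> k \<le> M" for k
    using unbroken[OF mK _ MK] bnd by blast
  have "m \<le> - cart r s - M" "- cart r s - m \<le> M" using refl[OF m(1)] refl[OF M(1)] iff by auto
  then have c: "cart r s = - m - M" by linarith
  have sm: "s + smul m r \<in> R" using m unfolding K_def by simp
  \<comment> \<open>At the lowest member the Cartan integer is minus the length of the string, and
    its product with the opposite Cartan integer, also negative, is at most 3.\<close>
  have len: "M - m \<le> 3"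
  proof (rule ccontr)
    assume "\<not> M - m \<le> 3"
    moreover have "cart r (s + smul m r) = m - M" using c by (simp add: cart_add cart_smul cart_self r)
    ultimately have lt: "cart r (s + smul m r) \<le> -4" by simp
    then have "cart (s + smul m r) r < 0"
      using cart_sign(2)[OF r, of "s + smul m r"] cart_sign(2)[OF sm, of r] by (simp add: root_ip_sym)
    then have "4 * 1 \<le> (- cart r (s + smul m r)) * (- cart (s + smul m r) r)"
      using lt by (intro mult_mono) auto
    then show False using cart_prod_lt_4[OF r sm] nonpar[of m] by simp
  qed
  show ?thesis
  proof (rule that[of "nat (- m)" "nat M"])
    fix k show "s + smul k r \<in> R \<longleftrightarrow> - int (nat (- m)) \<le> k \<and> k \<le> int (nat M)"
      using iff[of k] m M unfolding K_def by simp
  qed (use m M c len in auto)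
qed

section \<open>Positive roots and height\<close>

lemma sum_square_split:
  fixes f :: "nat \<Rightarrow> nat \<Rightarrow> int"
  shows "(\<Sum>i<k. \<Sum>j<k. f i j) = (\<Sum>i<k. f i i + (\<Sum>j<i. f i j + f j i))"
  by (induction k) (simp_all add: sum.distrib)

text \<open>The hypothesis is integrality of the co-root coordinates, and both the positive and the
  negative part of a root inherit it. Each mixed term occurs twice, and twice a Gram entry is a
  multiple of the squared length.\<close>

lemma norm_dvd:
  assumes "\<And>i. i < rk \<Longrightarrow> L dvd v i * dyn_len D i"
  shows "L dvd ip v v"
proof -
  have "ip v v = (\<Sum>i<rk. v i * v i * dyn_len D i + (\<Sum>j<i. v i * v j * (2 * dyn_gram D i j)))"
    unfolding root_ip_def
    by (subst sum_square_split) (simp add: dyn_gram_diag dyn_gram_sym[of D _ "_ :: nat"] mult.commute mult.left_commute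
      cong: sum.cong)
  also have "L dvd \<dots>"
  proof (intro dvd_sum dvd_add)
    fix i assume i: "i \<in> {..<rk}"
    then show "L dvd v i * v i * dyn_len D i" using assms[of i] by (simp add: mult.assoc)
    fix j assume j: "j \<in> {..<i}"
    then obtain c where "2 * dyn_gram D i j = dyn_len D i * c"
      using len_dvd_gram[of i j] i by (auto elim: dvdE)
    then have "v i * v j * (2 * dyn_gram D i j) = (v i * dyn_len D i) * (v j * c)"
      by (simp add: algebra_simps)
    then show "L dvd v i * v j * (2 * dyn_gram D i j)" using assms[of i] i by (metis dvd_mult2 lessThan_iff)
  qed
  finally show ?thesis .
qed

text \<open>Write \<open>r = p - m\<close> with \<open>p\<close>, \<open>m\<close> the positive and negative parts. Both norms are multiples of
  the norm of \<open>r\<close>, and their sum is at most the norm of \<open>r\<close> because \<open>(p, m) \<le> 0\<close>.\<close>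

lemma root_sign:
  assumes r: "r \<in> R"
  shows "(\<forall>i. r i \<ge> 0) \<or> (\<forall>i. r i \<le> 0)"
proof -
  define p where "p = (\<lambda>i. max (r i) 0)"
  define m where "m = (\<lambda>i. max (- r i) 0)"
  have L: "ip r r > 0" using root_norm_pos[OF r] .
  have rp: "r = p + smul (-1) m" unfolding p_def m_def by (auto simp: fun_eq_iff)
  have "ip r r = ip p p + ip m m - 2 * ip p m"
    by (subst (1 2) rp) (simp add: root_ip_linear root_ip_sym[of D m p])
  moreover have "ip p m \<le> 0" unfolding root_ip_def
  proof (intro sum_nonpos)
    fix i j show "p i * m j * dyn_gram D i j \<le> 0"
      using dyn_gram_off[of i j D] by (cases "i = j") (auto simp: p_def m_def max_def mult_nonneg_nonpos)
  qed
  ultimately have sum: "ip p p + ip m m \<le> ip r r" by linarith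
  have d: "ip r r dvd ip p p" "ip r r dvd ip m m"
    by (rule norm_dvd, use root_invariant[OF r] in \<open>auto simp: p_def m_def max_def\<close>)+
  have "ip p p = 0 \<or> ip m m = 0"
  proof (rule ccontr)
    assume "\<not> ?thesis"
    then have "ip p p > 0" "ip m m > 0" using ip_nonneg[of p] ip_nonneg[of m] by auto
    then have "ip r r \<le> ip p p" "ip r r \<le> ip m m" using d by (auto intro: zdvd_imp_le)
    then show False using sum L by linarith
  qed
  then show ?thesis
  proof
    assume 0: "ip p p = 0"
    have "r i \<le> 0" for i
    proof (cases "i < rk")
      case True
      then have "p i = 0" using ip_zeroD[OF 0] by simp
      then show ?thesis unfolding p_def by (auto simp: max_def split: if_splits)
    qed (use root_coord_outside[OF r] in auto)
    then show ?thesis by blast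
  next
    assume 0: "ip m m = 0"
    have "r i \<ge> 0" for i
    proof (cases "i < rk")
      case True
      then have "m i = 0" using ip_zeroD[OF 0] by simp
      then show ?thesis unfolding m_def by (auto simp: max_def split: if_splits)
    qed (use root_coord_outside[OF r] in auto)
    then show ?thesis by blast
  qed
qed

lemma R_pos_neg: "R = pos_roots D \<union> neg_roots D"
  unfolding pos_roots_def neg_roots_def using root_sign by auto

definition ht :: "root \<Rightarrow> int" where
  "ht r = (\<Sum>i<rk. r i)"

lemma ht_add: "ht (r + s) = ht r + ht s"
  unfolding ht_def by (simp add: sum.distrib)

lemma ht_smul: "ht (smul k r) = k * ht r"
  unfolding ht_def by (simp add: sum_distrib_left)

lemma ht_minus: "ht (- r) = - ht r"
  unfolding ht_def by (simp add: sum_negf)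

lemma ht_simple: "i < rk \<Longrightarrow> ht (simple_root i) = 1"
  unfolding ht_def simple_root_def by simp

lemma ht_pos: 
  assumes "r \<in> pos_roots D"
  shows "ht r > 0"
proof -
  have r: "r \<in> R" "\<And>i. r i \<ge> 0" using assms unfolding pos_roots_def by auto
  have "ht r \<ge> 0" unfolding ht_def using r by (simp add: sum_nonneg)
  moreover have "ht r \<noteq> 0"
  proof
    assume "ht r = 0"
    then have "\<forall>i<rk. r i = 0" unfolding ht_def using r by (subst (asm) sum_nonneg_eq_0_iff) auto
    then have "r = 0" using root_coord_outside[OF r(1)] by (auto simp: fun_eq_iff not_le) (metis not_le)
    then show False using r(1) zero_notin_R by simp
  qed
  ultimately show ?thesis by linarith
qed

lemma neg_roots_uminus: "r \<in> neg_roots D \<longleftrightarrow> - r \<in> pos_roots D"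
  unfolding neg_roots_def pos_roots_def by (auto simp: uminus_in_R_iff)

lemma ht_neg: "r \<in> neg_roots D \<Longrightarrow> ht r < 0"
  using ht_pos[of "- r"] by (simp add: neg_roots_uminus ht_minus)

end

section \<open>The finite types\<close>

lemma sum_three_deltas:
  fixes a :: int and f g :: "nat \<Rightarrow> int"
  assumes "i < l"
  shows "(\<Sum>j<l. (if j = i then a else 0) + (if j = i + 1 then f j else 0) + (if j + 1 = i then g j else 0)) =
    a + (if i + 1 < l then f (i + 1) else 0) + (if i > 0 then g (i - 1) else 0)"
proof -
  have "(\<Sum>j<l. if j + 1 = i then g j else 0) = (if i > 0 then g (i - 1) else (0 :: int))"
  proof (cases i)
    case (Suc k)
    have "(\<Sum>j<l. if j + 1 = i then g j else 0) = (\<Sum>j<l. if j = k then g j else 0)"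
      using Suc by (intro sum.cong) auto
    then show ?thesis using Suc assms by simp
  qed simp
  then show ?thesis using assms by (simp add: sum.distrib)
qed

text \<open>The vector consists of the coordinates of the sum of all positive roots; its product
  with every fundamental root is 2.\<close>

lemma finite_dynkin_A: "finite_dynkin (DynA l) 1 (\<lambda>i. (int i + 1) * (int l - int i))"
proof
  let ?u = "\<lambda>i. (int i + 1) * (int l - int i)"
  fix i assume i: "i < dyn_rank (DynA l)"
  have "(\<Sum>j<l. dyn_gram (DynA l) i j * ?u j) =
      (\<Sum>j<l. (if j = i then 2 * ?u i else 0) + (if j = i + 1 then - ?u j else 0) + (if j + 1 = i then - ?u j else 0))"
    by (intro sum.cong refl) (auto simp: dyn_gram_def)
  also have "\<dots> > 0"
  proof -
    consider "i + 1 < l" | "l = i + 1" using i by force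
    then show ?thesis using i by cases (subst sum_three_deltas; cases i; auto simp: algebra_simps)+
  qed
  finally show "(\<Sum>j<dyn_rank (DynA l). dyn_gram (DynA l) i j * ?u j) > 0" by simp
qed auto

text \<open>A concave quadratic along the chain, whose value at l - 2 is shared equally between the
  two end nodes. The rows are checked separately around the branch node l - 3.\<close>

lemma finite_dynkin_D:
  assumes "l \<ge> 4"
  shows "finite_dynkin (DynD l) 1 (\<lambda>i. if i < l - 2 then 2 * ((int i + 1) * (2 * int l - int i)) else (int l - 1) * (int l + 2))"
proof
  let ?u = "\<lambda>i. if i < l - 2 then 2 * ((int i + 1) * (2 * int l - int i)) else (int l - 1) * (int l + 2)"
  fix i assume i: "i < dyn_rank (DynD l)"
  obtain k where l: "l = k + 4" using assms by (metis add.commute le_Suc_ex)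
  consider "i < k + 1" | "i = k + 1" | "i = k + 2" | "i = k + 3" using i l by force
  then have "0 < (\<Sum>j<l. dyn_gram (DynD l) i j * ?u j)"
  proof cases
    case 1
    have "(\<Sum>j<l. dyn_gram (DynD l) i j * ?u j) =
        (\<Sum>j<l. (if j = i then 2 * ?u i else 0) + (if j = i + 1 then - ?u j else 0) + (if j + 1 = i then - ?u j else 0))"
      using 1 l by (intro sum.cong refl) (auto simp: dyn_gram_def)
    also have "\<dots> > 0" using 1 l by (subst sum_three_deltas; cases i; auto simp: algebra_simps)
    finally show ?thesis .
  next
    case 2
    have "(\<Sum>j<l. dyn_gram (DynD l) i j * ?u j) =
        (\<Sum>j<k. dyn_gram (DynD l) i j * ?u j) + dyn_gram (DynD l) i k * ?u k + dyn_gram (DynD l) i (k + 1) * ?u (k + 1)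
          + dyn_gram (DynD l) i (k + 2) * ?u (k + 2) + dyn_gram (DynD l) i (k + 3) * ?u (k + 3)"
      unfolding l by (simp add: eval_nat_numeral)
    also have "(\<Sum>j<k. dyn_gram (DynD l) i j * ?u j) = 0"
      using 2 l by (intro sum.neutral) (auto simp: dyn_gram_def)
    finally show ?thesis using 2 l by (simp add: dyn_gram_def algebra_simps)
  next
    case 3
    have "(\<Sum>j<l. dyn_gram (DynD l) i j * ?u j) =
        (\<Sum>j<k. dyn_gram (DynD l) i j * ?u j) + dyn_gram (DynD l) i k * ?u k + dyn_gram (DynD l) i (k + 1) * ?u (k + 1)
          + dyn_gram (DynD l) i (k + 2) * ?u (k + 2) + dyn_gram (DynD l) i (k + 3) * ?u (k + 3)"
      unfolding l by (simp add: eval_nat_numeral)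
    also have "(\<Sum>j<k. dyn_gram (DynD l) i j * ?u j) = 0"
      using 3 l by (intro sum.neutral) (auto simp: dyn_gram_def)
    finally show ?thesis using 3 l by (simp add: dyn_gram_def algebra_simps)
  next
    case 4
    have "(\<Sum>j<l. dyn_gram (DynD l) i j * ?u j) =
        (\<Sum>j<k. dyn_gram (DynD l) i j * ?u j) + dyn_gram (DynD l) i k * ?u k + dyn_gram (DynD l) i (k + 1) * ?u (k + 1)
          + dyn_gram (DynD l) i (k + 2) * ?u (k + 2) + dyn_gram (DynD l) i (k + 3) * ?u (k + 3)"
      unfolding l by (simp add: eval_nat_numeral)
    also have "(\<Sum>j<k. dyn_gram (DynD l) i j * ?u j) = 0"
      using 4 l by (intro sum.neutral) (auto simp: dyn_gram_def)
    finally show ?thesis using 4 l by (simp add: dyn_gram_def algebra_simps)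
  qed
  then show "(\<Sum>j<dyn_rank (DynD l). dyn_gram (DynD l) i j * ?u j) > 0" by simp
qed (use assms in auto)

text \<open>The lists are the coordinates of the sum of all positive roots, the branch node coming
  last. The lists for F_4 and G_2 below have the same origin.\<close>

lemma finite_dynkin_E:
  assumes "l \<in> {6, 7, 8}"
  shows "\<exists>u. finite_dynkin (DynE l) 1 u"
proof -
  consider "l = 6" | "l = 7" | "l = 8" using assms by blast
  then show ?thesis
  proof cases
    case 1
    have "finite_dynkin (DynE l) 1 (\<lambda>i. [16, 30, 42, 30, 16, 22] ! i)"
      by standard (auto simp: 1 dyn_gram_def eval_nat_numeral less_Suc_eq)
    then show ?thesis by blast
  next
    case 2
    have "finite_dynkin (DynE l) 1 (\<lambda>i. [34, 66, 96, 75, 52, 27, 49] ! i)"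
      by standard (auto simp: 2 dyn_gram_def eval_nat_numeral less_Suc_eq)
    then show ?thesis by blast
  next
    case 3
    have "finite_dynkin (DynE l) 1 (\<lambda>i. [92, 182, 270, 220, 168, 114, 58, 136] ! i)"
      by standard (auto simp: 3 dyn_gram_def eval_nat_numeral less_Suc_eq)
    then show ?thesis by blast
  qed
qed

lemma finite_dynkin_F4: "finite_dynkin DynF4 2 (\<lambda>i. [16, 30, 42, 22] ! i)"
  by standard (auto simp: dyn_gram_def eval_nat_numeral less_Suc_eq)

lemma finite_dynkin_G2: "finite_dynkin DynG2 3 (\<lambda>i. [10, 6] ! i)"
  by standard (auto simp: dyn_gram_def eval_nat_numeral less_Suc_eq)

text \<open>The quadratic is proportional to the sum of the positive co-roots, expressed in
  fundamental roots; every row gives 4.\<close>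

lemma finite_dynkin_B:
  assumes "l \<ge> 2"
  shows "finite_dynkin (DynB l) 2 (\<lambda>i. (int i + 1) * (2 * int l - int i))"
proof
  let ?u = "\<lambda>i. (int i + 1) * (2 * int l - int i)"
  fix i assume i: "i < dyn_rank (DynB l)"
  have "(\<Sum>j<l. dyn_gram (DynB l) i j * ?u j) =
      (\<Sum>j<l. (if j = i then dyn_len (DynB l) i * ?u i else 0) + (if j = i + 1 then - 2 * ?u j else 0) + (if j + 1 = i then - 2 * ?u j else 0))"
    using i by (intro sum.cong refl) (auto simp: dyn_gram_def)
  also have "\<dots> > 0"
  proof -
    consider "i + 1 < l" | "l = i + 1" using i by force
    then show ?thesis using i assms by cases (subst sum_three_deltas; cases i; auto simp: algebra_simps)+
  qed
  finally show "(\<Sum>j<dyn_rank (DynB l). dyn_gram (DynB l) i j * ?u j) > 0" by simp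
qed auto

text \<open>Twice the sum of all positive roots; the doubling avoids a half at the long end
  node.\<close>

lemma finite_dynkin_C:
  assumes "l \<ge> 2"
  shows "finite_dynkin (DynC l) 2 (\<lambda>i. (if i < l - 1 then 2 else 1) * ((int i + 1) * (2 * int l - int i)))"
proof
  let ?u = "\<lambda>i. (if i < l - 1 then 2 else 1) * ((int i + 1) * (2 * int l - int i))"
  fix i assume i: "i < dyn_rank (DynC l)"
  have "(\<Sum>j<l. dyn_gram (DynC l) i j * ?u j) =
      (\<Sum>j<l. (if j = i then dyn_len (DynC l) i * ?u i else 0)
        + (if j = i + 1 then (if i + 1 < l - 1 then -1 else -2) * ?u j else 0)
        + (if j + 1 = i then (if i < l - 1 then -1 else -2) * ?u j else 0))"
    using i by (intro sum.cong refl) (auto simp: dyn_gram_def)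
  also have "\<dots> > 0"
  proof -
    consider "i + 1 < l" | "l = i + 1" using i by force
    then show ?thesis using i assms by cases (subst sum_three_deltas; cases i; auto simp: algebra_simps)+
  qed
  finally show "(\<Sum>j<dyn_rank (DynC l). dyn_gram (DynC l) i j * ?u j) > 0" by simp
qed auto

section \<open>Linear maps acting on finitely many coordinates\<close>

text \<open>A matrix on the coordinates in \<open>X\<close>, completed by the identity elsewhere, so
  that these maps contain the identity and are closed under composition.\<close>

definition bmat :: "'i set \<Rightarrow> ('i \<Rightarrow> 'i \<Rightarrow> 'k::field) \<Rightarrow> ('i \<Rightarrow> 'k) \<Rightarrow> 'i \<Rightarrow> 'k" where
  "bmat X m v = (\<lambda>c. if c \<in> X then \<Sum>a\<in>X. m a c * v a else v c)"

definition bvec :: "'i \<Rightarrow> 'i \<Rightarrow> 'k::field" where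
  "bvec c = (\<lambda>d. if d = c then 1 else 0)"

definition scl :: "'k::field \<Rightarrow> ('i \<Rightarrow> 'k) \<Rightarrow> 'i \<Rightarrow> 'k" where
  "scl k v = (\<lambda>d. k * v d)"

definition is_bmat :: "'i set \<Rightarrow> (('i \<Rightarrow> 'k::field) \<Rightarrow> 'i \<Rightarrow> 'k) \<Rightarrow> bool" where
  "is_bmat X g \<longleftrightarrow> (\<exists>m. g = bmat X m)"

lemma scl_apply [simp]: "scl k v d = k * v d"
  unfolding scl_def by simp

lemma bvec_apply: "bvec c d = (if d = c then 1 else 0)"
  unfolding bvec_def by simp

lemma bmat_add: "bmat X m (v + w) = bmat X m v + bmat X m w"
  unfolding bmat_def by (auto simp: fun_eq_iff algebra_simps sum.distrib)

lemma bmat_scl: "bmat X m (scl k v) = scl k (bmat X m v)"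
  unfolding bmat_def by (auto simp: fun_eq_iff sum_distrib_left algebra_simps)

lemma is_bmat_add: "is_bmat X g \<Longrightarrow> g (v + w) = g v + g w"
  unfolding is_bmat_def using bmat_add by blast

lemma is_bmat_scl: "is_bmat X g \<Longrightarrow> g (scl k v) = scl k (g v)"
  unfolding is_bmat_def using bmat_scl by blast

lemma is_bmat_zero: "is_bmat X g \<Longrightarrow> g 0 = 0"
  using is_bmat_scl[of X g 0 0] by (auto simp: scl_def zero_fun_def)

lemma is_bmat_sum: "is_bmat X g \<Longrightarrow> g (\<Sum>i\<in>I. f i) = (\<Sum>i\<in>I. g (f i))"
  by (induction I rule: infinite_finite_induct) (auto simp: is_bmat_zero is_bmat_add)

lemma bmat_bvec:
  assumes "finite X" "a \<in> X"
  shows "bmat X m (bvec a) = (\<lambda>c. if c \<in> X then m a c else 0)"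
proof
  fix c
  have "(\<Sum>b\<in>X. m b c * bvec a b) = (\<Sum>b\<in>X. if b = a then m a c else 0)"
    by (intro sum.cong) (auto simp: bvec_def)
  then show "bmat X m (bvec a) c = (if c \<in> X then m a c else 0)"
    unfolding bmat_def using assms by (auto simp: bvec_def)
qed

lemma bmat_comp: "finite X \<Longrightarrow> bmat X m \<circ> bmat X m' = bmat X (\<lambda>a c. \<Sum>b\<in>X. m' a b * m b c)"
proof (rule ext)+
  fix v c assume X: "finite X"
  show "(bmat X m \<circ> bmat X m') v c = bmat X (\<lambda>a c. \<Sum>b\<in>X. m' a b * m b c) v c"
  proof (cases "c \<in> X")
    case True
    have "(bmat X m \<circ> bmat X m') v c = (\<Sum>b\<in>X. m b c * (\<Sum>a\<in>X. m' a b * v a))"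
      using True by (simp add: bmat_def)
    also have "\<dots> = (\<Sum>b\<in>X. \<Sum>a\<in>X. m' a b * m b c * v a)"
      by (simp add: sum_distrib_left mult.commute mult.left_commute)
    also have "\<dots> = (\<Sum>a\<in>X. \<Sum>b\<in>X. m' a b * m b c * v a)" by (rule sum.swap)
    also have "\<dots> = bmat X (\<lambda>a c. \<Sum>b\<in>X. m' a b * m b c) v c"
      using True by (simp add: bmat_def sum_distrib_right)
    finally show ?thesis .
  qed (simp add: bmat_def)
qed

lemma is_bmat_comp: "finite X \<Longrightarrow> is_bmat X g \<Longrightarrow> is_bmat X h \<Longrightarrow> is_bmat X (g \<circ> h)"
  unfolding is_bmat_def by (elim exE) (simp add: bmat_comp, rule exI, rule refl)

lemma is_bmat_id: "finite X \<Longrightarrow> is_bmat X id"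
  unfolding is_bmat_def bmat_def
  by (rule exI[of _ "\<lambda>a c. if a = c then 1 else 0"])
    (auto simp: fun_eq_iff if_distrib[of "\<lambda>x. x * _"] cong: if_cong)

text \<open>Basis vectors indexed by \<open>X\<close> suffice, since the behaviour on all other
  coordinates is prescribed.\<close>

lemma is_bmat_eqI:
  assumes X: "finite X" and g: "is_bmat X g" and h: "is_bmat X h"
    and eq: "\<And>a. a \<in> X \<Longrightarrow> g (bvec a) = h (bvec a)"
  shows "g = h"
proof -
  obtain m m' where m: "g = bmat X m" "h = bmat X m'" using g h unfolding is_bmat_def by blast
  have "m a c = m' a c" if "a \<in> X" "c \<in> X" for a c
    using eq[OF that(1)] that X unfolding m by (simp add: bmat_bvec fun_eq_iff split: if_splits)
  then show ?thesis unfolding m bmat_def by (intro ext) (auto intro!: sum.cong)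
qed

lemma is_bmat_apply:
  assumes "finite X" "is_bmat X g" "c \<in> X"
  shows "g v c = (\<Sum>a\<in>X. g (bvec a) c * v a)"
proof -
  obtain m where m: "g = bmat X m" using assms unfolding is_bmat_def by blast
  have "g (bvec a) c = m a c" if "a \<in> X" for a using assms that unfolding m by (simp add: bmat_bvec)
  then show ?thesis using assms unfolding m bmat_def by simp
qed

lemma is_bmat_comp_bvec:
  assumes "finite X" "is_bmat X g" "is_bmat X h" "a \<in> X" "c \<in> X"
  shows "(g \<circ> h) (bvec a) c = (\<Sum>b\<in>X. h (bvec a) b * g (bvec b) c)"
  using is_bmat_apply[OF assms(1,2,5), of "h (bvec a)"] by (simp add: mult.commute)

lemma is_bmat_outside:
  assumes "finite X" "is_bmat X g" "a \<in> X" "c \<notin> X"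
  shows "g (bvec a) c = 0"
  using assms unfolding is_bmat_def by (auto simp: bmat_bvec)

text \<open>Source of the finiteness of the groups: they permute an infinite function space, but
  each element is given by a finite matrix over a finite field.\<close>

lemma finite_is_bmat:
  assumes "finite X"
  shows "finite {g :: ('i \<Rightarrow> 'k::{field,finite}) \<Rightarrow> 'i \<Rightarrow> 'k. is_bmat X g}"
proof (rule finite_subset)
  let ?F = "(X \<times> X) \<rightarrow>\<^sub>E (UNIV :: 'k set)"
  show "{g :: ('i \<Rightarrow> 'k) \<Rightarrow> 'i \<Rightarrow> 'k. is_bmat X g} \<subseteq> (\<lambda>f. bmat X (\<lambda>a c. f (a, c))) ` ?F"
  proof
    fix g :: "('i \<Rightarrow> 'k) \<Rightarrow> 'i \<Rightarrow> 'k" assume "g \<in> {g. is_bmat X g}"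
    then obtain m where m: "g = bmat X m" unfolding is_bmat_def by blast
    let ?f = "restrict (\<lambda>(a, c). m a c) (X \<times> X)"
    have "g = bmat X (\<lambda>a c. ?f (a, c))" unfolding m bmat_def by (intro ext) (auto intro!: sum.cong)
    moreover have "?f \<in> ?F" by auto
    ultimately show "g \<in> (\<lambda>f. bmat X (\<lambda>a c. f (a, c))) ` ?F" by blast
  qed
  show "finite ((\<lambda>f. bmat X (\<lambda>a c. f (a, c))) ` ?F)"
    using assms by (intro finite_imageI finite_PiE) auto
qed

section \<open>The adjoint action of a root vector\<close>

locale chevalley = finite_dynkin +
  fixes N :: "root \<Rightarrow> root \<Rightarrow> int"
  assumes constants: "chevalley_constants D N"
begin

abbreviation "Bs \<equiv> chev_basis D"
abbreviation "lie \<equiv> lie_coeff D N"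
abbreviation "X \<equiv> chev_x D N"

lemma finite_Bs: "finite Bs"
  unfolding chev_basis_def using finite_R by simp

lemma Bs_simps [simp]: "Hb i \<in> Bs \<longleftrightarrow> i < rk" "Eb r \<in> Bs \<longleftrightarrow> r \<in> R"
  unfolding chev_basis_def by auto

lemma sum_Bs: "(\<Sum>b\<in>Bs. f b) = (\<Sum>i<rk. f (Hb i)) + (\<Sum>r\<in>R. f (Eb r))"
proof -
  have "(\<Sum>b\<in>Bs. f b) = (\<Sum>b\<in>Hb ` {..<rk}. f b) + (\<Sum>b\<in>Eb ` R. f b)"
    unfolding chev_basis_def using finite_R by (intro sum.union_disjoint) auto
  then show ?thesis by (simp add: sum.reindex inj_on_def)
qed

lemma lie_anti: "a \<in> Bs \<Longrightarrow> b \<in> Bs \<Longrightarrow> c \<in> Bs \<Longrightarrow> lie a b c = - lie b a c"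
  using constants unfolding chevalley_constants_def by blast

text \<open>The Jacobi identity as ad a ad b - ad b ad a = ad [a, b], applied to c and read at
  e.\<close>

lemma lie_jacobi:
  assumes "a \<in> Bs" "b \<in> Bs" "c \<in> Bs" "e \<in> Bs"
  shows "(\<Sum>d\<in>Bs. lie b c d * lie a d e) - (\<Sum>d\<in>Bs. lie a c d * lie b d e) = (\<Sum>d\<in>Bs. lie a b d * lie d c e)"
proof -
  have "0 = (\<Sum>d\<in>Bs. lie a b d * lie d c e + lie b c d * lie d a e + lie c a d * lie d b e)"
    using constants[unfolded chevalley_constants_def, THEN conjunct2, THEN conjunct2, rule_format, OF assms] by (rule sym)
  also have "\<dots> = (\<Sum>d\<in>Bs. lie a b d * lie d c e + lie b c d * (- lie a d e) + (- lie a c d) * (- lie b d e))"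
  proof (intro sum.cong refl)
    fix d assume d: "d \<in> Bs"
    note e = lie_anti[OF d assms(1,4)] lie_anti[OF assms(3,1) d] lie_anti[OF d assms(2,4)]
    show "lie a b d * lie d c e + lie b c d * lie d a e + lie c a d * lie d b e =
        lie a b d * lie d c e + lie b c d * (- lie a d e) + (- lie a c d) * (- lie b d e)"
      unfolding e ..
  qed
  also have "\<dots> = (\<Sum>d\<in>Bs. lie a b d * lie d c e) - (\<Sum>d\<in>Bs. lie b c d * lie a d e) + (\<Sum>d\<in>Bs. lie a c d * lie b d e)"
    by (simp add: sum.distrib sum_negf sum_subtractf)
  finally show ?thesis by simp
qed

text \<open>The element h_r, a combination of the fundamental co-roots, acts on e_s with this
  eigenvalue.\<close>

lemma coroot_cart: 
  assumes "r \<in> R"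
  shows "(\<Sum>i<rk. coroot_coeff D r i * cart (simple_root i) s) = cart r s"
proof (rule cart_eqI[OF assms, symmetric])
  have "cart (simple_root i) s = (\<Sum>j<rk. 2 * dyn_gram D i j div dyn_len D i * s j)" if i: "i < rk" for i
  proof (rule cart_eqI[OF simple_in_R[OF i]])
    have "(\<Sum>j<rk. 2 * dyn_gram D i j div dyn_len D i * s j) * dyn_len D i = (\<Sum>j<rk. 2 * dyn_gram D i j * s j)"
      unfolding sum_distrib_right
    proof (intro sum.cong refl)
      fix j assume "j \<in> {..<rk}"
      then have "2 * dyn_gram D i j div dyn_len D i * dyn_len D i = 2 * dyn_gram D i j"
        using len_dvd_gram[OF i] by simp
      then show "2 * dyn_gram D i j div dyn_len D i * s j * dyn_len D i = 2 * dyn_gram D i j * s j"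
        by (metis mult.assoc mult.commute)
    qed
    then show "(\<Sum>j<rk. 2 * dyn_gram D i j div dyn_len D i * s j) * ip (simple_root i) (simple_root i) =
        2 * ip (simple_root i) s"
    proof -
      have "ip (simple_root i) (simple_root i) = dyn_len D i"
        using i by (simp add: root_ip_simple_simple dyn_gram_diag)
      moreover have "2 * ip (simple_root i) s = (\<Sum>j<rk. 2 * dyn_gram D i j * s j)"
        using i by (simp add: root_ip_simple sum_distrib_left mult.assoc)
      ultimately show ?thesis
        using \<open>(\<Sum>j<rk. 2 * dyn_gram D i j div dyn_len D i * s j) * dyn_len D i = (\<Sum>j<rk. 2 * dyn_gram D i j * s j)\<close>
        by (simp only:)
    qed
  qed
  then show "(\<Sum>i<rk. coroot_coeff D r i * cart (simple_root i) s) * ip r r = 2 * ip r s"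
    using double_ip_coroot[OF assms, of s] by (simp add: mult.commute)
qed

lemma coroot_minus: "r \<in> R \<Longrightarrow> i < rk \<Longrightarrow> coroot_coeff D (- r) i = - coroot_coeff D r i"
  using coroot_exact[of r i] coroot_exact[of "- r" i] root_norm_pos[of r]
  by (simp add: uminus_in_R root_ip_linear) (metis minus_mult_left mult_cancel_right less_irrefl)

lemma coroot_simple: "i < rk \<Longrightarrow> j < rk \<Longrightarrow> coroot_coeff D (simple_root i) j = (if j = i then 1 else 0)"
  unfolding coroot_coeff_def using dyn_len_pos[of D i]
  by (simp add: root_ip_simple_simple dyn_gram_diag) (simp add: simple_root_def)

text \<open>The upper end of an r-string, starting anywhere in it and avoiding -r, so that ad e_r
  never leads into the Cartan subalgebra. A full string read backwards is a chain for -r.\<close>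

definition chain :: "root \<Rightarrow> (nat \<Rightarrow> root) \<Rightarrow> nat \<Rightarrow> bool" where
  "chain r \<rho> n \<longleftrightarrow> (\<forall>j\<le>n. \<rho> j \<in> R \<and> \<rho> j \<noteq> - r) \<and> (\<forall>j<n. r + \<rho> j = \<rho> (Suc j)) \<and> r + \<rho> n \<notin> R"

lemma chain_lie:
  assumes "chain r \<rho> n" "j \<le> n"
  shows "lie (Eb r) (Eb (\<rho> j)) c = (if j < n \<and> c = Eb (\<rho> (Suc j)) then N r (\<rho> j) else 0)"
  using assms unfolding chain_def by (cases "j = n") auto

lemma chain_ad_power:
  assumes c: "chain r \<rho> n" and i: "i \<le> n"
  shows "ad_power D N r k (Eb (\<rho> i)) b =
    (if i + k \<le> n \<and> b = Eb (\<rho> (i + k)) then \<Prod>j\<in>{i..<i + k}. N r (\<rho> j) else 0)"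
proof (induction k arbitrary: b)
  case 0
  then show ?case using i by auto
next
  case (Suc k)
  show ?case
  proof (cases "i + k \<le> n")
    case True
    have "\<rho> (i + k) \<in> R" using c True unfolding chain_def by blast
    have "ad_power D N r (Suc k) (Eb (\<rho> i)) b =
        (\<Sum>d\<in>Bs. if d = Eb (\<rho> (i + k)) then (\<Prod>j\<in>{i..<i + k}. N r (\<rho> j)) * lie (Eb r) (Eb (\<rho> (i + k))) b else 0)"
      unfolding ad_power.simps Suc.IH using True by (intro sum.cong refl) auto
    also have "\<dots> = (\<Prod>j\<in>{i..<i + k}. N r (\<rho> j)) * lie (Eb r) (Eb (\<rho> (i + k))) b"
      using finite_Bs \<open>\<rho> (i + k) \<in> R\<close> by simp
    also have "\<dots> = (if i + Suc k \<le> n \<and> b = Eb (\<rho> (i + Suc k)) then \<Prod>j\<in>{i..<i + Suc k}. N r (\<rho> j) else 0)"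
      using chain_lie[OF c True] by (auto simp: mult.commute)
    finally show ?thesis .
  qed (simp add: Suc.IH)
qed

lemma chain_reverse:
  assumes "chain r \<rho> n" and "\<And>j. j \<le> n \<Longrightarrow> \<rho> j \<noteq> r" and "\<rho> 0 - r \<notin> R"
  shows "chain (- r) (\<lambda>j. \<rho> (n - j)) n"
  unfolding chain_def
proof (intro conjI allI impI)
  fix j assume j: "j < n"
  then have "r + \<rho> (n - Suc j) = \<rho> (Suc (n - Suc j))" using assms(1) unfolding chain_def by auto
  also have "Suc (n - Suc j) = n - j" using j by simp
  finally show "- r + \<rho> (n - j) = \<rho> (n - Suc j)" by (metis add_minus_cancel minus_add_cancel)
qed (use assms in \<open>auto simp: chain_def add.commute\<close>)

text \<open>The products of structure constants up and down a root string are those of the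
  representation of \<open>sl\<^sub>2\<close> of dimension \<open>n + 1\<close>.\<close>

lemma string_constants:
  assumes r: "r \<in> R" and c: "chain r \<rho> n" and ne: "\<And>j. j \<le> n \<Longrightarrow> \<rho> j \<noteq> r" and start: "\<rho> 0 - r \<notin> R"
    and cart: "\<And>j. j \<le> n \<Longrightarrow> cart r (\<rho> j) = 2 * int j - int n"
    and j: "j < n"
  shows "N (- r) (\<rho> (Suc j)) * N r (\<rho> j) = (int j + 1) * (int n - int j)"
  using j
proof (induction j)
  have c': "chain (- r) (\<lambda>j. \<rho> (n - j)) n" by (rule chain_reverse[OF c ne start])
  have down: "lie (Eb (- r)) (Eb (\<rho> j)) d = (if 0 < j \<and> d = Eb (\<rho> (j - 1)) then N (- r) (\<rho> j) else 0)"
    if "j \<le> n" for j d using chain_lie[OF c', of "n - j" d] that by (auto simp: Suc_diff_Suc)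
  have inR: "\<rho> j \<in> R" if "j \<le> n" for j using c that unfolding chain_def by blast
  \<comment> \<open>The identity for e_r, e_{-r} and the j-th root vector, read at that same vector:
    consecutive products of constants differ by the eigenvalue of h_r. The sum of n - 2i for i from
    0 to j is (j + 1)(n - j).\<close>
  have jac: "(if 0 < j then N (- r) (\<rho> j) * N r (\<rho> (j - 1)) else 0) -
      (if j < n then N (- r) (\<rho> (Suc j)) * N r (\<rho> j) else 0) = 2 * int j - int n" if j: "j \<le> n" for j
  proof -
    have "(\<Sum>d\<in>Bs. lie (Eb (- r)) (Eb (\<rho> j)) d * lie (Eb r) d (Eb (\<rho> j))) =
        (\<Sum>d\<in>Bs. if d = Eb (\<rho> (j - 1)) then
          (if 0 < j then N (- r) (\<rho> j) * lie (Eb r) (Eb (\<rho> (j - 1))) (Eb (\<rho> j)) else 0) else 0)"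
      unfolding down[OF j] by (intro sum.cong refl) simp
    also have "\<dots> = (if 0 < j then N (- r) (\<rho> j) * lie (Eb r) (Eb (\<rho> (j - 1))) (Eb (\<rho> j)) else 0)"
      using finite_Bs inR[of "j - 1"] j by (subst sum.delta) auto
    also have "\<dots> = (if 0 < j then N (- r) (\<rho> j) * N r (\<rho> (j - 1)) else 0)"
      using chain_lie[OF c, of "j - 1" "Eb (\<rho> j)"] j by (cases j) (simp_all del: lie_coeff.simps)
    finally have 1: "(\<Sum>d\<in>Bs. lie (Eb (- r)) (Eb (\<rho> j)) d * lie (Eb r) d (Eb (\<rho> j))) = \<dots>" .
    have "(\<Sum>d\<in>Bs. lie (Eb r) (Eb (\<rho> j)) d * lie (Eb (- r)) d (Eb (\<rho> j))) =
        (\<Sum>d\<in>Bs. if d = Eb (\<rho> (Suc j)) then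
          (if j < n then N r (\<rho> j) * lie (Eb (- r)) (Eb (\<rho> (Suc j))) (Eb (\<rho> j)) else 0) else 0)"
      unfolding chain_lie[OF c j] by (intro sum.cong refl) simp
    also have "\<dots> = (if j < n then N r (\<rho> j) * lie (Eb (- r)) (Eb (\<rho> (Suc j))) (Eb (\<rho> j)) else 0)"
      using finite_Bs inR[of "Suc j"] by (subst sum.delta) auto
    also have "\<dots> = (if j < n then N (- r) (\<rho> (Suc j)) * N r (\<rho> j) else 0)"
      using down[of "Suc j" "Eb (\<rho> j)"] by (simp del: lie_coeff.simps)
    finally have 2: "(\<Sum>d\<in>Bs. lie (Eb r) (Eb (\<rho> j)) d * lie (Eb (- r)) d (Eb (\<rho> j))) = \<dots>" .
    have "(\<Sum>d\<in>Bs. lie (Eb r) (Eb (- r)) d * lie d (Eb (\<rho> j)) (Eb (\<rho> j))) =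
        (\<Sum>i<rk. coroot_coeff D r i * cart (simple_root i) (\<rho> j))"
      unfolding sum_Bs by (simp add: sum.neutral)
    also have "\<dots> = 2 * int j - int n" using coroot_cart[OF r] cart[OF j] by simp
    finally show ?thesis
      using lie_jacobi[of "Eb r" "Eb (- r)" "Eb (\<rho> j)" "Eb (\<rho> j)"] 1 2 r inR[OF j]
      by (simp add: uminus_in_R del: lie_coeff.simps)
  qed
  {
    case 0
    then show ?case using jac[of 0] by (simp add: fun_Compl_def)
  next
    case (Suc j)
    then show ?case using jac[of "Suc j"] by (simp add: fun_Compl_def algebra_simps)
  }
qed

lemma chain_N_abs:
  assumes r: "r \<in> R" and c: "chain r \<rho> n" and str: "\<And>k. \<rho> 0 + smul k r \<in> R \<longleftrightarrow> 0 \<le> k \<and> k \<le> int n"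
    and \<rho>: "\<And>j. j \<le> n \<Longrightarrow> \<rho> j = \<rho> 0 + smul (int j) r" and j: "j < n"
  shows "\<bar>N r (\<rho> j)\<bar> = int j + 1"
proof -
  have "r + \<rho> j \<in> R" "\<rho> j \<in> R" using c j unfolding chain_def by (metis Suc_leI less_imp_le)+
  then have "\<bar>N r (\<rho> j)\<bar> = int (Max {p. (\<lambda>i. \<rho> j i - int p * r i) \<in> R}) + 1"
    using constants r unfolding chevalley_constants_def by blast
  moreover have "(\<lambda>i. \<rho> j i - int p * r i) \<in> R \<longleftrightarrow> p \<le> j" for p
  proof -
    have "(\<lambda>i. \<rho> j i - int p * r i) = \<rho> 0 + smul (int j - int p) r"
      using \<rho>[of j] j by (simp add: fun_eq_iff algebra_simps)
    then show ?thesis using str[of "int j - int p"] j by auto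
  qed
  then have "{p. (\<lambda>i. \<rho> j i - int p * r i) \<in> R} = {..j}" by auto
  moreover have "Max {..j} = j" by (intro Max_eqI) auto
  ultimately show ?thesis by simp
qed

end

section \<open>Divided powers and root elements on a root string\<close>

lemma sum_fun_apply: "(\<Sum>i\<in>I. f i) x = (\<Sum>i\<in>I. f i x)"
  by (induction I rule: infinite_finite_induct) auto

context chevalley begin

text \<open>The coefficient of (ad e_r)^k / k!. For roots the division is exact, by
  \<open>ad_power_exact\<close>.\<close>

definition dpow :: "root \<Rightarrow> nat \<Rightarrow> chev_idx \<Rightarrow> chev_idx \<Rightarrow> int" where
  "dpow r k a c = ad_power D N r k a c div fact k"

definition xvec :: "(nat \<Rightarrow> root) \<Rightarrow> (nat \<Rightarrow> int) \<Rightarrow> nat \<Rightarrow> chev_idx \<Rightarrow> 'k::field" where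
  "xvec \<rho> \<eta> j = scl (of_int (\<eta> j)) (bvec (Eb (\<rho> j)))"

lemma X_bmat: "X r t = bmat Bs (\<lambda>a c. \<Sum>k\<le>3. of_int (dpow r k a c) * t ^ k)"
  unfolding chev_x_def bmat_def dpow_def ..

lemma is_bmat_X: "is_bmat Bs (X r t)"
  unfolding is_bmat_def X_bmat by blast

lemma X_bvec:
  assumes "a \<in> Bs" "c \<in> Bs"
  shows "X r t (bvec a) c = (\<Sum>k\<le>3. of_int (dpow r k a c) * t ^ k)"
  unfolding X_bmat using finite_Bs assms by (simp add: bmat_bvec)

text \<open>Up to the signs \<open>\<eta>\<close>, the divided powers act on a chain as on the monomials of a
  binary form.\<close>

lemma chain_dpow:
  assumes c: "chain r \<rho> n" and i: "i \<le> n" and \<eta>: "\<And>j. j \<le> n \<Longrightarrow> \<eta> j = 1 \<or> \<eta> j = -1"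
    and NN: "\<And>j. j < n \<Longrightarrow> N r (\<rho> j) = \<eta> j * \<eta> (Suc j) * (int j + 1)"
  shows "ad_power D N r k (Eb (\<rho> i)) b = fact k * dpow r k (Eb (\<rho> i)) b"
    and "dpow r k (Eb (\<rho> i)) b =
      (if i + k \<le> n \<and> b = Eb (\<rho> (i + k)) then \<eta> i * \<eta> (i + k) * int ((i + k) choose i) else 0)"
proof -
  have sq: "\<eta> j * \<eta> j = 1" if "j \<le> n" for j using \<eta>[OF that] by auto
  have "(\<Prod>j\<in>{i..<i + k}. N r (\<rho> j)) = fact k * (\<eta> i * \<eta> (i + k) * int ((i + k) choose i))" if "i + k \<le> n"
    using that
  proof (induction k)
    case 0
    then show ?case using sq[of i] i by simp
  next
    case (Suc k)
    have b: "(int i + int k + 1) * int ((i + k) choose i) = int (Suc k) * int ((i + Suc k) choose i)"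
    proof -
      have "Suc (i + k) * ((i + k) choose k) = Suc k * (Suc (i + k) choose Suc k)"
        using Suc_times_binomial_eq[of "i + k" k] by (simp add: mult.commute)
      moreover have "(i + k) choose k = (i + k) choose i" "Suc (i + k) choose Suc k = (i + Suc k) choose i"
        using binomial_symmetric[of k "i + k"] binomial_symmetric[of "Suc k" "Suc (i + k)"] by simp_all
      ultimately have "int (Suc (i + k) * ((i + k) choose i)) = int (Suc k * ((i + Suc k) choose i))" by simp
      then show ?thesis unfolding of_nat_mult by (simp add: algebra_simps)
    qed
    have "(\<Prod>j\<in>{i..<i + Suc k}. N r (\<rho> j)) = (\<Prod>j\<in>{i..<i + k}. N r (\<rho> j)) * N r (\<rho> (i + k))" by simp
    also have "\<dots> = fact k * (\<eta> i * \<eta> (i + k) * int ((i + k) choose i)) * (\<eta> (i + k) * \<eta> (Suc (i + k)) * (int (i + k) + 1))"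
      using Suc NN[of "i + k"] by simp
    also have "\<dots> = fact k * \<eta> i * (\<eta> (i + k) * \<eta> (i + k)) * \<eta> (i + Suc k) * ((int i + int k + 1) * int ((i + k) choose i))"
      by (simp add: algebra_simps)
    also have "\<dots> = fact (Suc k) * (\<eta> i * \<eta> (i + Suc k) * int ((i + Suc k) choose i))"
      unfolding b using sq[of "i + k"] Suc.prems by (simp add: algebra_simps)
    finally show ?case .
  qed
  then have "ad_power D N r k (Eb (\<rho> i)) b = fact k *
      (if i + k \<le> n \<and> b = Eb (\<rho> (i + k)) then \<eta> i * \<eta> (i + k) * int ((i + k) choose i) else 0)"
    unfolding chain_ad_power[OF c i] by auto
  then show "ad_power D N r k (Eb (\<rho> i)) b = fact k * dpow r k (Eb (\<rho> i)) b"
    and "dpow r k (Eb (\<rho> i)) b =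
      (if i + k \<le> n \<and> b = Eb (\<rho> (i + k)) then \<eta> i * \<eta> (i + k) * int ((i + k) choose i) else 0)"
    unfolding dpow_def by simp_all
qed

lemma chain_inj:
  assumes "chain r \<rho> n" "r \<in> R" "\<And>j. j \<le> n \<Longrightarrow> \<rho> j = \<rho> 0 + smul (int j) r" "i \<le> n" "j \<le> n" "\<rho> i = \<rho> j"
  shows "i = j"
proof -
  have "r \<noteq> 0" using assms zero_notin_R by blast
  then obtain k where "r k \<noteq> 0" by (auto simp: fun_eq_iff)
  moreover have "int i * r k = int j * r k"
    using assms(3)[OF assms(4)] assms(3)[OF assms(5)] assms(6) by (auto simp: fun_eq_iff)
  ultimately show ?thesis by simp
qed

text \<open>On the rescaled vectors the divided powers have binomial coefficients. The bound on n
  keeps the whole chain within the terms k \<le> 3 that \<open>chev_x\<close> retains.\<close>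

lemma chain_X:
  assumes c: "chain r \<rho> n" and i: "i \<le> n" and n3: "n \<le> 3" and \<eta>: "\<And>j. j \<le> n \<Longrightarrow> \<eta> j = 1 \<or> \<eta> j = -1"
    and NN: "\<And>j. j < n \<Longrightarrow> N r (\<rho> j) = \<eta> j * \<eta> (Suc j) * (int j + 1)"
    and inj: "\<And>i j. i \<le> n \<Longrightarrow> j \<le> n \<Longrightarrow> \<rho> i = \<rho> j \<Longrightarrow> i = j"
  shows "X r t (xvec \<rho> \<eta> i) = (\<Sum>m\<le>n. scl (of_nat (m choose i) * t ^ (m - i)) (xvec \<rho> \<eta> m))"
proof
  fix b
  have inR: "\<rho> j \<in> R" if "j \<le> n" for j using c that unfolding chain_def by blast
  have sumapp: "(\<Sum>m\<le>n. scl (of_nat (m choose i) * t ^ (m - i)) (xvec \<rho> \<eta> m)) b =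
      (\<Sum>m\<le>n. of_nat (m choose i) * t ^ (m - i) * (of_int (\<eta> m) * bvec (Eb (\<rho> m)) b))"
    by (simp add: sum_fun_apply xvec_def)
  show "X r t (xvec \<rho> \<eta> i) b = (\<Sum>m\<le>n. scl (of_nat (m choose i) * t ^ (m - i)) (xvec \<rho> \<eta> m)) b"
  proof (cases "\<exists>m\<le>n. b = Eb (\<rho> m)")
    case False
    have "X r t (xvec \<rho> \<eta> i) b = 0"
    proof (cases "b \<in> Bs")
      case True
      have "dpow r k (Eb (\<rho> i)) b = 0" for k using False chain_dpow(2)[OF c i \<eta> NN] by auto
      then show ?thesis using X_bvec[of "Eb (\<rho> i)" b r t] True inR[OF i]
        by (simp add: xvec_def is_bmat_scl[OF is_bmat_X])
    next
      case False
      then show ?thesis using is_bmat_outside[OF finite_Bs is_bmat_X _ False, of "Eb (\<rho> i)" r t] inR[OF i]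
        by (simp add: xvec_def is_bmat_scl[OF is_bmat_X])
    qed
    moreover have "bvec (Eb (\<rho> m)) b = (0 :: 'a)" if "m \<le> n" for m using False that by (auto simp: bvec_apply)
    ultimately show ?thesis unfolding sumapp by simp
  next
    case True
    then obtain m where m: "m \<le> n" "b = Eb (\<rho> m)" by blast
    have sq: "\<eta> j * \<eta> j = 1" if "j \<le> n" for j using \<eta>[OF that] by auto
    have "(\<Sum>m'\<le>n. of_nat (m' choose i) * t ^ (m' - i) * (of_int (\<eta> m') * bvec (Eb (\<rho> m')) b)) =
        (\<Sum>m'\<le>n. if m' = m then of_nat (m choose i) * t ^ (m - i) * of_int (\<eta> m) else 0)"
      using inj m by (intro sum.cong refl) (auto simp: bvec_apply)
    then have rhs: "(\<Sum>m\<le>n. scl (of_nat (m choose i) * t ^ (m - i)) (xvec \<rho> \<eta> m)) b =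
        of_nat (m choose i) * t ^ (m - i) * of_int (\<eta> m)" unfolding sumapp using m by simp
    have dp: "dpow r k (Eb (\<rho> i)) b = (if k = m - i \<and> i \<le> m then \<eta> i * \<eta> m * int (m choose i) else 0)" for k
    proof (cases "i + k = m")
      case True
      then have "i + k \<le> n \<and> b = Eb (\<rho> (i + k))" "k = m - i \<and> i \<le> m" using m by simp_all
      moreover have "dpow r k (Eb (\<rho> i)) b =
          (if i + k \<le> n \<and> b = Eb (\<rho> (i + k)) then \<eta> i * \<eta> (i + k) * int ((i + k) choose i) else 0)"
        by (rule chain_dpow(2)[OF c i \<eta> NN])
      ultimately show ?thesis unfolding True by (simp only: if_True simp_thms)
    next
      case False
      have "\<rho> (i + k) \<noteq> \<rho> m" if "i + k \<le> n" using inj[OF that m(1)] False by blast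
      then have "\<not> (i + k \<le> n \<and> b = Eb (\<rho> (i + k)))" using m(2) by blast
      moreover have "\<not> (k = m - i \<and> i \<le> m)" using False by linarith
      moreover have "dpow r k (Eb (\<rho> i)) b =
          (if i + k \<le> n \<and> b = Eb (\<rho> (i + k)) then \<eta> i * \<eta> (i + k) * int ((i + k) choose i) else 0)"
        by (rule chain_dpow(2)[OF c i \<eta> NN])
      ultimately show ?thesis by (simp only: if_False)
    qed
    have "X r t (bvec (Eb (\<rho> i))) b =
        (\<Sum>k\<le>3. if k = m - i then (if i \<le> m then of_int (\<eta> i * \<eta> m * int (m choose i)) * t ^ (m - i) else 0) else 0)"
    proof -
      have "b \<in> Bs" "Eb (\<rho> i) \<in> Bs" using inR[OF i] inR[OF m(1)] m(2) by simp_all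
      then show ?thesis unfolding X_bvec[OF \<open>Eb (\<rho> i) \<in> Bs\<close> \<open>b \<in> Bs\<close>] dp by (intro sum.cong refl) simp
    qed
    also have "\<dots> = (if i \<le> m then of_int (\<eta> i * \<eta> m * int (m choose i)) * t ^ (m - i) else 0)"
      using m n3 by (subst sum.delta) auto
    also have "\<dots> = of_int (\<eta> i * \<eta> m * int (m choose i)) * t ^ (m - i)"
      by (cases "i \<le> m") (auto simp: binomial_eq_0)
    finally have "X r t (xvec \<rho> \<eta> i) b = of_int (\<eta> i * \<eta> i) * (of_int (\<eta> m * int (m choose i)) * t ^ (m - i))"
      by (simp add: xvec_def is_bmat_scl[OF is_bmat_X] algebra_simps)
    then show ?thesis unfolding rhs sq[OF i] by (simp add: algebra_simps)
  qed
qed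

text \<open>The signs \<open>\<eta>\<close> make the action of the two opposite root subgroups on a root string that of
  the unitriangular subgroups of \<open>SL\<^sub>2\<close> on binary forms.\<close>

lemma root_string_chain:
  assumes r: "r \<in> R" and s: "s \<in> R" and ne: "s \<noteq> r" "s \<noteq> - r"
  obtains n i \<rho> and \<eta> :: "nat \<Rightarrow> int" where "n \<le> 3" "i \<le> n" "\<rho> i = s"
    and "\<And>j. j \<le> n \<Longrightarrow> \<rho> j = s + smul (int j - int i) r"
    and "\<And>j. j \<le> n \<Longrightarrow> \<rho> j \<in> R \<and> \<rho> j \<noteq> r \<and> \<rho> j \<noteq> - r"
    and "cart r s = 2 * int i - int n"
    and "\<And>j. \<eta> j = 1 \<or> \<eta> j = -1"
    and "chain r \<rho> n" "chain (- r) (\<lambda>j. \<rho> (n - j)) n"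
    and "\<And>j. j < n \<Longrightarrow> N r (\<rho> j) = \<eta> j * \<eta> (Suc j) * (int j + 1)"
    and "\<And>j. j < n \<Longrightarrow> N (- r) (\<rho> (Suc j)) = \<eta> j * \<eta> (Suc j) * (int n - int j)"
    and "\<And>i j. i \<le> n \<Longrightarrow> j \<le> n \<Longrightarrow> \<rho> i = \<rho> j \<Longrightarrow> i = j"
proof -
  obtain p q :: nat where pq: "\<And>k. s + smul k r \<in> R \<longleftrightarrow> - int p \<le> k \<and> k \<le> int q"
    and c: "int p - int q = cart r s" and l: "p + q \<le> 3" using root_string[OF r s ne] by blast
  define n where "n = p + q"
  define \<rho> where "\<rho> j = s + smul (int j - int p) r" for j
  have step: "r + \<rho> j = \<rho> (Suc j)" for j unfolding \<rho>_def by (simp add: fun_eq_iff algebra_simps)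
  have inR: "\<rho> j \<in> R \<longleftrightarrow> j \<le> n" for j unfolding \<rho>_def pq n_def by auto
  have nonpar: "\<rho> j \<noteq> r \<and> \<rho> j \<noteq> - r" for j
  proof -
    have "smul 1 s = smul (1 - (int j - int p)) r" if "\<rho> j = r"
      using that unfolding \<rho>_def by (auto simp: fun_eq_iff algebra_simps)
    moreover have "smul 1 s = smul (- 1 - (int j - int p)) r" if "\<rho> j = - r"
      using that unfolding \<rho>_def by (auto simp: fun_eq_iff algebra_simps)
    ultimately show ?thesis using root_multiple[OF r s] ne by blast
  qed
  have ch: "chain r \<rho> n" unfolding chain_def using inR nonpar step by auto
  have start: "\<rho> 0 - r \<notin> R"
  proof -
    have "\<rho> 0 - r = s + smul (- int p - 1) r" unfolding \<rho>_def by (simp add: fun_eq_iff algebra_simps)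
    then show ?thesis using pq by simp
  qed
  have ch': "chain (- r) (\<lambda>j. \<rho> (n - j)) n" by (rule chain_reverse[OF ch _ start]) (use nonpar in blast)
  have \<rho>0: "\<rho> j = \<rho> 0 + smul (int j) r" for j unfolding \<rho>_def by (simp add: fun_eq_iff algebra_simps)
  have str0: "\<rho> 0 + smul k r \<in> R \<longleftrightarrow> 0 \<le> k \<and> k \<le> int n" for k
  proof -
    have "\<rho> 0 + smul k r = s + smul (k - int p) r" unfolding \<rho>_def by (simp add: fun_eq_iff algebra_simps)
    then show ?thesis using pq[of "k - int p"] unfolding n_def by auto
  qed
  have cj: "cart r (\<rho> j) = 2 * int j - int n" for j
    unfolding \<rho>_def n_def using c by (simp add: cart_add cart_smul cart_self r)
  \<comment> \<open>The running product of signs makes the product of neighbouring values the sign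
    of the constant between them. The variant below freezes the value after the end of the string,
    where a constant could be 0.\<close>
  define \<eta> where "\<eta> j = (\<Prod>i<j. sgn (N r (\<rho> i)))" for j
  define \<eta>' where "\<eta>' j = (if \<eta> (min j n) = -1 then -1 else (1::int))" for j
  have abs: "\<bar>N r (\<rho> j)\<bar> = int j + 1" if "j < n" for j
    by (rule chain_N_abs[OF r ch str0 \<rho>0 that])
  have \<eta>1: "\<eta> j = 1 \<or> \<eta> j = -1" if "j \<le> n" for j
    using that
  proof (induction j)
    case (Suc j)
    then have "N r (\<rho> j) \<noteq> 0" using abs[of j] by auto
    then have "sgn (N r (\<rho> j)) = 1 \<or> sgn (N r (\<rho> j)) = -1" by (auto simp: sgn_if)
    then show ?case using Suc unfolding \<eta>_def by auto
  qed (simp add: \<eta>_def)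
  have \<eta>': "\<eta>' j = \<eta> j" if "j \<le> n" for j using \<eta>1[OF that] that unfolding \<eta>'_def by (auto simp: min_def)
  have Nr: "N r (\<rho> j) = \<eta>' j * \<eta>' (Suc j) * (int j + 1)" if "j < n" for j
  proof -
    have "N r (\<rho> j) = sgn (N r (\<rho> j)) * \<bar>N r (\<rho> j)\<bar>" by (simp add: sgn_mult_abs)
    moreover have "\<eta> j * \<eta> (Suc j) = sgn (N r (\<rho> j))" using \<eta>1[of j] that by (auto simp: \<eta>_def)
    ultimately show ?thesis using \<eta>'[of j] \<eta>'[of "Suc j"] that abs[OF that] by simp
  qed
  have Nr': "N (- r) (\<rho> (Suc j)) = \<eta>' j * \<eta>' (Suc j) * (int n - int j)" if j: "j < n" for j
  proof -
    have "N (- r) (\<rho> (Suc j)) * N r (\<rho> j) = (int j + 1) * (int n - int j)"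
      by (rule string_constants[OF r ch _ start cj j]) (use nonpar in blast)
    then have "(N (- r) (\<rho> (Suc j)) * (\<eta>' j * \<eta>' (Suc j))) * (int j + 1) = (int n - int j) * (int j + 1)"
      unfolding Nr[OF j] by (simp add: algebra_simps)
    then have "N (- r) (\<rho> (Suc j)) * (\<eta>' j * \<eta>' (Suc j)) = int n - int j" by simp
    moreover have "(\<eta>' j * \<eta>' (Suc j)) * (\<eta>' j * \<eta>' (Suc j)) = 1"
      using \<eta>1[of j] \<eta>1[of "Suc j"] \<eta>'[of j] \<eta>'[of "Suc j"] j by auto
    ultimately show ?thesis by (metis mult.assoc mult.commute mult.right_neutral)
  qed
  have inj: "i = j" if "i \<le> n" "j \<le> n" "\<rho> i = \<rho> j" for i j
    by (rule chain_inj[OF ch r \<rho>0 that])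
  show ?thesis
  proof (rule that[of n p \<rho> \<eta>'])
    show "\<rho> p = s" unfolding \<rho>_def by (simp add: fun_eq_iff)
    show "cart r s = 2 * int p - int n" using c unfolding n_def by simp
  qed (use l inR nonpar ch ch' Nr Nr' inj in \<open>auto simp: n_def \<rho>_def \<eta>'_def\<close>)
qed

lemma string_vectors:
  assumes r: "r \<in> R" and s: "s \<in> R" and ne: "s \<noteq> r" "s \<noteq> - r"
  obtains n i \<rho> and \<eta> :: "nat \<Rightarrow> int" where "n \<le> 3" "i \<le> n" "\<rho> i = s"
    and "\<And>j. j \<le> n \<Longrightarrow> \<rho> j = s + smul (int j - int i) r"
    and "\<And>j. j \<le> n \<Longrightarrow> \<rho> j \<in> R \<and> \<rho> j \<noteq> r \<and> \<rho> j \<noteq> - r"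
    and "cart r s = 2 * int i - int n"
    and "\<And>j. \<eta> j = 1 \<or> \<eta> j = -1"
    and "\<And>j (t :: 'k::field). j \<le> n \<Longrightarrow>
      X r t (xvec \<rho> \<eta> j) = (\<Sum>m\<le>n. scl (of_nat (m choose j) * t ^ (m - j)) (xvec \<rho> \<eta> m))"
    and "\<And>j (t :: 'k::field). j \<le> n \<Longrightarrow>
      X (- r) t (xvec \<rho> \<eta> j) = (\<Sum>m\<le>n. scl (of_nat ((n - m) choose (n - j)) * t ^ (j - m)) (xvec \<rho> \<eta> m))"
proof -
  obtain n i \<rho> and \<eta> :: "nat \<Rightarrow> int" where *: "n \<le> 3" "i \<le> n" "\<rho> i = s"
    "\<And>j. j \<le> n \<Longrightarrow> \<rho> j = s + smul (int j - int i) r"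
    "\<And>j. j \<le> n \<Longrightarrow> \<rho> j \<in> R \<and> \<rho> j \<noteq> r \<and> \<rho> j \<noteq> - r"
    "cart r s = 2 * int i - int n"
    "\<And>j. \<eta> j = 1 \<or> \<eta> j = -1"
    and ch: "chain r \<rho> n" "chain (- r) (\<lambda>j. \<rho> (n - j)) n"
    and NN: "\<And>j. j < n \<Longrightarrow> N r (\<rho> j) = \<eta> j * \<eta> (Suc j) * (int j + 1)"
    "\<And>j. j < n \<Longrightarrow> N (- r) (\<rho> (Suc j)) = \<eta> j * \<eta> (Suc j) * (int n - int j)"
    and inj: "\<And>i j. i \<le> n \<Longrightarrow> j \<le> n \<Longrightarrow> \<rho> i = \<rho> j \<Longrightarrow> i = j"
    using root_string_chain[OF assms] by blast
  have up: "X r t (xvec \<rho> \<eta> j) = (\<Sum>m\<le>n. scl (of_nat (m choose j) * t ^ (m - j)) (xvec \<rho> \<eta> m))"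
    if "j \<le> n" for j and t :: 'k
    by (rule chain_X[OF ch(1) that *(1)]) (use * NN inj in auto)
  have down: "X (- r) t (xvec \<rho> \<eta> j) = (\<Sum>m\<le>n. scl (of_nat ((n - m) choose (n - j)) * t ^ (j - m)) (xvec \<rho> \<eta> m))"
    if j: "j \<le> n" for j and t :: 'k
  proof -
    let ?\<rho> = "\<lambda>j. \<rho> (n - j)" and ?\<eta> = "\<lambda>j. \<eta> (n - j)"
    have "X (- r) t (xvec ?\<rho> ?\<eta> (n - j)) = (\<Sum>m\<le>n. scl (of_nat (m choose (n - j)) * t ^ (m - (n - j))) (xvec ?\<rho> ?\<eta> m))"
    proof (rule chain_X[OF ch(2) _ *(1)])
      fix k assume k: "k < n"
      then have "Suc (n - Suc k) = n - k" by simp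
      then show "N (- r) (\<rho> (n - k)) = \<eta> (n - k) * \<eta> (n - Suc k) * (int k + 1)"
        using NN(2)[of "n - Suc k"] k by (simp add: of_nat_diff mult.commute)
    next
      fix i j assume "i \<le> n" "j \<le> n" "\<rho> (n - i) = \<rho> (n - j)"
      then show "i = j" using inj[of "n - i" "n - j"] by auto
    qed (use * in auto)
    also have "\<dots> = (\<Sum>m\<le>n. scl (of_nat ((n - m) choose (n - j)) * t ^ ((n - m) - (n - j))) (xvec ?\<rho> ?\<eta> (n - m)))"
      by (rule sum.reindex_bij_witness[where i = "\<lambda>m. n - m" and j = "\<lambda>m. n - m"]) auto
    also have "\<dots> = (\<Sum>m\<le>n. scl (of_nat ((n - m) choose (n - j)) * t ^ (j - m)) (xvec \<rho> \<eta> m))"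
      using j by (intro sum.cong refl) (auto simp: xvec_def)
    finally show ?thesis using j by (simp add: xvec_def)
  qed
  show ?thesis by (rule that[OF * up down])
qed

section \<open>Root elements on the Cartan part and on opposite root vectors\<close>

lemma twice_notin_R: "r \<in> R \<Longrightarrow> r + r \<notin> R"
proof
  assume r: "r \<in> R" and rr: "r + r \<in> R"
  have "smul 1 (r + r) = smul 2 r" by (simp add: fun_eq_iff)
  then have "r + r = r \<or> r + r = - r" using root_multiple[OF r rr] by blast
  then have "r = 0" by (auto simp: fun_eq_iff)
  then show False using r zero_notin_R by simp
qed

lemma root_neq_uminus: "r \<in> R \<Longrightarrow> r \<noteq> - r"
proof
  assume r: "r \<in> R" "r = - r"
  then have "r i = - r i" for i by (metis uminus_apply)
  then have "r = 0" by (auto simp: fun_eq_iff)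
  then show False using r zero_notin_R by simp
qed

lemma ad_power_one: "a \<in> Bs \<Longrightarrow> ad_power D N r (Suc 0) a c = lie (Eb r) a c"
  using finite_Bs by (simp add: if_distrib[of "\<lambda>x. x * _"] cong: if_cong)

lemma lie_self: "r \<in> R \<Longrightarrow> lie (Eb r) (Eb r) c = 0"
  using twice_notin_R[of r] root_neq_uminus[of r] by simp

lemma ad_power_self: "r \<in> R \<Longrightarrow> ad_power D N r k (Eb r) c = (if k = 0 \<and> c = Eb r then 1 else 0)"
proof (induction k arbitrary: c)
  case (Suc k)
  have "ad_power D N r (Suc k) (Eb r) c = (\<Sum>b\<in>Bs. ad_power D N r k (Eb r) b * lie (Eb r) b c)" by simp
  also have "\<dots> = 0" using Suc lie_self by (intro sum.neutral ballI) auto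
  finally show ?case by simp
qed auto

lemma ad_power_Hb:
  assumes r: "r \<in> R" and j: "j < rk"
  shows "ad_power D N r k (Hb j) c = (if k = 0 then if c = Hb j then 1 else 0
    else if k = 1 \<and> c = Eb r then - cart (simple_root j) r else 0)"
proof -
  have 1: "ad_power D N r (Suc 0) (Hb j) c = (if c = Eb r then - cart (simple_root j) r else 0)" for c
    using ad_power_one[of "Hb j" r c] j by (simp del: ad_power.simps)
  have "ad_power D N r (Suc (Suc k)) (Hb j) c = 0" for k c
  proof (induction k arbitrary: c)
    case 0
    have "ad_power D N r (Suc (Suc 0)) (Hb j) c = (\<Sum>b\<in>Bs. ad_power D N r (Suc 0) (Hb j) b * lie (Eb r) b c)"
      by simp
    also have "\<dots> = 0" unfolding 1 using lie_self[OF r] by (intro sum.neutral ballI) auto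
    finally show ?case .
  next
    case (Suc k)
    have "ad_power D N r (Suc (Suc (Suc k))) (Hb j) c =
        (\<Sum>b\<in>Bs. ad_power D N r (Suc (Suc k)) (Hb j) b * lie (Eb r) b c)" by (rule ad_power.simps(2))
    then show ?case unfolding Suc by simp
  qed
  then show ?thesis using 1 by (cases k; cases "k - 1") auto
qed

text \<open>The sequence e_{-r}, h_r, -2 e_r, 0 of the three-dimensional simple algebra. The factor
  2 cancels against 2!, which gives the square in \<open>X_opposite\<close>.\<close>

lemma ad_power_opposite:
  assumes r: "r \<in> R"
  shows "ad_power D N r k (Eb (- r)) c = (if k = 0 then if c = Eb (- r) then 1 else 0
    else if k = 1 then (case c of Hb i \<Rightarrow> coroot_coeff D r i | Eb _ \<Rightarrow> 0)
    else if k = 2 \<and> c = Eb r then -2 else 0)"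
proof -
  have 1: "ad_power D N r (Suc 0) (Eb (- r)) c = (case c of Hb i \<Rightarrow> coroot_coeff D r i | Eb _ \<Rightarrow> 0)" for c
    using ad_power_one[of "Eb (- r)" r c] r by (simp add: uminus_in_R del: ad_power.simps)
  have 2: "ad_power D N r (Suc (Suc 0)) (Eb (- r)) c = (if c = Eb r then -2 else 0)" for c
  proof -
    have "ad_power D N r (Suc (Suc 0)) (Eb (- r)) c =
        (\<Sum>b\<in>Bs. ad_power D N r (Suc 0) (Eb (- r)) b * lie (Eb r) b c)" by (rule ad_power.simps(2))
    also have "\<dots> = (\<Sum>i<rk. coroot_coeff D r i * lie (Eb r) (Hb i) c)"
      unfolding 1 sum_Bs by simp
    also have "\<dots> = (if c = Eb r then - (\<Sum>i<rk. coroot_coeff D r i * cart (simple_root i) r) else 0)"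
      by (simp add: sum_negf)
    finally show ?thesis using coroot_cart[OF r, of r] cart_self[OF r] by simp
  qed
  define s where "s = - r"
  have "ad_power D N r (Suc (Suc (Suc k))) (Eb s) c = 0" for k c
  proof (induction k arbitrary: c)
    case 0
    have "ad_power D N r (Suc (Suc (Suc 0))) (Eb s) c =
        (\<Sum>b\<in>Bs. ad_power D N r (Suc (Suc 0)) (Eb s) b * lie (Eb r) b c)" by (rule ad_power.simps(2))
    also have "\<dots> = 0" unfolding s_def 2 using lie_self[OF r] by (intro sum.neutral ballI) auto
    finally show ?case .
  next
    case (Suc k)
    have "ad_power D N r (Suc (Suc (Suc (Suc k)))) (Eb s) c =
        (\<Sum>b\<in>Bs. ad_power D N r (Suc (Suc (Suc k))) (Eb s) b * lie (Eb r) b c)" by (rule ad_power.simps(2))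
    then show ?case unfolding Suc by simp
  qed
  moreover have "k = 0 \<or> k = Suc 0 \<or> k = Suc (Suc 0) \<or> (\<exists>j. k = Suc (Suc (Suc j)))"
    by (cases k; cases "k - 1"; cases "k - 2") auto
  ultimately show ?thesis using 1 2 unfolding s_def by (auto simp del: ad_power.simps(2))
qed

definition hvec :: "root \<Rightarrow> chev_idx \<Rightarrow> 'k::field" where
  "hvec r = (\<Sum>i<rk. scl (of_int (coroot_coeff D r i)) (bvec (Hb i)))"

lemma hvec_apply: "hvec r c = (case c of Hb i \<Rightarrow> if i < rk then of_int (coroot_coeff D r i) else 0 | Eb _ \<Rightarrow> 0)"
  unfolding hvec_def sum_fun_apply
  by (auto simp: bvec_apply if_distrib[of "\<lambda>x. _ * x"] split: chev_idx.splits cong: if_cong)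

lemma X_vecI:
  fixes t :: "'k::field"
  assumes a: "a \<in> Bs" and v: "\<And>c. c \<notin> Bs \<Longrightarrow> v c = 0"
    and eq: "\<And>c. c \<in> Bs \<Longrightarrow> (\<Sum>k\<le>3. of_int (dpow r k a c) * t ^ k) = v c"
  shows "X r t (bvec a) = v"
proof
  fix c show "X r t (bvec a) c = v c"
  proof (cases "c \<in> Bs")
    case True
    then show ?thesis using X_bvec[OF a True, of r t] eq[OF True] by simp
  next
    case False
    then show ?thesis using is_bmat_outside[OF finite_Bs is_bmat_X a False] v by simp
  qed
qed

lemma sum_atMost_3: "(\<Sum>k\<le>(3::nat). f k) = f 0 + f 1 + f 2 + f 3"
  by (simp add: eval_nat_numeral)

lemma X_self: "r \<in> R \<Longrightarrow> X r t (bvec (Eb r)) = bvec (Eb r)"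
  by (rule X_vecI) (auto simp: dpow_def ad_power_self sum_atMost_3 bvec_apply simp del: ad_power.simps)

lemma X_Hb:
  assumes "r \<in> R" "j < rk"
  shows "X r t (bvec (Hb j)) = bvec (Hb j) + scl (- (of_int (cart (simple_root j) r) * t)) (bvec (Eb r))"
  using assms
  by (intro X_vecI) (auto simp: dpow_def ad_power_Hb sum_atMost_3 bvec_apply simp del: ad_power.simps)

lemma X_opposite:
  assumes "r \<in> R"
  shows "X r t (bvec (Eb (- r))) = bvec (Eb (- r)) + scl t (hvec r) + scl (- (t\<^sup>2)) (bvec (Eb r))"
  using assms root_neq_uminus[OF assms]
  by (intro X_vecI) (auto simp: dpow_def ad_power_opposite sum_atMost_3 bvec_apply hvec_apply uminus_in_R
      mult.commute split: chev_idx.splits simp del: ad_power.simps)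

lemma X_hvec:
  assumes "r \<in> R" "s \<in> R"
  shows "X r t (hvec s) = hvec s + scl (- (of_int (cart s r) * t)) (bvec (Eb r))"
proof -
  have "X r t (hvec s) = (\<Sum>i<rk. scl (of_int (coroot_coeff D s i)) (bvec (Hb i)) +
      scl (- (of_int (coroot_coeff D s i * cart (simple_root i) r) * t)) (bvec (Eb r)))"
    unfolding hvec_def is_bmat_sum[OF is_bmat_X] is_bmat_scl[OF is_bmat_X]
    using assms by (intro sum.cong refl) (simp add: X_Hb fun_eq_iff algebra_simps)
  also have "\<dots> = hvec s + scl (- (of_int (\<Sum>i<rk. coroot_coeff D s i * cart (simple_root i) r) * t)) (bvec (Eb r))"
    unfolding hvec_def
    by (simp add: fun_eq_iff sum_fun_apply sum.distrib sum_distrib_left sum_distrib_right sum_negf)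
  finally show ?thesis unfolding coroot_cart[OF assms(2)] .
qed

lemma bvec_xvec:
  assumes "\<eta> i = 1 \<or> \<eta> i = -1"
  shows "bvec (Eb (\<rho> i)) = scl (of_int (\<eta> i)) (xvec \<rho> \<eta> i)"
  using assms by (auto simp: xvec_def fun_eq_iff)

text \<open>Strings have at most four members, so identities on them can be verified pair by
  pair.\<close>

lemma le_3_cases: 
  assumes "(n::nat) \<le> 3" "j \<le> n"
  obtains "n = 0" "j = 0" | "n = 1" "j = 0" | "n = 1" "j = 1" | "n = 2" "j = 0" | "n = 2" "j = 1" | "n = 2" "j = 2"
    | "n = 3" "j = 0" | "n = 3" "j = 1" | "n = 3" "j = 2" | "n = 3" "j = 3"
proof -
  have "(n = 0 \<and> j = 0) \<or> (n = 1 \<and> (j = 0 \<or> j = 1)) \<or> (n = 2 \<and> (j = 0 \<or> j = 1 \<or> j = 2)) \<or>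
      (n = 3 \<and> (j = 0 \<or> j = 1 \<or> j = 2 \<or> j = 3))" using assms by presburger
  then show ?thesis using that by blast
qed

lemma Bs_cases:
  assumes "a \<in> Bs" "r \<in> R"
  obtains (H) j where "j < rk" "a = Hb j" | (self) "a = Eb r" | (opp) "a = Eb (- r)"
    | (string) s where "s \<in> R" "s \<noteq> r" "s \<noteq> - r" "a = Eb s"
  using assms by (cases a) auto

lemmas X_linear = is_bmat_add[OF is_bmat_X] is_bmat_scl[OF is_bmat_X]

text \<open>The basis splits into the Cartan part, e_r, e_{-r} and the members of strings through
  other roots. On a string the claim is the binomial theorem.\<close>

lemma X_add:
  assumes r: "r \<in> R"
  shows "X r t \<circ> X r t' = X r (t + t')"
proof (rule is_bmat_eqI[OF finite_Bs is_bmat_comp[OF finite_Bs is_bmat_X is_bmat_X] is_bmat_X])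
  fix a assume "a \<in> Bs"
  then show "(X r t \<circ> X r t') (bvec a) = X r (t + t') (bvec a)"
    using r
  proof (cases rule: Bs_cases)
    case (H j)
    then show ?thesis using r by (simp add: X_Hb X_linear X_self fun_eq_iff algebra_simps)
  next
    case self
    then show ?thesis using r by (simp add: X_self)
  next
    case opp
    then show ?thesis using r
      by (simp add: X_opposite X_linear X_hvec X_self cart_self fun_eq_iff algebra_simps power2_eq_square)
  next
    case (string s)
    obtain n i \<rho> \<eta> where *: "n \<le> 3" "i \<le> n" "\<rho> i = s" "\<And>j. \<eta> j = 1 \<or> \<eta> j = -1"
      and X: "\<And>j t. j \<le> n \<Longrightarrow> X r t (xvec \<rho> \<eta> j) =
        (\<Sum>m\<le>n. scl (of_nat (m choose j) * t ^ (m - j)) (xvec \<rho> \<eta> m :: chev_idx \<Rightarrow> 'a))"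
      by (rule string_vectors[OF r string(1-3), where 'k = 'a]) blast
    have "X r t (X r t' (xvec \<rho> \<eta> i)) = X r (t + t') (xvec \<rho> \<eta> i)"
      using *(1,2) by (rule le_3_cases)
        (auto simp: X X_linear eval_nat_numeral atMost_Suc fun_eq_iff algebra_simps)
    then show ?thesis
      unfolding string(4) *(3)[symmetric] bvec_xvec[of \<eta> i \<rho>, OF *(4)] by (simp add: X_linear)
  qed
qed

lemma X_zero: "r \<in> R \<Longrightarrow> X r 0 = id"
proof (rule is_bmat_eqI[OF finite_Bs is_bmat_X is_bmat_id[OF finite_Bs]])
  fix a assume r: "r \<in> R" and a: "a \<in> Bs"
  show "X r 0 (bvec a) = id (bvec a)"
    by (rule X_vecI[OF a]) (use a in \<open>auto simp: dpow_def sum_atMost_3 bvec_apply\<close>)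
qed

lemma X_inverse: "r \<in> R \<Longrightarrow> X r t \<circ> X r (- t) = id" "r \<in> R \<Longrightarrow> X r (- t) \<circ> X r t = id"
  by (simp_all add: X_add X_zero)

lemma X_inverse_apply: "r \<in> R \<Longrightarrow> X r t (X r (- t) v) = v" "r \<in> R \<Longrightarrow> X r (- t) (X r t v) = v"
  using X_inverse by (metis comp_apply id_apply)+

lemma bij_X: "r \<in> R \<Longrightarrow> bij (X r t)"
  using X_inverse o_bij by blast

section \<open>The elements n_r(t) and h_r(t)\<close>

abbreviation "nn \<equiv> chev_n D N"
abbreviation "hh \<equiv> chev_h D N"

lemma is_bmat_n: "is_bmat Bs (nn r t)"
  unfolding chev_n_def by (intro is_bmat_comp finite_Bs is_bmat_X)

lemma is_bmat_h: "is_bmat Bs (hh r t)"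
  unfolding chev_h_def by (intro is_bmat_comp finite_Bs is_bmat_n)

lemmas n_linear = is_bmat_add[OF is_bmat_n] is_bmat_scl[OF is_bmat_n]

lemma hvec_minus: "r \<in> R \<Longrightarrow> hvec (- r) = scl (-1) (hvec r)"
  by (auto simp: fun_eq_iff hvec_apply coroot_minus split: chev_idx.splits)

lemma n_self:
  assumes r: "r \<in> R" and t: "t \<noteq> 0"
  shows "nn r t (bvec (Eb r)) = scl (- (inverse t)\<^sup>2) (bvec (Eb (- r)))"
proof -
  have r': "- r \<in> R" using uminus_in_R[OF r] .
  have "X (- r) (- inverse t) (bvec (Eb r)) =
      bvec (Eb r) + scl (inverse t) (hvec r) + scl (- ((inverse t)\<^sup>2)) (bvec (Eb (- r)))"
    using X_opposite[OF r', of "- inverse t"] by (simp add: hvec_minus[OF r] fun_eq_iff)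
  then show ?thesis unfolding chev_n_def
    using t by (simp add: X_self r X_linear X_hvec X_opposite cart_self)
      (simp add: fun_eq_iff field_simps power2_eq_square)
qed

lemma n_opposite:
  assumes r: "r \<in> R" and t: "t \<noteq> 0"
  shows "nn r t (bvec (Eb (- r))) = scl (- (t\<^sup>2)) (bvec (Eb r))"
proof -
  have r': "- r \<in> R" using uminus_in_R[OF r] .
  have 1: "X (- r) t' (bvec (Eb r)) =
      bvec (Eb r) + scl (- t') (hvec r) + scl (- (t'\<^sup>2)) (bvec (Eb (- r)))" for t'
    using X_opposite[OF r', of t'] by (simp add: hvec_minus[OF r] fun_eq_iff)
  have 2: "X (- r) t' (hvec r) = hvec r + scl (2 * t') (bvec (Eb (- r)))" for t'
    using X_hvec[OF r' r, of t'] cart_minus[OF r, of r] by (simp add: cart_self[OF r] fun_eq_iff)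
  show ?thesis unfolding chev_n_def
    using t by (simp add: X_self r r' X_linear X_hvec X_opposite 1 2 cart_self)
      (simp add: fun_eq_iff field_simps power2_eq_square)
qed

lemma n_Hb:
  assumes r: "r \<in> R" and j: "j < rk" and t: "t \<noteq> 0"
  shows "nn r t (bvec (Hb j)) = bvec (Hb j) + scl (- of_int (cart (simple_root j) r)) (hvec r)"
proof -
  have r': "- r \<in> R" using uminus_in_R[OF r] .
  have 1: "X (- r) t' (bvec (Eb r)) =
      bvec (Eb r) + scl (- t') (hvec r) + scl (- (t'\<^sup>2)) (bvec (Eb (- r)))" for t'
    using X_opposite[OF r', of t'] by (simp add: hvec_minus[OF r] fun_eq_iff)
  have 2: "cart (simple_root j) (- r) = - cart (simple_root j) r" using cart_minus simple_in_R[OF j] by blast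
  show ?thesis unfolding chev_n_def
    using t by (simp add: X_Hb r r' j X_linear X_hvec X_self X_opposite 1 2 cart_self)
      (simp add: fun_eq_iff field_simps power2_eq_square)
qed

lemma sum_scl: "(\<Sum>i\<in>I. scl (b i) v) = scl (\<Sum>i\<in>I. b i) v"
  by (simp add: fun_eq_iff sum_fun_apply sum_distrib_right)

lemma n_hvec:
  assumes r: "r \<in> R" and t: "t \<noteq> 0"
  shows "nn r t (hvec r) = scl (-1) (hvec r)"
proof -
  have "nn r t (hvec r) = nn r t (\<Sum>i<rk. scl (of_int (coroot_coeff D r i)) (bvec (Hb i)))"
    by (subst hvec_def) (rule refl)
  also have "\<dots> = (\<Sum>i<rk. scl (of_int (coroot_coeff D r i)) (nn r t (bvec (Hb i))))"
    unfolding is_bmat_sum[OF is_bmat_n] is_bmat_scl[OF is_bmat_n] ..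
  also have "\<dots> = (\<Sum>i<rk. scl (of_int (coroot_coeff D r i)) (bvec (Hb i)) +
      scl (- of_int (coroot_coeff D r i * cart (simple_root i) r)) (hvec r))"
    using assms by (intro sum.cong refl) (simp add: n_Hb fun_eq_iff algebra_simps)
  also have "\<dots> = hvec r + (\<Sum>i<rk. scl (- of_int (coroot_coeff D r i * cart (simple_root i) r)) (hvec r))"
    unfolding sum.distrib hvec_def[of r, symmetric] ..
  also have "\<dots> = hvec r + scl (- of_int (\<Sum>i<rk. coroot_coeff D r i * cart (simple_root i) r)) (hvec r)"
    unfolding sum_scl by (simp add: sum_negf)
  finally show ?thesis unfolding coroot_cart[OF r] cart_self[OF r] by (simp add: fun_eq_iff)
qed

text \<open>The matrix with rows (0, t) and (-1/t, 0) acting on the monomials of a binary form of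
  degree n: the variables change places with factors t and -1/t.\<close>

lemma n_string:
  fixes t :: "'k::field"
  assumes t: "t \<noteq> 0" and n: "n \<le> 3" "j \<le> n"
    and up: "\<And>j (t :: 'k). j \<le> n \<Longrightarrow> X r t (xvec \<rho> \<eta> j) = (\<Sum>m\<le>n. scl (of_nat (m choose j) * t ^ (m - j)) (xvec \<rho> \<eta> m))"
    and down: "\<And>j (t :: 'k). j \<le> n \<Longrightarrow>
      X (- r) t (xvec \<rho> \<eta> j) = (\<Sum>m\<le>n. scl (of_nat ((n - m) choose (n - j)) * t ^ (j - m)) (xvec \<rho> \<eta> m))"
  shows "nn r t (xvec \<rho> \<eta> j) = scl ((-1) ^ j * t powi (int n - 2 * int j)) (xvec \<rho> \<eta> (n - j))"
  using n unfolding chev_n_def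
  by (rule le_3_cases)
    (use t in \<open>simp add: up down X_linear eval_nat_numeral atMost_Suc power_int_def,
      simp add: fun_eq_iff field_simps\<close>)+

definition chi :: "(nat \<Rightarrow> 'k::field) \<Rightarrow> root \<Rightarrow> 'k" where
  "chi c s = (\<Prod>i<rk. c i powi s i)"

text \<open>The diagonal automorphism given by a character of the root lattice. Unlike the elements
  of \<open>chev_torus\<close>, these realise arbitrary nonzero values at the fundamental roots, as
  the scaling of commutator relations requires.\<close>

definition tor :: "(nat \<Rightarrow> 'k::field) \<Rightarrow> 'k lie_map" where
  "tor c v = (\<lambda>x. case x of Hb i \<Rightarrow> v x | Eb s \<Rightarrow> if s \<in> R then chi c s * v x else v x)"

definition wchi :: "(nat \<Rightarrow> 'k::field) \<Rightarrow> chev_idx \<Rightarrow> 'k" where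
  "wchi c a = (case a of Hb i \<Rightarrow> 1 | Eb s \<Rightarrow> chi c s)"

lemma tor_bvec: "a \<in> Bs \<Longrightarrow> tor c (bvec a) = scl (wchi c a) (bvec a)"
  unfolding tor_def wchi_def by (auto simp: fun_eq_iff bvec_apply split: chev_idx.splits)

lemma is_bmat_tor: "is_bmat Bs (tor c)"
proof -
  have "tor c = bmat Bs (\<lambda>a b. if a = b then wchi c a else 0)"
  proof (intro ext)
    fix v x
    show "tor c v x = bmat Bs (\<lambda>a b. if a = b then wchi c a else 0) v x"
      unfolding tor_def bmat_def wchi_def using finite_Bs
      by (auto simp: if_distrib[of "\<lambda>x. x * _"] split: chev_idx.splits cong: if_cong)
  qed
  then show ?thesis unfolding is_bmat_def by blast
qed

text \<open>On a root string h_r(t) is the square-free product of two variable exchanges, hence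
  diagonal with exponent the Cartan integer; linearity of that integer in s makes the eigenvalues a
  character.\<close>

lemma h_eq_tor:
  assumes r: "r \<in> R" and t: "t \<noteq> 0"
  shows "hh r t = tor (\<lambda>i. t powi cart r (simple_root i))"
proof (rule is_bmat_eqI[OF finite_Bs is_bmat_h is_bmat_tor])
  fix a assume a: "a \<in> Bs"
  have chi: "chi (\<lambda>i. t powi cart r (simple_root i)) s = t powi cart r s" if "s \<in> R" for s
  proof -
    have "cart r s = (\<Sum>i<rk. s i * cart r (simple_root i))"
      by (rule cart_simple_expand[OF r]) (use root_coord_outside[OF that] in auto)
    moreover have "(\<Prod>i\<in>I. t powi f i) = t powi (\<Sum>i\<in>I. f i)" for I and f :: "nat \<Rightarrow> int"
      using t by (induction I rule: infinite_finite_induct) (auto simp: power_int_add)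
    ultimately show ?thesis unfolding chi_def by (simp flip: power_int_mult add: mult.commute)
  qed
  show "hh r t (bvec a) = tor (\<lambda>i. t powi cart r (simple_root i)) (bvec a)"
    using a r
  proof (cases rule: Bs_cases)
    case (H j)
    then show ?thesis using r t
      by (simp add: tor_bvec chev_h_def n_Hb n_linear n_hvec wchi_def fun_eq_iff)
  next
    case self
    have "wchi (\<lambda>i. t powi cart r (simple_root i)) a = t\<^sup>2"
      unfolding self wchi_def using chi[OF r] cart_self[OF r] by simp
    then show ?thesis using r t self by (simp add: tor_bvec chev_h_def n_self n_opposite n_linear fun_eq_iff)
  next
    case opp
    have "wchi (\<lambda>i. t powi cart r (simple_root i)) a = (inverse t)\<^sup>2"
      unfolding opp wchi_def using chi[OF uminus_in_R[OF r]] cart_self[OF r]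
      by (simp add: cart_minus r power_int_minus power_inverse)
    then show ?thesis using r t opp by (simp add: tor_bvec uminus_in_R chev_h_def n_self n_opposite n_linear fun_eq_iff)
  next
    case (string s)
    obtain n i \<rho> \<eta> where *: "n \<le> 3" "i \<le> n" "\<rho> i = s" "cart r s = 2 * int i - int n" "\<And>j. \<eta> j = 1 \<or> \<eta> j = -1"
      and up: "\<And>j t. j \<le> n \<Longrightarrow> X r t (xvec \<rho> \<eta> j) =
        (\<Sum>m\<le>n. scl (of_nat (m choose j) * t ^ (m - j)) (xvec \<rho> \<eta> m :: chev_idx \<Rightarrow> 'a))"
      and down: "\<And>j t. j \<le> n \<Longrightarrow> X (- r) t (xvec \<rho> \<eta> j) =
        (\<Sum>m\<le>n. scl (of_nat ((n - m) choose (n - j)) * t ^ (j - m)) (xvec \<rho> \<eta> m :: chev_idx \<Rightarrow> 'a))"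
      by (rule string_vectors[OF r string(1-3), where 'k = 'a]) blast
    have "n - i \<le> n" by simp
    have "hh r t (xvec \<rho> \<eta> i) = scl (t powi (2 * int i - int n)) (xvec \<rho> \<eta> i)"
      using *(1,2) unfolding chev_h_def comp_apply
      by (rule le_3_cases) (use t in \<open>auto simp: n_string[OF _ *(1) _ up down] n_linear fun_eq_iff power_int_def\<close>)
    then have "hh r t (bvec (Eb s)) = scl (t powi cart r s) (bvec (Eb s))"
      unfolding *(3)[symmetric] *(4)[unfolded *(3)[symmetric]] bvec_xvec[of \<eta> i \<rho>, OF *(5)]
      by (simp add: is_bmat_scl[OF is_bmat_h] fun_eq_iff)
    then show ?thesis using string chi[OF string(1)] by (simp add: tor_bvec wchi_def)
  qed
qed

end

section \<open>Subgroups of the permutation group of the Lie algebra\<close>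

lemma lp_carrier: "carrier lie_perm = {f. bij f}"
  unfolding BijGroup_def Bij_def by (simp add: extensional_UNIV)

lemma lp_mult: "bij f \<Longrightarrow> bij g \<Longrightarrow> f \<otimes>\<^bsub>lie_perm\<^esub> g = f \<circ> g"
  unfolding BijGroup_def Bij_def by (simp add: extensional_UNIV compose_def comp_def restrict_def)

lemma lp_one: "\<one>\<^bsub>lie_perm\<^esub> = id"
  unfolding BijGroup_def by (simp add: id_def restrict_def)

lemma lp_group: "group lie_perm"
  by (rule group_BijGroup)

lemma lp_inv:
  assumes "bij f" "f \<circ> g = id" "g \<circ> f = id"
  shows "inv\<^bsub>lie_perm\<^esub> f = g"
proof -
  have "bij g" using assms o_bij by blast
  then show ?thesis
    using group.inv_equality[OF lp_group, of g f] assms by (simp add: lp_mult lp_one lp_carrier)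
qed

lemma lp_inv_bij:
  assumes "bij f"
  shows "bij (inv\<^bsub>lie_perm\<^esub> f)" "f \<circ> inv\<^bsub>lie_perm\<^esub> f = id" "inv\<^bsub>lie_perm\<^esub> f \<circ> f = id"
proof -
  show b: "bij (inv\<^bsub>lie_perm\<^esub> f)"
    using group.inv_closed[OF lp_group, of f] assms by (simp add: lp_carrier)
  show "f \<circ> inv\<^bsub>lie_perm\<^esub> f = id" "inv\<^bsub>lie_perm\<^esub> f \<circ> f = id"
    using group.r_inv[OF lp_group, of f] group.l_inv[OF lp_group, of f] assms b
    by (simp_all add: lp_carrier lp_mult lp_one)
qed

lemma lp_generate_induct:
  assumes h: "h \<in> generate lie_perm S" and bS: "\<And>x. x \<in> S \<Longrightarrow> bij x"
    and one: "P id" and incl: "\<And>x. x \<in> S \<Longrightarrow> P x" and inv: "\<And>x. x \<in> S \<Longrightarrow> P (inv\<^bsub>lie_perm\<^esub> x)"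
    and mult: "\<And>x y. x \<in> generate lie_perm S \<Longrightarrow> y \<in> generate lie_perm S \<Longrightarrow> P x \<Longrightarrow> P y \<Longrightarrow> P (x \<circ> y)"
  shows "P h"
proof -
  have b: "bij x" if "x \<in> generate lie_perm S" for x
    using group.generate_in_carrier[OF lp_group, of S x] bS that by (auto simp: lp_carrier)
  show ?thesis using h
  proof (induction rule: generate.induct)
    case one
    show ?case unfolding lp_one by (rule assms(3))
  next
    case (eng h1 h2)
    show ?case unfolding lp_mult[OF b[OF eng(1)] b[OF eng(2)]] by (rule mult[OF eng])
  qed (use incl inv in auto)
qed

lemma lp_generate_subgroup: "(\<And>x. x \<in> S \<Longrightarrow> bij x) \<Longrightarrow> subgroup (generate lie_perm S) lie_perm"
  by (rule group.generate_is_subgroup[OF lp_group]) (auto simp: lp_carrier)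

lemma lp_subgroup_comp: "subgroup S lie_perm \<Longrightarrow> x \<in> S \<Longrightarrow> y \<in> S \<Longrightarrow> x \<circ> y \<in> S"
  using subgroup.m_closed[of S lie_perm x y] subgroup.mem_carrier[of S lie_perm] by (simp add: lp_mult lp_carrier)

lemma lp_subgroup_id: "subgroup S lie_perm \<Longrightarrow> id \<in> S"
  using subgroup.one_closed[of S lie_perm] by (simp add: lp_one)

lemma lp_subgroup_bij: "subgroup S lie_perm \<Longrightarrow> x \<in> S \<Longrightarrow> bij x"
  using subgroup.mem_carrier[of S lie_perm x] by (simp add: lp_carrier)

section \<open>Weights and triangular maps\<close>

context chevalley begin

definition wt :: "chev_idx \<Rightarrow> root" where
  "wt a = (case a of Hb i \<Rightarrow> 0 | Eb r \<Rightarrow> r)"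

lemma lie_wt: "b \<in> Bs \<Longrightarrow> c \<in> Bs \<Longrightarrow> lie (Eb r) b c \<noteq> 0 \<Longrightarrow> wt c = r + wt b"
  unfolding wt_def by (cases b; cases c) (auto split: if_splits)

lemma ad_power_wt:
  assumes "a \<in> Bs" "c \<in> Bs" "ad_power D N r k a c \<noteq> 0"
  shows "wt c = wt a + smul (int k) r"
  using assms(2,3)
proof (induction k arbitrary: c)
  case 0
  then show ?case by (auto simp: fun_eq_iff split: if_splits)
next
  case (Suc k)
  then have "\<exists>b\<in>Bs. ad_power D N r k a b * lie (Eb r) b c \<noteq> 0"
    unfolding ad_power.simps(2) by (meson sum.not_neutral_contains_not_neutral)
  then obtain b where b: "b \<in> Bs" "ad_power D N r k a b \<noteq> 0" "lie (Eb r) b c \<noteq> 0" by auto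
  have "wt c = r + (wt a + smul (int k) r)" using lie_wt[OF b(1) Suc.prems(1) b(3)] Suc.IH[OF b(1,2)] by (auto simp: fun_eq_iff)
  then show ?case by (simp add: fun_eq_iff algebra_simps)
qed

lemma X_coef_wt:
  assumes "a \<in> Bs" "c \<in> Bs" "X r t (bvec a) c \<noteq> 0"
  shows "\<exists>k\<le>3. wt c = wt a + smul (int k) r \<and> (k = 0 \<longrightarrow> c = a)"
proof -
  have "\<exists>k\<in>{..3}. of_int (dpow r k a c) * t ^ k \<noteq> 0"
    using assms(3) unfolding X_bvec[OF assms(1,2)] by (meson sum.not_neutral_contains_not_neutral)
  then obtain k where k: "k \<le> 3" "of_int (dpow r k a c) * t ^ k \<noteq> 0" by blast
  then have "dpow r k a c \<noteq> 0" by (metis mult_zero_left of_int_0)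
  then have "ad_power D N r k a c \<noteq> 0" unfolding dpow_def by auto
  then show ?thesis using ad_power_wt[OF assms(1,2)] k by (intro exI[of _ k]) (auto split: if_splits)
qed

abbreviation "wht a \<equiv> ht (wt a)"

lemma ht_zero [simp]: "ht 0 = 0"
  unfolding ht_def by simp

text \<open>Upper (\<open>e = 1\<close>) or lower (\<open>e = -1\<close>) triangular with respect to the height.\<close>

definition tri :: "int \<Rightarrow> (chev_idx \<Rightarrow> 'k::field) \<Rightarrow> 'k lie_map \<Rightarrow> bool" where
  "tri e \<chi> g \<longleftrightarrow> is_bmat Bs g \<and>
     (\<forall>a\<in>Bs. \<forall>c\<in>Bs. \<not> e * wht a < e * wht c \<longrightarrow> g (bvec a) c = (if a = c then \<chi> a else 0))"

lemma tri_bmat: "tri e \<chi> g \<Longrightarrow> is_bmat Bs g"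
  unfolding tri_def by blast

lemma tri_coef:
  "tri e \<chi> g \<Longrightarrow> a \<in> Bs \<Longrightarrow> c \<in> Bs \<Longrightarrow> \<not> e * wht a < e * wht c \<Longrightarrow> g (bvec a) c = (if a = c then \<chi> a else 0)"
  unfolding tri_def by blast

lemma tri_nonzero:
  "tri e \<chi> g \<Longrightarrow> a \<in> Bs \<Longrightarrow> c \<in> Bs \<Longrightarrow> g (bvec a) c \<noteq> 0 \<Longrightarrow> a = c \<or> e * wht a < e * wht c"
  using tri_coef[of e \<chi> g a c] by (auto split: if_splits)

lemma tri_id: "tri e (\<lambda>_. 1) id"
  unfolding tri_def using is_bmat_id[OF finite_Bs] by (auto simp: bvec_apply)

lemma tri_comp:
  assumes g: "tri e \<chi> g" and h: "tri e \<psi> h"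
  shows "tri e (\<lambda>a. \<psi> a * \<chi> a) (g \<circ> h)"
  unfolding tri_def
proof (intro conjI ballI impI)
  show "is_bmat Bs (g \<circ> h)" using is_bmat_comp[OF finite_Bs] g h tri_bmat by blast
  fix a c assume a: "a \<in> Bs" and c: "c \<in> Bs" and nl: "\<not> e * wht a < e * wht c"
  have "(g \<circ> h) (bvec a) c = (\<Sum>b\<in>Bs. h (bvec a) b * g (bvec b) c)"
    by (rule is_bmat_comp_bvec[OF finite_Bs tri_bmat[OF g] tri_bmat[OF h] a c])
  also have "\<dots> = (\<Sum>b\<in>Bs. if b = a then (if a = c then \<psi> a * \<chi> a else 0) else 0)"
  proof (intro sum.cong refl)
    fix b assume b: "b \<in> Bs"
    show "h (bvec a) b * g (bvec b) c = (if b = a then (if a = c then \<psi> a * \<chi> a else 0) else 0)"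
    proof (cases "b = a")
      case True
      then show ?thesis using tri_coef[OF g a c nl] tri_coef[OF h a a] by auto
    next
      case False
      have "h (bvec a) b = 0 \<or> g (bvec b) c = 0"
      proof (rule ccontr)
        assume "\<not> ?thesis"
        then have "e * wht a < e * wht b" "b = c \<or> e * wht b < e * wht c"
          using tri_nonzero[OF h a b] tri_nonzero[OF g b c] False by auto
        then show False using nl by auto
      qed
      then show ?thesis using False by auto
    qed
  qed
  also have "\<dots> = (if a = c then \<psi> a * \<chi> a else 0)" using finite_Bs a by simp
  finally show "(g \<circ> h) (bvec a) c = (if a = c then \<psi> a * \<chi> a else 0)" .
qed

lemma tri_uni_comp: "tri e (\<lambda>_. 1) g \<Longrightarrow> tri e (\<lambda>_. 1) h \<Longrightarrow> tri e (\<lambda>_. 1) (g \<circ> h)"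
  using tri_comp[of e "\<lambda>_. 1" g "\<lambda>_. 1" h] by simp

lemma tri_tor: "tri e (wchi c) (tor c)"
  unfolding tri_def using is_bmat_tor by (auto simp: tor_bvec bvec_apply)

text \<open>The k-th divided power moves weights by k r, so every term with k > 0 moves the height
  strictly in the direction \<open>e\<close>.\<close>

lemma tri_X:
  assumes r: "r \<in> R" and e: "e * ht r > 0"
  shows "tri e (\<lambda>_. 1) (X r t)"
  unfolding tri_def
proof (intro conjI ballI impI is_bmat_X)
  fix a c assume a: "a \<in> Bs" and c: "c \<in> Bs" and nl: "\<not> e * wht a < e * wht c"
  show "X r t (bvec a) c = (if a = c then 1 else 0)"
  proof -
    have d: "dpow r k a c = 0" if "k > 0" for k
    proof (rule ccontr)
      assume "dpow r k a c \<noteq> 0"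
      then have "ad_power D N r k a c \<noteq> 0" unfolding dpow_def by auto
      then have "wht c = wht a + int k * ht r" using ad_power_wt[OF a c] by (simp add: ht_add ht_smul)
      then have "e * wht c = e * wht a + int k * (e * ht r)" by (simp add: algebra_simps)
      then show False using nl e that by simp
    qed
    show ?thesis unfolding X_bvec[OF a c] sum_atMost_3 using d[of 1] d[of 2] d[of 3]
      by (simp add: dpow_def)
  qed
qed

lemma bmat_diagI:
  assumes g: "is_bmat Bs g" and eq: "\<And>a c. a \<in> Bs \<Longrightarrow> c \<in> Bs \<Longrightarrow> g (bvec a) c = (if a = c then wchi k a else 0)"
  shows "g = tor k"
proof (rule is_bmat_eqI[OF finite_Bs g is_bmat_tor])
  fix a assume a: "a \<in> Bs"
  show "g (bvec a) = tor k (bvec a)"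
  proof
    fix c show "g (bvec a) c = tor k (bvec a) c"
      using eq[OF a, of c] is_bmat_outside[OF finite_Bs g a, of c] a
      by (cases "c \<in> Bs") (auto simp: tor_bvec bvec_apply)
  qed
qed

text \<open>Each entry between different heights is killed by one of the two hypotheses, and
  off-diagonal entries between equal heights by both.\<close>

lemma tri_both:
  assumes "tri e \<chi> g" "tri (- e) (wchi k) g" "e = 1 \<or> e = -1"
  shows "g = tor k"
proof (rule bmat_diagI[OF tri_bmat[OF assms(1)]])
  fix a c assume ac: "a \<in> Bs" "c \<in> Bs"
  show "g (bvec a) c = (if a = c then wchi k a else 0)"
  proof (cases "a = c \<or> \<not> - e * wht a < - e * wht c")
    case True
    then show ?thesis using tri_coef[OF assms(2) ac] by auto
  next
    case False
    then show ?thesis using tri_coef[OF assms(1) ac] by auto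
  qed
qed

lemma tor_comp: "(\<And>i. c i \<noteq> 0) \<Longrightarrow> (\<And>i. d i \<noteq> 0) \<Longrightarrow> tor c \<circ> tor d = tor (\<lambda>i. c i * d i)"
  unfolding tor_def chi_def
  by (intro ext) (auto simp: power_int_mult_distrib prod.distrib mult.assoc split: chev_idx.splits)

lemma tor_one: "(\<And>i. i < rk \<Longrightarrow> c i = 1) \<Longrightarrow> tor c = id"
  unfolding tor_def chi_def by (auto simp: fun_eq_iff split: chev_idx.splits)

lemma tor_inverse: "(\<And>i. c i \<noteq> 0) \<Longrightarrow> tor c \<circ> tor (\<lambda>i. inverse (c i)) = id \<and> tor (\<lambda>i. inverse (c i)) \<circ> tor c = id"
  by (simp add: tor_comp tor_one)

lemma bij_tor: "(\<And>i. c i \<noteq> 0) \<Longrightarrow> bij (tor c)"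
  using tor_inverse[of c] o_bij by blast

lemma wchi_nonzero: "(\<And>i. c i \<noteq> 0) \<Longrightarrow> wchi c a \<noteq> 0"
  unfolding wchi_def chi_def by (auto split: chev_idx.splits)

section \<open>The torus and the monomial subgroup\<close>

text \<open>Nonvanishing is demanded also at indices beyond the rank, where \<open>chi\<close> does
  not look, so that products and inverses carry no side conditions.\<close>

definition tor_like :: "'k::field lie_map \<Rightarrow> bool" where
  "tor_like g \<longleftrightarrow> (\<exists>c. (\<forall>i. c i \<noteq> 0) \<and> g = tor c)"

lemma tor_like_h: "r \<in> R \<Longrightarrow> t \<noteq> 0 \<Longrightarrow> tor_like (hh r t)"
  unfolding tor_like_def using h_eq_tor[of r t]
  by (intro exI[of _ "\<lambda>i. t powi cart r (simple_root i)"]) auto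

lemma tor_like_inv:
  assumes "tor_like g"
  shows "tor_like (inv\<^bsub>lie_perm\<^esub> g)"
proof -
  obtain c where c: "\<And>i. c i \<noteq> 0" "g = tor c" using assms unfolding tor_like_def by blast
  have "inv\<^bsub>lie_perm\<^esub> g = tor (\<lambda>i. inverse (c i))"
    unfolding c(2) by (rule lp_inv) (use c bij_tor tor_inverse in auto)
  then show ?thesis unfolding tor_like_def using c(1) by (metis inverse_nonzero_iff_nonzero)
qed

lemma tor_like_comp: "tor_like g \<Longrightarrow> tor_like h \<Longrightarrow> tor_like (g \<circ> h)"
  unfolding tor_like_def by (elim exE conjE) (simp add: tor_comp, rule exI, rule conjI[rotated], rule refl, simp)

lemma tor_like_id: "tor_like id"
  unfolding tor_like_def using tor_one[of "\<lambda>_. 1"] by (metis one_neq_zero)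

lemma bij_tor_like: "tor_like g \<Longrightarrow> bij g"
  unfolding tor_like_def using bij_tor by blast

lemma torus_tor_like:
  fixes g :: "'k::field lie_map"
  shows "g \<in> chev_torus D N \<Longrightarrow> tor_like g"
  unfolding chev_torus_def
proof (erule lp_generate_induct)
  fix x :: "'k lie_map" assume "x \<in> {hh r t | r t. r \<in> R \<and> t \<noteq> 0}"
  then show *: "tor_like x" using tor_like_h by blast
  show "bij x" "tor_like (inv\<^bsub>lie_perm\<^esub> x)" using bij_tor_like[OF *] tor_like_inv[OF *] .
qed (rule tor_like_id tor_like_comp; assumption?)+

lemma n_inverse:
  assumes r: "r \<in> R"
  shows "nn r t \<circ> nn r (- t) = id" "nn r (- t) \<circ> nn r t = id"
proof -
  have "- r \<in> R" using uminus_in_R[OF r] .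
  note X = X_inverse_apply[OF r] X_inverse_apply[OF this]
  show "nn r t \<circ> nn r (- t) = id" "nn r (- t) \<circ> nn r t = id"
    unfolding chev_n_def using X[of t] X[of "- t"] X(3,4)[of "inverse t"] by (auto simp: fun_eq_iff X)
qed

lemma bij_n: "r \<in> R \<Longrightarrow> bij (nn r t)"
  using n_inverse o_bij by blast

text \<open>The two traits of the monomial subgroup on which its intersection with the Borel
  subgroup depends.\<close>

definition mono :: "'k::field lie_map \<Rightarrow> bool" where
  "mono g \<longleftrightarrow> is_bmat Bs g \<and> (\<forall>s\<in>R. \<exists>s'\<in>R. \<exists>k. g (bvec (Eb s)) = scl k (bvec (Eb s'))) \<and>
     (\<forall>j<rk. \<forall>s\<in>R. g (bvec (Hb j)) (Eb s) = 0)"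

lemma mono_comp:
  assumes g: "mono g" and h: "mono h"
  shows "mono (g \<circ> h)"
  unfolding mono_def
proof (intro conjI ballI allI impI)
  have bg: "is_bmat Bs g" and bh: "is_bmat Bs h" using g h unfolding mono_def by auto
  show "is_bmat Bs (g \<circ> h)" using is_bmat_comp[OF finite_Bs bg bh] .
  fix s assume s: "s \<in> R"
  obtain s' k where s': "s' \<in> R" "h (bvec (Eb s)) = scl k (bvec (Eb s'))" using h s unfolding mono_def by blast
  obtain s'' k' where s'': "s'' \<in> R" "g (bvec (Eb s')) = scl k' (bvec (Eb s''))" using g s' unfolding mono_def by blast
  have "(g \<circ> h) (bvec (Eb s)) = scl (k * k') (bvec (Eb s''))"
    unfolding comp_apply s'(2) is_bmat_scl[OF bg] s''(2) by (simp add: fun_eq_iff)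
  then show "\<exists>s'\<in>R. \<exists>k. (g \<circ> h) (bvec (Eb s)) = scl k (bvec (Eb s'))" using s'' by blast
next
  fix j s assume j: "j < rk" and s: "s \<in> R"
  have bg: "is_bmat Bs g" and bh: "is_bmat Bs h" using g h unfolding mono_def by auto
  have "(g \<circ> h) (bvec (Hb j)) (Eb s) = (\<Sum>b\<in>Bs. h (bvec (Hb j)) b * g (bvec b) (Eb s))"
    using is_bmat_comp_bvec[OF finite_Bs bg bh] j s by simp
  also have "\<dots> = 0"
    using g h j s unfolding mono_def by (simp add: sum_Bs)
  finally show "(g \<circ> h) (bvec (Hb j)) (Eb s) = 0" .
qed

lemma mono_id: "mono id"
  unfolding mono_def using is_bmat_id[OF finite_Bs]
  by (auto simp: bvec_apply intro!: bexI exI[of _ 1])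

lemma mono_tor_like: "tor_like g \<Longrightarrow> mono g"
  unfolding mono_def tor_like_def using is_bmat_tor by (elim exE conjE) (simp add: tor_bvec bvec_apply, blast)

lemma mono_n:
  assumes r: "r \<in> R" and t: "t \<noteq> 0"
  shows "mono (nn r t)"
  unfolding mono_def
proof (intro conjI ballI allI impI is_bmat_n)
  fix s assume s: "s \<in> R"
  consider "s = r" | "s = - r" | "s \<noteq> r" "s \<noteq> - r" by blast
  then show "\<exists>s'\<in>R. \<exists>k. nn r t (bvec (Eb s)) = scl k (bvec (Eb s'))"
  proof cases
    case 3
    obtain n i \<rho> \<eta> where *: "n \<le> 3" "i \<le> n" "\<rho> i = s" "\<And>j. \<eta> j = 1 \<or> \<eta> j = -1"
      and \<rho>: "\<And>j. j \<le> n \<Longrightarrow> \<rho> j \<in> R \<and> \<rho> j \<noteq> r \<and> \<rho> j \<noteq> - r"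
      and up: "\<And>j t. j \<le> n \<Longrightarrow> X r t (xvec \<rho> \<eta> j) =
        (\<Sum>m\<le>n. scl (of_nat (m choose j) * t ^ (m - j)) (xvec \<rho> \<eta> m :: chev_idx \<Rightarrow> 'a))"
      and down: "\<And>j t. j \<le> n \<Longrightarrow> X (- r) t (xvec \<rho> \<eta> j) =
        (\<Sum>m\<le>n. scl (of_nat ((n - m) choose (n - j)) * t ^ (j - m)) (xvec \<rho> \<eta> m :: chev_idx \<Rightarrow> 'a))"
      by (rule string_vectors[OF r s 3, where 'k = 'a]) blast
    have ns: "nn r t (xvec \<rho> \<eta> i) = scl ((-1) ^ i * t powi (int n - 2 * int i)) (xvec \<rho> \<eta> (n - i))"
      by (rule n_string[OF t *(1,2) up down])
    have "nn r t (bvec (Eb s)) = scl (of_int (\<eta> i) * ((-1) ^ i * t powi (int n - 2 * int i)) * of_int (\<eta> (n - i))) (bvec (Eb (\<rho> (n - i))))"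
      unfolding *(3)[symmetric] bvec_xvec[of \<eta> i \<rho>, OF *(4)] n_linear ns
      by (simp add: fun_eq_iff xvec_def)
    then show ?thesis using \<rho>[of "n - i"] by (metis diff_le_self)
  qed (use r t n_self n_opposite uminus_in_R in blast)+
next
  fix j s assume "j < rk" "s \<in> R"
  then show "nn r t (bvec (Hb j)) (Eb s) = 0" using r t by (simp add: n_Hb hvec_apply bvec_apply)
qed

lemma monomial_mono:
  fixes g :: "'k::field lie_map"
  assumes "g \<in> chev_monomial D N"
  shows "mono g"
  using assms unfolding chev_monomial_def
proof (rule lp_generate_induct)
  fix x :: "'k lie_map" assume x: "x \<in> chev_torus D N \<union> {nn r 1 | r. r \<in> R}"
  then show "bij x" using bij_n bij_tor_like torus_tor_like by blast
  show "mono x" using x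
  proof
    assume "x \<in> {nn r 1 | r. r \<in> R}"
    then obtain r where r: "r \<in> R" "x = nn r 1" by blast
    show ?thesis unfolding r(2) by (rule mono_n[OF r(1)]) simp
  qed (rule mono_tor_like[OF torus_tor_like])
  show "mono (inv\<^bsub>lie_perm\<^esub> x)"
  proof (cases "x \<in> chev_torus D N")
    case True
    then show ?thesis using mono_tor_like tor_like_inv torus_tor_like by blast
  next
    case False
    then obtain r where r: "r \<in> R" "x = nn r 1" using x by blast
    have "inv\<^bsub>lie_perm\<^esub> x = nn r (- 1)"
      unfolding r(2) by (rule lp_inv[OF bij_n[OF r(1)] n_inverse[OF r(1)]])
    then show ?thesis using mono_n[OF r(1), of "-1"] by simp
  qed
qed (rule mono_id mono_comp; assumption?)+

lemma mono_uni_tor: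
  assumes g: "tri e (\<lambda>_. 1) g" and h: "tor_like h" and m: "mono (g \<circ> h)"
  shows "g = id"
proof (rule is_bmat_eqI[OF finite_Bs tri_bmat[OF g] is_bmat_id[OF finite_Bs]])
  fix a assume a: "a \<in> Bs"
  obtain c where c: "\<And>i. c i \<noteq> 0" "h = tor c" using h unfolding tor_like_def by blast
  have gh: "(g \<circ> h) (bvec b) = scl (wchi c b) (g (bvec b))" if "b \<in> Bs" for b
    using that by (simp add: c(2) tor_bvec is_bmat_scl[OF tri_bmat[OF g]])
  have w: "wchi c b \<noteq> 0" for b using wchi_nonzero c(1) by blast
  show "g (bvec a) = id (bvec a)"
  proof (cases a)
    case (Eb s)
    then have s: "s \<in> R" using a by simp
    obtain s' k where s': "s' \<in> R" "(g \<circ> h) (bvec (Eb s)) = scl k (bvec (Eb s'))" using m s unfolding mono_def by blast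
    have 1: "g (bvec a) a = 1" using tri_coef[OF g a a] by simp
    have eq: "wchi c a * g (bvec a) x = k * bvec (Eb s') x" for x
      using s'(2) gh[OF a] Eb by (auto simp: fun_eq_iff)
    have "Eb s' = a" using eq[of a] 1 w[of a] by (auto simp: bvec_apply split: if_splits)
    then have "k = wchi c a" using eq[of a] 1 by (simp add: bvec_apply)
    then show ?thesis using eq w[of a] \<open>Eb s' = a\<close> by (auto simp: fun_eq_iff)
  next
    case (Hb j)
    show ?thesis
    proof
      fix x
      show "g (bvec a) x = id (bvec a) x"
      proof (cases "x \<in> Bs")
        case True
        show ?thesis
        proof (cases x)
          case (Eb s)
          then have "(g \<circ> h) (bvec a) x = 0" using m True a Hb unfolding mono_def by auto
          then have "g (bvec a) x = 0" using gh[OF a] w[of a] by auto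
          then show ?thesis using Hb Eb by (simp add: bvec_apply)
        next
          case (Hb i)
          then show ?thesis using \<open>a = Hb j\<close> tri_coef[OF g a True] by (auto simp: wt_def bvec_apply)
        qed
      next
        case False
        then show ?thesis using is_bmat_outside[OF finite_Bs tri_bmat[OF g] a False] a by (auto simp: bvec_apply)
      qed
    qed
  qed
qed

section \<open>Unipotent subgroups and components at fundamental roots\<close>

lemma X_lp_inv: "r \<in> R \<Longrightarrow> inv\<^bsub>lie_perm\<^esub> (X r t) = X r (- t)"
  by (rule lp_inv) (use bij_X X_inverse in auto)

text \<open>The sign \<open>e\<close> treats U (e = 1) and V (e = -1) by the same proofs.\<close>

definition unip :: "int \<Rightarrow> 'k::field lie_map set" where
  "unip e = generate lie_perm {X r t | r t. r \<in> R \<and> e * ht r > 0}"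

lemma pos_roots_ht: "r \<in> pos_roots D \<longleftrightarrow> r \<in> R \<and> ht r > 0"
  using ht_pos[of r] ht_neg[of r] R_pos_neg by fastforce

lemma neg_roots_ht: "r \<in> neg_roots D \<longleftrightarrow> r \<in> R \<and> ht r < 0"
  using ht_pos[of r] ht_neg[of r] R_pos_neg by fastforce

lemma U_unip: "chev_U D N = unip 1"
  unfolding chev_U_def unip_def pos_roots_ht by simp

lemma V_unip: "chev_V D N = unip (-1)"
  unfolding chev_V_def unip_def neg_roots_ht by simp

lemma unip_subgroup: "subgroup (unip e) lie_perm"
  unfolding unip_def by (rule lp_generate_subgroup) (use bij_X in blast)

lemma X_in_unip: "r \<in> R \<Longrightarrow> e * ht r > 0 \<Longrightarrow> X r t \<in> unip e"
  unfolding unip_def by (rule generate.incl) blast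

lemma unip_tri:
  fixes g :: "'k::field lie_map"
  shows "g \<in> unip e \<Longrightarrow> tri e (\<lambda>_. 1) g"
  unfolding unip_def
proof (erule lp_generate_induct)
  fix x :: "'k lie_map" assume "x \<in> {X r t | r t. r \<in> R \<and> e * ht r > 0}"
  then obtain r t where x: "r \<in> R" "e * ht r > 0" "x = X r t" by blast
  show "bij x" "tri e (\<lambda>_. 1) x" "tri e (\<lambda>_. 1) (inv\<^bsub>lie_perm\<^esub> x)"
    unfolding x(3) X_lp_inv[OF x(1)] by (rule bij_X[OF x(1)] tri_X[OF x(1,2)])+
qed (rule tri_id tri_uni_comp; assumption?)+

definition sroot :: "int \<Rightarrow> nat \<Rightarrow> root" where
  "sroot e i = smul e (simple_root i)"

lemma sroot_1: "sroot 1 i = simple_root i" "sroot (-1) i = - simple_root i"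
  unfolding sroot_def by (auto simp: fun_eq_iff)

text \<open>The component at the i-th fundamental root, up to sign: x_r(t) sends e_{-r} to e_{-r} +
  t h_r - t^2 e_r, and the middle term is read off.\<close>

definition phi :: "int \<Rightarrow> nat \<Rightarrow> 'k::field lie_map \<Rightarrow> 'k" where
  "phi e i g = g (bvec (Eb (- sroot e i))) (Hb i)"

context
  fixes e :: int
  assumes e: "e = 1 \<or> e = -1"
begin

lemma sroot_R: "i < rk \<Longrightarrow> sroot e i \<in> R" "i < rk \<Longrightarrow> - sroot e i \<in> R"
  using e simple_in_R uminus_in_R by (auto simp: sroot_1)

lemma sroot_ht: "i < rk \<Longrightarrow> ht (sroot e i) = e"
  unfolding sroot_def by (simp add: ht_smul ht_simple)

lemma sroot_in_unip: "i < rk \<Longrightarrow> X (sroot e i) t \<in> unip e"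
  by (rule X_in_unip[OF sroot_R(1)]) (use e sroot_ht in auto)

text \<open>The two basis elements involved have consecutive heights -1 and 0 in the direction
  \<open>e\<close>, so nothing lies strictly between them and only two terms of the matrix product
  survive.\<close>

lemma phi_comp:
  assumes g: "tri e (\<lambda>_. 1) g" and h: "tri e (\<lambda>_. 1) h" and i: "i < rk"
  shows "phi e i (g \<circ> h) = phi e i g + phi e i h"
proof -
  let ?a = "Eb (- sroot e i)" and ?c = "Hb i"
  have a: "?a \<in> Bs" and c: "?c \<in> Bs" using i sroot_R by auto
  have wa: "e * wht ?a = -1" using e sroot_ht[OF i] by (auto simp: wt_def ht_minus)
  have wc: "wht ?c = 0" by (simp add: wt_def)
  have "phi e i (g \<circ> h) = (\<Sum>b\<in>Bs. h (bvec ?a) b * g (bvec b) ?c)"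
    unfolding phi_def by (rule is_bmat_comp_bvec[OF finite_Bs tri_bmat[OF g] tri_bmat[OF h] a c])
  also have "\<dots> = (\<Sum>b\<in>{?a, ?c}. h (bvec ?a) b * g (bvec b) ?c)"
  proof (rule sum.mono_neutral_right)
    show "\<forall>b\<in>Bs - {?a, ?c}. h (bvec ?a) b * g (bvec b) ?c = 0"
    proof
      fix b assume b: "b \<in> Bs - {?a, ?c}"
      have "h (bvec ?a) b = 0 \<or> g (bvec b) ?c = 0"
      proof (rule ccontr)
        assume "\<not> ?thesis"
        then have "e * wht ?a < e * wht b" "e * wht b < e * wht ?c"
          using tri_nonzero[OF h a, of b] tri_nonzero[OF g _ c, of b] b by auto
        then show False using wa wc by auto
      qed
      then show "h (bvec ?a) b * g (bvec b) ?c = 0" by auto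
    qed
  qed (use finite_Bs a c in auto)
  also have "\<dots> = phi e i g + phi e i h"
    using tri_coef[OF h a a] tri_coef[OF g c c] by (simp add: phi_def)
  finally show ?thesis .
qed

lemma phi_X:
  assumes r: "r \<in> R" and er: "e * ht r > 0" and i: "i < rk"
  shows "phi e i (X r t) = (if r = sroot e i then of_int e * t else 0)"
proof (cases "r = sroot e i")
  case True
  have "coroot_coeff D r i = e"
    using e True coroot_simple[OF i i] coroot_minus[OF simple_in_R[OF i] i] by (auto simp: sroot_1)
  then show ?thesis using True X_opposite[OF r, of t] i by (simp add: phi_def hvec_apply bvec_apply)
next
  case False
  have "phi e i (X r t) = 0"
  proof (rule ccontr)
    assume "phi e i (X r t) \<noteq> 0"
    then obtain k where k: "wt (Hb i) = wt (Eb (- sroot e i)) + smul (int k) r" "k = 0 \<longrightarrow> Hb i = Eb (- sroot e i)"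
      using X_coef_wt[of "Eb (- sroot e i)" "Hb i" r t] i sroot_R unfolding phi_def by auto
    then have *: "smul (int k) r = sroot e i" by (auto simp: wt_def fun_eq_iff)
    then have "int k * ht r = e" using sroot_ht[OF i] by (metis ht_smul)
    \<comment> \<open>Comparing heights, k times a positive integer is 1; so k = 1 and r would be
      the signed fundamental root itself.\<close>
    then have "int k * (e * ht r) = 1" using e by auto
    then have "int k = 1" by (auto simp: zmult_eq_1_iff)
    then show False using * False by (auto simp: fun_eq_iff)
  qed
  then show ?thesis using False by simp
qed

lemma phi_id: "i < rk \<Longrightarrow> phi e i id = 0"
  by (simp add: phi_def bvec_apply)

end

lemma chi_sroot:
  assumes "i < rk"
  shows "chi c (smul k (simple_root i)) = c i powi k"
proof -
  have "chi c (smul k (simple_root i)) = (\<Prod>j<rk. if j = i then c i powi k else 1)"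
    unfolding chi_def by (intro prod.cong refl) (simp add: simple_root_def)
  then show ?thesis using assms by simp
qed

text \<open>A matrix that commutes with a diagonal one has nonzero entries only between equal
  eigenvalues.\<close>

lemma tor_commute_coef:
  assumes g: "is_bmat Bs g" and com: "tor c \<circ> g = g \<circ> tor c" and ab: "a \<in> Bs" "b \<in> Bs" and nz: "g (bvec a) b \<noteq> 0"
  shows "wchi c a = wchi c b"
proof -
  have "tor c (g (bvec a)) b = wchi c b * g (bvec a) b"
    using ab unfolding tor_def wchi_def by (auto split: chev_idx.splits)
  moreover have "g (tor c (bvec a)) b = wchi c a * g (bvec a) b"
    using ab by (simp add: tor_bvec is_bmat_scl[OF g])
  ultimately show ?thesis using com nz by (metis comp_apply mult_cancel_right)
qed

lemma tor_commute_phi: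
  assumes e: "e = 1 \<or> e = -1" and g: "is_bmat Bs g" and com: "tor c \<circ> g = g \<circ> tor c"
    and i: "i < rk" and nz: "phi e i g \<noteq> 0" and c: "c i \<noteq> 0"
  shows "c i = 1"
proof -
  have "wchi c (Eb (- sroot e i)) = wchi c (Hb i)"
    using tor_commute_coef[OF g com _ _ nz[unfolded phi_def]] i sroot_R[OF e i]
    by (simp add: fun_Compl_def)
  then have "c i powi (- e) = 1"
    unfolding wchi_def using chi_sroot[OF i, of c "- e"] by (simp add: sroot_def uminus_root smul_def)
  then show ?thesis using e by (auto simp: power_int_minus)
qed

text \<open>Stated for subgroups of U, V and the torus, so that it covers untwisted and twisted
  groups alike. It reduces the theorem to the two elements \<open>u0\<close> and
  \<open>v0\<close>.\<close>

lemma lie_base: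
  fixes Gm :: "'k::{field,finite} lie_map monoid" and U' V' T' M' H :: "'k lie_map set"
  assumes simple: "simple_group Gm" and Gm: "Gm = lie_perm\<lparr>carrier := generate lie_perm (U' \<union> V')\<rparr>"
    and U: "subgroup U' lie_perm" "U' \<subseteq> unip 1" and V: "subgroup V' lie_perm" "V' \<subseteq> unip (-1)"
    and T: "subgroup T' lie_perm" "T' \<subseteq> chev_torus D N" "T' \<subseteq> carrier Gm"
    and M: "M' \<subseteq> chev_monomial D N" "T' \<subseteq> M'"
    and H: "H = (U' <#>\<^bsub>lie_perm\<^esub> T') \<inter> M'"
    and u0: "u0 \<in> U'" "\<And>h. h \<in> T' \<Longrightarrow> h \<circ> u0 = u0 \<circ> h \<Longrightarrow> h = id"
    and v0: "v0 \<in> V'" "\<And>h. h \<in> T' \<Longrightarrow> h \<circ> v0 = v0 \<circ> h \<Longrightarrow> h = id"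
  shows "base_number (rcosets\<^bsub>Gm\<^esub> H) (cartan_scheme Gm H) \<le> 2 \<and>
    (base_number (rcosets\<^bsub>Gm\<^esub> H) (cartan_scheme Gm H) = 1 \<longleftrightarrow> H = {\<one>\<^bsub>Gm\<^esub>})"
proof -
  let ?lp = "lie_perm :: 'k lie_map monoid"
  let ?K = "generate ?lp (U' \<union> V')"
  note bU = lp_subgroup_bij[OF U(1)] and bV = lp_subgroup_bij[OF V(1)] and bT = lp_subgroup_bij[OF T(1)]
  have HT: "H = T'"
  proof
    show "T' \<subseteq> H"
    proof
      fix t assume t: "t \<in> T'"
      have "t = id \<otimes>\<^bsub>?lp\<^esub> t" using bT[OF t] by (simp add: lp_mult)
      then have "t \<in> U' <#>\<^bsub>?lp\<^esub> T'" unfolding set_mult_def using lp_subgroup_id[OF U(1)] t by blast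
      then show "t \<in> H" unfolding H using M t by blast
    qed
    show "H \<subseteq> T'"
    proof
      fix h assume h: "h \<in> H"
      then obtain x t where xt: "x \<in> U'" "t \<in> T'" "h = x \<otimes>\<^bsub>?lp\<^esub> t" unfolding H set_mult_def by blast
      then have hc: "h = x \<circ> t" using lp_mult bU bT by blast
      have "x = id"
      proof (rule mono_uni_tor)
        show "tri 1 (\<lambda>_. 1) x" using unip_tri xt(1) U(2) by blast
        show "tor_like t" using torus_tor_like xt(2) T(2) by blast
        show "mono (x \<circ> t)" using monomial_mono h M(1) hc unfolding H by blast
      qed
      then show "h \<in> T'" using hc xt by simp
    qed
  qed
  have K: "subgroup ?K ?lp" using bU bV by (intro lp_generate_subgroup) blast
  have carr: "carrier Gm = ?K" unfolding Gm by simp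
  have mult: "x \<otimes>\<^bsub>Gm\<^esub> y = x \<otimes>\<^bsub>?lp\<^esub> y" for x y unfolding Gm by simp
  have one: "\<one>\<^bsub>Gm\<^esub> = id" unfolding Gm by (simp add: lp_one)
  have inv: "inv\<^bsub>Gm\<^esub> x = inv\<^bsub>?lp\<^esub> x" if "x \<in> ?K" for x
    unfolding Gm using group.m_inv_consistent[OF lp_group K that] by simp
  have bK: "bij x" if "x \<in> ?K" for x using lp_subgroup_bij[OF K that] .
  have sub: "subgroup S Gm" if S: "subgroup S ?lp" and le: "S \<subseteq> ?K" for S
    unfolding Gm using group.subgroup_incl[OF lp_group S K le] .
  have fin: "finite (carrier Gm)"
  proof (rule finite_subset[OF _ finite_is_bmat[OF finite_Bs]])
    have "is_bmat Bs g" if "g \<in> ?K" for g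
      using that
    proof (rule lp_generate_induct)
      fix x :: "'k lie_map" assume x: "x \<in> U' \<union> V'"
      then show "bij x" using bU bV by blast
      have "x \<in> unip 1 \<union> unip (-1)" using x U V by blast
      then show "is_bmat Bs x" using unip_tri tri_bmat by blast
      have "inv\<^bsub>?lp\<^esub> x \<in> U' \<union> V'" using x subgroup.m_inv_closed[OF U(1)] subgroup.m_inv_closed[OF V(1)] by blast
      then have "inv\<^bsub>?lp\<^esub> x \<in> unip 1 \<union> unip (-1)" using U V by blast
      then show "is_bmat Bs (inv\<^bsub>?lp\<^esub> x)" using unip_tri tri_bmat by blast
    qed (rule is_bmat_id[OF finite_Bs] is_bmat_comp[OF finite_Bs]; assumption?)+
    then show "carrier Gm \<subseteq> {g. is_bmat Bs g}" unfolding carr by blast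
  qed
  have gen_tri: "\<exists>\<chi>. tri e \<chi> g"
    if g: "g \<in> generate ?lp (W \<union> T')" and W: "subgroup W ?lp" "W \<subseteq> unip e" for W e g
    using g
  proof (rule lp_generate_induct)
    have *: "\<exists>\<chi>. tri e \<chi> x" if "x \<in> W \<union> T'" for x :: "'k lie_map"
    proof (cases "x \<in> W")
      case True
      then show ?thesis using unip_tri W(2) by blast
    next
      case False
      then have "tor_like x" using that torus_tor_like T(2) by blast
      then show ?thesis unfolding tor_like_def using tri_tor by blast
    qed
    fix x :: "'k lie_map" assume x: "x \<in> W \<union> T'"
    then show "bij x" using lp_subgroup_bij[OF W(1)] bT by blast
    show "\<exists>\<chi>. tri e \<chi> x" by (rule *[OF x])
    have "inv\<^bsub>?lp\<^esub> x \<in> W \<union> T'" using x subgroup.m_inv_closed[OF W(1)] subgroup.m_inv_closed[OF T(1)] by blast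
    then show "\<exists>\<chi>. tri e \<chi> (inv\<^bsub>?lp\<^esub> x)" by (rule *)
  next
    show "\<exists>\<chi>. tri e \<chi> id" using tri_id by blast
    fix x y :: "'k lie_map" assume "\<exists>\<chi>. tri e \<chi> x" "\<exists>\<chi>. tri e \<chi> y"
    then show "\<exists>\<chi>. tri e \<chi> (x \<circ> y)" using tri_comp by blast
  qed
  have TK: "T' \<subseteq> ?K" using T(3) unfolding carr .
  have UK: "U' \<subseteq> ?K" "V' \<subseteq> ?K" using generate.incl[of _ "U' \<union> V'" ?lp] by blast+
  have genK: "generate ?lp S \<subseteq> ?K" if "S \<subseteq> ?K" for S
    using group.generate_subgroup_incl[OF lp_group that K] .
  let ?P = "generate ?lp (U' \<union> T')" and ?Q = "generate ?lp (V' \<union> T')"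
  have sP: "subgroup ?P ?lp" using bU bT by (intro lp_generate_subgroup) blast
  have sQ: "subgroup ?Q ?lp" using bV bT by (intro lp_generate_subgroup) blast
  have PK: "?P \<subseteq> ?K" and QK: "?Q \<subseteq> ?K" using genK UK TK by (metis Un_least)+
  have inP: "x \<in> ?P" if "x \<in> U' \<union> T'" for x using generate.incl[OF that] .
  have inQ: "x \<in> ?Q" if "x \<in> V' \<union> T'" for x using generate.incl[OF that] .
  \<comment> \<open>The conjugate is triangular in direction \<open>e\<close> because it lies in the
    group generated by W' and T'. As a product of elements of W and h it is also triangular in the
    opposite direction, with the diagonal of h. Hence it equals h, and h commutes with x.\<close>
  have trivial: "h = \<one>\<^bsub>Gm\<^esub>"
    if h: "h \<in> T'" and w: "inv\<^bsub>Gm\<^esub> x \<otimes>\<^bsub>Gm\<^esub> h \<otimes>\<^bsub>Gm\<^esub> x \<in> generate ?lp (W' \<union> T')"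
      and x: "x \<in> W" and W: "subgroup W ?lp" "W \<subseteq> unip (- e)" "W \<subseteq> ?K"
      and W': "subgroup W' ?lp" "W' \<subseteq> unip e" and e: "e = 1 \<or> e = -1"
      and cent: "h \<circ> x = x \<circ> h \<Longrightarrow> h = id" for h x W W' e
  proof -
    have bx: "bij x" and bh: "bij h" using lp_subgroup_bij[OF W(1) x] bT[OF h] .
    note ix = lp_inv_bij[OF bx]
    have ixW: "inv\<^bsub>?lp\<^esub> x \<in> W" using subgroup.m_inv_closed[OF W(1) x] .
    let ?w = "inv\<^bsub>?lp\<^esub> x \<circ> h \<circ> x"
    have "inv\<^bsub>Gm\<^esub> x \<otimes>\<^bsub>Gm\<^esub> h \<otimes>\<^bsub>Gm\<^esub> x = ?w"
      unfolding mult inv[OF subsetD[OF W(3) x]] using ix bx bh by (simp add: lp_mult bij_comp)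
    then obtain \<chi> where tw: "tri e \<chi> ?w" using gen_tri[OF _ W'] w by auto
    obtain c where c: "\<And>i. c i \<noteq> 0" "h = tor c" using torus_tor_like T(2) h unfolding tor_like_def by blast
    have tw': "tri (- e) (wchi c) ?w"
      using tri_comp[OF tri_comp[OF unip_tri[OF subsetD[OF W(2) ixW]] tri_tor[of "- e" c]] unip_tri[OF subsetD[OF W(2) x]]]
      unfolding c(2) by simp
    have "?w = tor c" by (rule tri_both[OF tw tw' e])
    then have wh: "?w = h" unfolding c(2) .
    have "x \<circ> ?w = (x \<circ> inv\<^bsub>?lp\<^esub> x) \<circ> (h \<circ> x)" by (simp add: comp_assoc)
    then have "x \<circ> h = h \<circ> x" unfolding wh ix(2) by simp
    then show ?thesis using cent one by simp
  qed
  have base: "cc_base (rcosets\<^bsub>Gm\<^esub> H) (cartan_scheme Gm H) {H, H #>\<^bsub>Gm\<^esub> v0}"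
  proof (rule group.cartan_base_opposite[where P = ?P and Q = ?Q and g' = u0])
    interpret simple_group Gm by fact
    show "group Gm" by (rule is_group)
    show "generate Gm (?P \<union> ?Q) = carrier Gm"
    proof -
      have "generate Gm (?P \<union> ?Q) = generate ?lp (?P \<union> ?Q)"
        unfolding Gm using group.generate_consistent[OF lp_group _ K] PK QK by blast
      moreover have "generate ?lp (?P \<union> ?Q) \<subseteq> ?K" using genK PK QK by (metis Un_least)
      moreover have "?K \<subseteq> generate ?lp (?P \<union> ?Q)"
        using inP inQ by (intro group.mono_generate[OF lp_group]) blast
      ultimately show ?thesis unfolding carr by blast
    qed
    show "h = \<one>\<^bsub>Gm\<^esub>" if "h \<in> H" "inv\<^bsub>Gm\<^esub> v0 \<otimes>\<^bsub>Gm\<^esub> h \<otimes>\<^bsub>Gm\<^esub> v0 \<in> ?P" for h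
      by (rule trivial[of h v0 U' V' 1]) (use that HT v0 U V UK in auto)
    show "h = \<one>\<^bsub>Gm\<^esub>" if "h \<in> H" "inv\<^bsub>Gm\<^esub> u0 \<otimes>\<^bsub>Gm\<^esub> h \<otimes>\<^bsub>Gm\<^esub> u0 \<in> ?Q" for h
      by (rule trivial[of h u0 V' U' "-1"]) (use that HT u0 U V UK in auto)
    show "subgroup H Gm" unfolding HT by (rule sub[OF T(1) TK])
    show "subgroup ?P Gm" "subgroup ?Q Gm" by (rule sub[OF sP PK] sub[OF sQ QK])+
    show "H \<subseteq> ?P" "H \<subseteq> ?Q" "v0 \<in> ?Q" "u0 \<in> ?P" unfolding HT using inP inQ u0 v0 by blast+
  qed (rule fin)
  show ?thesis
    by (rule cartan_base_number[OF simple fin _ base]) (use sub[OF T(1) TK] HT in simp)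
qed

section \<open>Untwisted groups\<close>

lemma torus_subgroup: "subgroup (chev_torus D N) lie_perm"
  unfolding chev_torus_def by (rule lp_generate_subgroup) (use bij_tor_like tor_like_h in blast)

lemma torus_monomial: "chev_torus D N \<subseteq> chev_monomial D N"
  unfolding chev_monomial_def by (intro subsetI generate.incl UnI1)

lemma root_height_sign: "r \<in> R \<Longrightarrow> ht r > 0 \<or> ht r < 0"
  using R_pos_neg pos_roots_ht neg_roots_ht by blast

lemma chev_group_carrier: "carrier (chev_group D N) = generate lie_perm {X r t | r t. r \<in> R}"
  unfolding chev_group_def by simp

lemma chev_group_subgroup: "subgroup (carrier (chev_group D N)) lie_perm"
  unfolding chev_group_carrier by (rule lp_generate_subgroup) (use bij_X in blast)

lemma X_in_chev_group: "r \<in> R \<Longrightarrow> X r t \<in> carrier (chev_group D N)"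
  unfolding chev_group_carrier by (rule generate.incl) blast

lemma unip_chev_group: "unip e \<subseteq> carrier (chev_group D N)"
  unfolding unip_def
  by (rule group.generate_subgroup_incl[OF lp_group _ chev_group_subgroup]) (use X_in_chev_group in blast)

lemma n_in_chev_group: "r \<in> R \<Longrightarrow> nn r t \<in> carrier (chev_group D N)"
  unfolding chev_n_def
  by (intro lp_subgroup_comp[OF chev_group_subgroup] X_in_chev_group uminus_in_R)

lemma torus_chev_group: "chev_torus D N \<subseteq> carrier (chev_group D N)"
  unfolding chev_torus_def
proof (rule group.generate_subgroup_incl[OF lp_group _ chev_group_subgroup])
  show "{hh r t |r t. r \<in> R \<and> t \<noteq> 0} \<subseteq> carrier (chev_group D N)"
    unfolding chev_h_def using lp_subgroup_comp[OF chev_group_subgroup] n_in_chev_group by blast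
qed

lemma chev_group_eq_unip: "generate lie_perm (unip 1 \<union> unip (-1)) = carrier (chev_group D N)"
proof
  show "generate lie_perm (unip 1 \<union> unip (-1)) \<subseteq> carrier (chev_group D N)"
    by (rule group.generate_subgroup_incl[OF lp_group _ chev_group_subgroup]) (use unip_chev_group in blast)
  have "X r t \<in> unip 1 \<union> unip (-1)" if "r \<in> R" for r t
    using X_in_unip[OF that, of 1] X_in_unip[OF that, of "-1"] root_height_sign[OF that] by auto
  then show "carrier (chev_group D N) \<subseteq> generate lie_perm (unip 1 \<union> unip (-1))"
    unfolding chev_group_carrier by (intro group.mono_generate[OF lp_group]) blast
qed

lemma phi_regular:
  assumes e: "e = 1 \<or> e = -1" and g: "is_bmat Bs g" and nz: "\<And>i. i < rk \<Longrightarrow> phi e i g \<noteq> 0"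
    and h: "h \<in> chev_torus D N" and com: "h \<circ> g = g \<circ> h"
  shows "h = id"
proof -
  obtain c where c: "\<And>i. c i \<noteq> 0" "h = tor c" using torus_tor_like[OF h] unfolding tor_like_def by blast
  have "c i = 1" if "i < rk" for i
    by (rule tor_commute_phi[OF e g _ that nz[OF that] c(1)]) (use com c in simp)
  then show ?thesis using tor_one c(2) by blast
qed

text \<open>The product of the elements with parameter 1 at all fundamental roots, or at their
  negatives: components add up, and each factor contributes to one of them.\<close>

lemma untwisted_regular:
  assumes e: "e = 1 \<or> e = -1"
  shows "\<exists>g\<in>unip e. \<forall>i<rk. phi e i g = (of_int e :: 'k::field)"
proof -
  have "m \<le> rk \<Longrightarrow> \<exists>g\<in>unip e. \<forall>i<rk. phi e i g = (if i < m then of_int e else 0 :: 'k)" for m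
  proof (induction m)
    case 0
    show ?case
    proof (rule bexI[of _ id], intro allI impI)
      fix i assume "i < rk"
      then show "phi e i id = (if i < 0 then of_int e else 0 :: 'k)" unfolding phi_id[OF e \<open>i < rk\<close>] by simp
    qed (rule lp_subgroup_id[OF unip_subgroup])
  next
    case (Suc m)
    then obtain g where g: "g \<in> unip e" "\<forall>i<rk. phi e i g = (if i < m then of_int e else 0 :: 'k)" by auto
    let ?x = "X (sroot e m) 1"
    have x: "?x \<in> unip e" by (rule sroot_in_unip[OF e]) (use Suc in simp)
    have "phi e i (?x \<circ> g) = (if i < Suc m then of_int e else 0)" if i: "i < rk" for i
    proof -
      have "e * ht (sroot e m) > 0" using sroot_ht[OF e, of m] Suc e by auto
      moreover have "sroot e m = sroot e i \<longleftrightarrow> m = i"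
        unfolding sroot_def simple_root_def using e by (auto simp: fun_eq_iff)
      moreover have "sroot e m \<in> R" using sroot_R(1)[OF e] Suc by simp
      ultimately have "phi e i ?x = (if m = i then of_int e else 0)" by (subst phi_X[OF e _ _ i]) simp_all
      then show ?thesis
        unfolding phi_comp[OF e unip_tri[OF x] unip_tri[OF g(1)] i] using g(2) i by (auto simp: less_Suc_eq)
    qed
    then show ?case using lp_subgroup_comp[OF unip_subgroup x g(1)] by blast
  qed
  from this[of rk] show ?thesis by auto
qed

lemma lie_base_untwisted:
  assumes simple: "simple_group (chev_group D N :: 'k::{field,finite} lie_map monoid)"
    and H: "H = chev_borel D N \<inter> chev_monomial D N"
  shows "base_number (rcosets\<^bsub>chev_group D N\<^esub> H) (cartan_scheme (chev_group D N) H) \<le> 2 \<and>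
    (base_number (rcosets\<^bsub>chev_group D N\<^esub> H) (cartan_scheme (chev_group D N) H) = 1 \<longleftrightarrow>
      H = {\<one>\<^bsub>chev_group D N :: 'k lie_map monoid\<^esub>})"
proof -
  obtain u0 where u0: "u0 \<in> unip 1" "\<forall>i<rk. phi 1 i u0 = (of_int 1 :: 'k)" using untwisted_regular[of 1] by blast
  obtain v0 where v0: "v0 \<in> unip (-1)" "\<forall>i<rk. phi (-1) i v0 = (of_int (-1) :: 'k)" using untwisted_regular[of "-1"] by blast
  show ?thesis
  proof (rule lie_base[OF simple _ unip_subgroup _ unip_subgroup _ torus_subgroup _ torus_chev_group order_refl torus_monomial _ u0(1) _ v0(1)])
    show "chev_group D N = lie_perm\<lparr>carrier := generate lie_perm (unip 1 \<union> unip (-1))\<rparr>"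
      unfolding chev_group_eq_unip unfolding chev_group_def by simp
    show "H = (unip 1 <#>\<^bsub>lie_perm\<^esub> chev_torus D N) \<inter> chev_monomial D N"
      unfolding H chev_borel_def U_unip ..
    show "h = id" if "h \<in> chev_torus D N" "h \<circ> u0 = u0 \<circ> h" for h
      by (rule phi_regular[of 1, OF _ tri_bmat[OF unip_tri[OF u0(1)]] _ that]) (use u0 in auto)
    show "h = id" if "h \<in> chev_torus D N" "h \<circ> v0 = v0 \<circ> h" for h
      by (rule phi_regular[of "-1", OF _ tri_bmat[OF unip_tri[OF v0(1)]] _ that]) (use v0 in auto)
  qed auto
qed

end

section \<open>Commutator relations\<close>

text \<open>A type of linear endomorphisms, so that they form a ring in which polynomial identities
  can be computed. The rationals are the scalars because exponentials divide by factorials.\<close>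

typedef 'i endo = "{f :: ('i \<Rightarrow> rat) \<Rightarrow> 'i \<Rightarrow> rat. (\<forall>v w. f (v + w) = f v + f w) \<and> (\<forall>k v. f (scl k v) = scl k (f v))}"
  by (rule exI[of _ id]) simp

setup_lifting type_definition_endo

instantiation endo :: (type) ring_1
begin

lift_definition zero_endo :: "'a endo" is "\<lambda>_. 0" by (simp add: fun_eq_iff)
lift_definition one_endo :: "'a endo" is "\<lambda>v. v" by simp
lift_definition plus_endo :: "'a endo \<Rightarrow> 'a endo \<Rightarrow> 'a endo" is "\<lambda>f g v. f v + g v"
  by (simp add: fun_eq_iff algebra_simps)
lift_definition uminus_endo :: "'a endo \<Rightarrow> 'a endo" is "\<lambda>f v. - f v" by (simp add: fun_eq_iff)
lift_definition minus_endo :: "'a endo \<Rightarrow> 'a endo \<Rightarrow> 'a endo" is "\<lambda>f g v. f v - g v"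
  by (simp add: fun_eq_iff algebra_simps)
lift_definition times_endo :: "'a endo \<Rightarrow> 'a endo \<Rightarrow> 'a endo" is "\<lambda>f g v. f (g v)" by simp

instance
proof
  fix a b c :: "'a endo"
  show "a + b + c = a + (b + c)" by transfer (simp add: fun_eq_iff)
  show "a + b = b + a" by transfer (simp add: fun_eq_iff)
  show "0 + a = a" by transfer (simp add: fun_eq_iff)
  show "- a + a = 0" by transfer (simp add: fun_eq_iff)
  show "a - b = a + - b" by transfer (simp add: fun_eq_iff)
  show "a * b * c = a * (b * c)" by transfer simp
  show "1 * a = a" "a * 1 = a" by (transfer; simp)+
  show "(a + b) * c = a * c + b * c" by transfer (simp add: fun_eq_iff)
  show "a * (b + c) = a * b + a * c" by transfer (simp add: fun_eq_iff)
  show "0 \<noteq> (1 :: 'a endo)" by transfer (simp add: fun_eq_iff, rule exI[of _ "\<lambda>_. 1"], simp)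
qed

end

lift_definition qs :: "rat \<Rightarrow> 'i endo" is scl by (simp add: fun_eq_iff algebra_simps)

lemma qs_add: "qs (x + y) = qs x + qs y"
  by transfer (simp add: fun_eq_iff algebra_simps)

lemma qs_mult: "qs (x * y) = qs x * qs y"
  by transfer (simp add: fun_eq_iff algebra_simps)

lemma qs_one: "qs 1 = 1"
  by transfer (simp add: fun_eq_iff)

lemma qs_zero: "qs 0 = 0"
  by transfer (simp add: fun_eq_iff)

lemma qs_central: "A * qs x = qs x * A"
  by transfer (simp add: fun_eq_iff)

lemma qs_central_left: "A * (qs x * B) = qs x * (A * B)"
  by (metis mult.assoc qs_central)

lemma qs_of_nat: "qs (of_nat n) = of_nat n"
  by (induction n) (simp_all add: qs_zero qs_add qs_one)

lemma qs_cancel: "x \<noteq> 0 \<Longrightarrow> qs x * A = qs x * B \<Longrightarrow> A = B"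
proof -
  assume x: "x \<noteq> 0" and eq: "qs x * A = qs x * B"
  have "qs (inverse x) * (qs x * A) = qs (inverse x) * (qs x * B)" using eq by simp
  then show ?thesis using x by (simp add: mult.assoc[symmetric] qs_mult[symmetric] qs_one)
qed

definition dp :: "'i endo \<Rightarrow> nat \<Rightarrow> 'i endo" where
  "dp A k = qs (1 / fact k) * A ^ k"

definition expn :: "nat \<Rightarrow> 'i endo \<Rightarrow> 'i endo" where
  "expn K A = (\<Sum>k<K. dp A k)"

lemma dp_Suc: "qs (of_nat (Suc k)) * dp A (Suc k) = A * dp A k"
proof -
  have "qs (of_nat (Suc k)) * dp A (Suc k) = qs (of_nat (Suc k) * (1 / fact (Suc k))) * (A * A ^ k)"
    by (simp only: dp_def power_Suc qs_mult mult.assoc)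
  also have "of_nat (Suc k) * (1 / fact (Suc k)) = (1 / fact k :: rat)" by (simp add: fact_Suc del: of_nat_Suc)
  also have "qs (1 / fact k) * (A * A ^ k) = A * dp A k" by (simp only: dp_def qs_central_left)
  finally show ?thesis .
qed

lemma commute_power:
  fixes A B :: "'a::ring_1"
  assumes "A * B = B * A"
  shows "A ^ k * B = B * A ^ k"
  by (induction k) (simp_all add: mult.assoc, metis assms mult.assoc)

lemma commute_dp: "A * B = B * A \<Longrightarrow> dp A k * B = B * dp A k"
  unfolding dp_def by (simp add: mult.assoc commute_power qs_central_left)

text \<open>The binomial theorem for divided powers. Multiplied by m + 1, each summand splits into i
  and m + 1 - i, which raise the left and the right factor respectively.\<close>

lemma dp_add:
  assumes c: "A * B = B * A"
  shows "dp (A + B) m = (\<Sum>i\<le>m. dp A i * dp B (m - i))"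
proof (induction m)
  case 0
  show ?case by (simp add: dp_def qs_one)
next
  case (Suc m)
  have "qs (of_nat (Suc m)) * dp (A + B) (Suc m) = (A + B) * (\<Sum>i\<le>m. dp A i * dp B (m - i))"
    unfolding dp_Suc Suc.IH ..
  also have "\<dots> = (\<Sum>i\<le>m. (A * dp A i) * dp B (m - i)) + (\<Sum>i\<le>m. dp A i * (B * dp B (m - i)))"
    using commute_dp[OF c] by (simp add: sum_distrib_left distrib_right mult.assoc sum.distrib) (metis mult.assoc)
  also have "\<dots> = (\<Sum>i\<le>m. qs (of_nat (Suc i)) * dp A (Suc i) * dp B (m - i)) +
      (\<Sum>i\<le>m. qs (of_nat (Suc m - i)) * dp A i * dp B (Suc m - i))"
    by (intro arg_cong2[where f = "(+)"] sum.cong refl)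
      (simp_all only: dp_Suc[symmetric] Suc_diff_le atMost_iff qs_central_left mult.assoc)
  also have "\<dots> = (\<Sum>i\<le>Suc m. qs (of_nat i) * dp A i * dp B (Suc m - i)) +
      (\<Sum>i\<le>Suc m. qs (of_nat (Suc m - i)) * dp A i * dp B (Suc m - i))"
  proof -
    have "(\<Sum>i\<le>Suc m. qs (of_nat i) * dp A i * dp B (Suc m - i)) =
        (\<Sum>i\<le>m. qs (of_nat (Suc i)) * dp A (Suc i) * dp B (m - i))"
      unfolding sum.atMost_Suc_shift by (simp add: qs_zero)
    moreover have "(\<Sum>i\<le>Suc m. qs (of_nat (Suc m - i)) * dp A i * dp B (Suc m - i)) =
        (\<Sum>i\<le>m. qs (of_nat (Suc m - i)) * dp A i * dp B (Suc m - i))"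
      unfolding sum.atMost_Suc by (simp add: qs_zero)
    ultimately show ?thesis by (simp only:)
  qed
  also have "\<dots> = (\<Sum>i\<le>Suc m. (qs (of_nat i) + qs (of_nat (Suc m - i))) * (dp A i * dp B (Suc m - i)))"
    by (simp add: sum.distrib distrib_right mult.assoc)
  also have "\<dots> = (\<Sum>i\<le>Suc m. qs (of_nat (Suc m)) * (dp A i * dp B (Suc m - i)))"
    by (intro sum.cong refl) (simp add: qs_add[symmetric] of_nat_diff del: of_nat_Suc)
  finally have "qs (of_nat (Suc m)) * dp (A + B) (Suc m) =
      qs (of_nat (Suc m)) * (\<Sum>i\<le>Suc m. dp A i * dp B (Suc m - i))"
    unfolding sum_distrib_left .
  then show ?case by (rule qs_cancel[rotated]) (simp del: of_nat_Suc)
qed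

lemma dp_vanish: "A ^ K = 0 \<Longrightarrow> K \<le> k \<Longrightarrow> dp A k = 0"
  unfolding dp_def by (metis le_add_diff_inverse mult_zero_left mult_zero_right power_add)

lemma expn_mono: "A ^ K = 0 \<Longrightarrow> K \<le> K' \<Longrightarrow> expn K' A = expn K A"
  unfolding expn_def by (intro sum.mono_neutral_right) (auto simp: dp_vanish)

text \<open>Of the triangle i + j < K + L only the box i < K, j < L contributes, as all other
  products contain a vanishing power.\<close>

lemma expn_add:
  assumes c: "A * B = B * A" and A: "A ^ K = 0" and B: "B ^ L = 0"
  shows "expn (K + L) (A + B) = expn K A * expn L B" and "(A + B) ^ (K + L) = 0"
proof -
  have "expn K A * expn L B = (\<Sum>(i, j)\<in>{..<K} \<times> {..<L}. dp A i * dp B j)"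
    unfolding expn_def by (simp add: sum_product sum.cartesian_product)
  also have "\<dots> = (\<Sum>(i, j)\<in>{(i, j). i + j < K + L}. dp A i * dp B j)"
  proof (rule sum.mono_neutral_left)
    show "finite {(i, j). i + j < K + L}" 
      by (rule finite_subset[of _ "{..K + L} \<times> {..K + L}"]) auto
    show "\<forall>i\<in>{(i, j). i + j < K + L} - {..<K} \<times> {..<L}. (case i of (i, j) \<Rightarrow> dp A i * dp B j) = 0"
    proof
      fix p assume p: "p \<in> {(i, j). i + j < K + L} - {..<K} \<times> {..<L}"
      show "(case p of (i, j) \<Rightarrow> dp A i * dp B j) = 0"
      proof (cases "K \<le> fst p")
        case True
        then show ?thesis using dp_vanish[OF A, of "fst p"] by (simp add: split_def)
      next
        case False
        then show ?thesis using dp_vanish[OF B, of "snd p"] p by (cases p) auto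
      qed
    qed
  qed auto
  also have "\<dots> = (\<Sum>m<K + L. \<Sum>i\<le>m. dp A i * dp B (m - i))"
    by (rule sum.triangle_reindex)
  finally show "expn (K + L) (A + B) = expn K A * expn L B"
    unfolding expn_def dp_add[OF c] by simp
  have "dp (A + B) (K + L) = 0"
    unfolding dp_add[OF c]
  proof (intro sum.neutral ballI)
    fix i assume "i \<in> {..K + L}"
    then have "K \<le> i \<or> L \<le> K + L - i" by auto
    then show "dp A i * dp B (K + L - i) = 0" using dp_vanish[OF A] dp_vanish[OF B] by auto
  qed
  then have "qs (fact (K + L)) * (qs (1 / fact (K + L)) * (A + B) ^ (K + L)) = 0" unfolding dp_def by simp
  then show "(A + B) ^ (K + L) = 0" by (simp add: mult.assoc[symmetric] qs_mult[symmetric] qs_one)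
qed

lemma expn_inverse: "A ^ K = 0 \<Longrightarrow> expn K A * expn K (- A) = 1"
proof -
  assume A: "A ^ K = 0"
  then have A': "(- A) ^ K = 0" by (metis mult_zero_right power_minus)
  have "expn K A * expn K (- A) = expn (K + K) (A + - A)"
    by (rule expn_add(1)[symmetric]) (use A A' in auto)
  also have "\<dots> = dp 0 0" if "K > 0"
    unfolding expn_def using that by (simp add: lessThan_Suc_eq_insert_0[symmetric] dp_def
      sum.mono_neutral_right[of "{..<K + K}" "{0}"] power_0_left)
  finally show ?thesis using A by (cases "K = 0") (auto simp: dp_def qs_one)
qed

text \<open>Conjugating B by exp A gives B + C + D, since the repeated commutators of A with B are
  C, 2D and 0; the exponential of this sum of commuting terms then factors. Setting D = 0, or C = D
  = 0, gives the Heisenberg and the commuting case.\<close>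

lemma expn_commutator:
  fixes A B C D :: "'a endo"
  assumes C: "A * B = B * A + C" and D: "A * C = C * A + 2 * D" and AD: "A * D = D * A"
    and BC: "B * C = C * B" and BD: "B * D = D * B" and CD: "C * D = D * C"
    and A4: "A ^ 4 = 0" and B4: "B ^ 4 = 0" and C4: "C ^ 4 = 0" and D4: "D ^ 4 = 0"
  shows "expn 4 A * expn 4 B = expn 4 B * expn 4 C * expn 4 D * expn 4 A"
proof -
  let ?E = "expn 4 A" and ?S = "B + C + D"
  have pow: "A ^ k * B = B * A ^ k + of_nat k * (C * A ^ (k - 1)) + of_nat (k * (k - 1)) * (D * A ^ (k - 2))" for k
  proof (induction k)
    case (Suc k)
    have step: "A * (C * Z) = C * (A * Z) + 2 * (D * Z)" "A * (D * Z) = D * (A * Z)" "A * (B * Z) = B * (A * Z) + C * Z" for Z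
      using C D AD by (metis distrib_right mult.assoc)+
    have n: "A * (of_nat m * Z) = of_nat m * (A * Z)" for m Z
      by (metis mult.assoc mult_of_nat_commute)
    have s1: "of_nat k * (C * A ^ Suc (k - 1)) = of_nat k * (C * A ^ k)" by (cases k) auto
    have s2: "of_nat (k * (k - 1)) * (D * A ^ Suc (k - 2)) = of_nat (k * (k - 1)) * (D * A ^ (k - 1))"
      by (cases k; cases "k - 1") auto
    have "A ^ Suc k * B = A * (B * A ^ k + of_nat k * (C * A ^ (k - 1)) + of_nat (k * (k - 1)) * (D * A ^ (k - 2)))"
      using Suc by (simp add: mult.assoc)
    also have "\<dots> = B * A ^ Suc k + C * A ^ k + of_nat k * (C * A ^ Suc (k - 1)) + of_nat k * (2 * (D * A ^ (k - 1)))
        + of_nat (k * (k - 1)) * (D * A ^ Suc (k - 2))"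
      by (simp add: distrib_left step n add.assoc del: of_nat_mult)
    also have "\<dots> = B * A ^ Suc k + (of_nat k + 1) * (C * A ^ k) + (of_nat k * 2 + of_nat (k * (k - 1))) * (D * A ^ (k - 1))"
      unfolding s1 s2 by (simp add: distrib_right mult.assoc add.assoc add.commute add.left_commute)
    also have "of_nat k * 2 + of_nat (k * (k - 1)) = (of_nat (Suc k * k) :: 'a endo)"
      by (cases k) (simp_all add: algebra_simps mult_2_right flip: one_add_one)
    finally show ?case by (simp add: add.commute del: of_nat_mult)
  qed simp
  \<comment> \<open>Truncation leaves boundary terms in \<open>EB\<close> that must vanish. They do
    because A^4 B and A^5 B are zero, by the formula \<open>pow\<close> for k = 4 and k = 5 after
    division by integers.\<close>
  have z1: "4 * (C * A ^ 3) + 12 * (D * A ^ 2) = 0" using pow[of 4] A4 by simp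
  have "A ^ 5 = 0" using A4 by (metis mult_zero_right power_Suc numeral_eq_Suc pred_numeral_simps(3) eval_nat_numeral(3))
  then have "20 * (D * A ^ 3) = 0" using pow[of 5] A4 by simp
  moreover have q: "qs (numeral k) = (numeral k :: 'a endo)" for k using qs_of_nat[of "numeral k"] by simp
  ultimately have "qs 20 * (D * A ^ 3) = qs 20 * 0" by (simp only: q mult_zero_right)
  then have z2: "D * A ^ 3 = 0" by (rule qs_cancel[rotated]) simp
  have z3: "qs (1 / 6) * (C * A ^ 3) + qs (1 / 2) * (D * A ^ 2) = 0"
  proof -
    have "qs 24 * (qs (1 / 6) * (C * A ^ 3) + qs (1 / 2) * (D * A ^ 2)) = qs 24 * 0"
      using z1 by (simp add: distrib_left mult.assoc[symmetric] qs_mult[symmetric] flip: q)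
    then show ?thesis by (rule qs_cancel[rotated]) simp
  qed
  have Eexp: "?E = 1 + A + qs (1 / 2) * A ^ 2 + qs (1 / 6) * A ^ 3"
    unfolding expn_def dp_def by (simp add: eval_nat_numeral qs_one)
  have EB: "?E * B = ?S * ?E"
  proof -
    have "?E * B = B * ?E + (C + qs 1 * (C * A) + qs (1 / 2) * (C * A ^ 2)) + (D + D * A)"
    proof -
      have "qs (1 / 2) * (A ^ 2 * B) = qs (1 / 2) * (B * A ^ 2) + C * A + D"
        unfolding pow[of 2] 
        by (simp add: distrib_left mult.assoc[symmetric] qs_mult[symmetric] qs_one flip: q)
      moreover have "qs (1 / 6) * (A ^ 3 * B) = qs (1 / 6) * (B * A ^ 3) + qs (1 / 2) * (C * A ^ 2) + D * A"
        unfolding pow[of 3] 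
        by (simp add: distrib_left mult.assoc[symmetric] qs_mult[symmetric] qs_one flip: q)
      ultimately show ?thesis
        unfolding Eexp using C by (simp add: distrib_left distrib_right mult.assoc qs_central_left qs_one algebra_simps)
    qed
    also have "\<dots> = ?S * ?E - (qs (1 / 6) * (C * A ^ 3) + qs (1 / 2) * (D * A ^ 2)) - qs (1 / 6) * (D * A ^ 3)"
      unfolding Eexp by (simp add: distrib_left distrib_right qs_central_left qs_one algebra_simps)
    also have "\<dots> = ?S * ?E" unfolding z3 z2 by simp
    finally show ?thesis .
  qed
  have EBk: "?E * B ^ k = ?S ^ k * ?E" for k
  proof (induction k)
    case (Suc k)
    have "?E * B ^ Suc k = (?E * B) * B ^ k" by (simp add: mult.assoc)
    also have "\<dots> = ?S * (?E * B ^ k)" unfolding EB by (simp add: mult.assoc)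
    finally show ?case unfolding Suc by (simp add: mult.assoc)
  qed simp
  \<comment> \<open>Nilpotency of B passes to its conjugate, so the exponential of B + C + D may be
    cut off at 4 as well.\<close>
  have "?S ^ 4 * ?E * expn 4 (- A) = 0" unfolding EBk[symmetric] B4 by simp
  then have S4: "?S ^ 4 = 0" by (simp add: mult.assoc expn_inverse[OF A4])
  have "?E * expn 4 B = expn 4 ?S * ?E"
    unfolding expn_def[of 4 B] expn_def[of 4 ?S] sum_distrib_left sum_distrib_right
    by (intro sum.cong refl) (simp add: dp_def qs_central_left EBk mult.assoc)
  moreover have "expn 4 ?S = expn 4 B * expn 4 C * expn 4 D"
  proof -
    have c: "(B + C) * D = D * (B + C)" using BD CD by (simp add: distrib_left distrib_right)
    \<comment> \<open>\<open>expn_add\<close> adds nilpotency exponents, hence the detour through 8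
      and 12 before cutting back to 4.\<close>
    have "expn 12 ?S = expn 8 (B + C) * expn 4 D"
      using expn_add(1)[OF c, of 8 4] expn_add(2)[OF BC B4 C4] D4 by simp
    also have "expn 8 (B + C) = expn 4 B * expn 4 C" using expn_add(1)[OF BC B4 C4] by simp
    also have "expn 12 ?S = expn 4 ?S" using expn_mono[OF S4, of 12] by simp
    finally show ?thesis .
  qed
  ultimately show ?thesis by simp
qed

section \<open>Root elements as exponentials over the rationals\<close>

text \<open>In contrast to \<open>bmat\<close> this is zero off \<open>X\<close>: it is to be
  exponentiated, and its exponential is the identity there.\<close>

lift_definition mE :: "'i set \<Rightarrow> ('i \<Rightarrow> 'i \<Rightarrow> int) \<Rightarrow> 'i endo" is
  "\<lambda>X m v c. if c \<in> X then \<Sum>a\<in>X. of_int (m a c) * v a else 0"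
  by (auto simp: fun_eq_iff algebra_simps sum.distrib sum_distrib_left)

lemma mE_cong: "(\<And>a c. a \<in> X \<Longrightarrow> c \<in> X \<Longrightarrow> m a c = m' a c) \<Longrightarrow> mE X m = mE X m'"
  by transfer (auto simp: fun_eq_iff intro!: sum.cong)

lemma mE_add: "mE X m + mE X m' = mE X (\<lambda>a c. m a c + m' a c)"
  by transfer (simp add: fun_eq_iff algebra_simps sum.distrib)

lemma mE_zero: "mE X (\<lambda>a c. 0) = 0"
  by transfer (simp add: fun_eq_iff)

lemma mE_scale: "qs (of_int n) * mE X m = mE X (\<lambda>a c. n * m a c)"
  by transfer (simp add: fun_eq_iff sum_distrib_left mult.assoc)

lemma mE_mult: "finite X \<Longrightarrow> mE X m * mE X m' = mE X (\<lambda>a c. \<Sum>b\<in>X. m' a b * m b c)"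
proof transfer
  fix X :: "'i set" and m m' :: "'i \<Rightarrow> 'i \<Rightarrow> int" assume X: "finite X"
  show "(\<lambda>v c. if c \<in> X then \<Sum>a\<in>X. rat_of_int (m a c) *
            (if a \<in> X then \<Sum>b\<in>X. rat_of_int (m' b a) * v b else 0) else 0) =
     (\<lambda>v c. if c \<in> X then \<Sum>a\<in>X. rat_of_int (\<Sum>b\<in>X. m' a b * m b c) * v a else 0)"
  proof (intro ext)
    fix v :: "'i \<Rightarrow> rat" and c
    have "(\<Sum>b\<in>X. rat_of_int (m b c) * (\<Sum>a\<in>X. rat_of_int (m' a b) * v a)) =
        (\<Sum>b\<in>X. \<Sum>a\<in>X. rat_of_int (m' a b * m b c) * v a)"
      by (simp add: sum_distrib_left algebra_simps)
    also have "\<dots> = (\<Sum>a\<in>X. \<Sum>b\<in>X. rat_of_int (m' a b * m b c) * v a)" by (rule sum.swap)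
    also have "\<dots> = (\<Sum>a\<in>X. rat_of_int (\<Sum>b\<in>X. m' a b * m b c) * v a)"
      by (simp add: sum_distrib_right)
    finally show "(if c \<in> X then \<Sum>a\<in>X. rat_of_int (m a c) *
            (if a \<in> X then \<Sum>b\<in>X. rat_of_int (m' b a) * v b else 0) else 0) =
      (if c \<in> X then \<Sum>a\<in>X. rat_of_int (\<Sum>b\<in>X. m' a b * m b c) * v a else 0)"
      by simp
  qed
qed

context chevalley begin

definition adE :: "root \<Rightarrow> chev_idx endo" where
  "adE r = mE Bs (lie (Eb r))"

text \<open>The power 0 is excluded because the unit does not vanish off the basis.\<close>

lemma adE_power:
  assumes "k > 0"
  shows "adE r ^ k = mE Bs (ad_power D N r k)"
  using assms
proof (induction k)
  case (Suc k)
  show ?case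
  proof (cases "k = 0")
    case True
    have "mE Bs (lie (Eb r)) = mE Bs (ad_power D N r (Suc 0))"
      by (rule mE_cong) (rule ad_power_one[symmetric])
    then show ?thesis unfolding True adE_def by (simp del: ad_power.simps)
  next
    case False
    then have "adE r ^ Suc k = adE r * mE Bs (ad_power D N r k)" using Suc by simp
    also have "\<dots> = mE Bs (ad_power D N r (Suc k))"
      unfolding adE_def mE_mult[OF finite_Bs] by (rule mE_cong) simp
    finally show ?thesis .
  qed
qed simp

lemma ad_power_exact:
  assumes r: "r \<in> R" and a: "a \<in> Bs"
  shows "ad_power D N r k a c = fact k * dpow r k a c" and "k \<ge> 4 \<Longrightarrow> ad_power D N r k a c = 0"
proof -
  have "ad_power D N r k a c = fact k * dpow r k a c \<and> (k \<ge> 4 \<longrightarrow> ad_power D N r k a c = 0)"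
    using a r
  proof (cases rule: Bs_cases)
    case (H j)
    then show ?thesis unfolding dpow_def H(2) ad_power_Hb[OF r H(1)] by auto
  next
    case self
    then show ?thesis unfolding dpow_def self ad_power_self[OF r] by auto
  next
    case opp
    then show ?thesis unfolding dpow_def opp ad_power_opposite[OF r] by (auto split: chev_idx.split)
  next
    case (string s)
    obtain n i \<rho> and \<eta> :: "nat \<Rightarrow> int" where *: "n \<le> 3" "i \<le> n" "\<rho> i = s"
      "\<And>j. \<eta> j = 1 \<or> \<eta> j = -1" "chain r \<rho> n"
      "\<And>j. j < n \<Longrightarrow> N r (\<rho> j) = \<eta> j * \<eta> (Suc j) * (int j + 1)"
      by (rule root_string_chain[OF r string(1-3)]) blast
    have "ad_power D N r k (Eb (\<rho> i)) c = fact k * dpow r k (Eb (\<rho> i)) c"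
      by (rule chain_dpow(1)[OF *(5,2,4,6)])
    moreover have "ad_power D N r k (Eb (\<rho> i)) c = 0" if "k \<ge> 4"
      unfolding chain_ad_power[OF *(5,2)] using that *(1) by auto
    ultimately show ?thesis unfolding string(4) *(3) by blast
  qed
  then show "ad_power D N r k a c = fact k * dpow r k a c" "k \<ge> 4 \<Longrightarrow> ad_power D N r k a c = 0" by auto
qed

lemma adE_power4: "r \<in> R \<Longrightarrow> adE r ^ 4 = 0"
  unfolding adE_power[of 4, simplified] mE_zero[symmetric, of Bs]
  by (rule mE_cong) (simp add: ad_power_exact(2) del: ad_power.simps)

lemma qs_power: "(qs x * A) ^ k = qs (x ^ k) * A ^ k"
proof (induction k)
  case (Suc k)
  show ?case by (simp only: power_Suc Suc qs_mult mult.assoc qs_central_left[of A])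
qed (simp add: qs_one)

lemma scaled_adE_power4: "r \<in> R \<Longrightarrow> (qs x * adE r) ^ 4 = 0"
  by (simp add: qs_power adE_power4)

lemma Rep_endo_sum: "Rep_endo (\<Sum>i\<in>I. f i) v = (\<Sum>i\<in>I. Rep_endo (f i) v)"
  by (induction I rule: infinite_finite_induct) (simp_all add: zero_endo.rep_eq plus_endo.rep_eq)

lemma X_expn:
  assumes r: "r \<in> R"
  shows "X r t = Rep_endo (expn 4 (qs t * adE r))"
proof (intro ext)
  fix v c
  have d: "Rep_endo (dp (qs t * adE r) k) v c = (if c \<in> Bs then \<Sum>a\<in>Bs. of_int (dpow r k a c) * t ^ k * v a else 0)"
    if k: "k > 0" for k
  proof -
    have "dp (qs t * adE r) k = qs (1 / fact k * t ^ k) * mE Bs (ad_power D N r k)"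
      unfolding dp_def qs_power adE_power[OF k] qs_mult mult.assoc ..
    then have "Rep_endo (dp (qs t * adE r) k) v c =
        (if c \<in> Bs then 1 / fact k * t ^ k * (\<Sum>a\<in>Bs. of_int (ad_power D N r k a c) * v a) else 0)"
      by (simp add: times_endo.rep_eq qs.rep_eq mE.rep_eq)
    also have "\<dots> = (if c \<in> Bs then \<Sum>a\<in>Bs. of_int (dpow r k a c) * t ^ k * v a else 0)"
      by (simp add: sum_distrib_left ad_power_exact(1)[OF r] field_simps cong: sum.cong)
    finally show ?thesis .
  qed
  have d0: "Rep_endo (dp (qs t * adE r) 0) v c = v c"
    unfolding dp_def by (simp add: qs_one one_endo.rep_eq)
  have "Rep_endo (expn 4 (qs t * adE r)) v c = (\<Sum>k<4. Rep_endo (dp (qs t * adE r) k) v c)"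
    unfolding expn_def Rep_endo_sum sum_fun_apply ..
  also have "\<dots> = v c + (if c \<in> Bs then \<Sum>a\<in>Bs. (of_int (dpow r 1 a c) * t ^ 1 + of_int (dpow r 2 a c) * t ^ 2 +
      of_int (dpow r 3 a c) * t ^ 3) * v a else 0)"
    by (simp add: eval_nat_numeral d d0 sum.distrib distrib_right del: power_Suc)
  also have "\<dots> = X r t v c"
  proof (cases "c \<in> Bs")
    case True
    have "v c = (\<Sum>a\<in>Bs. of_int (dpow r 0 a c) * t ^ 0 * v a)"
      using True finite_Bs by (simp add: dpow_def if_distrib[of "\<lambda>x. of_int x * _"] cong: if_cong)
    then show ?thesis using True
      by (simp add: X_bmat bmat_def sum_atMost_3 sum.distrib distrib_right)
  qed (simp add: X_bmat bmat_def)
  finally show "X r t v c = Rep_endo (expn 4 (qs t * adE r)) v c" ..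
qed

text \<open>The Jacobi identity; for s different from -r the bracket of e_r and e_s has no part in
  the Cartan subalgebra.\<close>

lemma adE_commutator:
  assumes r: "r \<in> R" and s: "s \<in> R" and ne: "s \<noteq> - r"
  shows "adE r * adE s = adE s * adE r + (if r + s \<in> R then qs (of_int (N r s)) * adE (r + s) else 0)"
proof -
  let ?n = "if r + s \<in> R then N r s else 0"
  have "adE s * adE r + qs (of_int ?n) * adE (r + s) = adE r * adE s"
    unfolding adE_def mE_mult[OF finite_Bs] mE_scale mE_add
  proof (rule mE_cong)
    fix c e assume ce: "c \<in> Bs" "e \<in> Bs"
    have "(\<Sum>d\<in>Bs. lie (Eb r) (Eb s) d * lie d c e) =
        (\<Sum>d\<in>Bs. if d = Eb (r + s) then ?n * lie (Eb (r + s)) c e else 0)"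
      using ne by (intro sum.cong refl) auto
    also have "\<dots> = ?n * lie (Eb (r + s)) c e" using finite_Bs by simp
    finally show "(\<Sum>b\<in>Bs. lie (Eb r) c b * lie (Eb s) b e) + ?n * lie (Eb (r + s)) c e =
        (\<Sum>b\<in>Bs. lie (Eb s) c b * lie (Eb r) b e)"
      using lie_jacobi[of "Eb r" "Eb s" c e] r s ce by simp
  qed
  then show ?thesis by (simp add: qs_zero split: if_splits)
qed

lemma adE_commute: "r \<in> R \<Longrightarrow> s \<in> R \<Longrightarrow> s \<noteq> - r \<Longrightarrow> r + s \<notin> R \<Longrightarrow> adE r * adE s = adE s * adE r"
  using adE_commutator by simp

lemma scaled_commute:
  assumes "A * B = B * A"
  shows "(qs x * A) * (qs y * B) = (qs y * B) * (qs x * A)"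
proof -
  have "(qs x * A) * (qs y * B) = qs (x * y) * (A * B)"
    by (simp only: qs_mult mult.assoc qs_central_left[of A])
  moreover have "(qs y * B) * (qs x * A) = qs (y * x) * (B * A)"
    by (simp only: qs_mult mult.assoc qs_central_left[of B])
  ultimately show ?thesis using assms by (simp only: mult.commute[of x y])
qed

lemma Rep_endo_mult: "Rep_endo (A * B) = Rep_endo A \<circ> Rep_endo B"
  by (simp add: times_endo.rep_eq comp_def)

lemma expn_zero: "expn 4 0 = 1"
  unfolding expn_def by (simp add: eval_nat_numeral dp_def qs_one)

lemma commute_rat:
  assumes "r \<in> R" "s \<in> R" "s \<noteq> - r" "r + s \<notin> R"
  shows "X r t \<circ> X s t' = X s t' \<circ> X r (t :: rat)"
proof -
  have "expn 4 (qs t * adE r) * expn 4 (qs t' * adE s) =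
      expn 4 (qs t' * adE s) * expn 4 0 * expn 4 0 * expn 4 (qs t * adE r)"
  proof (rule expn_commutator)
    show "qs t * adE r * (qs t' * adE s) = qs t' * adE s * (qs t * adE r) + 0"
      using scaled_commute[OF adE_commute[OF assms]] by simp
  qed (use assms scaled_adE_power4 in auto)
  then show ?thesis
    by (simp only: X_expn[OF assms(1)] X_expn[OF assms(2)] expn_zero mult_1_right Rep_endo_mult[symmetric])
qed

lemma heisenberg_rat:
  assumes a: "a \<in> R" and b: "b \<in> R" and c: "a + b \<in> R" and ac: "a + (a + b) \<notin> R" and bc: "b + (a + b) \<notin> R"
    and ne: "b \<noteq> - a" "a + b \<noteq> - a" "a + b \<noteq> - b"
  shows "X a 1 \<circ> X b 1 = X b 1 \<circ> X (a + b) (of_int (N a b)) \<circ> X a (1 :: rat)"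
proof -
  let ?C = "qs (of_int (N a b)) * adE (a + b)"
  have "expn 4 (adE a) * expn 4 (adE b) = expn 4 (adE b) * expn 4 ?C * expn 4 0 * expn 4 (adE a)"
  proof (rule expn_commutator)
    show "adE a * adE b = adE b * adE a + ?C" using adE_commutator[OF a b ne(1)] c by simp
    show "adE a * ?C = ?C * adE a + 2 * 0"
      using adE_commute[OF a c ne(2) ac] by (simp add: qs_central_left mult.assoc)
    show "adE b * ?C = ?C * adE b"
      using adE_commute[OF b c ne(3) bc] by (simp add: qs_central_left mult.assoc)
  qed (use a b c adE_power4 scaled_adE_power4 in auto)
  then show ?thesis
    by (simp only: X_expn[OF a] X_expn[OF b] X_expn[OF c] qs_one mult_1_left expn_zero mult_1_right Rep_endo_mult[symmetric])
qed

text \<open>The double commutator of a with b carries N a b * N a (a + b), and the factor 2 in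
  \<open>expn_commutator\<close> halves it to \<open>m\<close>.\<close>

lemma b2_commutator_rat:
  assumes a: "a \<in> R" and b: "b \<in> R" and c: "a + b \<in> R" and d: "a + (a + b) \<in> R" and ad: "a + (a + (a + b)) \<notin> R"
    and bc: "b + (a + b) \<notin> R" and bd: "b + (a + (a + b)) \<notin> R" and cd: "(a + b) + (a + (a + b)) \<notin> R"
    and ne: "b \<noteq> - a" "a + b \<noteq> - a" "a + b \<noteq> - b" "a + (a + b) \<noteq> - a" "a + (a + b) \<noteq> - b" "a + (a + b) \<noteq> - (a + b)"
    and m: "2 * m = N a b * N a (a + b)"
  shows "X a 1 \<circ> X b 1 = X b 1 \<circ> X (a + b) (of_int (N a b)) \<circ> X (a + (a + b)) (of_int m) \<circ> X a (1 :: rat)"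
proof -
  let ?C = "qs (of_int (N a b)) * adE (a + b)" and ?D = "qs (of_int m) * adE (a + (a + b))"
  have "expn 4 (adE a) * expn 4 (adE b) = expn 4 (adE b) * expn 4 ?C * expn 4 ?D * expn 4 (adE a)"
  proof (rule expn_commutator)
    show "adE a * adE b = adE b * adE a + ?C" using adE_commutator[OF a b ne(1)] c by simp
    have two: "(2 :: chev_idx endo) = qs 2" using qs_of_nat[of 2] by simp
    have "adE a * ?C = qs (of_int (N a b)) * (adE a * adE (a + b))" by (simp add: qs_central_left)
    also have "\<dots> = ?C * adE a + qs (of_int (N a b)) * (qs (of_int (N a (a + b))) * adE (a + (a + b)))"
      unfolding adE_commutator[OF a c ne(2)] using d by (simp add: distrib_left mult.assoc)
    also have "qs (of_int (N a b)) * (qs (of_int (N a (a + b))) * adE (a + (a + b))) = qs (of_int (2 * m)) * adE (a + (a + b))"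
      unfolding m by (simp add: qs_mult mult.assoc)
    also have "\<dots> = 2 * ?D" unfolding two by (simp add: qs_mult mult.assoc)
    finally show "adE a * ?C = ?C * adE a + 2 * ?D" .
    show "adE a * ?D = ?D * adE a"
      using adE_commute[OF a d ne(4) ad] by (simp add: qs_central_left mult.assoc)
    show "adE b * ?C = ?C * adE b"
      using adE_commute[OF b c ne(3) bc] by (simp add: qs_central_left mult.assoc)
    show "adE b * ?D = ?D * adE b"
      using adE_commute[OF b d ne(5) bd] by (simp add: qs_central_left mult.assoc)
    show "?C * ?D = ?D * ?C" by (rule scaled_commute[OF adE_commute[OF c d ne(6) cd]])
  qed (use a b c d adE_power4 scaled_adE_power4 in auto)
  then show ?thesis
    by (simp only: X_expn[OF a] X_expn[OF b] X_expn[OF c] X_expn[OF d] qs_one mult_1_left Rep_endo_mult[symmetric])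
qed

text \<open>Words in the \<open>x\<^sub>r(n)\<close> with integral \<open>n\<close> have integral matrices, so that a relation between them
  that holds over the rationals holds over every field.\<close>

fun xword :: "(root \<times> int) list \<Rightarrow> 'k::field lie_map" where
  "xword [] = id"
| "xword ((r, n) # ws) = X r (of_int n) \<circ> xword ws"

fun zword :: "(root \<times> int) list \<Rightarrow> chev_idx \<Rightarrow> chev_idx \<Rightarrow> int" where
  "zword [] a c = (if a = c then 1 else 0)"
| "zword ((r, n) # ws) a c = (\<Sum>b\<in>Bs. zword ws a b * (\<Sum>k\<le>3. dpow r k b c * n ^ k))"

lemma xword_bmat: "xword ws = bmat Bs (\<lambda>a c. of_int (zword ws a c))"
proof (induction ws rule: xword.induct)
  case 1
  show ?case
    by (auto simp: bmat_def fun_eq_iff finite_Bs if_distrib[of "\<lambda>x. of_int x * _"] cong: if_cong)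
next
  case (2 r n ws)
  have Xi: "X r (of_int n) = bmat Bs (\<lambda>a c. of_int (\<Sum>k\<le>3. dpow r k a c * n ^ k))"
    unfolding X_bmat by simp
  show ?case unfolding xword.simps 2 Xi bmat_comp[OF finite_Bs] by simp
qed

lemma xword_transfer:
  assumes "xword ws = (xword ws' :: rat lie_map)"
  shows "xword ws = (xword ws' :: 'k::field lie_map)"
proof -
  have "zword ws a c = zword ws' a c" if a: "a \<in> Bs" and c: "c \<in> Bs" for a c
  proof -
    have "(xword ws :: rat lie_map) (bvec a) c = xword ws' (bvec a) c" using assms by simp
    then show ?thesis unfolding xword_bmat using a c by (simp add: bmat_bvec finite_Bs)
  qed
  then show ?thesis unfolding xword_bmat bmat_def by (auto simp: fun_eq_iff intro!: sum.cong)
qed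

lemma X_commute:
  assumes "r \<in> R" "s \<in> R" "s \<noteq> - r" "r + s \<notin> R"
  shows "X r 1 \<circ> X s 1 = X s 1 \<circ> (X r 1 :: 'k::field lie_map)"
  using xword_transfer[of "[(r, 1), (s, 1)]" "[(s, 1), (r, 1)]"] commute_rat[OF assms] by simp

lemma X_heisenberg:
  assumes "a \<in> R" "b \<in> R" "a + b \<in> R" "a + (a + b) \<notin> R" "b + (a + b) \<notin> R"
    and "b \<noteq> - a" "a + b \<noteq> - a" "a + b \<noteq> - b"
  shows "X a 1 \<circ> X b 1 = X b 1 \<circ> X (a + b) (of_int (N a b)) \<circ> (X a 1 :: 'k::field lie_map)"
  using xword_transfer[of "[(a, 1), (b, 1)]" "[(b, 1), (a + b, N a b), (a, 1)]"] heisenberg_rat[OF assms]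
  by (simp add: comp_assoc)

lemma X_b2_commutator:
  assumes "a \<in> R" "b \<in> R" "a + b \<in> R" "a + (a + b) \<in> R" "a + (a + (a + b)) \<notin> R"
    and "b + (a + b) \<notin> R" "b + (a + (a + b)) \<notin> R" "(a + b) + (a + (a + b)) \<notin> R"
    and "b \<noteq> - a" "a + b \<noteq> - a" "a + b \<noteq> - b" "a + (a + b) \<noteq> - a" "a + (a + b) \<noteq> - b" "a + (a + b) \<noteq> - (a + b)"
    and "2 * m = N a b * N a (a + b)"
  shows "X a 1 \<circ> X b 1 = X b 1 \<circ> X (a + b) (of_int (N a b)) \<circ> X (a + (a + b)) (of_int m) \<circ> (X a 1 :: 'k::field lie_map)"
  using xword_transfer[of "[(a, 1), (b, 1)]" "[(b, 1), (a + b, N a b), (a + (a + b), m), (a, 1)]"] b2_commutator_rat[OF assms]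
  by (simp add: comp_assoc)

lemma chi_add: "(\<And>i. c i \<noteq> 0) \<Longrightarrow> chi c (r + s) = chi c r * chi c s"
  unfolding chi_def by (simp add: power_int_add prod.distrib)

lemma chi_smul: "chi c (smul k r) = chi c r powi k"
proof -
  have "(\<Prod>i\<in>I. (c i powi r i) powi k) = (\<Prod>i\<in>I. c i powi r i) powi k" for I
    by (induction I rule: infinite_finite_induct) (auto simp: power_int_mult_distrib)
  then show ?thesis unfolding chi_def by (simp add: power_int_mult[symmetric] mult.commute)
qed

lemma wchi_chi: "wchi c a = chi c (wt a)"
  unfolding wchi_def wt_def chi_def by (auto split: chev_idx.splits)

text \<open>The k-th divided power shifts weights by k r, so conjugation multiplies its coefficient
  by the k-th power of the character value. This spreads relations with fixed parameters to scaled
  ones.\<close>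

lemma tor_X:
  assumes c: "\<And>i. c i \<noteq> 0"
  shows "tor c \<circ> X r t = X r (chi c r * t) \<circ> tor c"
proof (rule is_bmat_eqI[OF finite_Bs is_bmat_comp[OF finite_Bs is_bmat_tor is_bmat_X] is_bmat_comp[OF finite_Bs is_bmat_X is_bmat_tor]])
  fix a assume a: "a \<in> Bs"
  show "(tor c \<circ> X r t) (bvec a) = (X r (chi c r * t) \<circ> tor c) (bvec a)"
  proof
    fix b
    show "(tor c \<circ> X r t) (bvec a) b = (X r (chi c r * t) \<circ> tor c) (bvec a) b"
    proof (cases "b \<in> Bs")
      case True
      have "(tor c \<circ> X r t) (bvec a) b = wchi c b * X r t (bvec a) b"
        using True unfolding tor_def wchi_def by (auto split: chev_idx.splits)
      also have "\<dots> = (\<Sum>k\<le>3. wchi c a * (of_int (dpow r k a b) * (chi c r * t) ^ k))"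
        unfolding X_bvec[OF a True] sum_distrib_left
      proof (intro sum.cong refl)
        fix k :: nat
        show "wchi c b * (of_int (dpow r k a b) * t ^ k) = wchi c a * (of_int (dpow r k a b) * (chi c r * t) ^ k)"
        proof (cases "dpow r k a b = 0")
          case False
          then have "ad_power D N r k a b \<noteq> 0" unfolding dpow_def by auto
          then have "wt b = wt a + smul (int k) r" using ad_power_wt[OF a True] by blast
          then have "wchi c b = wchi c a * chi c r ^ k"
            unfolding wchi_chi by (simp add: chi_add c chi_smul)
          then show ?thesis by (simp add: power_mult_distrib)
        qed simp
      qed
      also have "\<dots> = (X r (chi c r * t) \<circ> tor c) (bvec a) b"
        using a by (simp add: tor_bvec is_bmat_scl[OF is_bmat_X] X_bvec[OF a True] sum_distrib_left)
      finally show ?thesis .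
    next
      case False
      then show ?thesis
        using is_bmat_outside[OF finite_Bs is_bmat_comp[OF finite_Bs is_bmat_tor is_bmat_X] a False]
          is_bmat_outside[OF finite_Bs is_bmat_comp[OF finite_Bs is_bmat_X is_bmat_tor] a False] by metis
    qed
  qed
qed

end

section \<open>Twisted groups\<close>

context chevalley begin

text \<open>A difference of distinct fundamental roots has coordinates of both signs, so the string
  starts at its second root and the Cartan integer gives its length.\<close>

lemma simple_root_string:
  assumes i: "i < rk" and j: "j < rk" and ne: "i \<noteq> j"
  shows "smul k (simple_root i) + simple_root j \<in> R \<longleftrightarrow> 0 \<le> k \<and> k \<le> - cart (simple_root i) (simple_root j)"
proof -
  let ?r = "simple_root i" and ?s = "simple_root j"
  have r: "?r \<in> R" and s: "?s \<in> R" using simple_in_R i j by auto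
  have "?s j \<noteq> ?r j" "?s j \<noteq> (- ?r) j" using ne by (auto simp: simple_root_def)
  then have "?s \<noteq> ?r" "?s \<noteq> - ?r" by metis+
  then obtain p q :: nat where pq: "\<And>k. ?s + smul k ?r \<in> R \<longleftrightarrow> - int p \<le> k \<and> k \<le> int q"
    and c: "int p - int q = cart ?r ?s" using root_string[OF r s] by blast
  have "?s + smul (-1) ?r \<notin> R"
  proof
    assume *: "?s + smul (-1) ?r \<in> R"
    have "(?s + smul (-1) ?r) j = 1" "(?s + smul (-1) ?r) i = -1" using ne by (auto simp: simple_root_def)
    then show False using root_sign[OF *] by (metis le_minus_one_simps(3) neg_le_0_iff_le not_one_le_zero)
  qed
  then have "p = 0" using pq[of "-1"] by simp
  then have "int q = - cart ?r ?s" using c by simp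
  then show ?thesis using pq[of k] \<open>p = 0\<close> by (simp only: add.commute[of "?s"]) simp
qed

lemma cart_simple:
  assumes i: "i < rk" and "j < rk"
  shows "cart (simple_root i) (simple_root j) = 2 * dyn_gram D i j div dyn_len D i"
  unfolding cartan_int_def using assms by (simp add: root_ip_simple_simple dyn_gram_diag)

lemma smul_in_R: "e = 1 \<or> e = -1 \<Longrightarrow> smul e r \<in> R \<longleftrightarrow> r \<in> R"
proof -
  assume "e = 1 \<or> e = -1"
  moreover have "smul 1 r = r" by (simp add: fun_eq_iff)
  ultimately show ?thesis using uminus_in_R_iff[of r] unfolding uminus_root by metis
qed

lemma sroot_string:
  assumes e: "e = 1 \<or> e = -1" and i: "i < rk" and j: "j < rk" and ne: "i \<noteq> j"
  shows "smul k (sroot e i) + sroot e j \<in> R \<longleftrightarrow> 0 \<le> k \<and> k \<le> - cart (simple_root i) (simple_root j)"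
proof -
  have "smul k (sroot e i) + sroot e j = smul e (smul k (simple_root i) + simple_root j)"
    unfolding sroot_def by (simp add: fun_eq_iff algebra_simps)
  then show ?thesis using smul_in_R[OF e] simple_root_string[OF i j ne] by simp
qed

lemma sroot_apply: "sroot e i j = (if j = i then e else 0)"
  unfolding sroot_def simple_root_def by simp

lemma sroot_sum_not_root:
  assumes e: "e = 1 \<or> e = -1" and i: "i < rk" and j: "j < rk" and ne: "i \<noteq> j" and g: "dyn_gram D i j = 0"
  shows "sroot e i + sroot e j \<notin> R"
proof -
  have "cart (simple_root i) (simple_root j) = 0" using g cart_simple[OF i j] by simp
  moreover have "smul 1 (sroot e i) + sroot e j = sroot e i + sroot e j" by (simp add: fun_eq_iff)
  ultimately show ?thesis using sroot_string[OF e i j ne, of 1] by simp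
qed

lemma sroot_neq:
  assumes "e = 1 \<or> e = -1" "i \<noteq> j"
  shows "sroot e i \<noteq> sroot e j" "sroot e i \<noteq> - sroot e j"
proof -
  have "sroot e i i \<noteq> sroot e j i" "sroot e i i \<noteq> (- sroot e j) i" using assms by (auto simp: sroot_apply)
  then show "sroot e i \<noteq> sroot e j" "sroot e i \<noteq> - sroot e j" by metis+
qed

lemma sroot_X_commute:
  assumes e: "e = 1 \<or> e = -1" and i: "i < rk" and j: "j < rk" and ne: "i \<noteq> j" and g: "dyn_gram D i j = 0"
  shows "X (sroot e i) 1 \<circ> X (sroot e j) 1 = X (sroot e j) 1 \<circ> (X (sroot e i) 1 :: 'k::field lie_map)"
  by (rule X_commute) (use sroot_R(1)[OF e] i j sroot_sum_not_root[OF assms] sroot_neq[OF e] ne in auto)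

lemma N_abs:
  assumes "r \<in> R" "s \<in> R" "r + s \<in> R" and p: "\<And>k. s + smul (- int k) r \<in> R \<longleftrightarrow> k \<le> p"
  shows "\<bar>N r s\<bar> = int p + 1"
proof -
  have "\<bar>N r s\<bar> = int (Max {p. (\<lambda>j. s j - int p * r j) \<in> R}) + 1"
    using constants assms(1-3) unfolding chevalley_constants_def by blast
  moreover have "(\<lambda>j. s j - int k * r j) = s + smul (- int k) r" for k by (simp add: fun_eq_iff)
  then have "{k. (\<lambda>j. s j - int k * r j) \<in> R} = {..p}" using p by auto
  moreover have "Max {..p} = p" by (intro Max_eqI) auto
  ultimately show ?thesis by simp
qed

text \<open>The exponent e undoes the sign in \<open>sroot\<close>. Conjugation by this element
  turns a relation with both parameters 1 into one with parameters s and t.\<close>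

lemma torus_with_values:
  fixes s t :: "'k::field"
  assumes e: "e = 1 \<or> e = -1" and ij: "i < rk" "j < rk" "i \<noteq> j" and st: "s \<noteq> 0" "t \<noteq> 0"
  obtains c where "\<And>k. c k \<noteq> 0" "chi c (sroot e i) = s" "chi c (sroot e j) = t"
proof -
  define c where "c k = (if k = i then s powi e else if k = j then t powi e else 1)" for k
  have ee: "(x powi e) powi e = x" if "x \<noteq> 0" for x :: 'k
    using e that by (auto simp: power_int_minus)
  show ?thesis
    by (rule that[of c]) (use st ij ee in \<open>auto simp: c_def sroot_def chi_sroot\<close>)
qed

lemma bij_comp_cancel: "bij g \<Longrightarrow> g \<circ> h = g \<circ> h' \<Longrightarrow> h = h'" "bij g \<Longrightarrow> h \<circ> g = h' \<circ> g \<Longrightarrow> h = h'"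
proof -
  assume g: "bij g"
  show "h = h'" if "g \<circ> h = g \<circ> h'"
    using that g by (metis bij_is_inj inj_iff comp_assoc id_comp)
  show "h = h'" if "h \<circ> g = h' \<circ> g"
    using that g by (metis bij_is_surj surj_iff comp_assoc comp_id)
qed

text \<open>By induction on the difference of heights: in the off-diagonal entry of g g all
  intermediate products vanish, and twice the entry of g is left.\<close>

lemma tri_involution:
  fixes g :: "'k::field lie_map"
  assumes g: "tri e (\<lambda>_. 1) g" and inv: "g \<circ> g = id" and two: "(2 :: 'k) \<noteq> 0"
  shows "g = id"
proof -
  have zero: "g (bvec a) c = 0" if "a \<in> Bs" "c \<in> Bs" "a \<noteq> c" for a c
    using that
  proof (induction "nat (e * wht c - e * wht a)" arbitrary: a c rule: less_induct)
    case less
    show ?case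
    proof (cases "e * wht a < e * wht c")
      case lt: True
      have "0 = (g \<circ> g) (bvec a) c" using inv less.prems by (simp add: bvec_apply)
      also have "\<dots> = (\<Sum>b\<in>Bs. g (bvec a) b * g (bvec b) c)"
        by (rule is_bmat_comp_bvec[OF finite_Bs tri_bmat[OF g] tri_bmat[OF g] less.prems(1,2)])
      also have "\<dots> = (\<Sum>b\<in>{a, c}. g (bvec a) b * g (bvec b) c)"
      proof (rule sum.mono_neutral_right)
        show "\<forall>b\<in>Bs - {a, c}. g (bvec a) b * g (bvec b) c = 0"
        proof
          fix b assume b: "b \<in> Bs - {a, c}"
          show "g (bvec a) b * g (bvec b) c = 0"
          proof (rule ccontr)
            assume nz: "\<not> ?thesis"
            then have "e * wht a < e * wht b" "e * wht b < e * wht c"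
              using tri_nonzero[OF g less.prems(1), of b] tri_nonzero[OF g _ less.prems(2), of b] b by auto
            then have "g (bvec a) b = 0" using less.hyps[of b a] less.prems b by auto
            then show False using nz by simp
          qed
        qed
      qed (use finite_Bs less.prems in auto)
      also have "\<dots> = 2 * g (bvec a) c"
        using tri_coef[OF g less.prems(1,1)] tri_coef[OF g less.prems(2,2)] less.prems by simp
      finally show ?thesis using two by simp
    next
      case False
      then show ?thesis using tri_coef[OF g less.prems(1,2)] less.prems by simp
    qed
  qed
  have "g = tor (\<lambda>_. 1)"
  proof (rule bmat_diagI[OF tri_bmat[OF g]])
    fix a c assume ac: "a \<in> Bs" "c \<in> Bs"
    have "wchi (\<lambda>_. 1 :: 'k) a = 1" unfolding wchi_def chi_def by (simp split: chev_idx.split)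
    then show "g (bvec a) c = (if a = c then wchi (\<lambda>_. 1) a else 0)"
      using zero[OF ac] tri_coef[OF g ac] by auto
  qed
  then show ?thesis using tor_one by metis
qed

end

section \<open>The fixed points of the twisting automorphism\<close>

locale twisted_chevalley = chevalley D \<kappa> u N for D \<kappa> u N +
  fixes \<sigma> :: "'k::{field,finite} lie_map \<Rightarrow> 'k lie_map" and \<tau> :: "nat \<Rightarrow> nat" and f :: "'k \<Rightarrow> 'k" and m :: "nat \<Rightarrow> nat"
  assumes hom: "\<sigma> \<in> hom (chev_group D N) (chev_group D N)" and faut: "field_aut f"
    and \<tau>: "\<And>i. i < rk \<Longrightarrow> \<tau> i < rk"
    and \<sigma>_simple: "\<And>i t. i < rk \<Longrightarrow> \<sigma> (X (simple_root i) t) = X (simple_root (\<tau> i)) (f t ^ m i)"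
    and \<sigma>_minus: "\<And>i t. i < rk \<Longrightarrow> \<sigma> (X (- simple_root i) t) = X (- simple_root (\<tau> i)) (f t ^ m i)"
begin

abbreviation "CG \<equiv> carrier (chev_group D N) :: 'k lie_map set"

lemma CG_subgroup: "subgroup CG lie_perm"
  by (rule chev_group_subgroup)

lemma \<sigma>_CG: "g \<in> CG \<Longrightarrow> \<sigma> g \<in> CG"
  using hom unfolding hom_def by auto

lemma CG_bij: "g \<in> CG \<Longrightarrow> bij g"
  using lp_subgroup_bij[OF CG_subgroup] .

lemma \<sigma>_comp:
  assumes "g \<in> CG" "h \<in> CG"
  shows "\<sigma> (g \<circ> h) = \<sigma> g \<circ> \<sigma> h"
proof -
  have m: "x \<otimes>\<^bsub>chev_group D N\<^esub> y = x \<circ> y" if "x \<in> CG" "y \<in> CG" for x y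
    using lp_mult[OF CG_bij CG_bij] that unfolding chev_group_def by simp
  have "\<sigma> (g \<otimes>\<^bsub>chev_group D N\<^esub> h) = \<sigma> g \<otimes>\<^bsub>chev_group D N\<^esub> \<sigma> h"
    using hom assms unfolding hom_def by blast
  then show ?thesis using m assms \<sigma>_CG by simp
qed

lemma id_CG: "id \<in> CG"
  by (rule lp_subgroup_id[OF CG_subgroup])

lemma \<sigma>_id: "\<sigma> id = id"
proof -
  have "\<sigma> id \<circ> \<sigma> id = \<sigma> id \<circ> id" using \<sigma>_comp[OF id_CG id_CG] by simp
  then show ?thesis by (rule bij_comp_cancel(1)[OF CG_bij[OF \<sigma>_CG[OF id_CG]]])
qed

lemma CG_inv: "g \<in> CG \<Longrightarrow> inv\<^bsub>lie_perm\<^esub> g \<in> CG"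
  using subgroup.m_inv_closed[OF CG_subgroup] .

lemma \<sigma>_inv:
  assumes "g \<in> CG"
  shows "\<sigma> (inv\<^bsub>lie_perm\<^esub> g) = inv\<^bsub>lie_perm\<^esub> (\<sigma> g)"
proof -
  note i = lp_inv_bij[OF CG_bij[OF assms]]
  have "\<sigma> g \<circ> \<sigma> (inv\<^bsub>lie_perm\<^esub> g) = id" "\<sigma> (inv\<^bsub>lie_perm\<^esub> g) \<circ> \<sigma> g = id"
    using \<sigma>_comp[OF assms CG_inv[OF assms]] \<sigma>_comp[OF CG_inv[OF assms] assms] i \<sigma>_id by simp_all
  then show ?thesis using lp_inv[OF CG_bij[OF \<sigma>_CG[OF assms]]] by simp
qed

lemma f_simps: "f (x + y) = f x + f y" "f (x * y) = f x * f y" "f 0 = 0" "f 1 = 1" "f (- x) = - f x"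
proof -
  show add: "f (x + y) = f x + f y" and mult: "f (x * y) = f x * f y" for x y
    using faut unfolding field_aut_def by auto
  show f0: "f 0 = 0" using add[of 0 0] by (metis add_cancel_right_right add_0)
  have inj: "inj f" using faut unfolding field_aut_def bij_def by blast
  have "f 1 \<noteq> 0" using inj f0 by (metis injD one_neq_zero)
  moreover have "f 1 * f 1 = f 1 * 1" using mult[of 1 1] by simp
  ultimately show "f 1 = 1" by simp
  have "f (- x) + f x = 0" using add[of "- x" x] f0 by simp
  then show "f (- x) = - f x" by (simp add: eq_neg_iff_add_eq_0)
qed

definition fx :: "int \<Rightarrow> 'k lie_map set" where
  "fx e = {g \<in> unip e. \<sigma> g = g}"

lemma fx_unip: "g \<in> fx e \<Longrightarrow> g \<in> unip e" and fx_\<sigma>: "g \<in> fx e \<Longrightarrow> \<sigma> g = g"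
  unfolding fx_def by auto

lemma unip_CG: "g \<in> unip e \<Longrightarrow> g \<in> CG"
  using unip_chev_group by blast

lemma fx_tri: "g \<in> fx e \<Longrightarrow> tri e (\<lambda>_. 1) g"
  using unip_tri fx_unip by blast

lemma fx_comp: "g \<in> fx e \<Longrightarrow> h \<in> fx e \<Longrightarrow> g \<circ> h \<in> fx e"
  using lp_subgroup_comp[OF unip_subgroup] \<sigma>_comp[OF unip_CG unip_CG] unfolding fx_def by auto

lemma fx_id: "id \<in> fx e"
  unfolding fx_def using lp_subgroup_id[OF unip_subgroup] \<sigma>_id by simp

lemma fx_subgroup: "subgroup (fx e) lie_perm"
proof (rule group.subgroupI[OF lp_group])
  show "fx e \<subseteq> carrier lie_perm" using lp_subgroup_bij[OF unip_subgroup] fx_unip by (auto simp: lp_carrier)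
  show "fx e \<noteq> {}" using fx_id by blast
  fix g assume g: "g \<in> fx e"
  then show "inv\<^bsub>lie_perm\<^esub> g \<in> fx e"
    using subgroup.m_inv_closed[OF unip_subgroup fx_unip[OF g]] \<sigma>_inv[OF unip_CG[OF fx_unip[OF g]]]
    unfolding fx_def by simp
  fix h assume "h \<in> fx e"
  then show "g \<otimes>\<^bsub>lie_perm\<^esub> h \<in> fx e"
    using fx_comp[OF g] lp_mult lp_subgroup_bij[OF unip_subgroup] fx_unip g by metis
qed

text \<open>What \<open>lie_base\<close> needs of a fixed element, demanded for the full torus and
  therefore valid for its intersection with the twisted group.\<close>

definition regular :: "int \<Rightarrow> bool" where
  "regular e \<longleftrightarrow> (\<exists>g\<in>fx e. \<forall>h\<in>chev_torus D N. h \<circ> g = g \<circ> h \<longrightarrow> h = id)"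

lemma lie_base_twisted:
  assumes simple: "simple_group Gm" and Gm: "Gm = lie_perm\<lparr>carrier := generate lie_perm (fx 1 \<union> fx (-1))\<rparr>"
    and H: "H = (fx 1 <#>\<^bsub>lie_perm\<^esub> (chev_torus D N \<inter> carrier Gm)) \<inter> (chev_monomial D N \<inter> carrier Gm)"
    and reg: "regular 1" "regular (-1)"
  shows "base_number (rcosets\<^bsub>Gm\<^esub> H) (cartan_scheme Gm H) \<le> 2 \<and>
    (base_number (rcosets\<^bsub>Gm\<^esub> H) (cartan_scheme Gm H) = 1 \<longleftrightarrow> H = {\<one>\<^bsub>Gm\<^esub>})"
proof -
  obtain u0 where u0: "u0 \<in> fx 1" "\<forall>h\<in>chev_torus D N. h \<circ> u0 = u0 \<circ> h \<longrightarrow> h = id"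
    using reg(1) unfolding regular_def by blast
  obtain v0 where v0: "v0 \<in> fx (-1)" "\<forall>h\<in>chev_torus D N. h \<circ> v0 = v0 \<circ> h \<longrightarrow> h = id"
    using reg(2) unfolding regular_def by blast
  have K: "subgroup (carrier Gm) lie_perm"
    unfolding Gm using lp_subgroup_bij[OF fx_subgroup] by (simp, intro lp_generate_subgroup) blast
  show ?thesis
  proof (rule lie_base[OF simple Gm fx_subgroup _ fx_subgroup _ _ _ _ _ _ H u0(1) _ v0(1)])
    show "subgroup (chev_torus D N \<inter> carrier Gm) lie_perm"
      by (rule group.subgroups_Inter_pair[OF lp_group torus_subgroup K])
  qed (use fx_unip u0 v0 torus_monomial in blast)+
qed

lemma sroot_\<sigma>:
  assumes e: "e = 1 \<or> e = -1" and i: "i < rk"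
  shows "\<sigma> (X (sroot e i) t) = X (sroot e (\<tau> i)) (f t ^ m i)"
  using e \<sigma>_simple[OF i] \<sigma>_minus[OF i] by (auto simp: sroot_1)

context
  fixes e :: int
  assumes e: "e = 1 \<or> e = -1"
begin

abbreviation "x i \<equiv> X (sroot e i) (1 :: 'k)"

lemma x_unip: "i < rk \<Longrightarrow> x i \<in> unip e"
  by (rule sroot_in_unip[OF e])

lemma x_CG: "i < rk \<Longrightarrow> x i \<in> CG"
  using unip_CG x_unip by blast

lemma \<sigma>_x: "i < rk \<Longrightarrow> \<sigma> (x i) = x (\<tau> i)"
  using sroot_\<sigma>[OF e] by (simp add: f_simps)

lemma e_nonzero: "of_int e \<noteq> (0 :: 'k)"
  using e by auto

lemma phi_x: "i < rk \<Longrightarrow> j < rk \<Longrightarrow> phi e j (x i) = (if i = j then of_int e else 0)"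
proof -
  assume ij: "i < rk" "j < rk"
  have "e * ht (sroot e i) > 0" using sroot_ht[OF e ij(1)] e by auto
  from phi_X[OF e sroot_R(1)[OF e ij(1)] this ij(2), of "1 :: 'k"] show ?thesis
    using sroot_neq(1)[OF e, of i j] by auto
qed

lemma phi_comp_unip:
  assumes "g \<in> unip e" "h \<in> unip e" "i < rk"
  shows "phi e i (g \<circ> h) = phi e i g + (phi e i h :: 'k)"
  by (rule phi_comp[OF e unip_tri[OF assms(1)] unip_tri[OF assms(2)] assms(3)])

lemma unip_comp: "g \<in> unip e \<Longrightarrow> h \<in> unip e \<Longrightarrow> g \<circ> h \<in> unip e"
  by (rule lp_subgroup_comp[OF unip_subgroup])

text \<open>Components are additive, and the supports of the factors are disjoint, so nothing
  cancels in the product.\<close>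

lemma combine_orbits:
  assumes "finite P" and "\<And>p. p \<in> P \<Longrightarrow> \<exists>g\<in>fx e. \<forall>j<rk. phi e j g \<noteq> 0 \<longleftrightarrow> j \<in> Or p"
    and "\<And>p q. p \<in> P \<Longrightarrow> q \<in> P \<Longrightarrow> p \<noteq> q \<Longrightarrow> Or p \<inter> Or q = {}"
  shows "\<exists>g\<in>fx e. \<forall>j<rk. phi e j g \<noteq> 0 \<longleftrightarrow> j \<in> \<Union>(Or ` P)"
  using assms
proof (induction P rule: finite_induct)
  case empty
  have "\<forall>j<rk. phi e j (id :: 'k lie_map) \<noteq> 0 \<longleftrightarrow> j \<in> \<Union>(Or ` {})" using phi_id[OF e] by blast
  then show ?case using fx_id by (rule bexI)
next
  case (insert p P)
  obtain g where g: "g \<in> fx e" "\<forall>j<rk. phi e j g \<noteq> 0 \<longleftrightarrow> j \<in> \<Union>(Or ` P)" using insert by auto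
  obtain h where h: "h \<in> fx e" "\<forall>j<rk. phi e j h \<noteq> 0 \<longleftrightarrow> j \<in> Or p" using insert.prems(1)[of p] by auto
  have dis: "Or p \<inter> \<Union>(Or ` P) = {}" using insert by fastforce
  have "phi e j (h \<circ> g) \<noteq> 0 \<longleftrightarrow> j \<in> \<Union>(Or ` insert p P)" if j: "j < rk" for j
  proof (cases "j \<in> Or p")
    case True
    then have "phi e j g = 0" "phi e j h \<noteq> 0" using g(2) h(2) j dis by blast+
    then show ?thesis using phi_comp_unip[OF fx_unip[OF h(1)] fx_unip[OF g(1)] j] True by simp
  next
    case False
    then have "phi e j h = 0" using h(2) j by blast
    then show ?thesis using phi_comp_unip[OF fx_unip[OF h(1)] fx_unip[OF g(1)] j] False g(2) j by simp
  qed
  then show ?case using fx_comp[OF h(1) g(1)] by blast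
qed

lemma regular_if_phi: "g \<in> fx e \<Longrightarrow> \<forall>j<rk. phi e j g \<noteq> 0 \<Longrightarrow> regular e"
  unfolding regular_def using phi_regular[OF e tri_bmat[OF fx_tri]] by blast

lemma fixed_node: "i < rk \<Longrightarrow> \<tau> i = i \<Longrightarrow> \<exists>g\<in>fx e. \<forall>j<rk. phi e j g \<noteq> 0 \<longleftrightarrow> j \<in> {i}"
  using x_unip \<sigma>_x phi_x e_nonzero by (intro bexI[of _ "x i"]) (auto simp: fx_def)

text \<open>The automorphism exchanges the two factors, and orthogonal fundamental roots have
  commuting root elements.\<close>

lemma commuting_pair:
  assumes i: "i < rk" and j: "j < rk" and ij: "i \<noteq> j" "\<tau> i = j" "\<tau> j = i" and g: "dyn_gram D i j = 0"
  shows "x i \<circ> x j \<in> fx e" and "\<forall>k<rk. phi e k (x i \<circ> x j) \<noteq> 0 \<longleftrightarrow> k \<in> {i, j}"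
proof -
  have "\<sigma> (x i \<circ> x j) = x i \<circ> x j"
    unfolding \<sigma>_comp[OF x_CG[OF i] x_CG[OF j]] \<sigma>_x[OF i] \<sigma>_x[OF j] ij(2,3)
    by (rule sroot_X_commute[OF e i j ij(1) g, symmetric])
  then show "x i \<circ> x j \<in> fx e" unfolding fx_def using unip_comp x_unip i j by blast
  show "\<forall>k<rk. phi e k (x i \<circ> x j) \<noteq> 0 \<longleftrightarrow> k \<in> {i, j}"
    using phi_comp_unip[OF x_unip[OF i] x_unip[OF j]] phi_x i j ij e_nonzero by auto
qed

lemma regular_involution:
  assumes inv: "\<And>i. i < rk \<Longrightarrow> \<tau> (\<tau> i) = i"
    and pairs: "\<And>i. i < rk \<Longrightarrow> i < \<tau> i \<Longrightarrow> \<exists>g\<in>fx e. \<forall>k<rk. phi e k g \<noteq> 0 \<longleftrightarrow> k \<in> {i, \<tau> i}"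
  shows "regular e"
proof -
  let ?P = "{i. i < rk \<and> i \<le> \<tau> i}"
  have "\<exists>g\<in>fx e. \<forall>j<rk. phi e j g \<noteq> 0 \<longleftrightarrow> j \<in> \<Union>((\<lambda>i. {i, \<tau> i}) ` ?P)"
  proof (rule combine_orbits)
    fix p assume p: "p \<in> ?P"
    show "\<exists>g\<in>fx e. \<forall>j<rk. phi e j g \<noteq> 0 \<longleftrightarrow> j \<in> {p, \<tau> p}"
      using pairs[of p] fixed_node[of p] p by (cases "\<tau> p = p") auto
    fix q assume "q \<in> ?P" "p \<noteq> q"
    then show "{p, \<tau> p} \<inter> {q, \<tau> q} = {}" using p inv[of p] inv[of q] by auto
  qed simp
  then obtain g where g: "g \<in> fx e" "\<forall>j<rk. phi e j g \<noteq> 0 \<longleftrightarrow> j \<in> \<Union>((\<lambda>i. {i, \<tau> i}) ` ?P)" by blast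
  have "j \<in> \<Union>((\<lambda>i. {i, \<tau> i}) ` ?P)" if "j < rk" for j
  proof (cases "j \<le> \<tau> j")
    case True
    then show ?thesis using that by (intro UN_I[of j]) auto
  next
    case False
    then show ?thesis using inv[OF that] \<tau>[OF that] by (intro UN_I[of "\<tau> j"]) auto
  qed
  then show ?thesis using regular_if_phi[OF g(1)] g(2) by blast
qed

end

end

section \<open>Pairs of type A_2\<close>

context chevalley begin

lemma tor_X_apply: "(\<And>i. c i \<noteq> 0) \<Longrightarrow> tor c (X r t v) = X r (chi c r * t) (tor c v)"
  using tor_X[of c r t] by (metis comp_apply)

lemma tor_surj:
  assumes "\<And>i. c i \<noteq> 0"
  obtains v where "w = tor c v"
  using tor_inverse[of c, OF assms] by (metis comp_apply id_apply)

text \<open>Conjugate of the commuting relation with parameters 1 by a diagonal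
  automorphism.\<close>

lemma X_commute_scaled:
  assumes rs: "r \<in> R" "s \<in> R" "s \<noteq> - r" "r + s \<notin> R" and c: "\<And>i. c i \<noteq> 0"
  shows "X r (chi c r) (X s (chi c s) w) = X s (chi c s) (X r (chi c r) w)"
proof -
  obtain v where v: "w = tor c v" using tor_surj[OF c] .
  have "tor c (X r 1 (X s 1 v)) = tor c (X s 1 (X r 1 v))"
    using X_commute[OF rs] by (metis comp_apply)
  then show ?thesis unfolding v tor_X_apply[of c, OF c] by simp
qed

context
  fixes e :: int and i j :: nat
  assumes e: "e = 1 \<or> e = -1" and ij: "i < rk" "j < rk" "i \<noteq> j"
    and simply: "cart (simple_root i) (simple_root j) = -1" "cart (simple_root j) (simple_root i) = -1"
begin

private abbreviation "a \<equiv> sroot e i"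
private abbreviation "b \<equiv> sroot e j"

lemma a2_roots: "a \<in> R" "b \<in> R" "a + b \<in> R" "a + (a + b) \<notin> R" "b + (a + b) \<notin> R"
    "b \<noteq> - a" "a + b \<noteq> - a" "a + b \<noteq> - b"
proof -
  show "a \<in> R" "b \<in> R" using sroot_R(1)[OF e] ij by auto
  have "smul 1 a + b = a + b" "smul 2 a + b = a + (a + b)" "smul 2 b + a = b + (a + b)"
    by (simp_all add: fun_eq_iff)
  then show "a + b \<in> R" "a + (a + b) \<notin> R" "b + (a + b) \<notin> R"
    using sroot_string[OF e ij, of 1] sroot_string[OF e ij, of 2]
      sroot_string[OF e ij(2,1), of 2] ij(3) simply by auto
  have "b j \<noteq> (- a) j" "(a + b) j \<noteq> (- a) j" "(a + b) i \<noteq> (- b) i" using e ij(3) by (auto simp: sroot_apply)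
  then show "b \<noteq> - a" "a + b \<noteq> - a" "a + b \<noteq> - b" by metis+
qed

lemma a2_constant: "N a b = 1 \<or> N a b = -1"
proof -
  have "\<bar>N a b\<bar> = int 0 + 1"
  proof (rule N_abs[OF a2_roots(1,2,3)])
    fix k :: nat
    show "b + smul (- int k) a \<in> R \<longleftrightarrow> k \<le> 0"
      using sroot_string[OF e ij, of "- int k"] simply by (simp add: add.commute)
  qed
  then show ?thesis by auto
qed

text \<open>For nonzero s and t conjugate by a diagonal automorphism with these values at a and b;
  its value at a + b is st.\<close>

lemma a2_heisenberg:
  "X a s (X b t w) = X b t (X (a + b) (of_int (N a b) * s * t) (X a s (w :: _ \<Rightarrow> 'k::field)))"
proof (cases "s = 0 \<or> t = 0")
  case True
  then show ?thesis by (auto simp: X_zero[OF a2_roots(1)] X_zero[OF a2_roots(2)] X_zero[OF a2_roots(3)])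
next
  case False
  then obtain c where c: "\<And>k. c k \<noteq> 0" "chi c a = s" "chi c b = t"
    using torus_with_values[OF e ij, of s t] by metis
  have ab: "chi c (a + b) = s * t" using chi_add[OF c(1)] c(2,3) by simp
  obtain v where v: "w = tor c v" using tor_surj[OF c(1)] .
  have "tor c (X a 1 (X b 1 v)) = tor c (X b 1 (X (a + b) (of_int (N a b)) (X a 1 v)))"
    using X_heisenberg[OF a2_roots] by (metis comp_apply)
  then show ?thesis unfolding v tor_X_apply[of c, OF c(1)] ab c(2,3) by (simp add: ac_simps)
qed

lemma a2_center: "X (a + b) t (X a s w) = X a s (X (a + b) t w)" "X (a + b) t (X b s w) = X b s (X (a + b) t (w :: _ \<Rightarrow> 'k::field))"
proof -
  have "X (a + b) t (X a s w) = X a s (X (a + b) t w) \<and> X (a + b) t (X b s w) = X b s (X (a + b) t w)"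
  proof (cases "s = 0 \<or> t = 0")
    case True
    then show ?thesis by (auto simp: X_zero[OF a2_roots(1)] X_zero[OF a2_roots(2)] X_zero[OF a2_roots(3)])
  next
    case False
    \<comment> \<open>The values s at a and t / s at b give t at a + b; exchanging the two values
      serves the commutation with b.\<close>
    then have st: "s \<noteq> 0" "t / s \<noteq> 0" by auto
    obtain c where c: "\<And>k. c k \<noteq> 0" "chi c a = s" "chi c b = t / s"
      using torus_with_values[OF e ij st] by metis
    obtain c' where c': "\<And>k. c' k \<noteq> 0" "chi c' a = t / s" "chi c' b = s"
      using torus_with_values[OF e ij st(2,1)] by metis
    have t: "chi c (a + b) = t" "chi c' (a + b) = t" using chi_add[OF c(1)] chi_add[OF c'(1)] c c' st by simp_all
    have "X a s (X (a + b) t w) = X (a + b) t (X a s w)"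
      using X_commute_scaled[OF a2_roots(1,3,7,4), of c w, OF c(1)] c t by simp
    moreover have "X b s (X (a + b) t w) = X (a + b) t (X b s w)"
      using X_commute_scaled[OF a2_roots(2,3,8,5), of c' w, OF c'(1)] c' t by simp
    ultimately show ?thesis by simp
  qed
  then show "X (a + b) t (X a s w) = X a s (X (a + b) t w)" "X (a + b) t (X b s w) = X b s (X (a + b) t w)" by auto
qed

end

end

context twisted_chevalley begin

context
  fixes e :: int
  assumes e: "e = 1 \<or> e = -1"
begin

text \<open>The fixed element is \<open>x\<^sub>a(1) x\<^sub>b(1) x\<^bsub>a+b\<^esub>(w)\<close> with \<open>w + f w = - N\<^sub>a\<^sub>b\<close>.\<close>

lemma heisenberg_pair:
  assumes i: "i < rk" and j: "j < rk" and ij: "i \<noteq> j" "\<tau> i = j" "\<tau> j = i" and m: "m i = 1" "m j = 1"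
    and simply: "cart (simple_root i) (simple_root j) = -1" "cart (simple_root j) (simple_root i) = -1"
    and f: "f \<noteq> id" "f ^^ 2 = id"
  shows "\<exists>g\<in>fx e. \<forall>k<rk. phi e k g \<noteq> 0 \<longleftrightarrow> k \<in> {i, j}"
proof -
  let ?a = "sroot e i" and ?b = "sroot e j"
  define c where "c = ?a + ?b"
  define n where "n = (of_int (N ?a ?b) :: 'k)"
  note roots = a2_roots[OF e i j ij(1) simply, folded c_def]
  note heis = a2_heisenberg[where 'k = 'k, OF e i j ij(1) simply, folded c_def n_def]
  note center = a2_center[where 'k = 'k, OF e i j ij(1) simply, folded c_def]
  have nn: "n * n = 1" using a2_constant[OF e i j ij(1) simply] unfolding n_def by auto
  have ff: "f (f y) = y" for y using f(2) by (simp add: numeral_2_eq_2 fun_eq_iff)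
  \<comment> \<open>An element of nonzero trace. In odd characteristic 1 will do. In characteristic
    2 a zero trace everywhere would mean f y = y for all y.\<close>
  obtain y where y: "y + f y \<noteq> 0"
  proof (cases "(2 :: 'k) = 0")
    case True
    obtain y where "f y \<noteq> y" using f(1) by (auto simp: fun_eq_iff)
    moreover have "y + y = 0" using True by (metis mult_2 mult_zero_left)
    ultimately have "y + f y \<noteq> 0" by (metis add_left_imp_eq)
    then show ?thesis using that by blast
  next
    case False
    then show ?thesis using that[of 1] f_simps(4) by simp
  qed
  \<comment> \<open>The denominator is fixed by the involution f, and so is n; hence w and f w add
    up to -n.\<close>
  define w where "w = - n * y / (y + f y)"
  have fn: "f n = n"
    using a2_constant[OF e i j ij(1) simply] unfolding n_def by (auto simp: f_simps)
  have "f w * (y + f y) = - n * f y"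
  proof -
    have "w * (y + f y) = - n * y" unfolding w_def using y by simp
    then have "f (w * (y + f y)) = f (- n * y)" by simp
    then show ?thesis by (simp add: f_simps ff fn add.commute)
  qed
  moreover have "w * (y + f y) = - n * y" unfolding w_def using y by simp
  ultimately have "(w + f w) * (y + f y) = - n * (y + f y)" by (simp add: algebra_simps)
  then have w: "w + f w = - n" using y by (metis mult_right_cancel)
  have eht: "e * ht ?a > 0" "e * ht ?b > 0" "e * ht c > 0"
    unfolding c_def ht_add sroot_ht[OF e i] sroot_ht[OF e j] using e by auto
  note in_unip = X_in_unip[OF roots(1) eht(1)] X_in_unip[OF roots(2) eht(2)] X_in_unip[OF roots(3) eht(3)]
  note CGs = in_unip[THEN unip_CG]
  have \<sigma>a: "\<sigma> (X ?a t) = X ?b (f t)" and \<sigma>b: "\<sigma> (X ?b t) = X ?a (f t)" for t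
    using sroot_\<sigma>[OF e i] sroot_\<sigma>[OF e j] ij m by simp_all
  have Xab: "X ?b t (X ?a s v) = X ?a s (X ?b t (X c (- n * s * t) v))" for s t v
  proof -
    have "X ?a s (X ?b t (X c (- n * s * t) v)) = X ?b t (X c (n * s * t) (X c (- n * s * t) (X ?a s v)))"
      unfolding heis center by simp
    then show ?thesis using X_inverse_apply(1)[OF roots(3), of "n * s * t"] by simp
  qed
  \<comment> \<open>The automorphism is prescribed only at fundamental roots and their negatives, so
    x_c(t) is written as a commutator. Exchanging a and b inverts it, whence the minus sign in the
    image.\<close>
  have word: "X c t = X ?b (-1) \<circ> X ?a (n * t) \<circ> X ?b 1 \<circ> X ?a (- n * t)" for t
  proof (rule ext)
    fix v
    show "X c t v = (X ?b (-1) \<circ> X ?a (n * t) \<circ> X ?b 1 \<circ> X ?a (- n * t)) v"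
      using X_inverse_apply(1)[OF roots(1), of "n * t" v] X_inverse_apply(2)[OF roots(2), of "1 :: 'k"]
      by (simp add: heis[of "n * t" 1] nn mult.assoc[symmetric])
  qed
  have \<sigma>c: "\<sigma> (X c t) = X c (- f t)" for t
  proof -
    have "\<sigma> (X c t) = X ?a (-1) \<circ> X ?b (n * f t) \<circ> X ?a 1 \<circ> X ?b (- n * f t)"
      unfolding word[of t] by (simp only: \<sigma>_comp lp_subgroup_comp[OF CG_subgroup] CGs \<sigma>a \<sigma>b f_simps fn)
    also have "\<dots> = X c (- f t)"
    proof (rule ext)
      fix v
      show "(X ?a (-1) \<circ> X ?b (n * f t) \<circ> X ?a 1 \<circ> X ?b (- n * f t)) v = X c (- f t) v"
        using X_inverse_apply(1)[OF roots(2), of "n * f t"] X_inverse_apply(2)[OF roots(1), of "1 :: 'k"]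
        by (simp add: Xab[of "n * f t" 1] center nn mult.assoc[symmetric])
    qed
    finally show ?thesis .
  qed
  define g where "g = X ?a 1 \<circ> X ?b 1 \<circ> X c w"
  have "\<sigma> g = X ?b 1 \<circ> X ?a 1 \<circ> X c (- f w)"
    unfolding g_def by (simp only: \<sigma>_comp lp_subgroup_comp[OF CG_subgroup] CGs \<sigma>a \<sigma>b \<sigma>c f_simps)
  also have "\<dots> = X ?a 1 \<circ> X ?b 1 \<circ> (X c (- n) \<circ> X c (- f w))"
    by (rule ext) (simp add: Xab[of 1 1])
  also have "X c (- n) \<circ> X c (- f w) = X c w"
    unfolding X_add[OF roots(3)] using w by (metis add_diff_cancel_right' diff_conv_add_uminus)
  finally have "\<sigma> g = g" unfolding g_def .
  moreover have gu: "g \<in> unip e" unfolding g_def by (intro unip_comp[OF e] in_unip)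
  moreover have "phi e k g \<noteq> 0 \<longleftrightarrow> k \<in> {i, j}" if k: "k < rk" for k
  proof -
    have "c i \<noteq> sroot e k i \<or> c j \<noteq> sroot e k j" unfolding c_def using ij e by (auto simp: sroot_apply)
    then have ck: "c \<noteq> sroot e k" by metis
    have "phi e k g = phi e k (X ?a (1 :: 'k)) + phi e k (X ?b (1 :: 'k)) + phi e k (X c w)"
      unfolding g_def by (simp only: phi_comp_unip[OF e] unip_comp[OF e] in_unip k)
    also have "\<dots> = (if i = k then of_int e else 0) + (if j = k then of_int e else 0)"
      unfolding phi_x[OF e i k] phi_x[OF e j k] phi_X[OF e roots(3) eht(3) k] using ck by simp
    finally show ?thesis using ij e_nonzero[OF e] by auto
  qed
  ultimately show ?thesis unfolding fx_def by blast
qed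

text \<open>The automorphism rotates the three factors cyclically; moving the factor at i back past
  the other two restores the product.\<close>

lemma triple_orbit:
  assumes n: "i < rk" "j < rk" "k < rk" "i \<noteq> j" "i \<noteq> k" "j \<noteq> k" and \<tau>: "\<tau> i = j" "\<tau> j = k" "\<tau> k = i"
    and g: "dyn_gram D i j = 0" "dyn_gram D i k = 0"
  shows "\<exists>g\<in>fx e. \<forall>h<rk. phi e h g \<noteq> 0 \<longleftrightarrow> h \<in> {i, j, k}"
proof -
  let ?x = "\<lambda>i. X (sroot e i) (1 :: 'k)"
  define g where "g = ?x i \<circ> ?x j \<circ> ?x k"
  note x_unip = x_unip[OF e]
  have "\<sigma> g = ?x j \<circ> ?x k \<circ> ?x i"
    unfolding g_def by (simp only: \<sigma>_comp lp_subgroup_comp[OF CG_subgroup] x_CG[OF e n(1)] x_CG[OF e n(2)] x_CG[OF e n(3)]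
      \<sigma>_x[OF e n(1)] \<sigma>_x[OF e n(2)] \<sigma>_x[OF e n(3)] \<tau>)
  also have "\<dots> = ?x j \<circ> ?x i \<circ> ?x k"
    using sroot_X_commute[OF e n(1,3,5) assms(11), where ?'k='k] by (metis comp_assoc)
  also have "\<dots> = g"
    unfolding g_def using sroot_X_commute[OF e n(1,2,4) assms(10), where ?'k='k] by metis
  finally have "\<sigma> g = g" .
  moreover have "g \<in> unip e" unfolding g_def by (intro unip_comp[OF e] x_unip n)
  moreover have "phi e h g \<noteq> 0 \<longleftrightarrow> h \<in> {i, j, k}" if h: "h < rk" for h
  proof -
    have "phi e h g = phi e h (?x i) + phi e h (?x j) + phi e h (?x k)"
      unfolding g_def by (simp only: phi_comp_unip[OF e] unip_comp[OF e] x_unip n h)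
    then show ?thesis unfolding phi_x[OF e n(1) h] phi_x[OF e n(2) h] phi_x[OF e n(3) h]
      using n e_nonzero[OF e] by auto
  qed
  ultimately show ?thesis unfolding fx_def by blast
qed

end

end

section \<open>Pairs of type B_2 and elements of odd order\<close>

context chevalley begin

text \<open>Apply both sides to e_{-r}: the left produces t times a co-root coefficient, while the
  right reaches the Cartan part only if r is a multiple of s. The coefficient is tested in the
  field, since it may vanish in characteristic 2.\<close>

lemma X_eq_zero:
  fixes t t' :: "'k::field"
  assumes r: "r \<in> R" and s: "s \<in> R" and ne: "\<And>k. r \<noteq> smul k s" and i: "i < rk"
    and co: "of_int (coroot_coeff D r i) \<noteq> (0 :: 'k)" and eq: "X r t = X s t'"
  shows "t = 0"
proof -
  have r': "- r \<in> R" using r uminus_in_R by blast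
  have "X s t' (bvec (Eb (- r))) (Hb i) = 0"
  proof (rule ccontr)
    assume "X s t' (bvec (Eb (- r))) (Hb i) \<noteq> 0"
    then obtain k where "wt (Hb i) = wt (Eb (- r)) + smul (int k) s"
      using X_coef_wt[of "Eb (- r)" "Hb i" s t'] i r' by auto
    then have "r = smul (int k) s" by (simp add: wt_def fun_eq_iff)
    then show False using ne by blast
  qed
  then have "X r t (bvec (Eb (- r))) (Hb i) = 0" using eq by simp
  then show ?thesis using co X_opposite[OF r, of t] i by (simp add: hvec_apply bvec_apply)
qed

context
  fixes e :: int and i j :: nat
  assumes e: "e = 1 \<or> e = -1" and ij: "i < rk" "j < rk" "i \<noteq> j"
    and b2: "\<kappa> = 2" "dyn_len D i = 2" "dyn_len D j = 4" "dyn_gram D i j = -2"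
begin

private abbreviation "p \<equiv> sroot e i"
private abbreviation "q \<equiv> sroot e j"

lemma b2_string:
  "smul k p + q \<in> R \<longleftrightarrow> 0 \<le> k \<and> k \<le> 2" "smul k q + p \<in> R \<longleftrightarrow> 0 \<le> k \<and> k \<le> 1"
  using sroot_string[OF e ij] sroot_string[OF e ij(2,1)] ij cart_simple[OF ij(1,2)] cart_simple[OF ij(2,1)]
    dyn_gram_sym[of D j i] b2 by auto

lemma b2_ip: "ip (smul k p + smul l q) (smul k p + smul l q) = 2 * k * k - 4 * k * l + 4 * l * l"
proof -
  have "ip p p = 2" "ip q q = 4" "ip p q = -2" "ip q p = -2"
    using e ij dyn_gram_sym[of D j i] b2
    by (auto simp: sroot_def root_ip_linear root_ip_simple_simple dyn_gram_diag)
  then show ?thesis unfolding root_ip_linear by (simp add: algebra_simps)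
qed

text \<open>Rules out 2p + 2q and 3p + 2q, whose norms are 8 and 10.\<close>

lemma b2_norm: "smul k p + smul l q \<in> R \<Longrightarrow> 2 * k * k - 4 * k * l + 4 * l * l \<in> {2, 4}"
  using root_norm b2_ip b2(1) by fastforce

lemma b2_roots: "p \<in> R" "q \<in> R" "p + q \<in> R" "p + (p + q) \<in> R" "p + (p + (p + q)) \<notin> R"
    "q + (p + q) \<notin> R" "q + (p + (p + q)) \<notin> R" "(p + q) + (p + (p + q)) \<notin> R"
    "q \<noteq> - p" "p + q \<noteq> - p" "p + q \<noteq> - q" "p + (p + q) \<noteq> - p" "p + (p + q) \<noteq> - q" "p + (p + q) \<noteq> - (p + q)"
proof -
  show "p \<in> R" "q \<in> R" using sroot_R(1)[OF e] ij by auto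
  have "smul 1 p + q = p + q" "smul 2 p + q = p + (p + q)" "smul 3 p + q = p + (p + (p + q))" "smul 2 q + p = q + (p + q)"
    by (simp_all add: fun_eq_iff)
  then show "p + q \<in> R" "p + (p + q) \<in> R" "p + (p + (p + q)) \<notin> R" "q + (p + q) \<notin> R"
    using b2_string(1)[of 1] b2_string(1)[of 2] b2_string(1)[of 3] b2_string(2)[of 2] by auto
  have "smul 2 p + smul 2 q = q + (p + (p + q))" "smul 3 p + smul 2 q = (p + q) + (p + (p + q))"
    by (simp_all add: fun_eq_iff)
  then show "q + (p + (p + q)) \<notin> R" "(p + q) + (p + (p + q)) \<notin> R"
    using b2_norm[of 2 2] b2_norm[of 3 2] by auto
  have "q j \<noteq> (- p) j" "(p + q) j \<noteq> (- p) j" "(p + q) i \<noteq> (- q) i"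
    "(p + (p + q)) i \<noteq> (- p) i" "(p + (p + q)) i \<noteq> (- q) i" "(p + (p + q)) i \<noteq> (- (p + q)) i"
    using e ij(3) by (auto simp: sroot_apply)
  then show "q \<noteq> - p" "p + q \<noteq> - p" "p + q \<noteq> - q" "p + (p + q) \<noteq> - p" "p + (p + q) \<noteq> - q" "p + (p + q) \<noteq> - (p + q)"
    by metis+
qed

lemma b2_constants: "\<bar>N p q\<bar> = 1" "\<bar>N p (p + q)\<bar> = 2"
proof -
  have "\<bar>N p q\<bar> = int 0 + 1"
  proof (rule N_abs[OF b2_roots(1,2,3)])
    fix k :: nat
    show "q + smul (- int k) p \<in> R \<longleftrightarrow> k \<le> 0"
      using b2_string(1)[of "- int k"] by (simp add: add.commute)
  qed
  then show "\<bar>N p q\<bar> = 1" by simp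
  have "\<bar>N p (p + q)\<bar> = int 1 + 1"
  proof (rule N_abs[OF b2_roots(1,3,4)])
    fix k :: nat
    have *: "p + q + smul (- int k) p = smul (1 - int k) p + q" by (simp add: fun_eq_iff algebra_simps)
    show "p + q + smul (- int k) p \<in> R \<longleftrightarrow> k \<le> 1"
      unfolding * b2_string(1) by auto
  qed
  then show "\<bar>N p (p + q)\<bar> = 2" by simp
qed

context
  assumes two: "(2 :: 'k::field) = 0"
begin

text \<open>The commutator of \<open>x\<^sub>p(1)\<close> and \<open>x\<^sub>q(1)\<close>. It is an involution, hence unchanged when \<open>p\<close> and
  \<open>q\<close> are exchanged.\<close>

abbreviation "b2_w \<equiv> X (p + q) (1 :: 'k) \<circ> X (p + (p + q)) 1"

lemma X_involution: "r \<in> R \<Longrightarrow> X r (1 :: 'k) (X r 1 v) = v"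
proof -
  assume r: "r \<in> R"
  have "(1 :: 'k) + 1 = 0" using two by simp
  then have "X r (1 :: 'k) \<circ> X r 1 = id" unfolding X_add[OF r] by (simp only: X_zero[OF r])
  then show ?thesis by (metis comp_apply id_apply)
qed

lemma b2_of_int: "\<bar>n\<bar> = 1 \<Longrightarrow> of_int n = (1 :: 'k)"
proof -
  assume "\<bar>n\<bar> = 1"
  moreover have "- 1 = (1 :: 'k)" using two by (metis add_eq_0_iff one_add_one)
  ultimately show ?thesis by (auto simp: abs_if split: if_splits)
qed

lemma b2_commute:
  shows "X p 1 (X (p + q) (1 :: 'k) v) = X (p + q) 1 (X p 1 v)"
    and "X p 1 (X (p + (p + q)) (1 :: 'k) v) = X (p + (p + q)) 1 (X p 1 v)"
    and "X q 1 (X (p + q) (1 :: 'k) v) = X (p + q) 1 (X q 1 v)"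
    and "X q 1 (X (p + (p + q)) (1 :: 'k) v) = X (p + (p + q)) 1 (X q 1 v)"
    and "X (p + q) 1 (X (p + (p + q)) (1 :: 'k) v) = X (p + (p + q)) 1 (X (p + q) 1 v)"
proof -
  note r = b2_roots
  \<comment> \<open>The constant is even, so the Heisenberg relation for p and p + q degenerates to
    commutation in characteristic 2.\<close>
  have "N p (p + q) = 2 \<or> N p (p + q) = -2" using b2_constants(2) by auto
  then have "of_int (N p (p + q)) = (0 :: 'k)" using two by auto
  then have "X p 1 \<circ> X (p + q) 1 = X (p + q) 1 \<circ> (X p 1 :: 'k lie_map)"
    using X_heisenberg[OF r(1,3,4,5) r(8) r(10,12,14)] X_zero[OF r(4)] by (metis comp_id)
  then show "X p 1 (X (p + q) (1 :: 'k) v) = X (p + q) 1 (X p 1 v)" by (metis comp_apply)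
  show "X p 1 (X (p + (p + q)) (1 :: 'k) v) = X (p + (p + q)) 1 (X p 1 v)"
    using X_commute[OF r(1,4,12,5)] by (metis comp_apply)
  show "X q 1 (X (p + q) (1 :: 'k) v) = X (p + q) 1 (X q 1 v)"
    using X_commute[OF r(2,3,11,6)] by (metis comp_apply)
  show "X q 1 (X (p + (p + q)) (1 :: 'k) v) = X (p + (p + q)) 1 (X q 1 v)"
    using X_commute[OF r(2,4,13,7)] by (metis comp_apply)
  show "X (p + q) 1 (X (p + (p + q)) (1 :: 'k) v) = X (p + (p + q)) 1 (X (p + q) 1 v)"
    using X_commute[OF r(3,4,14,8)] by (metis comp_apply)
qed

lemma b2_commutator: "b2_w = X q 1 \<circ> X p 1 \<circ> X q 1 \<circ> X p 1" "b2_w = X p 1 \<circ> X q 1 \<circ> X p 1 \<circ> X q 1"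
proof -
  define d where "d = p + (p + q)"
  note r = b2_roots[folded d_def] and comm = b2_commute[folded d_def]
  define m where "m = N p q * N p (p + q) div 2"
  have m: "2 * m = N p q * N p (p + q)" "\<bar>m\<bar> = 1"
  proof -
    have "(N p q = 1 \<or> N p q = -1) \<and> (N p (p + q) = 2 \<or> N p (p + q) = -2)" using b2_constants by linarith
    then show "2 * m = N p q * N p (p + q)" "\<bar>m\<bar> = 1" unfolding m_def by auto
  qed
  have "X p 1 \<circ> X q 1 = X q 1 \<circ> X (p + q) 1 \<circ> X d 1 \<circ> (X p 1 :: 'k lie_map)"
    using X_b2_commutator[OF b2_roots m(1), where 'k = 'k] unfolding b2_of_int[OF m(2)] b2_of_int[OF b2_constants(1)] d_def .
  then have *: "X p 1 (X q 1 v) = X q 1 (X (p + q) 1 (X d (1 :: 'k) (X p 1 v)))" for v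
    by (metis comp_apply)
  note inv = X_involution[OF r(1)] X_involution[OF r(2)] X_involution[OF r(3)] X_involution[OF r(4)]
  show "b2_w = X q 1 \<circ> X p 1 \<circ> X q 1 \<circ> X p 1"
    unfolding d_def[symmetric] by (rule ext) (simp add: * inv)
  show "b2_w = X p 1 \<circ> X q 1 \<circ> X p 1 \<circ> X q 1"
    unfolding d_def[symmetric] by (rule ext) (simp add: * comm inv)
qed

text \<open>Conjugation by the diagonal map changes the parameters of the two factors. Equality with
  the original forces an element of one root subgroup into the other, so both parameters stay 1.
  Thus the character is 1 at p + q and 2p + q, hence at their difference p and at q.\<close>

lemma b2_regular:
  assumes c: "\<And>k. c k \<noteq> 0" and com: "tor c \<circ> b2_w = b2_w \<circ> tor c"
  shows "c i = 1" "c j = 1"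
proof -
  define d where "d = p + (p + q)"
  define w where "w = X (p + q) (1 :: 'k) \<circ> X d 1"
  note r = b2_roots[folded d_def]
  note com = com[folded d_def, folded w_def]
  let ?c = "chi c (p + q)" and ?d = "chi c d"
  have *: "X (p + q) ?c \<circ> X d ?d = w"
  proof (rule ext)
    fix w' :: "chev_idx \<Rightarrow> 'k"
    obtain v where v: "w' = tor c v" using tor_surj[OF c] .
    show "(X (p + q) ?c \<circ> X d ?d) w' = w w'"
      using fun_cong[OF com, of v] unfolding v w_def by (simp add: tor_X_apply[of c, OF c])
  qed
  have eq: "X (p + q) (?c - 1) = X d (1 - ?d)"
  proof (rule ext)
    fix v :: "chev_idx \<Rightarrow> 'k"
    have "X (p + q) (-1) (X (p + q) ?c (X d ?d (X d (- ?d) v))) =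
        X (p + q) (-1) (X (p + q) 1 (X d 1 (X d (- ?d) v)))"
      using fun_cong[OF *, of "X d (- ?d) v"] unfolding w_def by simp
    moreover have "X (p + q) (-1) (X (p + q) ?c v) = X (p + q) (?c - 1) v"
      using fun_cong[OF X_add[OF r(3), of "-1" ?c], of v] by simp
    moreover have "X d 1 (X d (- ?d) v) = X d (1 - ?d) v"
      using fun_cong[OF X_add[OF r(4), of 1 "- ?d"], of v] by simp
    ultimately show "X (p + q) (?c - 1) v = X d (1 - ?d) v"
      using X_inverse_apply(1)[OF r(4), of ?d v] X_inverse_apply(2)[OF r(3), of "1 :: 'k"] by simp
  qed
  have norm: "ip (p + q) (p + q) = 2" "ip d d = 4"
  proof -
    have "smul 1 p + smul 1 q = p + q" "smul 2 p + smul 1 q = d" by (simp_all add: d_def fun_eq_iff)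
    then show "ip (p + q) (p + q) = 2" "ip d d = 4"
      using b2_ip[of 1 1] b2_ip[of 2 1] by simp_all
  qed
  have ne: "p + q \<noteq> smul k d" "d \<noteq> smul k (p + q)" for k
  proof -
    have "\<not> ((p + q) i = smul k d i \<and> (p + q) j = smul k d j)"
      "\<not> (d i = smul k (p + q) i \<and> d j = smul k (p + q) j)"
      using e ij(3) by (auto simp: d_def sroot_apply)
    then show "p + q \<noteq> smul k d" "d \<noteq> smul k (p + q)" by metis+
  qed
  \<comment> \<open>The coordinates i and j are chosen so that these co-root coefficients are units;
    in characteristic 2 an even one would be useless.\<close>
  have co: "coroot_coeff D (p + q) i = e" "coroot_coeff D d j = e"
    unfolding coroot_coeff_def norm b2 using ij(3) by (simp_all add: d_def sroot_apply)
  have e0: "of_int e \<noteq> (0 :: 'k)" using e by auto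
  have "?c - 1 = 0" by (rule X_eq_zero[OF r(3,4) ne(1) ij(1) _ eq]) (simp only: co e0 not_False_eq_True)
  moreover have "1 - ?d = 0" by (rule X_eq_zero[OF r(4,3) ne(2) ij(2) _ eq[symmetric]]) (simp only: co e0 not_False_eq_True)
  ultimately have "chi c p * chi c q = 1" "chi c p * (chi c p * chi c q) = 1"
    unfolding d_def chi_add[of c, OF c] by simp_all
  then have "chi c p = 1" "chi c q = 1" by simp_all
  then show "c i = 1" "c j = 1"
    using e chi_sroot[OF ij(1), of c e] chi_sroot[OF ij(2), of c e] unfolding sroot_def by (auto simp: power_int_minus)
qed

lemma b2_unip: "b2_w \<in> unip e"
proof (rule lp_subgroup_comp[OF unip_subgroup X_in_unip[OF b2_roots(3)] X_in_unip[OF b2_roots(4)]])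
  show "e * ht (p + q) > 0" "e * ht (p + (p + q)) > 0"
    unfolding ht_add sroot_ht[OF e ij(1)] sroot_ht[OF e ij(2)] using e by auto
qed

lemma b2_phi:
  assumes k: "k < rk"
  shows "phi e k b2_w = 0"
proof -
  have h: "e * ht (p + q) > 0" "e * ht (p + (p + q)) > 0"
    unfolding ht_add sroot_ht[OF e ij(1)] sroot_ht[OF e ij(2)] using e by auto
  have "ht (p + q) \<noteq> ht (sroot e k)" "ht (p + (p + q)) \<noteq> ht (sroot e k)"
    unfolding ht_add sroot_ht[OF e ij(1)] sroot_ht[OF e ij(2)] sroot_ht[OF e k] using e by auto
  then have "p + q \<noteq> sroot e k" "p + (p + q) \<noteq> sroot e k" by metis+
  then show ?thesis
    using phi_comp[OF e tri_X[OF b2_roots(3) h(1)] tri_X[OF b2_roots(4) h(2)] k, of "1 :: 'k" 1]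
      phi_X[OF e b2_roots(3) h(1) k, of "1 :: 'k"] phi_X[OF e b2_roots(4) h(2) k, of "1 :: 'k"] by simp
qed

end

end

text \<open>Powers of g range over finitely many matrices, so some positive power is the identity.
  While the exponent is even, half of it gives an involution, which is trivial by
  \<open>tri_involution\<close>; the exponent can be halved until it is odd.\<close>

lemma unip_odd_order:
  fixes g :: "'k::{field,finite} lie_map"
  assumes g: "g \<in> unip e" and two: "(2 :: 'k) \<noteq> 0"
  obtains k where "g ^^ (2 * k + 1) = id"
proof -
  have pow: "g ^^ n \<in> unip e" for n
    using lp_subgroup_comp[OF unip_subgroup g] lp_subgroup_id[OF unip_subgroup] by (induction n) auto
  have b: "bij (g ^^ n)" for n
    by (rule lp_subgroup_bij[OF unip_subgroup pow])
  have odd: "n > 0 \<Longrightarrow> g ^^ n = id \<Longrightarrow> \<exists>n. odd n \<and> g ^^ n = id" for n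
  proof (induction n rule: less_induct)
    case (less n)
    show ?case
    proof (cases "odd n")
      case False
      then obtain k where k: "n = k + k" by (metis evenE mult_2)
      have "g ^^ k = id"
        by (rule tri_involution[OF unip_tri[OF pow] _ two]) (use less.prems(2) in \<open>simp only: k funpow_add\<close>)
      then show ?thesis using less.IH[of k] less.prems k by simp
    qed (use less in blast)
  qed
  have "range (\<lambda>n. g ^^ n) \<subseteq> {g. is_bmat Bs g}" using tri_bmat[OF unip_tri[OF pow]] by auto
  then have "\<not> inj (\<lambda>n. g ^^ n)"
    using finite_subset[OF _ finite_is_bmat[OF finite_Bs]] finite_imageD[of "\<lambda>n. g ^^ n" UNIV] infinite_UNIV_nat by blast
  then obtain m n where mn: "m < n" "g ^^ m = g ^^ n"
    unfolding inj_def by (metis linorder_neqE_nat)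
  have "g ^^ (m + (n - m)) = g ^^ m" using mn by simp
  then have "g ^^ m \<circ> id = g ^^ m \<circ> g ^^ (n - m)" unfolding funpow_add comp_id by (rule sym)
  then have "g ^^ (n - m) = id" using bij_comp_cancel(1)[OF b] by metis
  then obtain n where "odd n" "g ^^ n = id" using odd[of "n - m"] mn by auto
  then show ?thesis using that by (metis oddE)
qed

end

section \<open>Fixed elements for pairs of type G_2 and B_2\<close>

context twisted_chevalley begin

context
  fixes e :: int
  assumes e: "e = 1 \<or> e = -1"
begin

text \<open>The element \<open>d = y\<inverse> \<sigma>(y)\<close> has odd order and is inverted by \<open>\<sigma>\<close>. If \<open>s\<close> is its square
  root among its powers, then \<open>y s\<close> is fixed by \<open>\<sigma>\<close>.\<close>

lemma square_root_correction:
  assumes y: "y \<in> unip e" and \<sigma>y: "\<sigma> y \<in> unip e" "\<sigma> (\<sigma> y) = y" and two: "(2 :: 'k) \<noteq> 0"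
    and phi: "\<And>i. i < rk \<Longrightarrow> phi e i (\<sigma> y) = phi e i y"
  shows "\<exists>g\<in>fx e. \<forall>i<rk. phi e i g = phi e i y"
proof -
  let ?inv = "\<lambda>g. inv\<^bsub>lie_perm\<^esub> g"
  note sub = unip_subgroup[where 'a = 'k, of e]
  note invs = lp_inv_bij[OF lp_subgroup_bij[OF sub]]
  have yi: "?inv y \<in> unip e" "?inv (\<sigma> y) \<in> unip e"
    using subgroup.m_inv_closed[OF sub] y \<sigma>y by auto
  define d where "d = ?inv y \<circ> \<sigma> y"
  define d' where "d' = ?inv (\<sigma> y) \<circ> y"
  have d: "d \<in> unip e" unfolding d_def by (rule unip_comp[OF e yi(1) \<sigma>y(1)])
  have \<sigma>d: "\<sigma> d = d'"
    unfolding d_def d'_def using \<sigma>_comp[OF unip_CG[OF yi(1)] unip_CG[OF \<sigma>y(1)]] \<sigma>_inv[OF unip_CG[OF y]] \<sigma>y(2) by simp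
  have dd: "d \<circ> d' = id" "y \<circ> d = \<sigma> y"
  proof -
    show "y \<circ> d = \<sigma> y" unfolding d_def using invs(2)[OF y] by (metis comp_assoc id_comp)
    have "d \<circ> d' = ?inv y \<circ> (\<sigma> y \<circ> ?inv (\<sigma> y)) \<circ> y" unfolding d_def d'_def by (simp add: comp_assoc)
    then show "d \<circ> d' = id" using invs(2)[OF \<sigma>y(1)] invs(3)[OF y] by simp
  qed
  have pow: "d ^^ n \<in> unip e" for n
    using unip_comp[OF e d] lp_subgroup_id[OF sub] by (induction n) auto
  have \<sigma>pow: "\<sigma> (d ^^ n) = d' ^^ n" for n
    using \<sigma>_id \<sigma>d \<sigma>_comp[OF unip_CG[OF d] unip_CG[OF pow]] by (induction n) auto
  have cancel: "d ^^ n \<circ> d' ^^ n = id" for n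
  proof (induction n)
    case (Suc n)
    have "d ^^ Suc n \<circ> d' ^^ Suc n = d ^^ n \<circ> (d \<circ> d') \<circ> d' ^^ n"
      by (simp only: funpow_Suc_right[of n d] funpow.simps(2)[of n d'] comp_assoc)
    also have "\<dots> = id" unfolding dd(1) comp_id by (rule Suc)
    finally show ?case .
  qed simp
  obtain k where k: "d ^^ (2 * k + 1) = id" using unip_odd_order[OF d two] .
  define g where "g = y \<circ> d ^^ (k + 1)"
  have g: "g \<in> unip e" unfolding g_def by (rule unip_comp[OF e y pow])
  have "d = d ^^ (k + 1) \<circ> d ^^ (k + 1)"
  proof -
    have "d ^^ (k + 1) \<circ> d ^^ (k + 1) = d ^^ (1 + (2 * k + 1))"
      unfolding funpow_add[symmetric] by (simp add: mult_2)
    also have "\<dots> = d" unfolding funpow_add[of 1] k by simp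
    finally show ?thesis ..
  qed
  then have "d \<circ> d' ^^ (k + 1) = d ^^ (k + 1) \<circ> (d ^^ (k + 1) \<circ> d' ^^ (k + 1))" by (metis comp_assoc)
  then have "d \<circ> d' ^^ (k + 1) = d ^^ (k + 1)" unfolding cancel by simp
  moreover have "\<sigma> g = y \<circ> (d \<circ> d' ^^ (k + 1))"
    unfolding g_def \<sigma>_comp[OF unip_CG[OF y] unip_CG[OF pow]] \<sigma>pow dd(2)[symmetric] by (simp only: comp_assoc)
  ultimately have "\<sigma> g = g" unfolding g_def by simp
  moreover have "phi e i g = phi e i y" if i: "i < rk" for i
  proof -
    note add = phi_comp_unip[OF e _ _ i]
    have "phi e i (\<sigma> y) = phi e i y + phi e i d" using add[OF y d] dd(2) by simp
    then have "phi e i d = 0" using phi[OF i] by simp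
    then have "phi e i (d ^^ n) = 0" for n
      using add[OF d pow] phi_id[OF e i, where 'a = 'k] by (induction n) auto
    from this[of "k + 1"] show ?thesis unfolding g_def add[OF y pow] by (simp only: add_0_right)
  qed
  ultimately show ?thesis using g unfolding fx_def by blast
qed

text \<open>The two orders of multiplying the fundamental root elements are exchanged by the
  automorphism and have equal, nonzero components; the correction by a square root keeps
  these.\<close>

lemma regular_pair_odd:
  assumes rk: "rk = 2" and \<tau>01: "\<tau> 0 = 1" "\<tau> 1 = 0" and two: "(2 :: 'k) \<noteq> 0"
  shows "regular e"
proof -
  let ?x = "\<lambda>i. X (sroot e i) (1 :: 'k)"
  have r: "0 < rk" "1 < rk" using rk by auto
  note xu = x_unip[OF e r(1)] x_unip[OF e r(2)]
  have \<sigma>1: "\<sigma> (?x 0 \<circ> ?x 1) = ?x 1 \<circ> ?x 0" and \<sigma>2: "\<sigma> (?x 1 \<circ> ?x 0) = ?x 0 \<circ> ?x 1"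
    using \<sigma>_comp[OF unip_CG[OF xu(1)] unip_CG[OF xu(2)]] \<sigma>_comp[OF unip_CG[OF xu(2)] unip_CG[OF xu(1)]]
      \<sigma>_x[OF e r(1)] \<sigma>_x[OF e r(2)] \<tau>01 by simp_all
  have phi: "phi e i (?x 1 \<circ> ?x 0) = phi e i (?x 0 \<circ> ?x 1)" "phi e i (?x 0 \<circ> ?x 1) \<noteq> 0" if i: "i < rk" for i
  proof -
    have "i = 0 \<or> i = 1" using i rk by auto
    then show "phi e i (?x 1 \<circ> ?x 0) = phi e i (?x 0 \<circ> ?x 1)" "phi e i (?x 0 \<circ> ?x 1) \<noteq> 0"
      using phi_comp_unip[OF e xu(1) xu(2) i] phi_comp_unip[OF e xu(2) xu(1) i]
        phi_x[OF e r(1) i] phi_x[OF e r(2) i] e_nonzero[OF e] by auto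
  qed
  obtain g where g: "g \<in> fx e" "\<forall>i<rk. phi e i g = phi e i (?x 0 \<circ> ?x 1)"
    using square_root_correction[of "?x 0 \<circ> ?x 1", unfolded \<sigma>1 \<sigma>2, OF unip_comp[OF e xu] unip_comp[OF e xu(2,1)] refl two] phi(1)
    by blast
  show ?thesis by (rule regular_if_phi[OF e g(1)]) (use g(2) phi(2) in simp)
qed

context
  fixes i j :: nat
  assumes ij: "i < rk" "j < rk" "i \<noteq> j" and \<tau>ij: "\<tau> i = j" "\<tau> j = i"
    and b2: "\<kappa> = 2" "dyn_len D i = 2" "dyn_len D j = 4" "dyn_gram D i j = -2" and two: "(2 :: 'k) = 0"
begin

lemma b2_fixed: "b2_w e i j \<in> fx e"
proof -
  let ?x = "\<lambda>i. X (sroot e i) (1 :: 'k)"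
  note com = b2_commutator[OF e ij b2 two]
  note x = x_CG[OF e ij(1)] x_CG[OF e ij(2)]
  have "\<sigma> (?x j \<circ> ?x i \<circ> ?x j \<circ> ?x i) = ?x i \<circ> ?x j \<circ> ?x i \<circ> ?x j"
    by (simp only: \<sigma>_comp lp_subgroup_comp[OF CG_subgroup] x \<sigma>_x[OF e ij(1)] \<sigma>_x[OF e ij(2)] \<tau>ij)
  then have "\<sigma> (b2_w e i j) = b2_w e i j" unfolding com(1)[symmetric] com(2)[symmetric] .
  then show ?thesis unfolding fx_def using b2_unip[OF e ij b2 two] by blast
qed

text \<open>The factor \<open>y\<close> controls the nodes outside the pair, the commutator those
  inside, and the latter adds nothing to the components of \<open>y\<close>. Once the torus element
  is 1 outside the pair it commutes with \<open>y\<close>, which cancels, and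
  \<open>b2_regular\<close> applies.\<close>

lemma regular_b2:
  assumes y: "y \<in> fx e" "\<And>k. k < rk \<Longrightarrow> k \<notin> {i, j} \<Longrightarrow> phi e k y \<noteq> 0"
    and y_com: "\<And>c. (\<And>k. c k \<noteq> 0) \<Longrightarrow> (\<And>k. k < rk \<Longrightarrow> k \<notin> {i, j} \<Longrightarrow> c k = 1) \<Longrightarrow> tor c \<circ> y = y \<circ> tor c"
  shows "regular e"
proof -
  let ?w = "b2_w e i j"
  show ?thesis unfolding regular_def
  proof (intro bexI[of _ "y \<circ> ?w"] ballI impI)
    show "y \<circ> ?w \<in> fx e" by (rule fx_comp[OF y(1) b2_fixed])
    fix h :: "'k lie_map" assume h: "h \<in> chev_torus D N" and com: "h \<circ> (y \<circ> ?w) = y \<circ> ?w \<circ> h"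
    obtain c where c: "\<And>i. c i \<noteq> 0" "h = tor c" using torus_tor_like[OF h] unfolding tor_like_def by blast
    have c1: "c k = 1" if k: "k < rk" "k \<notin> {i, j}" for k
    proof (rule tor_commute_phi[OF e _ _ k(1) _ c(1)])
      show "is_bmat Bs (y \<circ> ?w)" by (rule tri_bmat[OF fx_tri[OF fx_comp[OF y(1) b2_fixed]]])
      show "tor c \<circ> (y \<circ> ?w) = y \<circ> ?w \<circ> tor c" using com unfolding c(2) .
      show "phi e k (y \<circ> ?w) \<noteq> 0"
        using phi_comp_unip[OF e fx_unip[OF y(1)] fx_unip[OF b2_fixed] k(1)] b2_phi[OF e ij b2 two k(1)] y(2)[OF k] by simp
    qed
    have "tor c \<circ> y = y \<circ> tor c" by (rule y_com[of c, OF c(1) c1])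
    then have "y \<circ> (tor c \<circ> ?w) = y \<circ> (?w \<circ> tor c)" using com unfolding c(2) by (metis comp_assoc)
    then have "tor c \<circ> ?w = ?w \<circ> tor c" by (rule bij_comp_cancel(1)[OF CG_bij[OF unip_CG[OF fx_unip[OF y(1)]]]])
    then have "c i = 1" "c j = 1" using b2_regular[OF e ij b2 two, of c, OF c(1)] by auto
    then have "c k = 1" if "k < rk" for k using c1[OF that] by auto
    then show "h = id" unfolding c(2) by (rule tor_one)
  qed
qed

end

end

section \<open>Twisted types one by one\<close>

context
  fixes e :: int
  assumes e: "e = 1 \<or> e = -1"
begin

lemma regular_order_two:
  assumes inv: "\<And>i. i < rk \<Longrightarrow> \<tau> (\<tau> i) = i" and len: "\<And>i. i < rk \<Longrightarrow> dyn_len D i = 2"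
    and m: "\<And>i. i < rk \<Longrightarrow> m i = 1" and f: "f \<noteq> id" "f ^^ 2 = id"
  shows "regular e"
proof (rule regular_involution[OF e inv])
  fix i assume i: "i < rk" "i < \<tau> i"
  show "\<exists>g\<in>fx e. \<forall>k<rk. phi e k g \<noteq> 0 \<longleftrightarrow> k \<in> {i, \<tau> i}"
  proof (cases "dyn_gram D i (\<tau> i) = 0")
    case True
    note pair = commuting_pair[OF e i(1) \<tau>[OF i(1)] _ refl inv[OF i(1)] True]
    show ?thesis
    proof (rule bexI)
      show "\<forall>k<rk. phi e k (X (sroot e i) (1 :: 'k) \<circ> X (sroot e (\<tau> i)) 1) \<noteq> 0 \<longleftrightarrow> k \<in> {i, \<tau> i}"
        by (rule pair(2)) (use i in simp)
    qed (rule pair(1), use i in simp)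
  next
    \<comment> \<open>Two adjacent nodes exchanged by the symmetry: the middle of a chain of even
      length, a pair of type A_2.\<close>
    case False
    then have "dyn_gram D i (\<tau> i) = -1"
      using i len[OF i(1)] len[OF \<tau>[OF i(1)]] unfolding dyn_gram_def by (auto split: if_splits)
    then have "cart (simple_root i) (simple_root (\<tau> i)) = -1" "cart (simple_root (\<tau> i)) (simple_root i) = -1"
      using i \<tau>[OF i(1)] len dyn_gram_sym[of D i "\<tau> i"] by (simp_all add: cart_simple)
    then show ?thesis
      by (intro heisenberg_pair[OF e i(1) \<tau>[OF i(1)] _ refl inv[OF i(1)] m[OF i(1)] m[OF \<tau>[OF i(1)]] _ _ f]) (use i in auto)
  qed
qed

lemma regular_triality:
  assumes D: "D = DynD 4" and t: "\<tau> = twist_symmetry Tw3D4"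
  shows "regular e"
proof -
  let ?Or = "\<lambda>p. if p = (0::nat) then {0, 2, 3} else {1::nat}"
  have "\<exists>g\<in>fx e. \<forall>j<rk. phi e j g \<noteq> 0 \<longleftrightarrow> j \<in> \<Union>(?Or ` {0, 1})"
  proof (rule combine_orbits[OF e])
    fix p :: nat assume "p \<in> {0, 1}"
    then consider "p = 0" | "p = 1" by blast
    then show "\<exists>g\<in>fx e. \<forall>j<rk. phi e j g \<noteq> 0 \<longleftrightarrow> j \<in> ?Or p"
    proof cases
      case 1
      show ?thesis
        using triple_orbit[OF e, of 0 2 3] D t 1 by (simp add: dyn_gram_def)
    next
      case 2
      show ?thesis using fixed_node[OF e, of 1] D t 2 by simp
    qed
  qed auto
  then obtain g where g: "g \<in> fx e" "\<forall>j<rk. phi e j g \<noteq> 0 \<longleftrightarrow> j \<in> \<Union>(?Or ` {0, 1})" by blast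
  have "j \<in> \<Union>(?Or ` {0, 1})" if "j < rk" for j using that D by auto
  then show ?thesis using regular_if_phi[OF e g(1)] g(2) by blast
qed

text \<open>The pair is the whole diagram, with the short node 1 in the role of p; nothing is left
  outside, so \<open>y\<close> is the identity.\<close>

lemma regular_suzuki:
  assumes D: "D = DynB 2" "\<kappa> = 2" and t: "\<tau> = twist_symmetry Tw2B2" and two: "(2 :: 'k) = 0"
  shows "regular e"
proof (rule regular_b2[OF e, of 1 0, OF _ _ _ _ _ _ _ _ _ two fx_id])
  show "phi e k (id :: 'k lie_map) \<noteq> 0" if "k < rk" "k \<notin> {1, 0}" for k using that D by auto
qed (use D t in \<open>simp_all add: dyn_gram_def\<close>)

text \<open>The inner nodes form the pair of type B_2, with short node 2. The outer nodes 0 and 3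
  are orthogonal, and the product of their elements commutes with every diagonal map that is 1
  there.\<close>

lemma regular_ree_F4:
  assumes D: "D = DynF4" "\<kappa> = 2" and t: "\<tau> = twist_symmetry Tw2F4" and two: "(2 :: 'k) = 0"
  shows "regular e"
proof -
  have r: "0 < rk" "3 < rk" using D by auto
  have g: "dyn_gram D 0 3 = 0" "\<tau> 0 = 3" "\<tau> 3 = 0" using D t by (simp_all add: dyn_gram_def)
  define y where "y = X (sroot e 0) (1 :: 'k) \<circ> X (sroot e 3) 1"
  note y = commuting_pair[OF e r _ g(2,3,1), folded y_def]
  show ?thesis
  proof (rule regular_b2[OF e, of 2 1, OF _ _ _ _ _ _ _ _ _ two y(1)])
    show "phi e k y \<noteq> 0" if "k < rk" "k \<notin> {2, 1}" for k
    proof -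
      have "k \<in> {0, 3}" using that D by auto
      then show ?thesis using y(2) that by auto
    qed
    fix c :: "nat \<Rightarrow> 'k" assume c: "\<And>k. c k \<noteq> 0" "\<And>k. k < rk \<Longrightarrow> k \<notin> {2, 1} \<Longrightarrow> c k = 1"
    have "chi c (sroot e 0) = 1" "chi c (sroot e 3) = 1"
      using chi_sroot[OF r(1), of c e] chi_sroot[OF r(2), of c e] c(2)[OF r(1)] c(2)[OF r(2)] unfolding sroot_def by simp_all
    then show "tor c \<circ> y = y \<circ> tor c"
      unfolding y_def by (intro ext) (simp add: tor_X_apply[of c, OF c(1)])
  qed (use D t in \<open>simp_all add: dyn_gram_def\<close>)
qed

end

end

section \<open>Passage from the class of groups to the abstract setting\<close>

lemma CHAR_2_eq: "CHAR('k::field) = 2 \<Longrightarrow> (2 :: 'k) = 0"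
  using of_nat_CHAR[where ?'a = 'k] by simp

lemma CHAR_3_neq: "CHAR('k::field) = 3 \<Longrightarrow> (2 :: 'k) \<noteq> 0"
proof
  assume "CHAR('k) = 3" "(2 :: 'k) = 0"
  then have "of_nat 2 = (0 :: 'k)" by simp
  then have "CHAR('k) dvd 2" by (simp only: of_nat_eq_0_iff_char_dvd)
  then show False using \<open>CHAR('k) = 3\<close> by simp
qed

lemma finite_dynkin_untwisted:
  assumes "class_L_type (Untwisted D) k"
  shows "\<exists>\<kappa> u. finite_dynkin D \<kappa> u"
proof (cases D)
  case (DynA l)
  show ?thesis unfolding DynA using finite_dynkin_A by blast
next
  case (DynB l)
  then have "l \<ge> 2" using assms by simp
  then show ?thesis using finite_dynkin_B unfolding DynB by blast
next
  case (DynC l)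
  then have "l \<ge> 2" using assms by simp
  then show ?thesis using finite_dynkin_C unfolding DynC by blast
next
  case (DynD l)
  then have "l \<ge> 4" using assms by simp
  then show ?thesis using finite_dynkin_D unfolding DynD by blast
next
  case (DynE l)
  then have "l \<in> {6, 7, 8}" using assms by simp
  then show ?thesis using finite_dynkin_E unfolding DynE by blast
next
  case DynF4
  show ?thesis unfolding DynF4 using finite_dynkin_F4 by blast
next
  case DynG2
  show ?thesis unfolding DynG2 using finite_dynkin_G2 by blast
qed

lemma twisted_chevalleyI:
  fixes \<sigma> :: "'k::{field,finite} lie_map \<Rightarrow> 'k lie_map"
  assumes "finite_dynkin (twist_diagram w) \<kappa> u" "chevalley_constants (twist_diagram w) N"
    and "twist_field_aut w f" "twist_aut w N f \<sigma>"
    and "\<And>i. i < dyn_rank (twist_diagram w) \<Longrightarrow> twist_symmetry w i < dyn_rank (twist_diagram w)"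
  shows "twisted_chevalley (twist_diagram w) \<kappa> u N \<sigma> (twist_symmetry w) f
    (\<lambda>i. nat (dyn_len (twist_diagram w) (twist_symmetry w i) div 2))"
proof -
  have "field_aut f" using assms(3) by (cases w) auto
  moreover have "\<sigma> \<in> hom (chev_group (twist_diagram w) N) (chev_group (twist_diagram w) N)"
    using assms(4) unfolding twist_aut_def Let_def iso_def by blast
  ultimately show ?thesis
    using assms unfolding twisted_chevalley_def twisted_chevalley_axioms_def chevalley_def chevalley_axioms_def twist_aut_def Let_def
    by blast
qed

lemma twisted_regular:
  fixes \<sigma> :: "'k::{field,finite} lie_map \<Rightarrow> 'k lie_map"
  assumes cl: "class_L_type (Twisted w) k" and N: "chevalley_constants (twist_diagram w) N"
    and f: "twist_field_aut w f" and \<sigma>: "twist_aut w N f \<sigma>"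
  shows "\<exists>\<kappa> u m. twisted_chevalley (twist_diagram w) \<kappa> u N \<sigma> (twist_symmetry w) f m \<and>
    (\<forall>e. e = 1 \<or> e = -1 \<longrightarrow> twisted_chevalley.regular (twist_diagram w) N \<sigma> e)"
proof (cases w)
  case (Tw2A l)
  interpret twisted_chevalley "twist_diagram w" 1 "\<lambda>i. (int i + 1) * (int l - int i)" N \<sigma> "twist_symmetry w" f
    "\<lambda>i. nat (dyn_len (twist_diagram w) (twist_symmetry w i) div 2)"
    by (rule twisted_chevalleyI[OF _ N f \<sigma>]) (use Tw2A finite_dynkin_A in auto)
  have "regular e" if "e = 1 \<or> e = -1" for e
    by (rule regular_order_two[OF that]) (use Tw2A f in auto)
  then show ?thesis using twisted_chevalley_axioms by blast
next
  case (Tw2D l)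
  then have l: "l \<ge> 4" using cl by simp
  interpret twisted_chevalley "twist_diagram w" 1
    "\<lambda>i. if i < l - 2 then 2 * ((int i + 1) * (2 * int l - int i)) else (int l - 1) * (int l + 2)" N \<sigma> "twist_symmetry w" f
    "\<lambda>i. nat (dyn_len (twist_diagram w) (twist_symmetry w i) div 2)"
    by (rule twisted_chevalleyI[OF _ N f \<sigma>]) (use Tw2D finite_dynkin_D[OF l] l in auto)
  have "regular e" if "e = 1 \<or> e = -1" for e
    by (rule regular_order_two[OF that]) (use Tw2D f l in auto)
  then show ?thesis using twisted_chevalley_axioms by blast
next
  case Tw2E6
  obtain u where u: "finite_dynkin (DynE 6) 1 u" using finite_dynkin_E[of 6] by auto
  interpret twisted_chevalley "twist_diagram w" 1 u N \<sigma> "twist_symmetry w" f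
    "\<lambda>i. nat (dyn_len (twist_diagram w) (twist_symmetry w i) div 2)"
    by (rule twisted_chevalleyI[OF _ N f \<sigma>]) (use Tw2E6 u in auto)
  have "regular e" if "e = 1 \<or> e = -1" for e
    by (rule regular_order_two[OF that]) (use Tw2E6 f in auto)
  then show ?thesis using twisted_chevalley_axioms by blast
next
  case Tw3D4
  obtain u where u: "finite_dynkin (DynD 4) 1 u" using finite_dynkin_D[of 4] by blast
  interpret twisted_chevalley "twist_diagram w" 1 u N \<sigma> "twist_symmetry w" f
    "\<lambda>i. nat (dyn_len (twist_diagram w) (twist_symmetry w i) div 2)"
    by (rule twisted_chevalleyI[OF _ N f \<sigma>]) (use Tw3D4 u in auto)
  have "regular e" if "e = 1 \<or> e = -1" for e
    by (rule regular_triality[OF that]) (use Tw3D4 in auto)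
  then show ?thesis using twisted_chevalley_axioms by blast
next
  case Tw2B2
  obtain u where u: "finite_dynkin (DynB 2) 2 u" using finite_dynkin_B[of 2] by blast
  interpret twisted_chevalley "twist_diagram w" 2 u N \<sigma> "twist_symmetry w" f
    "\<lambda>i. nat (dyn_len (twist_diagram w) (twist_symmetry w i) div 2)"
    by (rule twisted_chevalleyI[OF _ N f \<sigma>]) (use Tw2B2 u in auto)
  have "regular e" if "e = 1 \<or> e = -1" for e
    by (rule regular_suzuki[OF that]) (use Tw2B2 f CHAR_2_eq in auto)
  then show ?thesis using twisted_chevalley_axioms by blast
next
  case Tw2F4
  interpret twisted_chevalley "twist_diagram w" 2 "\<lambda>i. [16, 30, 42, 22] ! i" N \<sigma> "twist_symmetry w" f
    "\<lambda>i. nat (dyn_len (twist_diagram w) (twist_symmetry w i) div 2)"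
    by (rule twisted_chevalleyI[OF _ N f \<sigma>]) (use Tw2F4 finite_dynkin_F4 in auto)
  have "regular e" if "e = 1 \<or> e = -1" for e
    by (rule regular_ree_F4[OF that]) (use Tw2F4 f CHAR_2_eq in auto)
  then show ?thesis using twisted_chevalley_axioms by blast
next
  case Tw2G2
  interpret twisted_chevalley "twist_diagram w" 3 "\<lambda>i. [10, 6] ! i" N \<sigma> "twist_symmetry w" f
    "\<lambda>i. nat (dyn_len (twist_diagram w) (twist_symmetry w i) div 2)"
    by (rule twisted_chevalleyI[OF _ N f \<sigma>]) (use Tw2G2 finite_dynkin_G2 in auto)
  have "regular e" if "e = 1 \<or> e = -1" for e
    by (rule regular_pair_odd[OF that]) (use Tw2G2 f CHAR_3_neq in auto)
  then show ?thesis using twisted_chevalley_axioms by blast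
qed

theorem theorem1p3:
  fixes G :: "'k::{field,finite} lie_map monoid" and B M H :: "'k lie_map set"
  assumes "class_L G B M"
    and "H = B \<inter> M"
  shows "base_number (rcosets\<^bsub>G\<^esub> H) (cartan_scheme G H) \<le> 2 \<and>
    (base_number (rcosets\<^bsub>G\<^esub> H) (cartan_scheme G H) = 1 \<longleftrightarrow> H = {\<one>\<^bsub>G\<^esub>})"
proof -
  obtain T where simple: "simple_group G" and cl: "class_L_type T CARD('k)" and T: "lie_type_BN T G B M"
    using assms(1) unfolding class_L_def by blast
  show ?thesis
  proof (cases T)
    case (Untwisted D)
    obtain N where N: "chevalley_constants D N" and G: "G = chev_group D N" "B = chev_borel D N" "M = chev_monomial D N"
      using T Untwisted by auto
    obtain \<kappa> u where "finite_dynkin D \<kappa> u" using finite_dynkin_untwisted cl Untwisted by blast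
    then interpret chevalley D \<kappa> u N using N by (intro chevalley.intro chevalley_axioms.intro)
    show ?thesis
      using lie_base_untwisted[of H] simple assms(2) unfolding G by blast
  next
    case (Twisted w)
    obtain N f \<sigma> where N: "chevalley_constants (twist_diagram w) N" "twist_field_aut w f" "twist_aut w N f \<sigma>"
      and G: "G = twisted_group w N \<sigma>" "B = twisted_borel w N \<sigma>" "M = twisted_monomial w N \<sigma>"
      using T Twisted by auto
    obtain \<kappa> u m where tw: "twisted_chevalley (twist_diagram w) \<kappa> u N \<sigma> (twist_symmetry w) f m"
      and reg: "\<forall>e. e = 1 \<or> e = -1 \<longrightarrow> twisted_chevalley.regular (twist_diagram w) N \<sigma> e"
      using twisted_regular[OF _ N] cl Twisted by blast
    interpret twisted_chevalley "twist_diagram w" \<kappa> u N \<sigma> "twist_symmetry w" f m by (rule tw)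
    have UV: "twisted_U w N \<sigma> = fx 1" "twisted_V w N \<sigma> = fx (-1)"
      unfolding twisted_U_def twisted_V_def fx_def U_unip V_unip by auto
    show ?thesis
    proof (rule lie_base_twisted[OF simple])
      show "G = lie_perm\<lparr>carrier := generate lie_perm (fx 1 \<union> fx (-1))\<rparr>"
        unfolding G twisted_group_def UV ..
      show "H = (fx 1 <#>\<^bsub>lie_perm\<^esub> (chev_torus (twist_diagram w) N \<inter> carrier G)) \<inter> (chev_monomial (twist_diagram w) N \<inter> carrier G)"
        unfolding assms(2) G twisted_borel_def twisted_torus_def twisted_monomial_def UV ..
    qed (use reg in auto)
  qed
qed

end
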